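(* Let $k\geqslant0$ and $a,q\geqslant1$ be fixed integers with $(a,q)=1$, $1\leqslant a\leqslant q$, and let $\alpha=a/q$. Suppose the Splitting Hypothesis and the Random Matrix Hypothesis (defined in the context) hold for every tuple $\boldsymbol\ell$ of nonnegative integers indexed by the Dirichlet characters modulo $q$ with $|\boldsymbol\ell|=k$. Then, as $T\to\infty$, $$\int_T^{2T}\left|\zeta\left(\tfrac12+it,\alpha\right)\right|^{2k}dt\sim c_k(\alpha)T(\log T)^{k^2},\qquad c_k(\alpha)=c_k\frac{q^k}{\varphi(q)^{2k-1}}\prod_{p\mid q}\left\{\sum_{m=0}^\infty\binom{m+k-1}{k-1}^2p^{-m}\right\}^{-1}.$$
   Context: $\zeta(s,\alpha)$ is the Hurwitz zeta function, $\sum_{n\geqslant0}(n+\alpha)^{-s}$ for $\Re s>1$, meromorphically continued. $\varphi$ is Euler's totient. $c_k=\frac{G(k+1)^2}{G(2k+1)}\prod_p\big\{(1-\frac1p)^{k^2}\sum_{m\geqslant0}d_k(p^m)^2p^{-m}\big\}$ is the (conjectural) proportionality constant for the $2k$-th moment of $\zeta(s)$, where $G$ is the Barnes $G$-function and $d_k$ the $k$-fold divisor function. Sums and products over $\chi$ run over Dirichlet characters modulo $q$; $q^*(\chi)$ is the conductor of $\chi$, $\chi^*$ the primitive character inducing $\chi$. For a tuple $\boldsymbol\ell=(\ell_\chi)_\chi$ of nonnegative integers: $|\boldsymbol\ell|=\sum_\chi\ell_\chi$, $\mathcal L^{\boldsymbol\ell}(s)=\prod_\chi L(s,\chi)^{\ell_\chi}$.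 Fix a non-negative $C^\infty$ function $f$ of mass one supported on $[0,1]$; for $X\geqslant2$ let $u(x)=Xf(X\log(x/e)+1)/x$, $U(z)=\int_0^\infty u(x)E_1(z\log x)dx$, $E_1(z)=\int_z^\infty e^{-w}w^{-1}dw$; $P_X(s,\chi)=\prod_{p\mid q}(1-\chi^*(p)p^{-s})\exp(\sum_{n\leqslant X}\chi^*(n)\Lambda(n)/(n^s\log n))$; $Z_X(s,\chi)=\exp(-\sum_\rho U((s-\rho)\log X))$ summed over zeros $\rho$ of $L(s,\chi^* )$ with $0\leqslant\Re\rho\leqslant1$ (with multiplicity); $\mathcal P_X^{\boldsymbol\ell}=\prod_\chi P_X(\cdot,\chi)^{\ell_\chi}$, $\mathcal Z_X^{\boldsymbol\ell}=\prod_\chi Z_X(\cdot,\chi)^{\ell_\chi}$. Splitting Hypothesis for $\boldsymbol\ell$: for every $\epsilon>0$, as $X,T\to\infty$ with $X\ll_\epsilon(\log T)^{2-\epsilon}$, with $s=1/2+it$, $\frac1T\int_T^{2T}|\mathcal L^{\boldsymbol\ell}(s)|^2dt\sim(\frac1T\int_T^{2T}|\mathcal P_X^{\boldsymbol\ell}(s)|^2dt)(\frac1T\int_T^{2T}|\mathcal Z_X^{\boldsymbol\ell}(s)|^2dt)$. Random Matrix Hypothesis for $\boldsymbol\ell$: in the same range, $\frac1T\int_T^{2T}|\mathcal Z_X^{\boldsymbol\ell}(s)|^2dt\sim\prod_\chi\big[\frac{G(\ell_\chi+1)^2}{G(2\ell_\chi+1)}(\frac{\log q^*(\chi)T}{e^\gamma\log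 X})^{\ell_\chi^2}\big]$, $\gamma$ the Euler–Mascheroni constant.
   Formalization: For k = 0 the formal theorem requires q ≤ 2: when k = 0 and q ≥ 3 the left side equals T while c_0(α) = φ(q) ≥ 2 (binomial read as d_0(p^m)), so the claim as printed is false there; for k ≥ 1 nothing is restricted. *)

theory Defs
  imports
    "HOL-Complex_Analysis.Complex_Analysis"
    "HOL-Number_Theory.Number_Theory"
    "HOL-Library.Landau_Symbols"
begin

section \<open>Hurwitz zeta function and Dirichlet \<open>L\<close>-functions\<close>

text \<open>
  The meromorphic continuation to the whole plane of a function given on \<open>Re s > 1\<close>.
  Being nicely meromorphic pins down the values at removable singularities (by continuity)
  and at poles (where the value is 0), so there is at most one such function.
\<close>
definition mero_continuation :: "(complex \<Rightarrow> complex) \<Rightarrow> complex \<Rightarrow> complex" where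
  "mero_continuation f0 =
     (THE f. f nicely_meromorphic_on UNIV \<and> (\<forall>s. Re s > 1 \<longrightarrow> f s = f0 s))"

definition hurwitz_zeta :: "real \<Rightarrow> complex \<Rightarrow> complex" where
  "hurwitz_zeta \<alpha> = mero_continuation (\<lambda>s. \<Sum>n. (of_nat n + of_real \<alpha>) powr (-s))"

text \<open>
  For \<open>q = 1\<close> the only character is constantly 1, also at 0, because 0 and 1 are coprime.
\<close>
definition dchars :: "nat \<Rightarrow> (nat \<Rightarrow> complex) set" where
  "dchars q = {chi. chi 1 = 1 \<and> (\<forall>m n. chi (m * n) = chi m * chi n) \<and>
     (\<forall>n. chi (n + q) = chi n) \<and> (\<forall>n. chi n = 0 \<longleftrightarrow> \<not> coprime n q)}"

definition dirichlet_L :: "(nat \<Rightarrow> complex) \<Rightarrow> complex \<Rightarrow> complex" where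
  "dirichlet_L chi = mero_continuation (\<lambda>s. \<Sum>n. chi (Suc n) / of_nat (Suc n) powr s)"

text \<open>
  \<open>\<psi>\<close> modulo \<open>d\<close> induces \<open>chi\<close> modulo \<open>q\<close> if \<open>d\<close> divides \<open>q\<close> and the two
  agree on all integers coprime to \<open>q\<close>. The conductor is the least modulus of an inducing
  character, and the inducing character of that modulus is primitive and unique.
\<close>
definition induces :: "nat \<Rightarrow> (nat \<Rightarrow> complex) \<Rightarrow> nat \<Rightarrow> (nat \<Rightarrow> complex) \<Rightarrow> bool" where
  "induces d \<psi> q chi \<longleftrightarrow> d dvd q \<and> \<psi> \<in> dchars d \<and> (\<forall>n. coprime n q \<longrightarrow> chi n = \<psi> n)"

definition conductor :: "nat \<Rightarrow> (nat \<Rightarrow> complex) \<Rightarrow> nat" where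
  "conductor q chi = (LEAST d. d > 0 \<and> (\<exists>\<psi>. induces d \<psi> q chi))"

definition prim_char :: "nat \<Rightarrow> (nat \<Rightarrow> complex) \<Rightarrow> nat \<Rightarrow> complex" where
  "prim_char q chi = (THE \<psi>. induces (conductor q chi) \<psi> q chi)"


section \<open>The hybrid Euler-Hadamard product\<close>

definition admissible_weight :: "(real \<Rightarrow> real) \<Rightarrow> bool" where
  "admissible_weight f \<longleftrightarrow>
     (\<forall>x. f x \<ge> 0) \<and> (\<forall>n x. (deriv ^^ n) f differentiable (at x)) \<and>
     (\<forall>x. x \<notin> {0..1} \<longrightarrow> f x = 0) \<and> (f has_integral 1) UNIV"

definition u_fun :: "(real \<Rightarrow> real) \<Rightarrow> real \<Rightarrow> real \<Rightarrow> real" where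
  "u_fun f X x = X * f (X * ln (x / exp 1) + 1) / x"

text \<open>
  The path from \<open>z\<close> to infinity is the horizontal ray \<open>{z + r | r \<ge> 0}\<close>. It avoids 0
  unless \<open>z\<close> is on the branch cut, the nonpositive reals, so this is the principal branch.
  On the cut the integral below does not exist and the value is the default 0.
\<close>
definition E1 :: "complex \<Rightarrow> complex" where
  "E1 z = integral {0..} (\<lambda>r. exp (- (z + of_real r)) / (z + of_real r))"

definition U_fun :: "(real \<Rightarrow> real) \<Rightarrow> real \<Rightarrow> complex \<Rightarrow> complex" where
  "U_fun f X z = integral {0..} (\<lambda>x. of_real (u_fun f X x) * E1 (z * of_real (ln x)))"

text \<open>The term for \<open>n = 1\<close> in the second factor is 0, since \<open>mangoldt 1 = 0\<close>.\<close>
definition P_fun :: "nat \<Rightarrow> real \<Rightarrow> (nat \<Rightarrow> complex) \<Rightarrow> complex \<Rightarrow> complex" where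
  "P_fun q X chi s =
     (\<Prod>p | prime p \<and> p dvd q. 1 - prim_char q chi p * of_nat p powr (-s)) *
     exp (\<Sum>n\<in>{n. 1 \<le> n \<and> real n \<le> X}.
            prim_char q chi n * mangoldt n / (of_nat n powr s * of_real (ln (real n))))"

text \<open>The predicate \<open>isolated_zero\<close> is stated via limits, so it does not hold at the
  pole of the zeta function even though its value there is set to 0.\<close>
definition strip_zeros :: "nat \<Rightarrow> (nat \<Rightarrow> complex) \<Rightarrow> complex set" where
  "strip_zeros q chi =
     {\<rho>. isolated_zero (dirichlet_L (prim_char q chi)) \<rho> \<and> 0 \<le> Re \<rho> \<and> Re \<rho> \<le> 1}"

definition Z_fun :: "(real \<Rightarrow> real) \<Rightarrow> nat \<Rightarrow> real \<Rightarrow> (nat \<Rightarrow> complex) \<Rightarrow> complex \<Rightarrow> complex" where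
  "Z_fun f q X chi s =
     exp (- (\<Sum>\<^sub>\<infinity>\<rho>\<in>strip_zeros q chi. of_int (zorder (dirichlet_L (prim_char q chi)) \<rho>) *
               U_fun f X ((s - \<rho>) * of_real (ln X))))"

type_synonym char_tuple = "(nat \<Rightarrow> complex) \<Rightarrow> nat"

definition tuple_size :: "nat \<Rightarrow> char_tuple \<Rightarrow> nat" where
  "tuple_size q l = (\<Sum>chi\<in>dchars q. l chi)"

definition L_tuple :: "nat \<Rightarrow> char_tuple \<Rightarrow> complex \<Rightarrow> complex" where
  "L_tuple q l s = (\<Prod>chi\<in>dchars q. dirichlet_L chi s ^ l chi)"

definition P_tuple :: "nat \<Rightarrow> real \<Rightarrow> char_tuple \<Rightarrow> complex \<Rightarrow> complex" where
  "P_tuple q X l s = (\<Prod>chi\<in>dchars q. P_fun q X chi s ^ l chi)"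

definition Z_tuple :: "(real \<Rightarrow> real) \<Rightarrow> nat \<Rightarrow> real \<Rightarrow> char_tuple \<Rightarrow> complex \<Rightarrow> complex" where
  "Z_tuple f q X l s = (\<Prod>chi\<in>dchars q. Z_fun f q X chi s ^ l chi)"


section \<open>The hypotheses\<close>

definition mean_square :: "(complex \<Rightarrow> complex) \<Rightarrow> real \<Rightarrow> real" where
  "mean_square F T = 1 / T * integral {T..2*T} (\<lambda>t. (norm (F (Complex (1/2) t)))\<^sup>2)"

text \<open>
  The filter for \<open>X, T \<rightarrow> \<infinity>\<close> subject to \<open>X \<le> C (log T)\<^bsup>2-\<epsilon>\<^esup>\<close>; the condition
  \<open>X \<lless> (log T)\<^bsup>2-\<epsilon>\<^esup>\<close> with an unspecified constant becomes a quantifier over \<open>C\<close>.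
\<close>
definition XT_range :: "real \<Rightarrow> real \<Rightarrow> (real \<times> real) filter" where
  "XT_range \<epsilon> C = inf (at_top \<times>\<^sub>F at_top) (principal {(X, T). X \<le> C * ln T powr (2 - \<epsilon>)})"

definition splitting_hypothesis :: "(real \<Rightarrow> real) \<Rightarrow> nat \<Rightarrow> char_tuple \<Rightarrow> bool" where
  "splitting_hypothesis f q l \<longleftrightarrow> (\<forall>\<epsilon>>0. \<forall>C>0.
     (\<lambda>(X, T). mean_square (L_tuple q l) T) \<sim>[XT_range \<epsilon> C]
     (\<lambda>(X, T). mean_square (P_tuple q X l) T * mean_square (Z_tuple f q X l) T))"

text \<open>The Barnes \<open>G\<close>-function on the reals, by its Weierstrass product for \<open>G (1 + z)\<close>.\<close>
definition barnes_G :: "real \<Rightarrow> real" where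
  "barnes_G x = (let z = x - 1 in
     (2 * pi) powr (z / 2) * exp (- (z + (1 + euler_mascheroni) * z\<^sup>2) / 2) *
     (\<Prod>n. (1 + z / real (Suc n)) ^ Suc n * exp (z\<^sup>2 / (2 * real (Suc n)) - z)))"

definition random_matrix_hypothesis :: "(real \<Rightarrow> real) \<Rightarrow> nat \<Rightarrow> char_tuple \<Rightarrow> bool" where
  "random_matrix_hypothesis f q l \<longleftrightarrow> (\<forall>\<epsilon>>0. \<forall>C>0.
     (\<lambda>(X, T). mean_square (Z_tuple f q X l) T) \<sim>[XT_range \<epsilon> C]
     (\<lambda>(X, T). \<Prod>chi\<in>dchars q.
        barnes_G (real (l chi) + 1) ^ 2 / barnes_G (2 * real (l chi) + 1) *
        (ln (real (conductor q chi) * T) / (exp euler_mascheroni * ln X)) ^ ((l chi)\<^sup>2)))"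


section \<open>The constants\<close>

text \<open>The number of ordered factorisations of \<open>n > 0\<close> into \<open>k\<close> factors.\<close>
definition divisor_fun :: "nat \<Rightarrow> nat \<Rightarrow> nat" where
  "divisor_fun k n = card {ds :: nat list. length ds = k \<and> prod_list ds = n}"

definition moment_const :: "nat \<Rightarrow> real" where
  "moment_const k = barnes_G (real k + 1) ^ 2 / barnes_G (2 * real k + 1) *
     (\<Prod>p. if prime p
           then (1 - 1 / real p) ^ (k\<^sup>2) * (\<Sum>m. real (divisor_fun k (p ^ m)) ^ 2 / real p ^ m)
           else 1)"

text \<open>
  The usual lower index \<open>k - 1\<close> of the binomial coefficient is replaced by the complementary
  one, which gives the same for \<open>k \<ge> 1\<close>. For \<open>k = 0\<close>, where \<open>k - 1\<close> would be truncated,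
  it gives the value \<open>divisor_fun 0 (p ^ m)\<close>, i.e. 1 for \<open>m = 0\<close> and 0 otherwise.
\<close>
definition hurwitz_moment_const :: "nat \<Rightarrow> nat \<Rightarrow> real" where
  "hurwitz_moment_const k q =
     moment_const k * (real q ^ k / real (totient q) powi (2 * int k - 1)) *
     (\<Prod>p | prime p \<and> p dvd q. inverse (\<Sum>m. real ((m + k - 1) choose m) ^ 2 / real p ^ m))"

end

theory Submission
  imports Defs "HOL-Real_Asymp.Real_Asymp"
begin

text \<open>
  Orthogonality of characters writes \<open>\<zeta>(s,a/q)\<close> as \<open>q\<^sup>s/\<phi>(q)\<close> times a combination of the functions
  \<open>L(s,\<chi>)\<close> with unimodular coefficients. For \<open>k \<ge> 2\<close> the \<open>2k\<close>-th power of the modulus of a sum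
  differs from the sum of the \<open>2k\<close>-th powers by at most an arbitrarily small multiple of the latter
  plus cross terms \<open>\<bar>L(s,\<chi>)\<bar>\<^bsup>2k-2\<^esup>\<bar>L(s,\<chi>')\<bar>\<^sup>2\<close>. So only the tuples concentrated on one character,
  and those with entries \<open>k-1\<close> and 1, are needed. The latter are of lower order because
  \<open>(k-1)\<^sup>2 + 1 < k\<^sup>2\<close>.

  The hypotheses allow \<open>X\<close> to tend to infinity as slowly with \<open>T\<close> as one likes. Hence the mean square of
  \<open>P\<^sub>X\<close> can be replaced by its limit as \<open>T \<rightarrow> \<infinity>\<close> for fixed \<open>X\<close>, a finite product of local factors
  given by Bohr's mean value, and Mertens' theorem is needed only along some sequence of \<open>X\<close>.

  For \<open>k = 1\<close> the claim is unconditional: approximate the zeta function by \<open>\<Sum>(n+\<alpha>)\<^bsup>-s\<^esup>\<close> over \<open>n < 2T\<close>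
  and integrate termwise. The case \<open>k = 0\<close> is trivial.
\<close>

section \<open>Continuation of the Hurwitz zeta function\<close>

text \<open>The hypotheses give mean squares for one tuple at a time, never a mean of L(s,\<chi>)
  against the conjugate of L(s,\<chi>'). Hence the comparison of the sum with its diagonal goes
  through absolute values only, and hence k = 1 stands apart: there (k-1)^2 + 1 = k^2, so the cross
  terms are no longer of lower order. For a concentrated tuple the random matrix prediction contains
  a power of e^\<gamma> log X, which the mean square of P_X has to cancel; this is the place of
  Mertens' theorem. As unboundedly many good cutoffs X suffice, a comparison of two Dirichlet series
  near 0 can replace a Tauberian argument. At a prime dividing q, P_X carries both a truncated Euler
  factor and the factor that inverts it in the limit. These primes drop out of the mean value, which
  explains the product over p | q in the constant and makes the limit the same for every character.
  For the mixed tuples any bound for P_X that depends on X alone will do: it lies below a small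
  power of log T once X grows slowly enough.\<close>

lemma mero_continuation_eq:
  assumes g: "g holomorphic_on UNIV" and f0: "\<And>s. Re s > 1 \<Longrightarrow> f0 s = g s / (s - 1)" and "s \<noteq> 1"
  shows "mero_continuation f0 s = g s / (s - 1)"
proof -
  define F where "F = remove_sings (\<lambda>s. g s / (s - 1))"
  have ana_g: "g analytic_on A" for A
    using g analytic_on_subset[of g UNIV A] by (simp add: analytic_on_open)
  have ana: "(\<lambda>s. g s / (s - 1)) analytic_on {z}" if "z \<noteq> 1" for z
    by (intro analytic_intros ana_g) (use that in auto)
  have F_eq: "F z = g z / (z - 1)" if "z \<noteq> 1" for z
    unfolding F_def using ana[OF that] by (rule remove_sings_at_analytic)
  have mero: "(\<lambda>s. g s / (s - 1)) meromorphic_on UNIV"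
    by (intro meromorphic_intros analytic_on_imp_meromorphic_on ana_g analytic_intros)
  have F: "F nicely_meromorphic_on UNIV" "\<forall>s. Re s > 1 \<longrightarrow> F s = f0 s"
  proof -
    show "F nicely_meromorphic_on UNIV"
      unfolding F_def by (rule remove_sings_nicely_meromorphic[OF mero])
    show "\<forall>s. Re s > 1 \<longrightarrow> F s = f0 s"
      using F_eq f0 by (metis less_irrefl one_complex.sel(1))
  qed
  have "mero_continuation f0 = F"
    unfolding mero_continuation_def
  proof (rule the_equality)
    fix h assume h: "h nicely_meromorphic_on UNIV \<and> (\<forall>s. Re s > 1 \<longrightarrow> h s = f0 s)"
    have hm: "h meromorphic_on UNIV" and Fm: "F meromorphic_on UNIV"
      using h F by (auto simp: nicely_meromorphic_on_def)
    \<comment> \<open>A difference of nicely meromorphic functions need not be nicely meromorphic,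
      since poles may cancel and leave a wrong value behind. \<open>remove_sings\<close> repairs
      this, so that the identity theorem applies.\<close>
    define d where "d = remove_sings (\<lambda>s. h s - F s)"
    have dm: "(\<lambda>s. h s - F s) meromorphic_on UNIV"
      using hm Fm by (intro meromorphic_intros)
    have dn: "d nicely_meromorphic_on UNIV"
      unfolding d_def by (rule remove_sings_nicely_meromorphic[OF dm])
    have op: "open {s::complex. Re s > 1}"
      by (simp add: open_halfspace_Re_gt)
    have d0: "d s = 0" if "Re s > 1" for s
      unfolding d_def
    proof (rule remove_sings_eqI)
      have "eventually (\<lambda>z. z \<in> {s. Re s > 1}) (at s)"
        using op that by (intro eventually_at_in_open') auto
      hence "eventually (\<lambda>z. h z - F z = 0) (at s)"
        by eventually_elim (use h F in auto)
      thus "(\<lambda>z. h z - F z) \<midarrow>s\<rightarrow> 0"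
        by (simp add: tendsto_eventually)
    qed
    have "d constant_on {s. Re s > 1}"
      unfolding constant_on_def using d0 by auto
    moreover have "{s::complex. Re s > 1} \<noteq> {}" by (auto intro!: exI[of _ 2])
    ultimately have "d constant_on UNIV"
      using constant_on_extend_nicely_meromorphic_on[OF dn _ op] by auto
    moreover have "d 2 = 0" by (rule d0) auto
    ultimately have d: "d z = 0" for z
      unfolding constant_on_def by (metis UNIV_I)
    \<comment> \<open>Vanishing of \<open>d\<close> yields equality on punctured neighbourhoods
      only. The values at the points follow from niceness: poles and limits depend on punctured
      neighbourhoods alone, and a pole forces the value 0.\<close>
    have ev: "eventually (\<lambda>w. h w = F w) (at z)" for z
    proof -
      have "isolated_singularity_at (\<lambda>s. h s - F s) z"
        using dm by (meson UNIV_I meromorphic_on_isolated_singularity meromorphic_on_subset subset_UNIV)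
      from eventually_remove_sings_eq_at[OF this] show ?thesis
        by eventually_elim (use d in \<open>auto simp: d_def\<close>)
    qed
    show "h = F"
    proof
      fix z
      have hz: "is_pole h z \<and> h z = 0 \<or> h \<midarrow>z\<rightarrow> h z" and Fz: "is_pole F z \<and> F z = 0 \<or> F \<midarrow>z\<rightarrow> F z"
        using h F by (auto simp: nicely_meromorphic_on_def)
      have p: "is_pole h z \<longleftrightarrow> is_pole F z"
        by (intro is_pole_cong ev refl)
      have t: "h \<midarrow>z\<rightarrow> c \<longleftrightarrow> F \<midarrow>z\<rightarrow> c" for c
        by (intro tendsto_cong ev)
      show "h z = F z"
      proof (cases "is_pole h z")
        case True
        hence "h z = 0" "F z = 0"
          using hz Fz p t by (metis is_pole_def not_tendsto_and_filterlim_at_infinity at_neq_bot)+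
        thus ?thesis by simp
      next
        case False
        thus ?thesis using hz Fz p t LIM_unique by metis
      qed
    qed
  qed (use F in auto)
  thus ?thesis using F_eq assms by simp
qed

section \<open>Continuation by telescoping Taylor expansions\<close>

definition hurwitz_series :: "real \<Rightarrow> complex \<Rightarrow> complex" where
  "hurwitz_series \<alpha> s = (\<Sum>n. (of_nat n + of_real \<alpha>) powr (-s))"

text \<open>\<open>falling j s * z powr (1 - s - of_nat j)\<close> is the \<open>j\<close>-th
  derivative of \<open>z powr (1 - s)\<close>.\<close>

definition falling :: "nat \<Rightarrow> complex \<Rightarrow> complex" where
  "falling j s = (\<Prod>i<j. 1 - s - of_nat i)"

text \<open>
  Summing the remainder over \<open>x = n + \<alpha>\<close>, where the first two terms telescope, expresses
  \<open>(s-1) \<zeta>(s,\<alpha>)\<close> by \<open>\<alpha>\<^bsup>1-s\<^esup>\<close>, the values \<open>\<zeta>(s+j,\<alpha>)\<close> with \<open>j \<ge> 1\<close> and a series that converges in a larger half plane.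
\<close>
definition taylor_remainder :: "nat \<Rightarrow> real \<Rightarrow> complex \<Rightarrow> complex" where
  "taylor_remainder K x s = of_real (x + 1) powr (1 - s) -
     (\<Sum>j\<le>K. falling j s * of_real x powr (1 - s - of_nat j) / fact j)"

lemma norm_of_real_powr: "x > 0 \<Longrightarrow> norm (of_real x powr s :: complex) = x powr Re s"
  by (subst norm_powr_real_powr) auto

text \<open>Taylor's formula for \<open>z powr (1 - s)\<close> on the segment from \<open>x\<close>
  to \<open>x + 1\<close>. The condition on \<open>Re s\<close> makes the modulus of the derivative
  of order \<open>K + 1\<close> nonincreasing along the segment, so its value at \<open>x\<close>
  bounds it.\<close>

lemma norm_taylor_remainder:
  assumes x: "x > 0" and s: "Re s \<ge> - real K"
  shows "norm (taylor_remainder K x s) \<le> norm (falling (Suc K) s) * x powr (- Re s - real K) / fact K"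
proof -
  define S where "S = complex_of_real ` {x..x+1}"
  have S: "convex S" unfolding S_def
    by (intro convex_linear_image) (auto simp: linear_linear intro!: bounded_linear.linear bounded_linear_of_real)
  define f where "f = (\<lambda>j z. falling j s * z powr (1 - s - of_nat j))"
  have "norm (f 0 (of_real (x + 1)) - (\<Sum>i\<le>K. f i (of_real x) * (of_real (x + 1) - of_real x) ^ i / fact i))
        \<le> norm (falling (Suc K) s) * x powr (- Re s - real K) * norm (complex_of_real (x+1) - of_real x) ^ Suc K / fact K"
  proof (rule complex_Taylor[OF S])
    fix i z assume "z \<in> S" "i \<le> K"
    then obtain y where y: "z = of_real y" "y \<ge> x" by (auto simp: S_def)
    hence "z \<notin> \<real>\<^sub>\<le>\<^sub>0" using x by (auto simp: complex_nonpos_Reals_iff)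
    hence "((\<lambda>z. falling i s * z powr (1 - s - of_nat i)) has_field_derivative
             falling i s * ((1 - s - of_nat i) * z powr (1 - s - of_nat i - 1))) (at z within S)"
      by (auto intro!: derivative_eq_intros)
    thus "(f i has_field_derivative f (Suc i) z) (at z within S)"
      by (simp add: f_def falling_def algebra_simps)
  next
    fix z assume "z \<in> S"
    then obtain y where y: "z = of_real y" "y \<ge> x" by (auto simp: S_def)
    have "norm (f (Suc K) z) = norm (falling (Suc K) s) * y powr (- Re s - real K)"
      unfolding f_def y norm_mult using x y by (subst norm_of_real_powr) auto
    also have "\<dots> \<le> norm (falling (Suc K) s) * x powr (- Re s - real K)"
      using x y s by (intro mult_left_mono powr_mono2') auto
    finally show "norm (f (Suc K) z) \<le> norm (falling (Suc K) s) * x powr (- Re s - real K)" .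
  qed (use x in \<open>auto simp: S_def simp del: of_real_add\<close>)
  thus ?thesis
    by (simp add: f_def taylor_remainder_def falling_def)
qed

lemma summable_shift_powr:
  assumes "\<alpha> > 0" "a > 1"
  shows "summable (\<lambda>n. (real n + \<alpha>) powr (- a))"
proof (rule summable_comparison_test_ev)
  show "summable (\<lambda>n. real n powr (- a))" using assms by (simp add: summable_real_powr_iff)
  show "eventually (\<lambda>n. norm ((real n + \<alpha>) powr (- a)) \<le> real n powr (- a)) sequentially"
    using eventually_gt_at_top[of 0] by eventually_elim (use assms in \<open>auto intro!: powr_mono2'\<close>)
qed

lemma sums_hurwitz_series:
  assumes "\<alpha> > 0" "Re s > 1"
  shows "(\<lambda>n. of_real (real n + \<alpha>) powr (-s)) sums hurwitz_series \<alpha> s"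
proof -
  have "summable (\<lambda>n. norm (of_real (real n + \<alpha>) powr (-s) :: complex))"
  proof -
    have "norm (of_real (real n + \<alpha>) powr (-s) :: complex) = (real n + \<alpha>) powr (- Re s)" for n
      by (subst norm_of_real_powr) (use assms in auto)
    thus ?thesis using summable_shift_powr[OF assms] by presburger
  qed
  hence "(\<lambda>n. of_real (real n + \<alpha>) powr (-s) :: complex) sums (\<Sum>n. of_real (real n + \<alpha>) powr (-s))"
    by (rule summable_sums[OF summable_norm_cancel])
  thus ?thesis
    by (simp add: hurwitz_series_def)
qed

lemma summable_taylor_remainder:
  assumes "\<alpha> > 0" "Re s > 1 - real K"
  shows "summable (\<lambda>n. taylor_remainder K (real n + \<alpha>) s)"
proof (rule summable_comparison_test)
  show "\<exists>N. \<forall>n\<ge>N. norm (taylor_remainder K (real n + \<alpha>) s) \<le>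
      norm (falling (Suc K) s) / fact K * (real n + \<alpha>) powr (- (Re s + real K))"
    using norm_taylor_remainder[of "real n + \<alpha>" K s for n] assms by (auto simp: field_simps)
  show "summable (\<lambda>n. norm (falling (Suc K) s) / fact K * (real n + \<alpha>) powr (- (Re s + real K)))"
    using assms by (intro summable_mult summable_shift_powr) auto
qed

lemma open_Re_gt: "open {s::complex. Re s > c}"
  by (simp add: open_halfspace_Re_gt)

lemma holomorphic_taylor_remainder_sum:
  assumes \<alpha>: "\<alpha> > 0"
  shows "(\<lambda>s. \<Sum>n. taylor_remainder K (real n + \<alpha>) s) holomorphic_on {s. Re s > 1 - real K}"
proof (rule holomorphic_uniform_sequence[OF open_Re_gt])
  fix n
  show "(\<lambda>s. \<Sum>i<n. taylor_remainder K (real i + \<alpha>) s) holomorphic_on {s. Re s > 1 - real K}"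
    unfolding taylor_remainder_def falling_def using \<alpha>
    by (intro holomorphic_intros) (auto simp: complex_eq_iff)
next
  fix z assume z: "z \<in> {s. Re s > 1 - real K}"
  \<comment> \<open>Half the distance of \<open>z\<close> to the boundary line: on the closed disc
    of this radius the terms are \<open>O(n powr (-1 - d))\<close>.\<close>
  define d where "d = (Re z - (1 - real K)) / 2"
  have d: "d > 0" using z by (auto simp: d_def)
  have cb: "Re s \<ge> 1 - real K + d" if "s \<in> cball z d" for s
  proof -
    have "\<bar>Re (z - s)\<bar> \<le> d" using that abs_Re_le_cmod[of "z - s"] by (auto simp: dist_norm)
    thus ?thesis unfolding d_def minus_complex.sel by argo
  qed
  have "continuous_on (cball z d) (\<lambda>s. falling (Suc K) s)"
    unfolding falling_def by (intro continuous_intros)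
  hence "compact ((\<lambda>s. falling (Suc K) s) ` cball z d)"
    by (intro compact_continuous_image) auto
  then obtain C where C: "norm (falling (Suc K) s) \<le> C" if "s \<in> cball z d" for s
    by (meson bounded_iff compact_imp_bounded imageI)
  have "uniform_limit (cball z d) (\<lambda>n s. \<Sum>i<n. taylor_remainder K (real i + \<alpha>) s)
      (\<lambda>s. \<Sum>n. taylor_remainder K (real n + \<alpha>) s) sequentially"
  proof (rule Weierstrass_m_test_ev)
    show "summable (\<lambda>n. C / fact K * (real n + \<alpha>) powr (- (1 + d)))"
      using \<alpha> d by (intro summable_mult summable_shift_powr) auto
    show "\<forall>\<^sub>F n in sequentially. \<forall>s\<in>cball z d. norm (taylor_remainder K (real n + \<alpha>) s) \<le> C / fact K * (real n + \<alpha>) powr (- (1 + d))"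
      \<comment> \<open>From \<open>n = 1\<close> on the base \<open>n + \<alpha>\<close> is at
        least 1, as the comparison of exponents requires.\<close>
      using eventually_gt_at_top[of 0]
    proof eventually_elim
      case (elim n)
      show ?case
      proof
        fix s assume s: "s \<in> cball z d"
        have "norm (taylor_remainder K (real n + \<alpha>) s) \<le>
            norm (falling (Suc K) s) * (real n + \<alpha>) powr (- Re s - real K) / fact K"
          using cb[OF s] d \<alpha> by (intro norm_taylor_remainder) auto
        also have "\<dots> \<le> C * (real n + \<alpha>) powr (- (1 + d)) / fact K"
          using cb[OF s] C[OF s] elim \<alpha>
          by (intro divide_right_mono mult_mono powr_mono) (auto intro: order_trans[OF norm_ge_zero])
        finally show "norm (taylor_remainder K (real n + \<alpha>) s) \<le> C / fact K * (real n + \<alpha>) powr (- (1 + d))"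
          by simp
      qed
    qed
  qed
  moreover have "cball z d \<subseteq> {s. Re s > 1 - real K}"
    using cb d by fastforce
  ultimately show "\<exists>d>0. cball z d \<subseteq> {s. Re s > 1 - real K} \<and>
      uniform_limit (cball z d) (\<lambda>n s. \<Sum>i<n. taylor_remainder K (real i + \<alpha>) s)
      (\<lambda>s. \<Sum>n. taylor_remainder K (real n + \<alpha>) s) sequentially"
    using d by blast
qed

lemma falling_Suc: "falling (Suc j) s = falling j s * (1 - s - of_nat j)"
  by (simp add: falling_def)

lemma tendsto_shift_powr_0:
  assumes "Re s < 0"
  shows "(\<lambda>n. complex_of_real (real n + \<alpha>) powr s) \<longlonglongrightarrow> 0"
proof (rule tendsto_norm_zero_cancel)
  have "(\<lambda>n. (real n + \<alpha>) powr Re s) \<longlonglongrightarrow> 0"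
    using assms by real_asymp
  moreover have "\<forall>\<^sub>F n in sequentially. real n + \<alpha> > 0"
    by real_asymp
  hence "\<forall>\<^sub>F n in sequentially. (real n + \<alpha>) powr Re s = norm (complex_of_real (real n + \<alpha>) powr s)"
    by eventually_elim (rule norm_of_real_powr[symmetric])
  ultimately show "(\<lambda>n. norm (complex_of_real (real n + \<alpha>) powr s)) \<longlonglongrightarrow> 0"
    by (rule Lim_transform_eventually)
qed

lemma suminf_taylor_remainder:
  assumes \<alpha>: "\<alpha> > 0" and s: "Re s > 1"
  shows "(\<Sum>n. taylor_remainder (Suc K) (real n + \<alpha>) s) =
    (s - 1) * hurwitz_series \<alpha> s - of_real \<alpha> powr (1 - s)
    - (\<Sum>j<K. falling (j+2) s / fact (j+2) * hurwitz_series \<alpha> (s + of_nat (j+1)))"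
proof -
  define x where "x n = complex_of_real (real n + \<alpha>)" for n
  have "(\<lambda>n. x (Suc n) powr (1 - s) - x n powr (1 - s)) sums (0 - x 0 powr (1 - s))"
    unfolding x_def using s by (intro telescope_sums tendsto_shift_powr_0) auto
  moreover have "(\<lambda>n. \<Sum>j<Suc K. falling (Suc j) s / fact (Suc j) * x n powr - (s + of_nat j)) sums
     (\<Sum>j<Suc K. falling (Suc j) s / fact (Suc j) * hurwitz_series \<alpha> (s + of_nat j))"
    unfolding x_def using s by (intro sums_sum sums_mult sums_hurwitz_series \<alpha>) auto
  ultimately have "(\<lambda>n. (x (Suc n) powr (1 - s) - x n powr (1 - s)) -
      (\<Sum>j<Suc K. falling (Suc j) s / fact (Suc j) * x n powr - (s + of_nat j))) sums
     ((0 - x 0 powr (1 - s)) - (\<Sum>j<Suc K. falling (Suc j) s / fact (Suc j) * hurwitz_series \<alpha> (s + of_nat j)))"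
    by (rule sums_diff)
  also have "(\<lambda>n. (x (Suc n) powr (1 - s) - x n powr (1 - s)) -
      (\<Sum>j<Suc K. falling (Suc j) s / fact (Suc j) * x n powr - (s + of_nat j))) =
      (\<lambda>n. taylor_remainder (Suc K) (real n + \<alpha>) s)"
  proof
    fix n
    have "(\<Sum>j\<le>Suc K. falling j s * x n powr (1 - s - of_nat j) / fact j) =
      x n powr (1 - s) + (\<Sum>j<Suc K. falling (Suc j) s / fact (Suc j) * x n powr - (s + of_nat j))"
      by (subst sum.atMost_Suc_shift) (simp add: lessThan_Suc_atMost falling_def field_simps)
    thus "(x (Suc n) powr (1 - s) - x n powr (1 - s)) -
      (\<Sum>j<Suc K. falling (Suc j) s / fact (Suc j) * x n powr - (s + of_nat j)) =
       taylor_remainder (Suc K) (real n + \<alpha>) s"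
      by (simp add: taylor_remainder_def x_def add_ac)
  qed
  finally have "(\<Sum>n. taylor_remainder (Suc K) (real n + \<alpha>) s) =
      - (x 0 powr (1 - s)) - (\<Sum>j<Suc K. falling (Suc j) s / fact (Suc j) * hurwitz_series \<alpha> (s + of_nat j))"
    by (simp add: sums_iff)
  also have "(\<Sum>j<Suc K. falling (Suc j) s / fact (Suc j) * hurwitz_series \<alpha> (s + of_nat j)) =
    (1 - s) * hurwitz_series \<alpha> s + (\<Sum>j<K. falling (j+2) s / fact (j+2) * hurwitz_series \<alpha> (s + of_nat (j+1)))"
    by (subst sum.lessThan_Suc_shift) (simp add: falling_def)
  finally show ?thesis by (simp add: x_def algebra_simps)
qed

text \<open>Values of \<open>(s - 1) \<zeta>(s,\<alpha>)\<close>, so that no pole occurs. Level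
  \<open>K\<close> at \<open>s + j + 1\<close> already contains the factor \<open>s + j\<close>,
  which up to sign is the last factor of \<open>falling (j+2) s\<close>; this explains both
  \<open>falling (Suc j) s\<close> over \<open>fact (j + 2)\<close> and the minus sign. Each level
  moves the boundary line one unit to the left.\<close>

fun hurwitz_cont :: "real \<Rightarrow> nat \<Rightarrow> complex \<Rightarrow> complex" where
  "hurwitz_cont \<alpha> 0 s = of_real \<alpha> powr (1 - s) + (\<Sum>n. taylor_remainder 1 (real n + \<alpha>) s)"
| "hurwitz_cont \<alpha> (Suc K) s = of_real \<alpha> powr (1 - s) + (\<Sum>n. taylor_remainder (Suc (Suc K)) (real n + \<alpha>) s)
     - (\<Sum>j<Suc K. falling (Suc j) s / fact (j + 2) * hurwitz_cont \<alpha> K (s + of_nat (j+1)))"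

lemma hurwitz_cont_eq:
  assumes "\<alpha> > 0" "Re s > 1"
  shows "hurwitz_cont \<alpha> K s = (s - 1) * hurwitz_series \<alpha> s"
  using assms(2)
proof (induction K arbitrary: s)
  case 0
  thus ?case using suminf_taylor_remainder[OF assms(1), of s 0] by simp
next
  case (Suc K)
  have "(\<Sum>j<Suc K. falling (Suc j) s / fact (j + 2) * hurwitz_cont \<alpha> K (s + of_nat (j+1))) =
    (\<Sum>j<Suc K. - (falling (j+2) s / fact (j+2) * hurwitz_series \<alpha> (s + of_nat (j+1))))"
  proof (intro sum.cong refl)
    fix j
    have e: "falling (j+2) s = falling (Suc j) s * (- (s + of_nat (j+1) - 1))"
      using falling_Suc[of "Suc j" s] by (simp add: algebra_simps)
    have e': "x / f * (t * h) = - (x * (- t) / f * h)" for x f t h :: complex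
      by simp
    have "hurwitz_cont \<alpha> K (s + of_nat (j+1)) = (s + of_nat (j+1) - 1) * hurwitz_series \<alpha> (s + of_nat (j+1))"
      using Suc.prems by (intro Suc.IH) auto
    thus "falling (Suc j) s / fact (j + 2) * hurwitz_cont \<alpha> K (s + of_nat (j+1)) =
      - (falling (j+2) s / fact (j+2) * hurwitz_series \<alpha> (s + of_nat (j+1)))"
      unfolding e by (simp only: e')
  qed
  thus ?case
    using suminf_taylor_remainder[OF assms(1) Suc.prems, of "Suc K"]
    by (simp add: sum_negf del: sum.lessThan_Suc of_nat_Suc of_nat_add)
qed

lemma holomorphic_hurwitz_cont:
  assumes "\<alpha> > 0"
  shows "hurwitz_cont \<alpha> K holomorphic_on {s. Re s > - real K}"
proof (induction K)
  case 0
  have "(\<lambda>s. of_real \<alpha> powr (1 - s) + (\<Sum>n. taylor_remainder 1 (real n + \<alpha>) s)) holomorphic_on {s. Re s > - real 0}"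
    using holomorphic_taylor_remainder_sum[OF assms, of 1] assms
    by (intro holomorphic_intros) (auto simp: complex_nonpos_Reals_iff)
  thus ?case by simp
next
  case (Suc K)
  have "(\<lambda>s. hurwitz_cont \<alpha> K (s + of_nat (j+1))) holomorphic_on {s. Re s > - real (Suc K)}" for j
  proof -
    have "(\<lambda>s. s + of_nat (j+1)) holomorphic_on {s. Re s > - real (Suc K)}"
      by (intro holomorphic_intros)
    moreover have "(\<lambda>s. s + of_nat (j+1)) ` {s. Re s > - real (Suc K)} \<subseteq> {s. Re s > - real K}"
      by auto
    ultimately show ?thesis
      using holomorphic_on_compose_gen[OF _ Suc.IH] by (fastforce simp: o_def)
  qed
  moreover have "(\<lambda>s. \<Sum>n. taylor_remainder (Suc (Suc K)) (real n + \<alpha>) s) holomorphic_on {s. Re s > - real (Suc K)}"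
    using holomorphic_taylor_remainder_sum[OF assms, of "Suc (Suc K)"] by simp
  ultimately have "(\<lambda>s. of_real \<alpha> powr (1 - s) + (\<Sum>n. taylor_remainder (Suc (Suc K)) (real n + \<alpha>) s)
     - (\<Sum>j<Suc K. falling (Suc j) s / fact (j + 2) * hurwitz_cont \<alpha> K (s + of_nat (j+1)))) holomorphic_on {s. Re s > - real (Suc K)}"
    unfolding falling_def using assms
    by (intro holomorphic_intros) (auto simp: complex_nonpos_Reals_iff)
  thus ?case by (simp del: sum.lessThan_Suc of_nat_Suc of_nat_add)
qed

lemma hurwitz_cont_unique:
  assumes \<alpha>: "\<alpha> > 0" and s: "Re s > - real K" "Re s > - real L"
  shows "hurwitz_cont \<alpha> K s = hurwitz_cont \<alpha> L s"
proof (rule analytic_continuation_open[OF open_Re_gt[of 1] open_Re_gt[of "max (- real K) (- real L)"],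
      where f = "hurwitz_cont \<alpha> K" and g = "hurwitz_cont \<alpha> L" and z = s])
  show "{s. 1 < Re s} \<noteq> {}" by (auto intro!: exI[of _ 2])
  show "connected {s. max (- real K) (- real L) < Re s}"
    by (intro convex_connected convex_halfspace_Re_gt)
  show "hurwitz_cont \<alpha> K holomorphic_on {s. max (- real K) (- real L) < Re s}"
    by (rule holomorphic_on_subset[OF holomorphic_hurwitz_cont[OF \<alpha>]]) auto
  show "hurwitz_cont \<alpha> L holomorphic_on {s. max (- real K) (- real L) < Re s}"
    by (rule holomorphic_on_subset[OF holomorphic_hurwitz_cont[OF \<alpha>]]) auto
  show "hurwitz_cont \<alpha> K z = hurwitz_cont \<alpha> L z" if "z \<in> {s. 1 < Re s}" for z
    using that by (simp add: hurwitz_cont_eq[OF \<alpha>])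
qed (use s in auto)

text \<open>The level depends on the point, but levels agree wherever both are valid, so near any
  point the function coincides with a single fixed level. Holomorphy is proved in this way.\<close>

definition hurwitz_entire :: "real \<Rightarrow> complex \<Rightarrow> complex" where
  "hurwitz_entire \<alpha> s = hurwitz_cont \<alpha> (nat (\<lceil>- Re s\<rceil> + 1)) s"

lemma hurwitz_entire_eq:
  assumes "\<alpha> > 0" "Re s > - real K"
  shows "hurwitz_entire \<alpha> s = hurwitz_cont \<alpha> K s"
proof -
  have "Re s > - real (nat (\<lceil>- Re s\<rceil> + 1))"
    by linarith
  thus ?thesis
    unfolding hurwitz_entire_def using assms by (intro hurwitz_cont_unique)
qed

lemma holomorphic_hurwitz_entire:
  assumes "\<alpha> > 0"
  shows "hurwitz_entire \<alpha> holomorphic_on A"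
proof -
  have "hurwitz_entire \<alpha> analytic_on {z}" for z
  proof -
    obtain K :: nat where K: "Re z > - real K"
      using reals_Archimedean2[of "- Re z"] by (metis minus_less_iff)
    have "hurwitz_entire \<alpha> holomorphic_on {s. Re s > - real K}"
      using holomorphic_hurwitz_cont[OF assms] by (rule holomorphic_transform) (simp add: hurwitz_entire_eq[OF assms])
    thus ?thesis using K open_Re_gt analytic_at by blast
  qed
  thus ?thesis
    by (meson analytic_imp_holomorphic analytic_on_analytic_at)
qed

lemma hurwitz_zeta_eq:
  assumes "\<alpha> > 0" "s \<noteq> 1"
  shows "hurwitz_zeta \<alpha> s = hurwitz_entire \<alpha> s / (s - 1)"
  unfolding hurwitz_zeta_def
proof (rule mero_continuation_eq[OF holomorphic_hurwitz_entire])
  fix z :: complex assume z: "Re z > 1"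
  hence "hurwitz_entire \<alpha> z = (z - 1) * hurwitz_series \<alpha> z"
    using hurwitz_entire_eq[of \<alpha> 0 z] hurwitz_cont_eq[of \<alpha> z 0] assms by simp
  thus "(\<Sum>n. (of_nat n + complex_of_real \<alpha>) powr (-z)) = hurwitz_entire \<alpha> z / (z - 1)"
    using z by (auto simp: hurwitz_series_def)
qed (use assms in auto)

section \<open>Dirichlet characters and their \<open>L\<close>-functions\<close>

lemma coprime_add_self: "coprime (n + q) q \<longleftrightarrow> coprime n (q :: nat)"
  unfolding coprime_iff_gcd_eq_1 by (simp only: gcd_add1)

text \<open>A character of a subgroup of the units modulo \<open>q\<close>. The subgroup is
  represented by all integers in its classes, hence the closure under congruence; closure under
  inverses follows from Euler's theorem.\<close>

definition partial_char :: "nat \<Rightarrow> nat set \<Rightarrow> (nat \<Rightarrow> complex) \<Rightarrow> bool" where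
  "partial_char q H \<psi> \<longleftrightarrow> 1 \<in> H \<and> \<psi> 1 = 1 \<and> (\<forall>n\<in>H. coprime n q) \<and>
     (\<forall>m\<in>H. \<forall>n\<in>H. m * n \<in> H \<and> \<psi> (m * n) = \<psi> m * \<psi> n) \<and>
     (\<forall>m n. m \<in> H \<longrightarrow> [m = n] (mod q) \<longrightarrow> n \<in> H \<and> \<psi> n = \<psi> m)"

lemma partial_charD:
  assumes "partial_char q H \<psi>"
  shows "1 \<in> H" "\<psi> 1 = 1" "n \<in> H \<Longrightarrow> coprime n q"
    "m \<in> H \<Longrightarrow> n \<in> H \<Longrightarrow> m * n \<in> H" "m \<in> H \<Longrightarrow> n \<in> H \<Longrightarrow> \<psi> (m * n) = \<psi> m * \<psi> n"
    "m \<in> H \<Longrightarrow> [m = n] (mod q) \<Longrightarrow> n \<in> H" "m \<in> H \<Longrightarrow> [m = n] (mod q) \<Longrightarrow> \<psi> n = \<psi> m"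
  using assms unfolding partial_char_def by blast+

lemma partial_char_power:
  assumes "partial_char q H \<psi>" "n \<in> H"
  shows "n ^ k \<in> H" "\<psi> (n ^ k) = \<psi> n ^ k"
  using partial_charD(1,2,4,5)[OF assms(1)] assms(2) by (induction k) simp_all

text \<open>By Euler's theorem \<open>a ^ (totient q - 1)\<close> inverts \<open>a\<close> modulo
  \<open>q\<close>, and it lies in \<open>H\<close> because \<open>H\<close> is closed under
  products.\<close>

lemma partial_char_cancel:
  assumes H: "partial_char q H \<psi>" and "q > 0" "a \<in> H" "a * b \<in> H"
  shows "b \<in> H"
proof -
  have "coprime a q" using assms by (intro partial_charD(3)[OF H])
  hence e: "[a ^ totient q = 1] (mod q)" by (rule euler_theorem)
  have "a ^ (totient q - 1) * (a * b) \<in> H"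
    by (intro partial_charD(4)[OF H] partial_char_power[OF H] assms)
  also have "a ^ (totient q - 1) * (a * b) = a ^ totient q * b"
    using \<open>q > 0\<close> by (cases "totient q") (auto simp: algebra_simps)
  finally have "a ^ totient q * b \<in> H" .
  moreover have "[a ^ totient q * b = 1 * b] (mod q)"
    using e by (rule cong_scalar_right)
  ultimately have "1 * b \<in> H" by (rule partial_charD(6)[OF H])
  thus ?thesis by simp
qed

text \<open>The new group consists of the classes of \<open>h * g ^ i\<close>, and the new character
  sends them to \<open>\<psi> h * w ^ i\<close>. As \<open>m\<close> is the order of
  \<open>g\<close> modulo \<open>H\<close>, the equation for \<open>w\<close> is exactly what makes
  this independent of the representation.\<close>

lemma partial_char_extend:
  assumes H: "partial_char q H \<psi>" and q: "q > 0" and g: "coprime g q"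
    and m: "m > 0" "g ^ m \<in> H" "\<And>i. 0 < i \<Longrightarrow> i < m \<Longrightarrow> g ^ i \<notin> H"
    and w: "w ^ m = \<psi> (g ^ m)"
  shows "\<exists>H' \<psi>'. partial_char q H' \<psi>' \<and> H \<subseteq> H' \<and> g \<in> H' \<and> (\<forall>n\<in>H. \<psi>' n = \<psi> n) \<and> \<psi>' g = w"
proof -
  note Hd = partial_charD[OF H]
  note mult = Hd(4,5) and cong = Hd(6,7)
  \<comment> \<open>By minimality of \<open>m\<close>, a power of \<open>g\<close> lies in
    \<open>H\<close> only if its exponent is a multiple of \<open>m\<close>.\<close>
  have pow: "\<psi> (g ^ i) = w ^ i" if "g ^ i \<in> H" for i
  proof -
    have e: "g ^ i = (g ^ m) ^ (i div m) * g ^ (i mod m)"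
      by (metis mult_div_mod_eq power_add power_mult)
    have "g ^ (i mod m) \<in> H"
      using partial_char_cancel[OF H q partial_char_power(1)[OF H m(2)]] that e by metis
    hence "i mod m = 0" using m by (metis mod_less_divisor not_gr_zero)
    hence "g ^ i = (g ^ m) ^ (i div m)" "i = m * (i div m)" using e by auto
    thus ?thesis
      using partial_char_power(2)[OF H m(2), of "i div m"] w by (metis power_mult)
  qed
  have wd': "\<psi> h * w ^ i = \<psi> h' * w ^ j"
    if "h \<in> H" "h' \<in> H" "[h * g ^ i = h' * g ^ j] (mod q)" "i \<le> j" for h h' i j
  proof -
    have "h' * g ^ j = h' * g ^ (j - i) * g ^ i" using that(4) by (simp flip: power_add)
    hence "[h * g ^ i = h' * g ^ (j - i) * g ^ i] (mod q)" using that(3) by metis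
    hence c: "[h = h' * g ^ (j - i)] (mod q)" using g by (simp add: cong_mult_rcancel_nat)
    hence "h' * g ^ (j - i) \<in> H" using cong that by blast
    hence "g ^ (j - i) \<in> H" using partial_char_cancel[OF H q that(2)] by blast
    hence "\<psi> h = \<psi> h' * w ^ (j - i)"
      using cong(2)[OF that(1) c] mult(2)[OF that(2)] pow by simp
    thus ?thesis using that(4) by (simp flip: power_add)
  qed
  have wd: "\<psi> h * w ^ i = \<psi> h' * w ^ j"
    if "h \<in> H" "h' \<in> H" "[h * g ^ i = h' * g ^ j] (mod q)" for h h' i j
    using wd'[OF that] wd'[OF that(2,1) cong_sym[OF that(3)]] by (metis nat_le_linear)
  \<comment> \<open>The graph of the extended character; \<open>wd\<close> makes it
    single-valued.\<close>
  define P where "P n v \<longleftrightarrow> (\<exists>h\<in>H. \<exists>i. [n = h * g ^ i] (mod q) \<and> v = \<psi> h * w ^ i)" for n v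
  define H' where "H' = {n. \<exists>v. P n v}"
  define \<psi>' where "\<psi>' n = (SOME v. P n v)" for n
  have uniq: "v = v'" if "P n v" "P n v'" for n v v'
    using that wd unfolding P_def by (metis cong_sym cong_trans)
  have \<psi>': "\<psi>' n = v" if "P n v" for n v
    unfolding \<psi>'_def using that uniq by (metis someI)
  have PH: "P n (\<psi> n)" if "n \<in> H" for n
    unfolding P_def using that by (auto intro!: bexI[of _ n] exI[of _ 0])
  have Pg: "P g w"
    unfolding P_def using Hd(1,2) by (intro bexI[of _ 1] exI[of _ 1]) simp_all
  have "partial_char q H' \<psi>'"
    unfolding partial_char_def
  proof (intro conjI ballI allI impI)
    show "1 \<in> H'" "\<psi>' 1 = 1" using PH[OF Hd(1)] Hd(2) \<psi>' unfolding H'_def by auto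
  next
    fix n assume "n \<in> H'"
    then obtain h i where "h \<in> H" and c: "[n = h * g ^ i] (mod q)" unfolding H'_def P_def by auto
    hence "coprime (h * g ^ i) q" using Hd(3) g by simp
    thus "coprime n q" using cong_imp_coprime[OF cong_sym[OF c]] by simp
  next
    fix a b assume "a \<in> H'" "b \<in> H'"
    then obtain v v' where v: "P a v" "P b v'" unfolding H'_def by blast
    then obtain h i h' j where *: "h \<in> H" "[a = h * g ^ i] (mod q)" "v = \<psi> h * w ^ i"
       "h' \<in> H" "[b = h' * g ^ j] (mod q)" "v' = \<psi> h' * w ^ j" unfolding P_def by blast
    have "[a * b = (h * g ^ i) * (h' * g ^ j)] (mod q)" using * by (intro cong_mult)
    hence "[a * b = (h * h') * g ^ (i + j)] (mod q)" by (simp add: power_add mult_ac)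
    moreover have "v * v' = \<psi> (h * h') * w ^ (i + j)"
      using mult(2)[OF *(1,4)] *(3,6) by (simp add: power_add)
    ultimately have "P (a * b) (v * v')" unfolding P_def using mult(1)[OF *(1,4)] by blast
    thus "a * b \<in> H'" "\<psi>' (a * b) = \<psi>' a * \<psi>' b" using v \<psi>' unfolding H'_def by auto
  next
    fix a b assume "a \<in> H'" and c: "[a = b] (mod q)"
    then obtain v where v: "P a v" unfolding H'_def by blast
    hence "P b v" unfolding P_def using c by (meson cong_sym cong_trans)
    thus "b \<in> H'" "\<psi>' b = \<psi>' a" using v \<psi>' unfolding H'_def by auto
  qed
  thus ?thesis
    using PH Pg \<psi>' by (intro exI[of _ H'] exI[of _ \<psi>']) (auto simp: H'_def)
qed

lemma partial_char_nonzero: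
  assumes H: "partial_char q H \<psi>" and "q > 0" "n \<in> H"
  shows "\<psi> n \<noteq> 0"
proof -
  have "[n ^ totient q = 1] (mod q)" using assms by (intro euler_theorem partial_charD(3)[OF H])
  hence "\<psi> (n ^ totient q) = \<psi> 1"
    by (intro partial_charD(7)[OF H partial_charD(1)[OF H] cong_sym])
  hence "\<psi> n ^ totient q = 1"
    using partial_char_power(2)[OF H \<open>n \<in> H\<close>] partial_charD(2)[OF H] by simp
  thus ?thesis using \<open>q > 0\<close> by (auto simp: power_0_left split: if_splits)
qed

text \<open>Induction on the number of units outside \<open>H\<close>, of which each round adjoins
  one. Nothing obstructs the extension, because every nonzero complex number has \<open>m\<close>-th
  roots.\<close>

lemma partial_char_imp_dchar:
  assumes "partial_char q H \<psi>" "q > 0"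
  shows "\<exists>chi\<in>dchars q. \<forall>n\<in>H. chi n = \<psi> n"
  using assms(1)
proof (induction "card {n. n < q \<and> coprime n q \<and> n \<notin> H}" arbitrary: H \<psi> rule: less_induct)
  case (less H \<psi>)
  note H = less.prems
  note Hd = partial_charD[OF H]
  show ?case
  proof (cases "\<exists>g. g < q \<and> coprime g q \<and> g \<notin> H")
    case False
    have all: "n \<in> H" if "coprime n q" for n
    proof -
      have "coprime (n mod q) q" using that \<open>q > 0\<close> by (subst coprime_mod_left_iff) auto
      hence "n mod q \<in> H" using False \<open>q > 0\<close> by auto
      moreover have "[n mod q = n] (mod q)" by simp
      ultimately show ?thesis by (rule Hd(6))
    qed
    have nz: "\<psi> n \<noteq> 0" if "n \<in> H" for n
      using partial_char_nonzero[OF H \<open>q > 0\<close> that] .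
    define chi where "chi n = (if coprime n q then \<psi> n else 0)" for n
    have "chi \<in> dchars q"
      unfolding dchars_def mem_Collect_eq
    proof (intro conjI allI)
      show "chi 1 = 1" using Hd(2) by (simp add: chi_def)
      show "chi (m * n) = chi m * chi n" for m n
        using Hd(5)[OF all all, of m n] by (cases "coprime m q"; cases "coprime n q") (auto simp: chi_def)
      show "chi n = 0 \<longleftrightarrow> \<not> coprime n q" for n
        using nz[OF all, of n] by (auto simp: chi_def)
      show "chi (n + q) = chi n" for n
      proof -
        have "[n = n + q] (mod q)" by (simp add: cong_def)
        moreover have "coprime (n + q) q \<longleftrightarrow> coprime n q" by (rule coprime_add_self)
        ultimately show ?thesis using Hd(7)[OF all, of n "n + q"] by (simp add: chi_def)
      qed
    qed
    moreover have "\<forall>n\<in>H. chi n = \<psi> n" using Hd(3) by (simp add: chi_def)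
    ultimately show ?thesis by (intro bexI[of _ chi])
  next
    case True
    then obtain g where g: "g < q" "coprime g q" "g \<notin> H" by blast
    have "[g ^ totient q = 1] (mod q)" using g by (intro euler_theorem)
    hence "g ^ totient q \<in> H" using Hd(6)[OF Hd(1), of "g ^ totient q"] cong_sym[of "g ^ totient q" 1 q] by simp
    moreover have "totient q > 0" using \<open>q > 0\<close> by simp
    ultimately have ex: "\<exists>m>0. g ^ m \<in> H" by blast
    define m where "m = (LEAST m. m > 0 \<and> g ^ m \<in> H)"
    have m: "m > 0" "g ^ m \<in> H" using LeastI_ex[OF ex] by (auto simp: m_def)
    have m': "g ^ i \<notin> H" if "0 < i" "i < m" for i
      using not_less_Least[of i "\<lambda>m. m > 0 \<and> g ^ m \<in> H"] that by (auto simp: m_def)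
    define w where "w = exp (Ln (\<psi> (g ^ m)) / of_nat m)"
    have "w ^ m = exp (Ln (\<psi> (g ^ m)))"
      unfolding w_def exp_of_nat_mult[symmetric] using m by simp
    hence w: "w ^ m = \<psi> (g ^ m)"
      using partial_char_nonzero[OF H \<open>q > 0\<close> m(2)] by simp
    have "\<exists>H' \<psi>'. partial_char q H' \<psi>' \<and> H \<subseteq> H' \<and> g \<in> H' \<and> (\<forall>n\<in>H. \<psi>' n = \<psi> n) \<and> \<psi>' g = w"
      by (rule partial_char_extend[OF H \<open>q > 0\<close> g(2) m _ w]) (rule m')
    then obtain H' \<psi>' where H': "partial_char q H' \<psi>'" "H \<subseteq> H'" "g \<in> H'" "\<forall>n\<in>H. \<psi>' n = \<psi> n"
      by (elim exE conjE)
    have "\<exists>chi\<in>dchars q. \<forall>n\<in>H'. chi n = \<psi>' n"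
    proof (rule less.hyps[OF psubset_card_mono H'(1)])
      show "{n. n < q \<and> coprime n q \<and> n \<notin> H'} \<subset> {n. n < q \<and> coprime n q \<and> n \<notin> H}"
        using g H'(2,3) by blast
    qed simp
    then obtain chi where "chi \<in> dchars q" "\<forall>n\<in>H'. chi n = \<psi>' n" by (elim bexE)
    thus ?thesis using H'(2,4) by (intro bexI[of _ chi]) auto
  qed
qed

text \<open>The trivial character of the trivial subgroup is extended to \<open>g\<close>. If
  \<open>g\<close> has order \<open>m > 1\<close>, any \<open>m\<close>-th root of unity may serve
  as the value there, in particular one different from 1.\<close>

lemma dchar_separation:
  assumes "q > 0" "coprime g q" "\<not> [g = 1] (mod q)"
  shows "\<exists>chi\<in>dchars q. chi g \<noteq> 1"
proof -
  define H where "H = {n. [n = 1] (mod q)}"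
  have H: "partial_char q H (\<lambda>_. 1)"
    unfolding partial_char_def H_def
  proof (safe, goal_cases)
    case (2 n)
    thus ?case using cong_imp_coprime[of 1 n q] by (simp add: cong_sym)
  next
    case (3 m n)
    thus ?case using cong_mult[of m 1 q n 1] by simp
  next
    case (5 m n)
    thus ?case by (metis cong_sym cong_trans)
  qed auto
  have "[g ^ totient q = 1] (mod q)" using assms by (intro euler_theorem)
  hence ex: "\<exists>m>0. g ^ m \<in> H" using \<open>q > 0\<close> by (intro exI[of _ "totient q"]) (auto simp: H_def)
  define m where "m = (LEAST m. m > 0 \<and> g ^ m \<in> H)"
  have m: "m > 0" "g ^ m \<in> H" using LeastI_ex[OF ex] by (auto simp: m_def)
  have m': "g ^ i \<notin> H" if "0 < i" "i < m" for i
    using not_less_Least[of i "\<lambda>m. m > 0 \<and> g ^ m \<in> H"] that by (auto simp: m_def)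
  have "m \<noteq> 1" using m assms by (auto simp: H_def)
  hence m2: "m \<ge> 2" using m by linarith
  define w where "w = cis (2 * pi / m)"
  have "w ^ m = cis (real m * (2 * pi / m))" unfolding w_def by (rule Complex.DeMoivre)
  hence w: "w ^ m = 1" using m by simp
  have "w \<noteq> 1"
  proof
    assume "w = 1"
    hence c: "cos (2 * pi / m) = 1" by (auto simp: w_def complex_eq_iff)
    then obtain n :: int where "2 * pi / m = n * (2 * pi)" by (auto simp: cos_one_2pi_int mult_ac)
    hence "1 = real_of_int n * real m" using m by (simp add: field_simps)
    hence "n * int m = 1" by (metis of_int_eq_iff of_int_mult of_int_of_nat_eq of_int_1)
    thus False using m2 by (auto simp: zmult_eq_1_iff)
  qed
  have "\<exists>H' \<psi>'. partial_char q H' \<psi>' \<and> H \<subseteq> H' \<and> g \<in> H' \<and> (\<forall>n\<in>H. \<psi>' n = 1) \<and> \<psi>' g = w"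
    by (rule partial_char_extend[OF H assms(1,2) m _ w]) (rule m')
  then obtain H' \<psi>' where H': "partial_char q H' \<psi>'" "g \<in> H'" "\<psi>' g = w"
    by (elim exE conjE)
  thus ?thesis using partial_char_imp_dchar[OF H'(1) assms(1)] \<open>w \<noteq> 1\<close> by metis
qed

section \<open>Finiteness and orthogonality of the characters modulo q\<close>

lemma dcharD:
  assumes "chi \<in> dchars q"
  shows "chi 1 = 1" "chi (m * n) = chi m * chi n" "chi (n + q) = chi n" "chi n = 0 \<longleftrightarrow> \<not> coprime n q"
  using assms unfolding dchars_def by blast+

lemma dchar_add_mult: "chi \<in> dchars q \<Longrightarrow> chi (n + k * q) = chi n"
proof (induction k)
  case (Suc k)
  have "chi (n + Suc k * q) = chi (n + k * q + q)" by (simp add: add_ac)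
  thus ?case using Suc dcharD(3)[of chi q "n + k * q"] by simp
qed simp

lemma dchar_mod: "chi \<in> dchars q \<Longrightarrow> chi (n mod q) = chi n"
  using dchar_add_mult[of chi q "n mod q" "n div q"] by simp

lemma dchar_cong: "chi \<in> dchars q \<Longrightarrow> [m = n] (mod q) \<Longrightarrow> chi m = chi n"
  unfolding cong_def using dchar_mod by metis

lemma dchar_power: "chi \<in> dchars q \<Longrightarrow> chi (n ^ k) = chi n ^ k"
  by (induction k) (auto simp: dcharD simp del: One_nat_def simp flip: One_nat_def)

lemma dchar_power_totient:
  assumes "chi \<in> dchars q" "coprime n q"
  shows "chi n ^ totient q = 1"
  using dchar_cong[OF assms(1) euler_theorem[OF assms(2)]] dchar_power[OF assms(1)] dcharD(1)[OF assms(1)] by simp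

lemma norm_dchar:
  assumes "chi \<in> dchars q" "coprime n q" "q > 0"
  shows "norm (chi n) = 1"
  using power_eq_1_iff[OF dchar_power_totient[OF assms(1,2)]] assms(3) by simp

lemma norm_dchar_le:
  assumes "chi \<in> dchars q" "q > 0"
  shows "norm (chi n) \<le> 1"
  using norm_dchar[OF assms(1) _ assms(2), of n] dcharD(4)[OF assms(1), of n] by (cases "coprime n q") auto

lemma finite_dchars:
  assumes "q > 0"
  shows "finite (dchars q)"
proof -
  \<comment> \<open>A value is 0 or a root of unity of order dividing \<open>totient q\<close>, and
    a character is determined by its values below \<open>q\<close>.\<close>
  define R where "R = insert 0 {z::complex. z ^ totient q = 1}"
  have fR: "finite R" unfolding R_def using assms by (auto intro!: finite_roots_unity Suc_leI)
  have "dchars q \<subseteq> (\<lambda>f n. f (n mod q)) ` PiE {..<q} (\<lambda>_. R)"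
  proof
    fix chi assume chi: "chi \<in> dchars q"
    have "chi n \<in> R" for n
      unfolding R_def using dchar_power_totient[OF chi, of n] dcharD(4)[OF chi, of n] by auto
    hence "restrict chi {..<q} \<in> PiE {..<q} (\<lambda>_. R)" by auto
    moreover have "chi = (\<lambda>n. restrict chi {..<q} (n mod q))"
      using dchar_mod[OF chi] assms by (auto simp: fun_eq_iff)
    ultimately show "chi \<in> (\<lambda>f n. f (n mod q)) ` PiE {..<q} (\<lambda>_. R)" by blast
  qed
  thus ?thesis using fR by (meson finite_PiE finite_imageI finite_lessThan finite_subset)
qed

definition principal_dchar :: "nat \<Rightarrow> nat \<Rightarrow> complex" where
  "principal_dchar q n = (if coprime n q then 1 else 0)"

lemma principal_dchar: "principal_dchar q \<in> dchars q"
  unfolding dchars_def principal_dchar_def using coprime_add_self by auto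

lemma mult_dchars: "chi \<in> dchars q \<Longrightarrow> psi \<in> dchars q \<Longrightarrow> (\<lambda>n. chi n * psi n) \<in> dchars q"
  unfolding dchars_def by auto

lemma sum_dchar:
  assumes chi: "chi \<in> dchars q" and q: "q > 0"
  shows "(\<Sum>n<q. chi n) = (if chi = principal_dchar q then of_nat (totient q) else 0)"
proof (cases "chi = principal_dchar q")
  case True
  have "(\<Sum>n<q. principal_dchar q n) = (\<Sum>n\<in>{n\<in>{..<q}. coprime n q}. 1)"
    unfolding principal_dchar_def by (subst sum.inter_filter) auto
  also have "{n\<in>{..<q}. coprime n q} = {n. n < q \<and> coprime n q}" by auto
  finally have "(\<Sum>n<q. principal_dchar q n) = of_nat (card {n. n < q \<and> coprime n q})" by simp
  also have "card {n. n < q \<and> coprime n q} = totient q"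
  \<comment> \<open>\<open>totatives q\<close> lies in \<open>{1..q}\<close>. For
    \<open>q > 1\<close> it is the same set as on the left; for \<open>q = 1\<close> the two sets
    are \<open>{0}\<close> and \<open>{1}\<close>, of equal size.\<close>
  proof (cases "q = 1")
    case False
    have "n < q" if "n \<le> q" "coprime n q" for n
      using that False q by (cases "n = q") auto
    moreover have "n > 0" if "coprime n q" for n
      using that False by (cases "n = 0") auto
    ultimately have "{n. n < q \<and> coprime n q} = totatives q"
      unfolding totatives_def by auto
    thus ?thesis by (simp add: totient_def)
  qed auto
  finally show ?thesis using True by simp
next
  case False
  then obtain c where c: "chi c \<noteq> principal_dchar q c" by auto
  hence cop: "coprime c q" "chi c \<noteq> 1"
    using dcharD(4)[OF chi, of c] by (auto simp: principal_dchar_def split: if_splits)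
  have "(\<Sum>n<q. chi n) = (\<Sum>n<q. chi ((c * n) mod q))"
  proof (rule sum.reindex_bij_betw[symmetric])
    have "inj_on (\<lambda>n. c * n mod q) {..<q}"
    proof (rule inj_onI)
      fix x y assume "x \<in> {..<q}" "y \<in> {..<q}" "c * x mod q = c * y mod q"
      hence "[c * x = c * y] (mod q)" by (simp add: cong_def)
      hence "[x = y] (mod q)" using cop by (simp add: cong_mult_lcancel_nat)
      thus "x = y" using \<open>x \<in> {..<q}\<close> \<open>y \<in> {..<q}\<close> by (simp add: cong_def)
    qed
    moreover have "(\<lambda>n. c * n mod q) ` {..<q} \<subseteq> {..<q}" using q by auto
    ultimately show "bij_betw (\<lambda>n. c * n mod q) {..<q} {..<q}"
      by (simp add: bij_betw_def endo_inj_surj)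
  qed
  also have "\<dots> = chi c * (\<Sum>n<q. chi n)"
    by (simp add: dchar_mod[OF chi] dcharD(2)[OF chi] sum_distrib_left)
  finally show ?thesis using cop False by simp
qed

text \<open>Multiplication by a character \<open>psi\<close> with \<open>psi n \<noteq> 1\<close>
  permutes the characters and multiplies the sum by \<open>psi n\<close>.\<close>

lemma sum_dchars_eq_0:
  assumes q: "q > 0" and n: "coprime n q" "\<not> [n = 1] (mod q)"
  shows "(\<Sum>chi\<in>dchars q. chi n) = 0"
proof -
  obtain psi where psi: "psi \<in> dchars q" "psi n \<noteq> 1" using dchar_separation[OF assms] by blast
  have "(\<Sum>chi\<in>dchars q. chi n) = (\<Sum>chi\<in>dchars q. (\<lambda>n. psi n * chi n) n)"
  proof (rule sum.reindex_bij_betw[symmetric, where g = "\<lambda>chi. chi n"])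
    have "inj_on (\<lambda>chi n. psi n * chi n) (dchars q)"
    proof (rule inj_onI)
      fix x y assume xy: "x \<in> dchars q" "y \<in> dchars q" "(\<lambda>n. psi n * x n) = (\<lambda>n. psi n * y n)"
      show "x = y"
      proof
        fix m show "x m = y m"
          using fun_cong[OF xy(3), of m] dcharD(4)[OF xy(1), of m] dcharD(4)[OF xy(2), of m] dcharD(4)[OF psi(1), of m]
          by (cases "coprime m q") auto
      qed
    qed
    moreover have "(\<lambda>chi n. psi n * chi n) ` dchars q \<subseteq> dchars q" using mult_dchars psi by auto
    ultimately show "bij_betw (\<lambda>chi n. psi n * chi n) (dchars q) (dchars q)"
      using finite_dchars[OF q] by (simp add: bij_betw_def endo_inj_surj)
  qed
  also have "\<dots> = psi n * (\<Sum>chi\<in>dchars q. chi n)" by (simp add: sum_distrib_left)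
  finally show ?thesis using psi by simp
qed

text \<open>Double counting of the sum of \<open>chi n\<close> over all characters and all
  \<open>n < q\<close>: each of the two orthogonality relations evaluates it. The class of 1 appears
  as \<open>1 mod q\<close> in order to cover \<open>q = 1\<close>.\<close>

lemma card_dchars:
  assumes q: "q > 0"
  shows "card (dchars q) = totient q"
proof -
  have "(\<Sum>chi\<in>dchars q. \<Sum>n<q. chi n) = (\<Sum>chi\<in>dchars q. if chi = principal_dchar q then of_nat (totient q) else 0)"
    by (intro sum.cong refl sum_dchar q)
  also have "\<dots> = of_nat (totient q)"
    using finite_dchars[OF q] principal_dchar by simp
  finally have 1: "(\<Sum>chi\<in>dchars q. \<Sum>n<q. chi n) = of_nat (totient q)" .
  have "(\<Sum>chi\<in>dchars q. \<Sum>n<q. chi n) = (\<Sum>n<q. \<Sum>chi\<in>dchars q. chi n)"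
    by (rule sum.swap)
  also have "\<dots> = (\<Sum>n<q. if n = 1 mod q then of_nat (card (dchars q)) else 0)"
  proof (intro sum.cong refl)
    fix n assume n: "n \<in> {..<q}"
    show "(\<Sum>chi\<in>dchars q. chi n) = (if n = 1 mod q then of_nat (card (dchars q)) else 0)"
    proof (cases "n = 1 mod q")
      case True
      have "chi n = 1" if "chi \<in> dchars q" for chi
        using dchar_mod[OF that, of 1] dcharD(1)[OF that] True by simp
      hence "(\<Sum>chi\<in>dchars q. chi n) = (\<Sum>chi\<in>dchars q. 1)" by (intro sum.cong refl)
      thus ?thesis using True by simp
    next
      case False
      hence *: "\<not> [n = 1] (mod q)" using n by (simp add: cong_def)
      show ?thesis
      proof (cases "coprime n q")
        case True
        thus ?thesis using sum_dchars_eq_0[OF q True *] False by simp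
      next
        case c: False
        hence "(\<Sum>chi\<in>dchars q. chi n) = 0" by (intro sum.neutral) (simp add: dcharD(4))
        thus ?thesis using False by simp
      qed
    qed
  qed
  also have "\<dots> = of_nat (card (dchars q))" using q by simp
  finally show ?thesis using 1 by (simp only: of_nat_eq_iff)
qed

text \<open>\<open>cnj (chi a)\<close> is the value of \<open>chi\<close> at an inverse of
  \<open>a\<close> modulo \<open>q\<close>, which reduces the claim to the sum of all characters at
  one point.\<close>

lemma dchar_orthogonality:
  assumes q: "q > 0" and a: "coprime a q"
  shows "(\<Sum>chi\<in>dchars q. cnj (chi a) * chi n) = (if [n = a] (mod q) then of_nat (totient q) else 0)"
proof -
  obtain b where b: "[a * b = 1] (mod q)" using cong_solve_coprime_nat[OF a] by auto
  have cb: "coprime b q"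
    using b by (metis cong_imp_coprime cong_sym coprime_1_left coprime_mult_left_iff)
  have cnj: "cnj (chi a) = chi b" if chi: "chi \<in> dchars q" for chi
  proof -
    have "chi a * chi b = 1" using dchar_cong[OF chi b] dcharD(1,2)[OF chi] by simp
    moreover have "chi a * cnj (chi a) = 1"
      using norm_dchar[OF chi a q] by (simp add: complex_norm_square[symmetric])
    ultimately show ?thesis by (metis mult_cancel_left mult_zero_left zero_neq_one)
  qed
  have "(\<Sum>chi\<in>dchars q. cnj (chi a) * chi n) = (\<Sum>chi\<in>dchars q. chi (b * n))"
    by (intro sum.cong refl) (simp add: cnj dcharD(2))
  also have "\<dots> = (if [n = a] (mod q) then of_nat (totient q) else 0)"
  proof (cases "[n = a] (mod q)")
    case True
    have "[b * n = 1] (mod q)"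
      using b cong_scalar_left[OF True, of b] by (metis cong_trans mult.commute)
    hence "chi (b * n) = 1" if "chi \<in> dchars q" for chi
      using dchar_cong[OF that] dcharD(1)[OF that] by metis
    hence "(\<Sum>chi\<in>dchars q. chi (b * n)) = (\<Sum>chi\<in>dchars q. 1)" by (intro sum.cong refl)
    thus ?thesis using True card_dchars[OF q] by simp
  next
    case False
    have *: "\<not> [b * n = 1] (mod q)"
    proof
      assume "[b * n = 1] (mod q)"
      hence "[b * n = b * a] (mod q)" using b by (metis cong_sym cong_trans mult.commute)
      thus False using False cb by (simp add: cong_mult_lcancel_nat)
    qed
    show ?thesis
    proof (cases "coprime (b * n) q")
      case True
      thus ?thesis using sum_dchars_eq_0[OF q True *] False by simp
    next
      case c: False
      hence "(\<Sum>chi\<in>dchars q. chi (b * n)) = 0" by (intro sum.neutral ballI) (simp only: dcharD(4) not_False_eq_True)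
      thus ?thesis using False by simp
    qed
  qed
  finally show ?thesis .
qed

section \<open>Primitive characters\<close>

lemma exists_cong_coprime:
  assumes "coprime n d" "q > 0"
  shows "\<exists>m. [m = n] (mod d) \<and> coprime m (q::nat)"
proof -
  \<comment> \<open>The product of the primes that divide \<open>q\<close> but not \<open>n\<close>.
    A prime divisor of \<open>q\<close> divides exactly one of \<open>n\<close> and
    \<open>t\<close>, and if it divides \<open>n\<close> it does not divide \<open>d\<close>; in
    either case it does not divide \<open>n + d * t\<close>.\<close>
  define t where "t = \<Prod>{p. prime p \<and> p dvd q \<and> \<not> p dvd n}"
  have fin: "finite {p. prime p \<and> p dvd q \<and> \<not> p dvd n}"
    by (rule finite_subset[of _ "{p. p dvd q}"]) (use assms in auto)
  have pt: "p dvd t \<longleftrightarrow> \<not> p dvd n" if p: "prime p" "p dvd q" for p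
  proof
    assume "p dvd t"
    then obtain p' where "prime p'" "\<not> p' dvd n" "p dvd p'"
      using prime_dvd_prod_iff[OF fin p(1), of "\<lambda>x. x"] unfolding t_def by auto
    thus "\<not> p dvd n" using p by (metis primes_dvd_imp_eq)
  next
    assume "\<not> p dvd n"
    thus "p dvd t" unfolding t_def using p fin by (intro dvd_prodI[OF fin, where f = "\<lambda>x. x", simplified]) auto
  qed
  have "coprime (n + d * t) q"
  proof (rule ccontr)
    assume "\<not> coprime (n + d * t) q"
    then obtain p where p: "prime p" "p dvd n + d * t" "p dvd q"
      unfolding coprime_iff_gcd_eq_1 using prime_factor_nat[of "gcd (n + d * t) q"] that
      by (meson dvd_trans gcd_dvd1 gcd_dvd2)
    show False
    proof (cases "p dvd n")
      case True
      hence "p dvd d * t" using p dvd_add_right_iff[of p n "d * t"] by blast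
      hence "p dvd d" using pt[OF p(1,3)] True p(1) by (auto simp: prime_dvd_mult_iff)
      thus False using True assms(1) p(1) coprime_common_divisor_nat[of n d p] not_prime_1 by blast
    next
      case False
      hence "p dvd d * t" using pt[OF p(1,3)] by simp
      thus False using False p(2) dvd_add_left_iff[of p "d * t" n] by blast
    qed
  qed
  thus ?thesis by (intro exI[of _ "n + d * t"]) (auto simp: cong_def)
qed

text \<open>The description by \<open>THE\<close> needs uniqueness: every class coprime to the
  conductor contains an integer coprime to \<open>q\<close>, and there each inducing character
  agrees with \<open>chi\<close>.\<close>

lemma prim_char:
  assumes chi: "chi \<in> dchars q" and q: "q > 0"
  shows "conductor q chi > 0" "induces (conductor q chi) (prim_char q chi) q chi"
proof -
  have "induces q chi q chi" using chi by (simp add: induces_def)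
  hence ex: "\<exists>d. d > 0 \<and> (\<exists>\<psi>. induces d \<psi> q chi)" using q by blast
  show d: "conductor q chi > 0"
    unfolding conductor_def using LeastI_ex[OF ex] by blast
  obtain \<psi> where \<psi>: "induces (conductor q chi) \<psi> q chi"
    unfolding conductor_def using LeastI_ex[OF ex] by blast
  have "\<psi>' = \<psi>" if "induces (conductor q chi) \<psi>' q chi" for \<psi>'
  proof
    fix n
    show "\<psi>' n = \<psi> n"
    proof (cases "coprime n (conductor q chi)")
      case True
      then obtain m where m: "[m = n] (mod conductor q chi)" "coprime m q"
        using exists_cong_coprime[OF _ q] by blast
      have "\<psi>' m = chi m" "\<psi> m = chi m" using that \<psi> m(2) by (auto simp: induces_def)
      moreover have "\<psi>' m = \<psi>' n" "\<psi> m = \<psi> n"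
        using that \<psi> dchar_cong[OF _ m(1)] by (auto simp: induces_def)
      ultimately show ?thesis by simp
    next
      case False
      hence "\<psi>' n = 0" "\<psi> n = 0" using that \<psi> dcharD(4) by (auto simp: induces_def)
      thus ?thesis by simp
    qed
  qed
  with \<psi> have "prim_char q chi = \<psi>"
    unfolding prim_char_def by (rule the_equality)
  with \<psi> show "induces (conductor q chi) (prim_char q chi) q chi" by simp
qed

lemma prim_char_power_and_norm:
  assumes "chi \<in> dchars q" "q > 0"
  shows "prim_char q chi (n ^ k) = prim_char q chi n ^ k" "norm (prim_char q chi n) \<le> 1"
    "coprime n q \<Longrightarrow> norm (prim_char q chi n) = 1"
proof -
  have p: "prim_char q chi \<in> dchars (conductor q chi)" "\<And>n. coprime n q \<Longrightarrow> chi n = prim_char q chi n"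
    using prim_char(2)[OF assms] by (auto simp: induces_def)
  show "prim_char q chi (n ^ k) = prim_char q chi n ^ k" by (rule dchar_power[OF p(1)])
  show "norm (prim_char q chi n) \<le> 1" by (rule norm_dchar_le[OF p(1) prim_char(1)[OF assms]])
  show "norm (prim_char q chi n) = 1" if "coprime n q"
    using p(2)[OF that] norm_dchar[OF assms(1) that assms(2)] by simp
qed

section \<open>L-functions in terms of the Hurwitz zeta function and conversely\<close>

lemma dirichlet_series_eq:
  assumes chi: "chi \<in> dchars q" and q: "q > 0" and s: "Re s > 1"
  shows "(\<Sum>n. chi (Suc n) / of_nat (Suc n) powr s) =
    (\<Sum>r=1..q. chi r * (of_nat q powr (-s) * hurwitz_series (real r / real q) s))"
proof -
  define f where "f n = chi (Suc n) / of_nat (Suc n) powr s" for n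
  have "summable f"
  proof (rule summable_comparison_test)
    have "norm (f n) \<le> (real n + 1) powr (- Re s)" for n
    proof -
      have "norm (f n) = norm (chi (Suc n)) / norm (of_real (real (Suc n)) powr s :: complex)"
        by (simp add: f_def norm_divide)
      also have "norm (of_real (real (Suc n)) powr s :: complex) = (real n + 1) powr Re s"
        by (subst norm_of_real_powr) (auto simp: add_ac)
      also have "norm (chi (Suc n)) / (real n + 1) powr Re s \<le> 1 / (real n + 1) powr Re s"
        using norm_dchar_le[OF chi q] by (intro divide_right_mono) auto
      finally show ?thesis by (simp add: powr_minus field_simps)
    qed
    thus "\<exists>N. \<forall>n\<ge>N. norm (f n) \<le> (real n + 1) powr (- Re s)" by blast
    show "summable (\<lambda>n. (real n + 1) powr (- Re s))" using s by (intro summable_shift_powr) auto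
  qed
  hence "f sums suminf f" by (rule summable_sums)
  \<comment> \<open>Block \<open>m\<close> runs over the integers \<open>r + m * q\<close> with
    \<open>r\<close> from 1 to \<open>q\<close>. The class of 0 is thus represented by
    \<open>q\<close>, and all parameters \<open>r / q\<close> are positive.\<close>
  from sums_group[OF this q] have "(\<lambda>m. sum f {m * q..<m * q + q}) sums suminf f" .
  moreover have "(\<lambda>m. \<Sum>r=1..q. chi r * (of_nat q powr (-s) * of_real (real m + real r / real q) powr (-s))) sums
      (\<Sum>r=1..q. chi r * (of_nat q powr (-s) * hurwitz_series (real r / real q) s))"
    using q s by (intro sums_sum sums_mult sums_hurwitz_series) auto
  moreover have "sum f {m * q..<m * q + q} =
    (\<Sum>r=1..q. chi r * (of_nat q powr (-s) * of_real (real m + real r / real q) powr (-s)))" for m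
  proof -
    have "sum f {m * q..<m * q + q} = (\<Sum>r=1..q. f (m * q + (r - 1)))"
      by (rule sum.reindex_bij_witness[of _ "\<lambda>r. m * q + (r - 1)" "\<lambda>n. n - m * q + 1"]) (use q in auto)
    also have "\<dots> = (\<Sum>r=1..q. chi r * (of_nat q powr (-s) * of_real (real m + real r / real q) powr (-s)))"
    proof (intro sum.cong refl)
      fix r assume r: "r \<in> {1..q}"
      hence e: "Suc (m * q + (r - 1)) = r + m * q" by simp
      have "of_nat (r + m * q) = complex_of_real (real q) * of_real (real m + real r / real q)"
        unfolding of_real_mult[symmetric] using q by (simp add: field_simps)
      hence "of_nat (r + m * q) powr s = of_nat q powr s * of_real (real m + real r / real q) powr s"
        using powr_times_real[of "of_real (real q)" "of_real (real m + real r / real q)" s] by simp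
      thus "f (m * q + (r - 1)) = chi r * (of_nat q powr (-s) * of_real (real m + real r / real q) powr (-s))"
        unfolding f_def e dchar_add_mult[OF chi] by (simp add: powr_minus field_simps)
    qed
    finally show ?thesis .
  qed
  ultimately show ?thesis
    unfolding f_def[symmetric] using sums_unique2 by (metis (no_types, lifting) sums_cong)
qed

lemma dirichlet_L_eq:
  assumes chi: "chi \<in> dchars q" and q: "q > 0" and s: "s \<noteq> 1"
  shows "dirichlet_L chi s = of_nat q powr (-s) * (\<Sum>r=1..q. chi r * hurwitz_zeta (real r / real q) s)"
proof -
  define g where "g s = of_nat q powr (-s) * (\<Sum>r=1..q. chi r * hurwitz_entire (real r / real q) s)" for s
  have "dirichlet_L chi s = g s / (s - 1)"
    unfolding dirichlet_L_def
  proof (rule mero_continuation_eq[OF _ _ s])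
    show "g holomorphic_on UNIV"
      unfolding g_def using q by (intro holomorphic_intros holomorphic_hurwitz_entire) auto
  next
    fix s :: complex assume s: "Re s > 1"
    have "(\<Sum>r=1..q. chi r * (of_nat q powr (-s) * hurwitz_series (real r / real q) s)) =
       (\<Sum>r=1..q. of_nat q powr (-s) * (chi r * hurwitz_entire (real r / real q) s) / (s - 1))"
    proof (intro sum.cong refl)
      fix r assume "r \<in> {1..q}"
      hence "hurwitz_entire (real r / real q) s = (s - 1) * hurwitz_series (real r / real q) s"
        using hurwitz_entire_eq[of "real r / real q" 0 s] hurwitz_cont_eq[of "real r / real q" s 0] s by simp
      thus "chi r * (of_nat q powr (-s) * hurwitz_series (real r / real q) s) =
        of_nat q powr (-s) * (chi r * hurwitz_entire (real r / real q) s) / (s - 1)"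
        using s by (auto simp: divide_simps)
    qed
    thus "(\<Sum>n. chi (Suc n) / of_nat (Suc n) powr s) = g s / (s - 1)"
      unfolding dirichlet_series_eq[OF chi q s] g_def by (simp add: sum_distrib_left sum_divide_distrib)
  qed
  also have "\<dots> = of_nat q powr (-s) * (\<Sum>r=1..q. chi r * hurwitz_zeta (real r / real q) s)"
  proof -
    have "(\<Sum>r=1..q. chi r * hurwitz_zeta (real r / real q) s) = (\<Sum>r=1..q. chi r * hurwitz_entire (real r / real q) s / (s - 1))"
      using s by (intro sum.cong refl) (subst hurwitz_zeta_eq, auto)
    thus ?thesis by (simp add: g_def flip: sum_divide_distrib)
  qed
  finally show ?thesis .
qed

lemma hurwitz_zeta_eq_sum_dirichlet_L:
  assumes a: "1 \<le> a" "a \<le> q" "coprime a q" and s: "s \<noteq> 1"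
  shows "hurwitz_zeta (real a / real q) s =
    of_nat q powr s / of_nat (totient q) * (\<Sum>chi\<in>dchars q. cnj (chi a) * dirichlet_L chi s)"
proof -
  have q: "q > 0" using a by simp
  have "(\<Sum>chi\<in>dchars q. cnj (chi a) * dirichlet_L chi s) =
    (\<Sum>chi\<in>dchars q. \<Sum>r=1..q. of_nat q powr (-s) * (cnj (chi a) * chi r) * hurwitz_zeta (real r / real q) s)"
    by (intro sum.cong refl) (simp add: dirichlet_L_eq[OF _ q s] sum_distrib_left mult_ac)
  also have "\<dots> = (\<Sum>r=1..q. of_nat q powr (-s) * (\<Sum>chi\<in>dchars q. cnj (chi a) * chi r) * hurwitz_zeta (real r / real q) s)"
    by (subst sum.swap) (simp add: sum_distrib_left sum_distrib_right)
  also have "\<dots> = (\<Sum>r=1..q. if r = a then of_nat q powr (-s) * of_nat (totient q) * hurwitz_zeta (real r / real q) s else 0)"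
  proof (intro sum.cong refl)
    fix r assume r: "r \<in> {1..q}"
    have "[r = a] (mod q) \<longleftrightarrow> r = a"
    proof
      assume "[r = a] (mod q)"
      hence "[r - 1 = a - 1] (mod q)" using r a by (metis atLeastAtMost_iff cong_diff_nat cong_refl)
      hence "r - 1 = a - 1" using r a by (auto simp: cong_def)
      thus "r = a" using r a by auto
    qed auto
    thus "of_nat q powr (-s) * (\<Sum>chi\<in>dchars q. cnj (chi a) * chi r) * hurwitz_zeta (real r / real q) s =
      (if r = a then of_nat q powr (-s) * of_nat (totient q) * hurwitz_zeta (real r / real q) s else 0)"
      using dchar_orthogonality[OF q a(3), of r] by simp
  qed
  also have "\<dots> = of_nat q powr (-s) * of_nat (totient q) * hurwitz_zeta (real a / real q) s"
    using a by simp
  finally show ?thesis using q by (simp add: powr_minus field_simps)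
qed

lemma holomorphic_dirichlet_L:
  assumes chi: "chi \<in> dchars q" and q: "q > 0"
  shows "dirichlet_L chi holomorphic_on - {1}"
proof -
  have "(\<lambda>s. of_nat q powr (-s) * (\<Sum>r=1..q. chi r * (hurwitz_entire (real r / real q) s / (s - 1)))) holomorphic_on - {1}"
    using q by (intro holomorphic_intros holomorphic_hurwitz_entire) auto
  thus ?thesis
  proof (rule holomorphic_transform)
    fix s :: complex assume "s \<in> - {1}"
    thus "of_nat q powr (-s) * (\<Sum>r=1..q. chi r * (hurwitz_entire (real r / real q) s / (s - 1))) = dirichlet_L chi s"
      using dirichlet_L_eq[OF chi q, of s] hurwitz_zeta_eq[of "real r / real q" s for r] q by simp
  qed
qed

lemma continuous_on_Complex_half: "continuous_on A (\<lambda>t. Complex (1/2) t)"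
  unfolding Complex_eq by (intro continuous_intros)

lemma continuous_on_dirichlet_L:
  assumes "chi \<in> dchars q" "q > 0"
  shows "continuous_on A (\<lambda>t. dirichlet_L chi (Complex (1/2) t))"
  by (rule continuous_on_compose2[OF holomorphic_on_imp_continuous_on[OF holomorphic_dirichlet_L[OF assms]] continuous_on_Complex_half])
     (auto simp: complex_eq_iff)

section \<open>The second moment of the Hurwitz zeta function\<close>

lemma taylor_remainder_1:
  "taylor_remainder 1 x s = of_real (x + 1) powr (1 - s) - of_real x powr (1 - s) - (1 - s) * of_real x powr (-s)"
  by (simp add: taylor_remainder_def falling_def)

text \<open>Level 0 of the continuation with its first \<open>N\<close> remainders evaluated: their
  differences telescope and the rest is the partial sum of the series.\<close>

lemma hurwitz_zeta_euler_maclaurin: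
  assumes \<alpha>: "\<alpha> > 0" and s: "Re s > 0" "s \<noteq> 1"
  shows "hurwitz_zeta \<alpha> s = (\<Sum>n<N. of_real (real n + \<alpha>) powr (-s)) + of_real (real N + \<alpha>) powr (1 - s) / (s - 1)
     + (\<Sum>n. taylor_remainder 1 (real (n + N) + \<alpha>) s) / (s - 1)"
proof -
  define x where "x n = complex_of_real (real n + \<alpha>)" for n
  have "summable (\<lambda>n. taylor_remainder 1 (real n + \<alpha>) s)"
    using \<alpha> s by (intro summable_taylor_remainder) auto
  hence "(\<Sum>n. taylor_remainder 1 (real n + \<alpha>) s) =
     (\<Sum>n. taylor_remainder 1 (real (n + N) + \<alpha>) s) + (\<Sum>n<N. taylor_remainder 1 (real n + \<alpha>) s)"
    by (rule suminf_split_initial_segment)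
  also have "(\<Sum>n<N. taylor_remainder 1 (real n + \<alpha>) s) =
     (\<Sum>n<N. x (Suc n) powr (1 - s) - x n powr (1 - s)) - (1 - s) * (\<Sum>n<N. x n powr (-s))"
    unfolding taylor_remainder_1 sum_subtractf sum_distrib_left by (simp add: x_def add_ac)
  also have "(\<Sum>n<N. x (Suc n) powr (1 - s) - x n powr (1 - s)) = x N powr (1 - s) - x 0 powr (1 - s)"
    by (rule sum_lessThan_telescope)
  finally have "hurwitz_entire \<alpha> s = (\<Sum>n. taylor_remainder 1 (real (n + N) + \<alpha>) s) +
      x N powr (1 - s) + (s - 1) * (\<Sum>n<N. x n powr (-s))"
    using hurwitz_entire_eq[OF \<alpha>, of 0 s] s by (simp add: x_def algebra_simps)
  thus ?thesis
    using hurwitz_zeta_eq[OF \<alpha> s(2)] s(2) by (simp add: x_def add_divide_distrib add_ac)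
qed

text \<open>Makes sums over integer shifts of \<open>y\<close> telescope. With \<open>a\<close> and
  \<open>b\<close> the two square roots, \<open>b\<^sup>2 - a\<^sup>2 = 1\<close> turns
  \<open>1 / a - 1 / b\<close> into \<open>1 / (a * b * (a + b))\<close>, and
  \<open>a \<le> b\<close> does the rest.\<close>

lemma powr_neg_three_halves_le:
  assumes "y > 1"
  shows "y powr (-3/2) \<le> 2 * (1 / sqrt (y - 1) - 1 / sqrt y)"
proof -
  define a b where "a = sqrt (y - 1)" and "b = sqrt y"
  have ab: "a > 0" "b > 0" "a \<le> b" and sq: "b\<^sup>2 - a\<^sup>2 = 1"
    using assms by (auto simp: a_def b_def)
  have "y powr (-3/2) = (b\<^sup>2) powr (-3/2)" using assms by (simp add: b_def)
  also have "\<dots> = b powr (-3)" using ab by (simp add: powr_powr flip: powr_numeral)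
  also have "\<dots> = 1 / (b * b * b)" using ab by (simp add: powr_minus power3_eq_cube field_simps)
  also have "\<dots> \<le> 2 / (a * b * (b + a))"
  proof -
    have "a * b * (b + a) \<le> b * b * (b + b)" using ab by (intro mult_mono add_mono) auto
    hence "2 / (b * b * (b + b)) \<le> 2 / (a * b * (b + a))" using ab by (intro divide_left_mono) auto
    thus ?thesis using ab by (simp add: field_simps)
  qed
  also have "2 / (a * b * (b + a)) = 2 * (1 / a - 1 / b)"
  proof -
    have "(b + a) * (b - a) = 1" using sq by (simp add: power2_eq_square algebra_simps)
    hence "2 / (a * b * (b + a)) = 2 * ((b + a) * (b - a)) / (a * b * (b + a))" by simp
    also have "\<dots> = 2 * (b - a) / (a * b)" using ab by (simp add: divide_simps)
    also have "\<dots> = 2 * (1 / a - 1 / b)" using ab by (simp add: field_simps)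
    finally show ?thesis .
  qed
  finally show ?thesis by (simp add: a_def b_def)
qed

text \<open>Here \<open>falling 2 s = s * (s - 1)\<close>, so that division by \<open>s - 1\<close>
  leaves a bound proportional to \<open>norm s\<close>.\<close>

lemma norm_suminf_taylor_remainder_1:
  assumes \<alpha>: "\<alpha> > 0" and N: "N \<ge> 1" and s: "Re s = 1/2"
  shows "norm ((\<Sum>n. taylor_remainder 1 (real (n + N) + \<alpha>) s) / (s - 1)) \<le> 2 * norm s / sqrt (real N + \<alpha> - 1)"
proof -
  define y where "y n = real (n + N) + \<alpha>" for n
  have y: "y n > 1" for n using \<alpha> N by (simp add: y_def)
  have s1: "s \<noteq> 1" using s by auto
  have bound: "norm (taylor_remainder 1 (y n) s) \<le> norm s * norm (s - 1) * (2 * (1 / sqrt (y n - 1) - 1 / sqrt (y (Suc n) - 1)))" for n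
  proof -
    have "norm (taylor_remainder 1 (y n) s) \<le> norm (falling (Suc 1) s) * y n powr (- Re s - real 1) / fact 1"
      using y[of n] s by (intro norm_taylor_remainder) auto
    also have "norm (falling (Suc 1) s) = norm s * norm (s - 1)"
      by (simp add: falling_def norm_mult norm_minus_commute mult.commute)
    also have "- Re s - real 1 = -3/2" using s by simp
    also have "norm s * norm (s - 1) * y n powr (-3/2) / fact 1 \<le> norm s * norm (s - 1) * (2 * (1 / sqrt (y n - 1) - 1 / sqrt (y n)))"
      using powr_neg_three_halves_le[OF y[of n]] by (auto intro!: mult_left_mono)
    finally show ?thesis by (simp add: y_def add_ac)
  qed
  have lim: "(\<lambda>n. 1 / sqrt (y n - 1)) \<longlonglongrightarrow> 0"
    unfolding y_def by real_asymp
  have "(\<lambda>n. 1 / sqrt (y n - 1) - 1 / sqrt (y (Suc n) - 1)) sums (1 / sqrt (y 0 - 1) - 0)"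
    by (rule telescope_sums'[OF lim])
  hence sums: "(\<lambda>n. norm s * norm (s - 1) * (2 * (1 / sqrt (y n - 1) - 1 / sqrt (y (Suc n) - 1)))) sums
     (norm s * norm (s - 1) * (2 * (1 / sqrt (y 0 - 1))))"
    by (intro sums_mult) simp
  have "norm (\<Sum>n. taylor_remainder 1 (y n) s) \<le> (\<Sum>n. norm s * norm (s - 1) * (2 * (1 / sqrt (y n - 1) - 1 / sqrt (y (Suc n) - 1))))"
    by (rule norm_suminf_le[OF bound sums_summable[OF sums]])
  also have "\<dots> = norm s * norm (s - 1) * (2 * (1 / sqrt (y 0 - 1)))"
    using sums by (rule sums_unique[symmetric])
  finally show ?thesis
    using s1 by (simp add: y_def norm_divide divide_le_eq mult_ac)
qed

text \<open>The exponential is the ratio of consecutive terms \<open>x powr (-s)\<close>. Because of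
  \<open>t \<le> x\<close> its angle is at most 1, far from a full turn, so the ratio stays away
  from 1 and the imaginary part alone shows it.\<close>

lemma norm_one_minus_ratio_ge:
  assumes x: "x \<ge> 1" and t: "0 < t" "t \<le> x"
  shows "t / (8 * x) \<le> norm (1 - exp (- (Complex (1/2) t * of_real (ln (1 + 1 / x)))))"
proof -
  define y where "y = ln (1 + 1 / x)"
  have y: "y \<le> 1 / x" "1 / (2 * x) \<le> y"
  proof -
    show "y \<le> 1 / x" unfolding y_def using x by (intro ln_add_one_self_le_self) auto
    have "ln (x / (x + 1)) \<le> x / (x + 1) - 1" using x by (intro ln_le_minus_one) auto
    also have "ln (x / (x + 1)) = - y"
      using x by (simp add: y_def ln_div field_simps)
    finally have "y \<ge> 1 / (x + 1)" using x by (simp add: field_simps)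
    moreover have "1 / (2 * x) \<le> 1 / (x + 1)" using x by (intro divide_left_mono) auto
    ultimately show "1 / (2 * x) \<le> y" by linarith
  qed
  have y0: "y > 0" "y \<le> 1" 
    using y x by (smt (verit, best) divide_pos_pos divide_le_eq_1)+
  have u: "0 < t * y" "t * y \<le> 1"
  proof -
    have "t * y \<le> x * (1 / x)" using t y x y0 by (intro mult_mono) auto
    thus "t * y \<le> 1" using x by simp
  qed (use t y0 in auto)
  have "sin (t * y) \<ge> (t * y) / 2"
  proof -
    have "sin 0 - 0 / 2 \<le> sin (t * y) - (t * y) / 2"
    proof (rule DERIV_nonneg_imp_nondecreasing[where f = "\<lambda>u. sin u - u / 2"])
      fix v :: real assume v: "0 \<le> v" "v \<le> t * y"
      have "cos v \<ge> cos (pi / 3)"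
        using v u pi_gt3 by (intro cos_monotone_0_pi_le) auto
      hence "cos v - 1 / 2 \<ge> 0" by (simp add: cos_60)
      moreover have "((\<lambda>u. sin u - u / 2) has_real_derivative (cos v - 1 / 2)) (at v)"
        by (auto intro!: derivative_eq_intros)
      ultimately show "\<exists>d. ((\<lambda>u. sin u - u / 2) has_real_derivative d) (at v) \<and> 0 \<le> d" by blast
    qed (use u in auto)
    thus ?thesis by simp
  qed
  moreover have "exp (- y / 2) \<ge> 1 / 2"
    using exp_ge_add_one_self[of "- y / 2"] y0 by linarith
  ultimately have "exp (- y / 2) * sin (t * y) \<ge> 1 / 2 * ((t * y) / 2)"
    using u by (intro mult_mono) auto
  moreover have "t / (8 * x) \<le> 1 / 2 * ((t * y) / 2)"
  proof -
    have "t * (1 / (2 * x)) \<le> t * y" using y t by (intro mult_left_mono) auto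
    thus ?thesis by simp
  qed
  moreover have "Im (1 - exp (- (Complex (1/2) t * of_real y))) = exp (- y / 2) * sin (t * y)"
    by (simp add: Im_exp)
  moreover have "\<bar>Im (1 - exp (- (Complex (1/2) t * of_real y)))\<bar> \<le> norm (1 - exp (- (Complex (1/2) t * of_real y)))"
    by (rule abs_Im_le_cmod)
  ultimately show ?thesis unfolding y_def by linarith
qed

lemma norm_exp_diff_le:
  assumes "a \<ge> 0" "b \<ge> 0" "Re s \<ge> 0"
  shows "norm (exp (- (s * of_real a)) - exp (- (s * of_real b))) \<le> norm s * \<bar>a - b\<bar>"
proof -
  have S: "convex (complex_of_real ` {0..})"
    by (intro convex_linear_image) (auto simp: linear_linear intro!: bounded_linear.linear bounded_linear_of_real)
  have "norm (exp (- (s * of_real a)) - exp (- (s * of_real b))) \<le> norm s * norm (complex_of_real a - of_real b)"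
  proof (rule field_differentiable_bound[OF S])
    fix z assume z: "z \<in> complex_of_real ` {0..}"
    show "((\<lambda>z. exp (- (s * z))) has_field_derivative (- s * exp (- (s * z)))) (at z within complex_of_real ` {0..})"
      by (auto intro!: derivative_eq_intros)
    show "norm (- s * exp (- (s * z))) \<le> norm s"
      using z assms by (auto simp: norm_mult intro!: mult_left_le)
  qed (use assms in auto)
  thus ?thesis by (simp flip: of_real_diff)
qed

text \<open>Consecutive values of \<open>ln (1 + 1 / x)\<close> differ by
  \<open>ln (1 + 1 / (x * (x + 2)))\<close>, which is of second order in \<open>1 / x\<close>. This
  smoothness of the ratios is what the summation by parts lives on.\<close>

lemma norm_ratio_diff_le:
  assumes x: "x > 0" and s: "Re s \<ge> 0"
  shows "norm (exp (- (s * of_real (ln (1 + 1 / (x + 1))))) - exp (- (s * of_real (ln (1 + 1 / x))))) \<le> norm s / (x * (x + 1))"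
proof -
  have "ln (1 + 1 / x) - ln (1 + 1 / (x + 1)) = ln (1 + 1 / (x * (x + 2)))"
  proof -
    have "1 + 1 / x = (x + 1) / x" "1 + 1 / (x + 1) = (x + 2) / (x + 1)"
      using x by (simp_all add: field_simps)
    moreover have "((x + 1) / x) / ((x + 2) / (x + 1)) = 1 + 1 / (x * (x + 2))"
      using x by (simp add: divide_simps) (simp add: algebra_simps)
    ultimately show ?thesis using x ln_div[of "(x + 1) / x" "(x + 2) / (x + 1)"] by simp
  qed
  also have "\<dots> \<le> 1 / (x * (x + 2))" using x by (intro ln_add_one_self_le_self) auto
  also have "\<dots> \<le> 1 / (x * (x + 1))" using x by (intro divide_left_mono) auto
  finally have "ln (1 + 1 / x) - ln (1 + 1 / (x + 1)) \<le> 1 / (x * (x + 1))" .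
  moreover have "ln (1 + 1 / (x + 1)) \<le> ln (1 + 1 / x)" "0 \<le> ln (1 + 1 / (x + 1))"
    using x by (auto simp: field_simps)
  ultimately have l: "\<bar>ln (1 + 1 / (x + 1)) - ln (1 + 1 / x)\<bar> \<le> 1 / (x * (x + 1))" by linarith
  have "norm (exp (- (s * of_real (ln (1 + 1 / (x + 1))))) - exp (- (s * of_real (ln (1 + 1 / x)))))
     \<le> norm s * \<bar>ln (1 + 1 / (x + 1)) - ln (1 + 1 / x)\<bar>"
    using x s by (intro norm_exp_diff_le) auto
  also have "\<dots> \<le> norm s * (1 / (x * (x + 1)))"
    by (intro mult_left_mono l) auto
  finally show ?thesis by simp
qed

text \<open>Summation by parts, starting from \<open>a n = (a n - a (Suc n)) * c n\<close>. As
  \<open>c n\<close> has size \<open>x n / t\<close> and varies by \<open>O(1 / t)\<close> per step,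
  the sum is no larger than its last boundary term. The constant 272 is 8 + 8 from the two boundary
  terms and 256 from the variation of \<open>c\<close>.\<close>

lemma norm_sum_oscillating_le:
  assumes \<alpha>: "\<alpha> > 0" and t: "t \<ge> 1" "t \<le> real M" and MN: "M \<le> N"
  shows "norm (\<Sum>n=M..<N. complex_of_real (real n + \<alpha>) powr (- Complex (1/2) t)) \<le> 272 * sqrt (real N + \<alpha>) / t"
proof -
  define s where "s = Complex (1/2) t"
  have s: "Re s = 1/2" "norm s \<le> 2 * t" "s \<noteq> 0"
    using t cmod_le[of s] by (auto simp: s_def complex_eq_iff)
  define x where "x n = real n + \<alpha>" for n
  define a where "a n = complex_of_real (x n) powr (- s)" for n
  define r where "r n = exp (- (s * of_real (ln (1 + 1 / x n))))" for n
  define c where "c n = 1 / (1 - r n)" for n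
  have x: "x n > 0" for n using \<alpha> by (simp add: x_def add_nonneg_pos)
  have xS: "x (Suc n) = x n + 1" for n by (simp add: x_def)
  have xM: "x n \<ge> t" "x n \<ge> 1" if "n \<ge> M" for n using that t \<alpha> by (auto simp: x_def)
  have aS: "a (Suc n) = a n * r n" for n
  proof -
    have "1 + 1 / x n = x (Suc n) / x n" using x[of n] by (simp add: xS field_simps)
    hence "ln (1 + 1 / x n) = ln (x (Suc n)) - ln (x n)" using x[of n] x[of "Suc n"] by (simp add: ln_div)
    hence l: "ln (x (Suc n)) = ln (x n) + ln (1 + 1 / x n)" by simp
    have "a n = exp (- (s * of_real (ln (x n))))" for n
      using x[of n] by (simp add: a_def powr_def Ln_of_real)
    thus ?thesis unfolding r_def by (simp add: l algebra_simps flip: exp_add)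
  qed
  have na: "norm (a n) = 1 / sqrt (x n)" for n
  proof -
    have "norm (a n) = x n powr Re (- s)" unfolding a_def using x[of n] by (rule norm_of_real_powr)
    also have "Re (- s) = - (1 / 2)" by (simp add: s_def)
    finally show ?thesis using x[of n] by (simp add: powr_minus powr_half_sqrt inverse_eq_divide)
  qed
  have c: "norm (c n) \<le> 8 * x n / t" "1 - r n \<noteq> 0" if n: "n \<ge> M" for n
  proof -
    have l: "t / (8 * x n) \<le> norm (1 - r n)"
      unfolding r_def s_def using xM[OF n] t by (intro norm_one_minus_ratio_ge) auto
    have p: "t / (8 * x n) > 0" using x[of n] t by simp
    show "1 - r n \<noteq> 0" using l p by auto
    have "norm (c n) = 1 / norm (1 - r n)" by (simp add: c_def norm_divide)
    also have "\<dots> \<le> 1 / (t / (8 * x n))" using l p by (intro divide_left_mono mult_pos_pos) linarith+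
    finally show "norm (c n) \<le> 8 * x n / t" by simp
  qed
  \<comment> \<open>The growth of \<open>c (Suc n) * c n\<close> cancels against the denominator in
    the bound for \<open>r (Suc n) - r n\<close>. The constant is 8 times 8 times 2, the last factor
    from \<open>norm s \<le> 2 * t\<close>.\<close>
  have cd: "norm (c (Suc n) - c n) \<le> 128 / t" if n: "n \<ge> M" for n
  proof -
    have "c (Suc n) - c n = (r (Suc n) - r n) * (c (Suc n) * c n)"
      using c(2)[OF n] c(2)[of "Suc n"] n by (simp add: c_def divide_simps)
    hence "norm (c (Suc n) - c n) = norm (r (Suc n) - r n) * (norm (c (Suc n)) * norm (c n))"
      by (simp add: norm_mult)
    also have "\<dots> \<le> norm s / (x n * (x n + 1)) * ((8 * x (Suc n) / t) * (8 * x n / t))"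
    proof (intro mult_mono)
      show "norm (r (Suc n) - r n) \<le> norm s / (x n * (x n + 1))"
        unfolding r_def xS using x[of n] s by (intro norm_ratio_diff_le) auto
    qed (use c(1)[OF n] c(1)[of "Suc n"] n x[of n] x[of "Suc n"] t in auto)
    also have "\<dots> = 64 * norm s / (t * t)"
      using x[of n] by (simp add: xS divide_simps)
    also have "\<dots> \<le> 64 * (2 * t) / (t * t)"
      using s t by (intro divide_right_mono mult_left_mono) auto
    finally show ?thesis using t by simp
  qed
  have id: "a n = (a n * c n - a (Suc n) * c (Suc n)) + a (Suc n) * (c (Suc n) - c n)" if "n \<ge> M" for n
  proof -
    have "a n * c n - a (Suc n) * c n = a n * ((1 - r n) * c n)" by (simp add: aS algebra_simps)
    also have "(1 - r n) * c n = 1" using c(2)[OF that] by (simp add: c_def)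
    finally have "a n * c n - a (Suc n) * c n = a n" by simp
    thus ?thesis by (simp add: algebra_simps)
  qed
  have "(\<Sum>n=M..<N. a n) = (\<Sum>n=M..<N. a n * c n - a (Suc n) * c (Suc n)) + (\<Sum>n=M..<N. a (Suc n) * (c (Suc n) - c n))"
    unfolding sum.distrib[symmetric] by (intro sum.cong refl id) auto
  also have "(\<Sum>n=M..<N. a n * c n - a (Suc n) * c (Suc n)) = a M * c M - a N * c N"
    using sum_Suc_diff'[OF MN, of "\<lambda>n. - (a n * c n)"] by simp
  finally have "norm (\<Sum>n=M..<N. a n) \<le> norm (a M * c M - a N * c N) + norm (\<Sum>n=M..<N. a (Suc n) * (c (Suc n) - c n))"
    by (metis norm_triangle_ineq)
  with norm_triangle_ineq4[of "a M * c M" "a N * c N"]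
  have "norm (\<Sum>n=M..<N. a n) \<le> norm (a M * c M) + norm (a N * c N) + norm (\<Sum>n=M..<N. a (Suc n) * (c (Suc n) - c n))"
    by linarith
  moreover have ac: "norm (a n * c n) \<le> 8 * sqrt (x n) / t" if "n \<ge> M" for n
  proof -
    have "norm (a n * c n) \<le> 1 / sqrt (x n) * (8 * x n / t)"
      unfolding norm_mult na using c(1)[OF that] x[of n] by (intro mult_left_mono) auto
    also have "\<dots> = 8 * (x n / sqrt (x n)) / t" by simp
    also have "x n / sqrt (x n) = sqrt (x n)" using x[of n] by (simp add: real_div_sqrt)
    finally show ?thesis .
  qed
  moreover have "norm (a M * c M) \<le> 8 * sqrt (x N) / t"
    using ac[of M] MN t by (auto simp: x_def elim!: order_trans intro!: divide_right_mono)
  moreover have "norm (a N * c N) \<le> 8 * sqrt (x N) / t"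
    using ac[OF MN] .
  moreover have "norm (\<Sum>n=M..<N. a (Suc n) * (c (Suc n) - c n)) \<le> 256 * sqrt (x N) / t"
  proof -
    have "norm (\<Sum>n=M..<N. a (Suc n) * (c (Suc n) - c n)) \<le> (\<Sum>n=M..<N. 256 / t * (sqrt (x (Suc n)) - sqrt (x n)))"
    proof (rule sum_norm_le)
      fix n assume n: "n \<in> {M..<N}"
      have "1 / sqrt (x (Suc n)) \<le> 2 * (sqrt (x (Suc n)) - sqrt (x n))"
      proof -
        have p: "sqrt (x n) > 0" "sqrt (x (Suc n)) > 0" "sqrt (x n) \<le> sqrt (x (Suc n))"
          using x[of n] x[of "Suc n"] by (auto simp: xS)
        have "(sqrt (x (Suc n)) - sqrt (x n)) * (sqrt (x (Suc n)) + sqrt (x n)) = 1"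
          using x[of n] by (simp add: xS algebra_simps)
        hence "1 \<le> (sqrt (x (Suc n)) - sqrt (x n)) * (2 * sqrt (x (Suc n)))"
          using p by (smt (verit, best) mult_left_mono)
        thus ?thesis using p by (simp add: field_simps)
      qed
      hence "norm (a (Suc n)) * norm (c (Suc n) - c n) \<le> (2 * (sqrt (x (Suc n)) - sqrt (x n))) * (128 / t)"
        unfolding na using cd[of n] n x by (intro mult_mono) (auto simp: xS)
      thus "norm (a (Suc n) * (c (Suc n) - c n)) \<le> 256 / t * (sqrt (x (Suc n)) - sqrt (x n))"
        by (simp add: norm_mult mult_ac)
    qed
    also have "\<dots> = 256 / t * (sqrt (x N) - sqrt (x M))"
      unfolding sum_distrib_left[symmetric] by (subst sum_Suc_diff'[OF MN]) auto
    also have "\<dots> \<le> 256 / t * sqrt (x N)"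
      using x[of M] t by (intro mult_left_mono) auto
    finally show ?thesis by simp
  qed
  ultimately show ?thesis by (simp add: a_def s_def x_def add_divide_distrib[symmetric])
qed

text \<open>Two cutoffs: at \<open>N\<close>, about \<open>T\<^sup>2\<close>, the correction terms
  of the Euler-Maclaurin formula are bounded, and the terms from \<open>M\<close>, about
  \<open>2 * T\<close>, up to \<open>N\<close> form a bounded oscillating sum because
  \<open>t \<le> M\<close>. The three bounds are 544, 2 and 6.\<close>

lemma hurwitz_zeta_approx:
  assumes \<alpha>: "\<alpha> > 0" "\<alpha> \<le> 1" and T: "T \<ge> 2" and t: "T \<le> t" "t \<le> 2 * T"
  shows "norm (hurwitz_zeta \<alpha> (Complex (1/2) t) - (\<Sum>n<nat \<lceil>2 * T\<rceil>. complex_of_real (real n + \<alpha>) powr (- Complex (1/2) t))) \<le> 600"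
proof -
  define s where "s = Complex (1/2) t"
  define M where "M = nat \<lceil>2 * T\<rceil>"
  define N where "N = nat \<lceil>T\<^sup>2\<rceil> + 1"
  have T2: "2 * T \<le> T\<^sup>2" using T by (simp add: power2_eq_square)
  have M: "2 * T \<le> real M" unfolding M_def by linarith
  have N: "real N \<ge> T\<^sup>2 + 1" "real N \<le> T\<^sup>2 + 2" unfolding N_def using T zero_le_power2[of T] by linarith+
  have MN: "M \<le> N" unfolding M_def N_def using T2 by linarith
  have s: "Re s = 1/2" "s \<noteq> 1" "norm s \<le> 3 * T" "norm (s - 1) \<ge> T"
  proof -
    show "norm s \<le> 3 * T" using cmod_le[of s] t T by (simp add: s_def)
    show "norm (s - 1) \<ge> T" using abs_Im_le_cmod[of "s - 1"] t T by (simp add: s_def)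
  qed (auto simp: s_def complex_eq_iff)
  have sqN: "sqrt (real N + \<alpha>) \<le> 2 * T"
  proof (rule real_le_lsqrt)
    have "2 * 2 \<le> T * T" using T by (intro mult_mono) auto
    thus "real N + \<alpha> \<le> (2 * T)\<^sup>2" using N \<alpha> by (simp add: power2_eq_square)
  qed (use \<alpha> T in auto)
  have sqN': "T \<le> sqrt (real N + \<alpha> - 1)" using N \<alpha> T by (intro real_le_rsqrt) auto
  have "hurwitz_zeta \<alpha> s - (\<Sum>n<M. of_real (real n + \<alpha>) powr (-s)) = (\<Sum>n=M..<N. of_real (real n + \<alpha>) powr (-s)) +
      of_real (real N + \<alpha>) powr (1 - s) / (s - 1) + (\<Sum>n. taylor_remainder 1 (real (n + N) + \<alpha>) s) / (s - 1)"
  proof -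
    have "(\<Sum>n<N. of_real (real n + \<alpha>) powr (-s)) = (\<Sum>n<M. of_real (real n + \<alpha>) powr (-s)) + (\<Sum>n=M..<N. complex_of_real (real n + \<alpha>) powr (-s))"
      using sum.atLeastLessThan_concat[of 0 M N "\<lambda>n. complex_of_real (real n + \<alpha>) powr (-s)"] MN by (simp add: atLeast0LessThan)
    thus ?thesis using hurwitz_zeta_euler_maclaurin[OF \<alpha>(1) _ s(2), of N] s(1) by simp
  qed
  also have "norm \<dots> \<le> norm (\<Sum>n=M..<N. complex_of_real (real n + \<alpha>) powr (-s)) + norm (of_real (real N + \<alpha>) powr (1 - s) / (s - 1))
     + norm ((\<Sum>n. taylor_remainder 1 (real (n + N) + \<alpha>) s) / (s - 1))"
    by (intro norm_triangle_mono order_refl norm_triangle_ineq)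
  also have "\<dots> \<le> 544 + 2 + (6 :: real)"
  proof (intro add_mono)
    have "norm (\<Sum>n=M..<N. complex_of_real (real n + \<alpha>) powr (-s)) \<le> 272 * sqrt (real N + \<alpha>) / t"
      unfolding s_def using T t M MN \<alpha> by (intro norm_sum_oscillating_le) auto
    also have "\<dots> \<le> 272 * (2 * T) / T" using sqN T t by (intro frac_le) auto
    also have "\<dots> = 544" using T by simp
    finally show "norm (\<Sum>n=M..<N. complex_of_real (real n + \<alpha>) powr (-s)) \<le> 544" .
    have "norm (complex_of_real (real N + \<alpha>) powr (1 - s)) = (real N + \<alpha>) powr Re (1 - s)"
      using \<alpha> by (intro norm_of_real_powr) auto
    also have "Re (1 - s) = 1 / 2" by (simp add: s_def)
    finally have "norm (of_real (real N + \<alpha>) powr (1 - s) / (s - 1)) = sqrt (real N + \<alpha>) / norm (s - 1)"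
      unfolding norm_divide using \<alpha> by (simp add: powr_half_sqrt)
    also have "\<dots> \<le> (2 * T) / T" using sqN s(4) T by (intro frac_le) auto
    finally show "norm (of_real (real N + \<alpha>) powr (1 - s) / (s - 1)) \<le> 2" using T by simp
    have "norm ((\<Sum>n. taylor_remainder 1 (real (n + N) + \<alpha>) s) / (s - 1)) \<le> 2 * norm s / sqrt (real N + \<alpha> - 1)"
      using \<alpha> s by (intro norm_suminf_taylor_remainder_1) (auto simp: N_def)
    also have "\<dots> \<le> 2 * (3 * T) / T" using sqN' s(3) T by (intro frac_le) auto
    finally show "norm ((\<Sum>n. taylor_remainder 1 (real (n + N) + \<alpha>) s) / (s - 1)) \<le> 6" using T by simp
  qed
  also have "544 + 2 + 6 \<le> (600 :: real)" by simp
  finally show ?thesis unfolding s_def M_def .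
qed

section \<open>Mean square of the approximating sum\<close>

text \<open>A single termwise integration leaves denominators \<open>l m - l n\<close> and calls for
  Hilbert's inequality. Integrating twice squares the denominators in \<open>G\<close>, so that
  absolute values are affordable; and since \<open>g\<close> is nondecreasing, it lies between
  difference quotients of \<open>G\<close> of step \<open>h\<close>. The price is the term
  \<open>D * h\<close>.\<close>

lemma dirichlet_poly_mean_square:
  fixes c l :: "nat \<Rightarrow> real"
  assumes inj: "inj_on l {..<M}" and h: "h > 0" and T: "T \<ge> 0"
  defines "S \<equiv> (\<lambda>t. \<Sum>n<M. of_real (c n) * exp (- (\<i> * of_real (l n * t))))"
  defines "D \<equiv> (\<Sum>n<M. (c n)\<^sup>2)"
  defines "B \<equiv> (\<Sum>m<M. \<Sum>n\<in>{..<M}-{m}. \<bar>c m * c n\<bar> / (l m - l n)\<^sup>2)"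
  shows "\<bar>integral {T..2*T} (\<lambda>t. (norm (S t))\<^sup>2) - D * T\<bar> \<le> D * h + 4 * B / h"
proof -
  define R where "R t = (\<Sum>m<M. \<Sum>n\<in>{..<M}-{m}. - (c m * c n * cos ((l m - l n) * t) / (l m - l n)\<^sup>2))" for t
  define R1 where "R1 t = (\<Sum>m<M. \<Sum>n\<in>{..<M}-{m}. c m * c n * sin ((l m - l n) * t) / (l m - l n))" for t
  define G where "G t = D * t\<^sup>2 / 2 + R t" for t
  define g where "g t = D * t + R1 t" for t
  have nz: "l m - l n \<noteq> 0" if "m < M" "n \<in> {..<M} - {m}" for m n
    using that inj by (auto simp: inj_on_def)
  have R: "(R has_real_derivative R1 t) (at t)" for t
    unfolding R_def R1_def
  proof (intro DERIV_sum)
    fix m n assume "m \<in> {..<M}" "n \<in> {..<M} - {m}"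
    hence "l m - l n \<noteq> 0" using nz by simp
    thus "((\<lambda>t. - (c m * c n * cos ((l m - l n) * t) / (l m - l n)\<^sup>2)) has_real_derivative
        c m * c n * sin ((l m - l n) * t) / (l m - l n)) (at t)"
      by (auto intro!: derivative_eq_intros simp: power2_eq_square)
  qed
  have G: "(G has_real_derivative g t) (at t)" for t
    unfolding G_def g_def by (auto intro!: derivative_eq_intros R)
  have S2: "(norm (S t))\<^sup>2 = D + (\<Sum>m<M. \<Sum>n\<in>{..<M}-{m}. c m * c n * cos ((l m - l n) * t))" for t
  proof -
    have "complex_of_real ((norm (S t))\<^sup>2) = S t * cnj (S t)" by (rule complex_norm_square)
    also have "\<dots> = (\<Sum>m<M. \<Sum>n<M. of_real (c m) * exp (- (\<i> * of_real (l m * t))) * cnj (of_real (c n) * exp (- (\<i> * of_real (l n * t)))))"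
      unfolding S_def cnj_sum sum_product ..
    also have "Re \<dots> = (\<Sum>m<M. \<Sum>n<M. c m * c n * cos ((l m - l n) * t))"
    proof (unfold Re_sum, intro sum.cong refl)
      fix m n
      have "of_real (c m) * exp (- (\<i> * of_real (l m * t))) * cnj (of_real (c n) * exp (- (\<i> * of_real (l n * t)))) =
         of_real (c m * c n) * exp (\<i> * of_real ((l n - l m) * t))"
        by (simp add: exp_cnj algebra_simps flip: exp_add)
      also have "Re \<dots> = c m * c n * cos ((l n - l m) * t)" by (simp add: Re_exp)
      also have "cos ((l n - l m) * t) = cos ((l m - l n) * t)"
        by (metis cos_minus minus_diff_eq mult_minus_left)
      finally show "Re (of_real (c m) * exp (- (\<i> * of_real (l m * t))) * cnj (of_real (c n) * exp (- (\<i> * of_real (l n * t))))) =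
         c m * c n * cos ((l m - l n) * t)" .
    qed
    also have "\<dots> = (\<Sum>m<M. (c m)\<^sup>2 + (\<Sum>n\<in>{..<M}-{m}. c m * c n * cos ((l m - l n) * t)))"
      by (intro sum.cong refl) (subst sum.remove, auto simp: power2_eq_square)
    finally show ?thesis by (simp add: sum.distrib D_def)
  qed
  have g: "(g has_real_derivative (norm (S t))\<^sup>2) (at t)" for t
  proof -
    have "(R1 has_real_derivative (\<Sum>m<M. \<Sum>n\<in>{..<M}-{m}. c m * c n * cos ((l m - l n) * t))) (at t)"
      unfolding R1_def
    proof (intro DERIV_sum)
      fix m n assume "m \<in> {..<M}" "n \<in> {..<M} - {m}"
      hence "l m - l n \<noteq> 0" using nz by simp
      thus "((\<lambda>t. c m * c n * sin ((l m - l n) * t) / (l m - l n)) has_real_derivative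
          c m * c n * cos ((l m - l n) * t)) (at t)"
        by (auto intro!: derivative_eq_intros)
    qed
    thus ?thesis unfolding g_def S2 by (auto intro!: derivative_eq_intros)
  qed
  have mono: "g u \<le> g v" if "u \<le> v" for u v
    using that g by (intro DERIV_nonneg_imp_nondecreasing[of u v g]) (auto intro!: exI)
  have up: "h * g u \<le> G (u + h) - G u" and lo: "G u - G (u - h) \<le> h * g u" for u
  proof -
    obtain z where "z > u" "z < u + h" "G (u + h) - G u = (u + h - u) * g z"
      using MVT2[of u "u + h" G g] h G by auto
    thus "h * g u \<le> G (u + h) - G u" using mono[of u z] h by (auto intro!: mult_left_mono)
    obtain z where "z > u - h" "z < u" "G u - G (u - h) = (u - (u - h)) * g z"
      using MVT2[of "u - h" u G g] h G by auto
    thus "G u - G (u - h) \<le> h * g u" using mono[of z u] h by (auto intro!: mult_left_mono)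
  qed
  have RB: "\<bar>R t\<bar> \<le> B" for t
    unfolding R_def B_def
  proof (intro order_trans[OF sum_abs] sum_mono)
    fix m n assume "m \<in> {..<M}" "n \<in> {..<M} - {m}"
    have "\<bar>- (c m * c n * cos ((l m - l n) * t) / (l m - l n)\<^sup>2)\<bar> = \<bar>c m * c n\<bar> * \<bar>cos ((l m - l n) * t)\<bar> / (l m - l n)\<^sup>2"
      by (simp add: abs_mult)
    also have "\<dots> \<le> \<bar>c m * c n\<bar> / (l m - l n)\<^sup>2"
      by (intro divide_right_mono mult_left_le) auto
    finally show "\<bar>- (c m * c n * cos ((l m - l n) * t) / (l m - l n)\<^sup>2)\<bar> \<le> \<bar>c m * c n\<bar> / (l m - l n)\<^sup>2" .
  qed
  \<comment> \<open>The square of \<open>u + h\<close> costs \<open>D * h / 2\<close> and the two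
    values of \<open>R\<close> cost \<open>2 * B / h\<close>. The integral has two endpoints, hence
    twice this in the conclusion.\<close>
  have up': "g u \<le> D * u + D * h / 2 + 2 * B / h" for u
  proof -
    have "h * g u \<le> D * (u + h)\<^sup>2 / 2 - D * u\<^sup>2 / 2 + 2 * B"
      using up[of u] RB[of "u + h"] RB[of u] unfolding G_def by linarith
    also have "\<dots> = h * (D * u + D * h / 2 + 2 * B / h)" using h by (simp add: power2_eq_square field_simps)
    finally show ?thesis using h by simp
  qed
  have lo': "g u \<ge> D * u - D * h / 2 - 2 * B / h" for u
  proof -
    have "h * (D * u - D * h / 2 - 2 * B / h) = D * u\<^sup>2 / 2 - D * (u - h)\<^sup>2 / 2 - 2 * B"
      using h by (simp add: power2_eq_square field_simps)
    also have "\<dots> \<le> h * g u"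
      using lo[of u] RB[of "u - h"] RB[of u] unfolding G_def by linarith
    finally show ?thesis using h by simp
  qed
  have "((\<lambda>t. (norm (S t))\<^sup>2) has_integral (g (2 * T) - g T)) {T..2*T}"
    using T g by (intro fundamental_theorem_of_calculus) (auto simp: has_real_derivative_iff_has_vector_derivative[symmetric] intro: has_field_derivative_at_within)
  hence "integral {T..2*T} (\<lambda>t. (norm (S t))\<^sup>2) = g (2 * T) - g T" by (rule integral_unique)
  moreover have "g (2 * T) - g T \<le> D * T + D * h + 4 * B / h"
    using up'[of "2 * T"] lo'[of T] by (simp add: algebra_simps)
  moreover have "g (2 * T) - g T \<ge> D * T - D * h - 4 * B / h"
    using lo'[of "2 * T"] up'[of T] by (simp add: algebra_simps)
  ultimately show ?thesis by linarith
qed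

lemma sum_inverse_squares_le: "(\<Sum>k=1..n. 1 / (real k)\<^sup>2) \<le> 2"
proof (cases n)
  case (Suc m)
  have "(\<Sum>k=1..Suc m. 1 / (real k)\<^sup>2) \<le> 2 - 1 / real (Suc m)" for m
  proof (induction m)
    case (Suc m)
    have "1 / (real (Suc (Suc m)))\<^sup>2 \<le> 1 / (real (Suc m) * real (Suc (Suc m)))"
      unfolding power2_eq_square by (intro divide_left_mono mult_mono mult_pos_pos) auto
    also have "\<dots> = 1 / real (Suc m) - 1 / real (Suc (Suc m))"
      by (simp add: divide_simps)
    finally have "1 / (real (Suc (Suc m)))\<^sup>2 \<le> 1 / real (Suc m) - 1 / real (Suc (Suc m))" .
    moreover have "(\<Sum>k=1..Suc (Suc m). 1 / (real k)\<^sup>2) = (\<Sum>k=1..Suc m. 1 / (real k)\<^sup>2) + 1 / (real (Suc (Suc m)))\<^sup>2"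
      by (rule sum.cl_ivl_Suc[THEN trans]) simp
    ultimately show ?case using Suc by linarith
  qed simp
  from this[of m] have "(\<Sum>k=1..n. 1 / (real k)\<^sup>2) \<le> 2 - 1 / real (Suc m)" using Suc by simp
  moreover have "0 \<le> 1 / real (Suc m)" by simp
  ultimately show ?thesis by linarith
qed simp

lemma sum_inverse_square_diffs_le:
  assumes "n < M"
  shows "(\<Sum>m\<in>{..<M}-{n}. 1 / (real m - real n)\<^sup>2) \<le> 4"
proof -
  have eq: "{..<M}-{n} = {..<n} \<union> {n<..<M}" using assms by auto
  have "(\<Sum>m\<in>{..<M}-{n}. 1 / (real m - real n)\<^sup>2) = (\<Sum>m<n. 1 / (real m - real n)\<^sup>2) + (\<Sum>m\<in>{n<..<M}. 1 / (real m - real n)\<^sup>2)"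
    unfolding eq by (rule sum.union_disjoint) auto
  also have "(\<Sum>m<n. 1 / (real m - real n)\<^sup>2) = (\<Sum>k=1..n. 1 / (real k)\<^sup>2)"
  proof (rule sum.reindex_bij_witness[of _ "\<lambda>k. n - k" "\<lambda>m. n - m"])
    fix m assume "m \<in> {..<n}"
    hence "real (n - m) = - (real m - real n)" by (simp add: of_nat_diff)
    thus "1 / (real (n - m))\<^sup>2 = 1 / (real m - real n)\<^sup>2" by (simp only: power2_minus)
  qed auto
  also have "(\<Sum>m\<in>{n<..<M}. 1 / (real m - real n)\<^sup>2) = (\<Sum>k=1..M-n-1. 1 / (real k)\<^sup>2)"
  proof (rule sum.reindex_bij_witness[of _ "\<lambda>k. n + k" "\<lambda>m. m - n"])
    fix m assume "m \<in> {n<..<M}"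
    hence "real (m - n) = real m - real n" by (simp add: of_nat_diff)
    thus "1 / (real (m - n))\<^sup>2 = 1 / (real m - real n)\<^sup>2" by simp
  qed auto
  finally show ?thesis using sum_inverse_squares_le[of n] sum_inverse_squares_le[of "M-n-1"] by linarith
qed

lemma sum_inverse_sqrt_le:
  assumes "\<alpha> > 0" "M \<ge> 1"
  shows "(\<Sum>n<M. 1 / sqrt (real n + \<alpha>)) \<le> 1 / sqrt \<alpha> + 2 * sqrt (real M)"
proof -
  have "(\<Sum>n<Suc m. 1 / sqrt (real n + \<alpha>)) \<le> 1 / sqrt \<alpha> + 2 * sqrt (real m)" for m
  proof (induction m)
    case (Suc m)
    have "1 / sqrt (real (Suc m) + \<alpha>) \<le> 1 / sqrt (real (Suc m))"
      using assms by (intro divide_left_mono) auto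
    also have "\<dots> \<le> 2 * (sqrt (real (Suc m)) - sqrt (real m))"
    proof -
      have "(sqrt (real (Suc m)) - sqrt (real m)) * (sqrt (real (Suc m)) + sqrt (real m)) = 1"
        by (simp add: algebra_simps)
      moreover have "(sqrt (real (Suc m)) - sqrt (real m)) * (sqrt (real (Suc m)) + sqrt (real m)) \<le> (sqrt (real (Suc m)) - sqrt (real m)) * (2 * sqrt (real (Suc m)))"
        by (intro mult_left_mono) auto
      ultimately have "1 \<le> (sqrt (real (Suc m)) - sqrt (real m)) * (2 * sqrt (real (Suc m)))" by linarith
      moreover have "u * (2 * v) = 2 * u * v" for u v :: real by simp
      moreover have "sqrt (real (Suc m)) > 0" by simp
      ultimately show ?thesis by (simp only: pos_divide_le_eq mult_ac)
    qed
    finally show ?case using Suc by simp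
  qed simp
  from this[of "M - 1"] have "(\<Sum>n<M. 1 / sqrt (real n + \<alpha>)) \<le> 1 / sqrt \<alpha> + 2 * sqrt (real (M - 1))" using assms by simp
  also have "sqrt (real (M - 1)) \<le> sqrt (real M)" by simp
  finally show ?thesis by simp
qed

lemma ln_diff_ge:
  assumes "0 < a" "a < (b::real)"
  shows "(b - a) / b \<le> ln b - ln a"
  using ln_le_minus_one[of "a / b"] assms by (simp add: ln_div field_simps)

text \<open>The bound \<open>(a + b)\<^sup>2 / (a - b)\<^sup>2\<close> for
  \<open>1 / (ln a - ln b)\<^sup>2\<close> equals \<open>1 + 4 * (a * b) / (a - b)\<^sup>2\<close>.
  With the weight \<open>1 / sqrt (a * b)\<close> the first part sums to at most the square of the
  sum of \<open>1 / sqrt x\<close>, giving \<open>2 / \<alpha> + 8\<close>. The second becomes at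
  most \<open>4 * M / (a - b)\<^sup>2\<close>, whose sum over one index is at most
  \<open>16 * M\<close>; and 8 + 16 = 24.\<close>

lemma hurwitz_off_diagonal_le:
  assumes \<alpha>: "\<alpha> > 0" "\<alpha> \<le> 1" and M: "M \<ge> 1"
  shows "(\<Sum>m<M. \<Sum>n\<in>{..<M}-{m}. \<bar>1 / sqrt (real m + \<alpha>) * (1 / sqrt (real n + \<alpha>))\<bar> / (ln (real m + \<alpha>) - ln (real n + \<alpha>))\<^sup>2)
     \<le> (2 / \<alpha> + 24) * (real M)\<^sup>2" (is "?L \<le> _")
proof -
  define x where "x n = real n + \<alpha>" for n
  have x: "x n > 0" for n using \<alpha> by (simp add: x_def add_nonneg_pos)
  have bd: "1 / (ln a - ln b)\<^sup>2 \<le> (a + b)\<^sup>2 / (a - b)\<^sup>2" if "a > 0" "b > 0" "a \<noteq> b" for a b :: real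
  proof -
    have *: "1 / (ln a - ln b)\<^sup>2 \<le> (a + b)\<^sup>2 / (a - b)\<^sup>2" if ab: "0 < a" "a < b" for a b :: real
    proof -
      have "(b - a) / (a + b) \<le> (b - a) / b" using ab by (intro divide_left_mono) auto
      also have "\<dots> \<le> ln b - ln a" by (rule ln_diff_ge[OF ab])
      finally have "((b - a) / (a + b))\<^sup>2 \<le> (ln b - ln a)\<^sup>2" using ab by (intro power_mono) auto
      hence "1 / (ln b - ln a)\<^sup>2 \<le> 1 / ((b - a) / (a + b))\<^sup>2" using ab by (intro divide_left_mono mult_pos_pos) auto
      thus ?thesis by (simp add: power_divide power2_commute)
    qed
    show ?thesis using *[of a b] *[of b a] that by (cases "a < b") (auto simp: power2_commute add_ac)
  qed
  have "?L \<le> (\<Sum>m<M. \<Sum>n\<in>{..<M}-{m}. 1 / sqrt (x m) * (1 / sqrt (x n)) + 4 * real M * (1 / (real n - real m)\<^sup>2))"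
  proof (intro sum_mono)
    fix m n assume mn: "m \<in> {..<M}" "n \<in> {..<M} - {m}"
    define a b where "a = x m" and "b = x n"
    have ab: "a > 0" "b > 0" "a \<noteq> b" "a \<le> real M" "b \<le> real M" "a - b = real m - real n"
      using mn x \<alpha> by (auto simp: a_def b_def x_def)
    have "1 / sqrt a * (1 / sqrt b) * (1 / (ln a - ln b)\<^sup>2) \<le> 1 / sqrt a * (1 / sqrt b) * ((a + b)\<^sup>2 / (a - b)\<^sup>2)"
      using ab(1,2) bd[OF ab(1,2,3)] by (intro mult_left_mono) auto
    also have "(a + b)\<^sup>2 / (a - b)\<^sup>2 = 1 + 4 * (a * b) / (a - b)\<^sup>2"
    proof -
      have "(a - b)\<^sup>2 \<noteq> 0" using ab(3) by simp
      moreover have "(a + b)\<^sup>2 = (a - b)\<^sup>2 + 4 * (a * b)" by (simp add: power2_eq_square algebra_simps)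
      ultimately show ?thesis by (simp add: add_divide_distrib)
    qed
    also have "1 / sqrt a * (1 / sqrt b) * (1 + 4 * (a * b) / (a - b)\<^sup>2) = 1 / sqrt a * (1 / sqrt b) + 4 * ((a / sqrt a) * (b / sqrt b)) / (a - b)\<^sup>2"
      by (simp add: algebra_simps)
    also have "(a / sqrt a) * (b / sqrt b) = sqrt a * sqrt b" using ab by (simp add: real_div_sqrt)
    also have "sqrt a * sqrt b \<le> sqrt (real M) * sqrt (real M)" using ab by (intro mult_mono) auto
    also have "sqrt (real M) * sqrt (real M) = real M" by simp
    finally have "1 / sqrt a * (1 / sqrt b) * (1 / (ln a - ln b)\<^sup>2) \<le> 1 / sqrt a * (1 / sqrt b) + 4 * real M / (a - b)\<^sup>2"
      by (simp add: divide_right_mono mult_left_mono)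
    thus "\<bar>1 / sqrt (real m + \<alpha>) * (1 / sqrt (real n + \<alpha>))\<bar> / (ln (real m + \<alpha>) - ln (real n + \<alpha>))\<^sup>2
       \<le> 1 / sqrt (x m) * (1 / sqrt (x n)) + 4 * real M * (1 / (real n - real m)\<^sup>2)"
      using ab by (simp add: a_def b_def x_def power2_commute)
  qed
  also have "\<dots> \<le> (\<Sum>m<M. (\<Sum>n<M. 1 / sqrt (x m) * (1 / sqrt (x n))) + 4 * real M * 4)"
  proof (intro sum_mono)
    fix m assume m: "m \<in> {..<M}"
    have "(\<Sum>n\<in>{..<M}-{m}. 1 / sqrt (x m) * (1 / sqrt (x n))) \<le> (\<Sum>n<M. 1 / sqrt (x m) * (1 / sqrt (x n)))"
      using x by (intro sum_mono2) (auto simp: less_imp_le)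
    moreover have "4 * real M * (\<Sum>n\<in>{..<M}-{m}. 1 / (real n - real m)\<^sup>2) \<le> 4 * real M * 4"
      using sum_inverse_square_diffs_le[of m M] m by (intro mult_left_mono) auto
    ultimately show "(\<Sum>n\<in>{..<M}-{m}. 1 / sqrt (x m) * (1 / sqrt (x n)) + 4 * real M * (1 / (real n - real m)\<^sup>2)) \<le>
        (\<Sum>n<M. 1 / sqrt (x m) * (1 / sqrt (x n))) + 4 * real M * 4"
      unfolding sum.distrib sum_distrib_left by linarith
  qed
  also have "\<dots> = (\<Sum>n<M. 1 / sqrt (x n))\<^sup>2 + 16 * (real M)\<^sup>2"
    by (simp add: sum.distrib power2_eq_square sum_product)
  also have "(\<Sum>n<M. 1 / sqrt (x n))\<^sup>2 \<le> (1 / sqrt \<alpha> + 2 * sqrt (real M))\<^sup>2"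
    using sum_inverse_sqrt_le[OF \<alpha>(1) M] x unfolding x_def[symmetric]
    by (intro power_mono sum_nonneg) (auto simp: less_imp_le)
  also have "\<dots> \<le> 2 * (1 / sqrt \<alpha>)\<^sup>2 + 2 * (2 * sqrt (real M))\<^sup>2"
    using sum_squares_bound[of "1 / sqrt \<alpha>" "2 * sqrt (real M)"] by (simp add: power2_sum)
  also have "\<dots> = 2 / \<alpha> + 8 * real M" using \<alpha> by (simp add: power_divide)
  also have "\<dots> \<le> (2 / \<alpha>) * (real M)\<^sup>2 + 8 * (real M)\<^sup>2"
    using M \<alpha> self_le_power[of "real M" 2] by (intro add_mono) (auto simp: field_simps)
  finally show ?thesis by (simp add: algebra_simps)
qed

lemma sum_inverse_shift_bounds:
  assumes \<alpha>: "\<alpha> > 0" "\<alpha> \<le> 1" and M: "M \<ge> 1"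
  shows "ln (real M) \<le> (\<Sum>n<M. 1 / (real n + \<alpha>))" "(\<Sum>n<M. 1 / (real n + \<alpha>)) \<le> ln (real M) + 1 + 1 / \<alpha>"
proof -
  have "ln (real M) \<le> harm M" 
  proof -
    have "ln (real M) \<le> ln (real M + 1)" using M by simp
    thus ?thesis using ln_le_harm[of M] by linarith
  qed
  also have "harm M = (\<Sum>n<M. 1 / (real n + 1))"
    unfolding harm_def by (rule sum.reindex_bij_witness[of _ Suc "\<lambda>n. n - 1"]) (auto simp: field_simps of_nat_diff)
  also have "\<dots> \<le> (\<Sum>n<M. 1 / (real n + \<alpha>))"
    using \<alpha> by (intro sum_mono divide_left_mono) (auto intro!: add_nonneg_pos mult_pos_pos)
  finally show "ln (real M) \<le> (\<Sum>n<M. 1 / (real n + \<alpha>))" .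
  have 1: "(\<Sum>n<Suc m. 1 / (real n + \<alpha>)) \<le> harm m + 1 / \<alpha>" for m
  proof (induction m)
    case (Suc m)
    have "1 / (real (Suc m) + \<alpha>) \<le> 1 / real (Suc m)"
      using \<alpha> by (intro divide_left_mono) auto
    with Suc show ?case by (simp add: harm_Suc inverse_eq_divide)
  qed (simp add: harm_def)
  have 2: "harm m \<le> ln (real (Suc m)) + 1" for m
  proof -
    have "harm m \<le> (harm (Suc m) :: real)" by (intro harm_mono) auto
    moreover have "harm (Suc m) - ln (real (Suc m)) \<le> harm (Suc 0) - ln (real (Suc 0))"
      using decseqD[OF decseq_harm_diff_ln, of 0 m] by simp
    moreover have "harm (Suc 0) - ln (real (Suc 0)) = 1" by (simp add: harm_def)
    ultimately show ?thesis by linarith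
  qed
  obtain m where m: "M = Suc m" using M by (cases M) auto
  show "(\<Sum>n<M. 1 / (real n + \<alpha>)) \<le> ln (real M) + 1 + 1 / \<alpha>"
    using 1[of m] 2[of m] unfolding m by linarith
qed

text \<open>The parameter \<open>\<eta>\<close> splits the cross term: one part is absorbed into a
  small multiple of the main term, the other is a constant.\<close>

lemma abs_norm_square_diff_le:
  assumes "norm (a - b) \<le> C" "\<eta> > 0"
  shows "\<bar>(norm a)\<^sup>2 - (norm b)\<^sup>2\<bar> \<le> \<eta> * (norm b)\<^sup>2 + (1 + 1 / \<eta>) * C\<^sup>2"
proof -
  define x y where "x = norm a" and "y = norm b"
  have xy: "x \<ge> 0" "y \<ge> 0" "\<bar>x - y\<bar> \<le> C"
    using norm_triangle_ineq3[of a b] assms by (auto simp: x_def y_def)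
  have C: "C \<ge> 0" using xy by linarith
  have am: "2 * C * y \<le> \<eta> * y\<^sup>2 + C\<^sup>2 / \<eta>"
  proof -
    have "0 \<le> (\<eta> * y - C)\<^sup>2 / \<eta>" using assms by simp
    also have "\<dots> = \<eta> * y\<^sup>2 + C\<^sup>2 / \<eta> - 2 * C * y" using assms by (simp add: power2_eq_square field_simps)
    finally show ?thesis by simp
  qed
  have "\<bar>x\<^sup>2 - y\<^sup>2\<bar> = \<bar>x - y\<bar> * (x + y)"
    using xy by (simp add: power2_eq_square abs_mult square_diff_square_factored)
  also have "\<dots> \<le> C * (2 * y + C)" using xy C by (intro mult_mono) auto
  also have "\<dots> = 2 * C * y + C\<^sup>2" by (simp add: power2_eq_square algebra_simps)
  also have "\<dots> \<le> \<eta> * y\<^sup>2 + C\<^sup>2 / \<eta> + C\<^sup>2" using am by simp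
  finally show ?thesis by (simp add: x_def y_def algebra_simps)
qed

lemma integral_norm_square_diff_le:
  fixes f g :: "real \<Rightarrow> complex"
  assumes f: "continuous_on {a..b} f" and g: "continuous_on {a..b} g" and ab: "a \<le> b" and \<eta>: "\<eta> > 0"
    and bd: "\<And>t. t \<in> {a..b} \<Longrightarrow> norm (f t - g t) \<le> C"
  shows "\<bar>integral {a..b} (\<lambda>t. (norm (f t))\<^sup>2) - integral {a..b} (\<lambda>t. (norm (g t))\<^sup>2)\<bar>
    \<le> \<eta> * integral {a..b} (\<lambda>t. (norm (g t))\<^sup>2) + (1 + 1 / \<eta>) * C\<^sup>2 * (b - a)"
proof -
  have if2: "(\<lambda>t. (norm (f t))\<^sup>2) integrable_on {a..b}" and ig2: "(\<lambda>t. (norm (g t))\<^sup>2) integrable_on {a..b}"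
    by (intro integrable_continuous_real continuous_intros f g)+
  have ib: "(\<lambda>t. \<eta> * (norm (g t))\<^sup>2 + (1 + 1 / \<eta>) * C\<^sup>2) integrable_on {a..b}"
    by (intro integrable_continuous_real continuous_intros f g)
  have "integral {a..b} (\<lambda>t. (norm (f t))\<^sup>2) - integral {a..b} (\<lambda>t. (norm (g t))\<^sup>2) =
     integral {a..b} (\<lambda>t. (norm (f t))\<^sup>2 - (norm (g t))\<^sup>2)"
    by (rule Henstock_Kurzweil_Integration.integral_diff[OF if2 ig2, symmetric])
  also have "norm \<dots> \<le> integral {a..b} (\<lambda>t. \<eta> * (norm (g t))\<^sup>2 + (1 + 1 / \<eta>) * C\<^sup>2)"
    using abs_norm_square_diff_le[OF bd \<eta>]
    by (intro integral_norm_bound_integral integrable_diff if2 ig2 ib) auto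
  also have "\<dots> = \<eta> * integral {a..b} (\<lambda>t. (norm (g t))\<^sup>2) + (1 + 1 / \<eta>) * C\<^sup>2 * (b - a)"
    using ab by (subst Henstock_Kurzweil_Integration.integral_add)
      (auto intro!: integrable_continuous_real continuous_intros g)
  finally show ?thesis by simp
qed

text \<open>The step \<open>h = T / sqrt (ln T)\<close> balances \<open>D * h\<close>, where
  \<open>D\<close> is about \<open>ln T\<close>, against \<open>4 * B / h\<close>, where
  \<open>B = O(T\<^sup>2)\<close>: both are \<open>O(T * sqrt (ln T))\<close>. The weight
  \<open>1 / sqrt (ln T)\<close> in passing from the sum to zeta is chosen likewise. The factor 36
  comes from \<open>M \<le> 3 * T\<close>.\<close>

lemma hurwitz_second_moment_bound:
  assumes \<alpha>: "\<alpha> > 0" "\<alpha> \<le> 1" and T: "T \<ge> 3"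
  defines "E \<equiv> (3 + 1 / \<alpha>) + (ln T + (3 + 1 / \<alpha>)) / sqrt (ln T) + 36 * (2 / \<alpha> + 24) * sqrt (ln T)"
  shows "\<bar>integral {T..2*T} (\<lambda>t. (norm (hurwitz_zeta \<alpha> (Complex (1/2) t)))\<^sup>2) - T * ln T\<bar> \<le>
    T * E + 1 / sqrt (ln T) * (T * ln T + T * E) + (1 + sqrt (ln T)) * 600\<^sup>2 * T"
proof -
  define M where "M = nat \<lceil>2 * T\<rceil>"
  define S where "S t = (\<Sum>n<M. complex_of_real (1 / sqrt (real n + \<alpha>)) * exp (- (\<i> * of_real (ln (real n + \<alpha>) * t))))" for t
  define D where "D = (\<Sum>n<M. (1 / sqrt (real n + \<alpha>))\<^sup>2)"
  define B where "B = (\<Sum>m<M. \<Sum>n\<in>{..<M}-{m}. \<bar>1 / sqrt (real m + \<alpha>) * (1 / sqrt (real n + \<alpha>))\<bar> / (ln (real m + \<alpha>) - ln (real n + \<alpha>))\<^sup>2)"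
  define h where "h = T / sqrt (ln T)"
  define A where "A = 3 + 1 / \<alpha>"
  have A: "A \<ge> 0" using \<alpha> by (simp add: A_def)
  have M: "2 * T \<le> real M" "real M \<le> 3 * T" "M \<ge> 1" unfolding M_def using T by linarith+
  have xpos: "real n + \<alpha> > 0" for n using \<alpha> by (simp add: add_nonneg_pos)
  have "ln T > 0" using T by simp
  hence sl: "sqrt (ln T) > 0" by simp
  have h: "h > 0" using T sl by (simp add: h_def)
  have S_eq: "S t = (\<Sum>n<M. complex_of_real (real n + \<alpha>) powr (- Complex (1/2) t))" for t
    unfolding S_def
  proof (intro sum.cong refl)
    fix n
    define x where "x = real n + \<alpha>"
    have x: "x > 0" using xpos by (simp add: x_def)
    have "complex_of_real x powr (- Complex (1/2) t) = exp (- Complex (1/2) t * of_real (ln x))"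
      using x by (simp add: powr_def Ln_of_real)
    also have "- Complex (1/2) t * of_real (ln x) = of_real (- (ln x / 2)) + (- (\<i> * of_real (ln x * t)))"
      by (simp add: complex_eq_iff)
    also have "exp \<dots> = of_real (exp (- (ln x / 2))) * exp (- (\<i> * of_real (ln x * t)))"
      by (simp only: exp_add exp_of_real)
    also have "exp (- (ln x / 2)) = 1 / sqrt x"
      using x by (simp add: exp_minus ln_sqrt[symmetric] inverse_eq_divide)
    finally show "complex_of_real (1 / sqrt (real n + \<alpha>)) * exp (- (\<i> * of_real (ln (real n + \<alpha>) * t))) =
       complex_of_real (real n + \<alpha>) powr (- Complex (1/2) t)" by (simp add: x_def)
  qed
  have inj: "inj_on (\<lambda>n. ln (real n + \<alpha>)) {..<M}"
    using xpos by (auto simp: inj_on_def)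
  define I where "I = integral {T..2*T} (\<lambda>t. (norm (S t))\<^sup>2)"
  have I0: "\<bar>I - D * T\<bar> \<le> D * h + 4 * B / h"
    unfolding I_def S_def D_def B_def using T h inj by (intro dirichlet_poly_mean_square) auto
  have D: "\<bar>D - ln T\<bar> \<le> A"
  proof -
    have "(1 / sqrt (real n + \<alpha>))\<^sup>2 = 1 / (real n + \<alpha>)" for n
      using xpos[of n] by (simp add: power_divide)
    hence D: "D = (\<Sum>n<M. 1 / (real n + \<alpha>))" by (simp add: D_def)
    have "ln T \<le> ln (real M)" using M T by simp
    moreover have "ln (real M) \<le> ln (3 * T)" using M T by (subst ln_le_cancel_iff) auto
    moreover have "ln (3 * T) = ln 3 + ln T" using T by (simp add: ln_mult)
    moreover have "ln (3 :: real) \<le> 2" using ln_le_minus_one[of "3::real"] by simp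
    ultimately show ?thesis
      using sum_inverse_shift_bounds[OF \<alpha> M(3)] unfolding D A_def by linarith
  qed
  have B: "4 * B / h \<le> T * (36 * (2 / \<alpha> + 24) * sqrt (ln T))"
  proof -
    have "B \<le> (2 / \<alpha> + 24) * (real M)\<^sup>2" unfolding B_def by (rule hurwitz_off_diagonal_le[OF \<alpha> M(3)])
    also have "\<dots> \<le> (2 / \<alpha> + 24) * (3 * T)\<^sup>2" using M T \<alpha> by (intro mult_left_mono power_mono) auto
    finally have "4 * B / h \<le> 4 * ((2 / \<alpha> + 24) * (3 * T)\<^sup>2) / h" using h by (intro divide_right_mono mult_left_mono) auto
    also have "\<dots> = T * (36 * (2 / \<alpha> + 24) * sqrt (ln T))"
      using T sl by (simp add: h_def power2_eq_square field_simps)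
    finally show ?thesis .
  qed
  have I: "\<bar>I - T * ln T\<bar> \<le> T * E"
  proof -
    have "\<bar>I - T * ln T\<bar> \<le> \<bar>I - D * T\<bar> + \<bar>D - ln T\<bar> * T"
    proof -
      have "I - T * ln T = (I - D * T) + (D - ln T) * T" by (simp add: algebra_simps)
      hence "\<bar>I - T * ln T\<bar> \<le> \<bar>I - D * T\<bar> + \<bar>(D - ln T) * T\<bar>" by (metis abs_triangle_ineq)
      thus ?thesis using T by (simp add: abs_mult)
    qed
    also have "\<dots> \<le> (D * h + 4 * B / h) + A * T"
      using I0 D T by (intro add_mono mult_right_mono) auto
    also have "D * h \<le> (ln T + A) * h" using D h by (intro mult_right_mono) auto
    also have "(ln T + A) * h = T * ((ln T + A) / sqrt (ln T))" by (simp add: h_def)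
    finally have "\<bar>I - T * ln T\<bar> \<le> T * ((ln T + A) / sqrt (ln T)) + T * (36 * (2 / \<alpha> + 24) * sqrt (ln T)) + A * T"
      using B by linarith
    also have "\<dots> = T * (A + (ln T + A) / sqrt (ln T) + 36 * (2 / \<alpha> + 24) * sqrt (ln T))" by (simp add: algebra_simps)
    finally show ?thesis unfolding E_def A_def .
  qed
  have "\<bar>integral {T..2*T} (\<lambda>t. (norm (hurwitz_zeta \<alpha> (Complex (1/2) t)))\<^sup>2) - I\<bar> \<le>
     1 / sqrt (ln T) * I + (1 + 1 / (1 / sqrt (ln T))) * 600\<^sup>2 * (2 * T - T)"
    unfolding I_def
  proof (rule integral_norm_square_diff_le)
    show "continuous_on {T..2*T} (\<lambda>t. hurwitz_zeta \<alpha> (Complex (1/2) t))"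
    proof -
      have "hurwitz_zeta \<alpha> (Complex (1/2) t) = hurwitz_entire \<alpha> (Complex (1/2) t) / (Complex (1/2) t - 1)" for t
        by (intro hurwitz_zeta_eq \<alpha>) (auto simp: complex_eq_iff)
      moreover have "continuous_on {T..2*T} (\<lambda>t. hurwitz_entire \<alpha> (Complex (1/2) t) / (Complex (1/2) t - 1))"
        unfolding Complex_eq
        by (intro continuous_intros
            continuous_on_compose2[OF holomorphic_on_imp_continuous_on[OF holomorphic_hurwitz_entire[OF \<alpha>(1), of UNIV]]])
           (auto simp: complex_eq_iff)
      ultimately show ?thesis by simp
    qed
    show "continuous_on {T..2*T} S" unfolding S_def by (intro continuous_intros)
    show "norm (hurwitz_zeta \<alpha> (Complex (1/2) t) - S t) \<le> 600" if "t \<in> {T..2*T}" for t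
      unfolding S_eq M_def using that T \<alpha> by (intro hurwitz_zeta_approx) auto
  qed (use T sl in auto)
  also have "(1 + 1 / (1 / sqrt (ln T))) * 600\<^sup>2 * (2 * T - T) = (1 + sqrt (ln T)) * 600\<^sup>2 * T" by simp
  also have "1 / sqrt (ln T) * I \<le> 1 / sqrt (ln T) * (T * ln T + T * E)"
    using I sl by (intro mult_left_mono) auto
  finally show ?thesis using I by linarith
qed

lemma asymp_equivI_ratio:
  fixes f g h :: "real \<Rightarrow> real"
  assumes "eventually (\<lambda>x. \<bar>f x - g x\<bar> \<le> h x) at_top" "((\<lambda>x. h x / g x) \<longlongrightarrow> 0) at_top" "eventually (\<lambda>x. g x > 0) at_top"
  shows "f \<sim>[at_top] g"
proof (rule asymp_equivI')
  have "((\<lambda>x. f x / g x - 1) \<longlongrightarrow> 0) at_top"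
  proof (rule Lim_null_comparison[OF _ assms(2)])
    show "eventually (\<lambda>x. norm (f x / g x - 1) \<le> h x / g x) at_top"
      using assms(1,3)
    proof eventually_elim
      case (elim x)
      have "f x / g x - 1 = (f x - g x) / g x" using elim by (simp add: field_simps)
      thus ?case using elim by (simp add: divide_right_mono)
    qed
  qed
  thus "((\<lambda>x. f x / g x) \<longlongrightarrow> 1) at_top" by (simp add: LIM_zero_iff)
qed

lemma hurwitz_second_moment:
  assumes \<alpha>: "\<alpha> > 0" "\<alpha> \<le> 1"
  shows "(\<lambda>T. integral {T..2*T} (\<lambda>t. (norm (hurwitz_zeta \<alpha> (Complex (1/2) t)))\<^sup>2)) \<sim>[at_top] (\<lambda>T. T * ln T)"
proof (rule asymp_equivI_ratio)
  define A where "A = 3 + 1 / \<alpha>"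
  define K where "K = 36 * (2 / \<alpha> + 24)"
  have AK: "A > 0" "K > 0" using \<alpha> by (auto simp: A_def K_def add_pos_pos)
  define E where "E T = A + (ln T + A) / sqrt (ln T) + K * sqrt (ln T)" for T :: real
  show "\<forall>\<^sub>F T in at_top. \<bar>integral {T..2*T} (\<lambda>t. (norm (hurwitz_zeta \<alpha> (Complex (1/2) t)))\<^sup>2) - T * ln T\<bar> \<le>
      T * E T + 1 / sqrt (ln T) * (T * ln T + T * E T) + (1 + sqrt (ln T)) * 600\<^sup>2 * T"
    using eventually_ge_at_top[of 3]
    by eventually_elim (unfold E_def A_def K_def, rule hurwitz_second_moment_bound[OF \<alpha>])
  show "((\<lambda>T. (T * E T + 1 / sqrt (ln T) * (T * ln T + T * E T) + (1 + sqrt (ln T)) * 600\<^sup>2 * T) / (T * ln T)) \<longlongrightarrow> 0) at_top"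
    unfolding E_def using AK by real_asymp
  show "\<forall>\<^sub>F x in at_top. x * ln x > (0 :: real)" by real_asymp
qed

section \<open>Special values of the constants\<close>

definition barnes_ln_term :: "real \<Rightarrow> nat \<Rightarrow> real" where
  "barnes_ln_term z n = real (Suc n) * ln (1 + z / real (Suc n)) + z\<^sup>2 / (2 * real (Suc n)) - z"

lemma ln_cubic_bounds:
  assumes "y > (0::real)"
  shows "0 \<le> ln (1 + y) - y + y\<^sup>2 / 2" "ln (1 + y) - y + y\<^sup>2 / 2 \<le> y ^ 3"
proof -
  define f where "f y = ln (1 + y) - y + y\<^sup>2 / 2" for y :: real
  have deriv: "(f has_real_derivative t\<^sup>2 / (1 + t)) (at t)" if "t \<ge> 0" for t
  proof -
    have "1 / (1 + t) - 1 + t = t\<^sup>2 / (1 + t)" using that by (simp add: field_simps power2_eq_square)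
    moreover have "(f has_real_derivative 1 / (1 + t) - 1 + t) (at t)"
      unfolding f_def using that by (auto intro!: derivative_eq_intros)
    ultimately show ?thesis by simp
  qed
  have "\<exists>t. 0 < t \<and> t < y \<and> f y - f 0 = (y - 0) * (t\<^sup>2 / (1 + t))"
    by (rule MVT2[OF assms]) (rule deriv)
  then obtain t where t: "0 < t" "t < y" "f y - f 0 = (y - 0) * (t\<^sup>2 / (1 + t))" by blast
  have fy: "f y = y * (t\<^sup>2 / (1 + t))" using t(3) by (simp add: f_def)
  have "t\<^sup>2 / (1 + t) \<le> t\<^sup>2 / 1" using t by (intro divide_left_mono) auto
  hence "t\<^sup>2 / (1 + t) \<le> t\<^sup>2" by simp
  also have "\<dots> \<le> y\<^sup>2" using t by (intro power_mono) auto
  finally have "f y \<le> y * y\<^sup>2" unfolding fy using assms by (intro mult_left_mono) auto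
  moreover have "y * y\<^sup>2 = y ^ 3" by (simp add: power3_eq_cube power2_eq_square)
  ultimately show "ln (1 + y) - y + y\<^sup>2 / 2 \<le> y ^ 3" by (simp add: f_def)
  have "0 \<le> f y" unfolding fy using t assms by (intro mult_nonneg_nonneg divide_nonneg_nonneg) auto
  thus "0 \<le> ln (1 + y) - y + y\<^sup>2 / 2" unfolding f_def .
qed

text \<open>With \<open>u = n + 1\<close> the term is \<open>u\<close> times the remainder of the
  logarithm at \<open>z / u\<close> after two terms, hence \<open>O(1 / u\<^sup>2)\<close>.\<close>

lemma summable_barnes_ln_term:
  assumes "z > 0"
  shows "summable (barnes_ln_term z)"
proof (rule summable_comparison_test)
  have eq: "u * a + z\<^sup>2 / (2 * u) - z = u * (a - z / u + (z / u)\<^sup>2 / 2)" if "u > 0" for u a :: real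
    using that by (simp add: field_simps power2_eq_square)
  have "norm (barnes_ln_term z n) \<le> z ^ 3 * (1 / (real (Suc n))\<^sup>2)" for n
  proof -
    define u where "u = real (Suc n)"
    have u: "u > 0" by (simp add: u_def)
    have b: "barnes_ln_term z n = u * (ln (1 + z / u) - z / u + (z / u)\<^sup>2 / 2)"
      unfolding barnes_ln_term_def u_def[symmetric] by (rule eq[OF u])
    have "u * (ln (1 + z / u) - z / u + (z / u)\<^sup>2 / 2) \<le> u * (z / u) ^ 3"
      using ln_cubic_bounds(2)[of "z / u"] u assms by (intro mult_left_mono) auto
    also have "\<dots> = z ^ 3 * (1 / u\<^sup>2)" using u by (simp add: power3_eq_cube power2_eq_square)
    finally show ?thesis
      unfolding b u_def[symmetric] using ln_cubic_bounds(1)[of "z / u"] u assms by simp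
  qed
  thus "\<exists>N. \<forall>n\<ge>N. norm (barnes_ln_term z n) \<le> z ^ 3 * (1 / (real (Suc n))\<^sup>2)" by blast
  have "summable (\<lambda>n. 1 / (real (Suc n))\<^sup>2)"
    using inverse_power_summable[of 2, where 'a = real] by (subst summable_Suc_iff[of "\<lambda>n. 1 / (real n)\<^sup>2"]) (simp add: inverse_eq_divide)
  thus "summable (\<lambda>n. z ^ 3 * (1 / (real (Suc n))\<^sup>2))" by (rule summable_mult)
qed

lemma barnes_G_eq:
  assumes "z > 0"
  shows "barnes_G (z + 1) = (2 * pi) powr (z / 2) * exp (- (z + (1 + euler_mascheroni) * z\<^sup>2) / 2) *
           exp (suminf (barnes_ln_term z))"
proof -
  have "(1 + z / real (Suc n)) ^ Suc n * exp (z\<^sup>2 / (2 * real (Suc n)) - z) = exp (barnes_ln_term z n)" for n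
  proof -
    have "1 + z / real (Suc n) > 0" using assms by (simp add: add_pos_pos)
    hence "exp (real (Suc n) * ln (1 + z / real (Suc n))) = (1 + z / real (Suc n)) ^ Suc n"
      by (simp only: exp_of_nat_mult exp_ln)
    moreover have "barnes_ln_term z n = real (Suc n) * ln (1 + z / real (Suc n)) + (z\<^sup>2 / (2 * real (Suc n)) - z)"
      by (simp add: barnes_ln_term_def)
    ultimately show ?thesis by (simp only: exp_add)
  qed
  hence "(\<Prod>n. (1 + z / real (Suc n)) ^ Suc n * exp (z\<^sup>2 / (2 * real (Suc n)) - z)) = exp (suminf (barnes_ln_term z))"
    using prodinf_exp[OF summable_barnes_ln_term[OF assms]] by presburger
  thus ?thesis by (simp add: barnes_G_def Let_def)
qed

lemma barnes_G_1: "barnes_G 1 = 1"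
  by (simp add: barnes_G_def)

lemma barnes_G_pos: "barnes_G (real k + 1) > 0"
proof (cases "k = 0")
  case True
  thus ?thesis by (simp add: barnes_G_1)
next
  case False
  thus ?thesis by (subst barnes_G_eq) (auto intro!: mult_pos_pos)
qed

text \<open>In the sum of \<open>2 * barnes_ln_term 1 n - barnes_ln_term 2 n\<close> the logarithms
  telescope and the rational parts leave a harmonic number. The limit \<open>-1 - \<gamma>\<close>
  is what the exponential prefactors require. The quotient belongs to an entry 1 of a tuple.\<close>

lemma barnes_G_2_3: "(barnes_G 2)\<^sup>2 / barnes_G 3 = 1"
proof -
  define S1 S2 where "S1 = suminf (barnes_ln_term 1)" and "S2 = suminf (barnes_ln_term 2)"
  have part: "(\<Sum>n<N. 2 * barnes_ln_term 1 n - barnes_ln_term 2 n) =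
      (real N + 1) * ln (real N + 1) - real N * ln (real N + 2) - harm N" for N
  proof (induction N)
    case (Suc N)
    have l: "ln (1 + 1 / real (Suc N)) = ln (real N + 2) - ln (real N + 1)"
    proof -
      have "1 + 1 / real (Suc N) = (real N + 2) / (real N + 1)" by (simp add: field_simps)
      thus ?thesis by (simp add: ln_div)
    qed
    have l2: "ln (1 + 2 / real (Suc N)) = ln (real N + 3) - ln (real N + 1)"
    proof -
      have "1 + 2 / real (Suc N) = (real N + 3) / (real N + 1)" by (simp add: field_simps)
      thus ?thesis by (simp add: ln_div)
    qed
    have "2 * barnes_ln_term 1 N - barnes_ln_term 2 N =
      2 * (real N + 1) * (ln (real N + 2) - ln (real N + 1)) - (real N + 1) * (ln (real N + 3) - ln (real N + 1)) - 1 / (real N + 1)"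
    proof -
      have "2 * (u * a + 1\<^sup>2 / (2 * u) - 1) - (u * b + 2\<^sup>2 / (2 * u) - 2) = 2 * u * a - u * b - 1 / u" if "u \<noteq> 0" for u a b :: real
        using that by (simp add: field_simps)
      from this[of "real (Suc N)"] show ?thesis unfolding barnes_ln_term_def l l2 by (simp add: add_ac)
    qed
    thus ?case using Suc by (simp add: harm_Suc inverse_eq_divide algebra_simps)
  qed (simp add: harm_def)
  have "(\<lambda>n. 2 * barnes_ln_term 1 n - barnes_ln_term 2 n) sums (2 * S1 - S2)"
    unfolding S1_def S2_def by (intro sums_diff sums_mult summable_sums summable_barnes_ln_term) auto
  hence lim: "(\<lambda>N. (real N + 1) * ln (real N + 1) - real N * ln (real N + 2) - harm N) \<longlonglongrightarrow> 2 * S1 - S2"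
    unfolding sums_def part .
  have "(\<lambda>N. (real N + 1) * ln (real N + 1) - real N * ln (real N + 2) - ln (real N)) \<longlonglongrightarrow> -1"
    by real_asymp
  hence "(\<lambda>N. ((real N + 1) * ln (real N + 1) - real N * ln (real N + 2) - ln (real N)) - (harm N - ln (real N))) \<longlonglongrightarrow> -1 - euler_mascheroni"
    using euler_mascheroni_LIMSEQ by (intro tendsto_diff) auto
  hence "(\<lambda>N. (real N + 1) * ln (real N + 1) - real N * ln (real N + 2) - harm N) \<longlonglongrightarrow> -1 - euler_mascheroni"
    by (simp add: algebra_simps)
  from LIMSEQ_unique[OF lim this] have S: "S2 = 2 * S1 + 1 + euler_mascheroni" by simp
  have "barnes_G 2 = sqrt (2 * pi) * exp (- 1 - euler_mascheroni / 2) * exp S1"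
    using barnes_G_eq[of 1] by (simp add: S1_def powr_half_sqrt field_simps)
  hence "(barnes_G 2)\<^sup>2 = 2 * pi * (exp (- 1 - euler_mascheroni / 2 + S1))\<^sup>2"
    by (simp add: power_mult_distrib exp_add)
  also have "\<dots> = 2 * pi * exp (- 2 - euler_mascheroni + 2 * S1)"
    by (simp add: exp_double [symmetric] algebra_simps)
  finally have 1: "(barnes_G 2)\<^sup>2 = 2 * pi * exp (- 2 - euler_mascheroni + 2 * S1)" .
  have "barnes_G 3 = 2 * pi * exp (- 3 - 2 * euler_mascheroni) * exp S2"
    using barnes_G_eq[of 2] by (simp add: S2_def field_simps)
  also have "\<dots> = 2 * pi * exp (- 2 - euler_mascheroni + 2 * S1)"
    unfolding S by (simp add: mult.assoc flip: exp_add)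
  finally show ?thesis using 1 by simp
qed

section \<open>The constants for k = 0 and k = 1\<close>

text \<open>Factorisations of \<open>p ^ m\<close> into \<open>k\<close> factors correspond to lists
  of \<open>k\<close> exponents with sum \<open>m\<close>, counted by stars and bars. The truncated
  subtraction gives the right values for \<open>k = 0\<close> as well.\<close>

lemma divisor_fun_prime_power:
  assumes p: "prime p"
  shows "divisor_fun k (p ^ m) = (m + k - 1) choose m"
proof -
  have "bij_betw (map (\<lambda>e. p ^ e)) {l. length l = k \<and> sum_list l = m} {ds. length ds = k \<and> prod_list ds = p ^ m}"
  proof (rule bij_betw_imageI)
    show "inj_on (map (\<lambda>e. p ^ e)) {l. length l = k \<and> sum_list l = m}"
      using prime_gt_1_nat[OF p] by (intro inj_onI) (auto simp: list_eq_iff_nth_eq)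
    have prod: "prod_list (map (\<lambda>e. p ^ e) l) = p ^ sum_list l" for l
      by (induction l) (auto simp: power_add)
    have ex: "\<exists>l. ds = map (\<lambda>e. p ^ e) l" if "prod_list ds = p ^ m" for ds m
      using that
    proof (induction ds arbitrary: m)
      case (Cons d ds)
      have "d dvd p ^ m" using Cons.prems by (metis dvd_triv_left prod_list.Cons)
      then obtain i where i: "d = p ^ i" "i \<le> m" using divides_primepow_nat[OF p] by blast
      hence "p ^ i * prod_list ds = p ^ i * p ^ (m - i)" using Cons.prems by (simp flip: power_add)
      hence "prod_list ds = p ^ (m - i)" using prime_gt_0_nat[OF p] by simp
      then obtain l where "ds = map (\<lambda>e. p ^ e) l" using Cons.IH by blast
      thus ?case using i by (intro exI[of _ "i # l"]) auto
    qed auto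
    show "map (\<lambda>e. p ^ e) ` {l. length l = k \<and> sum_list l = m} = {ds. length ds = k \<and> prod_list ds = p ^ m}"
    proof (intro equalityI subsetI)
      fix ds assume "ds \<in> {ds. length ds = k \<and> prod_list ds = p ^ m}"
      hence ds: "length ds = k" "prod_list ds = p ^ m" by auto
      then obtain l where l: "ds = map (\<lambda>e. p ^ e) l" using ex by blast
      hence "p ^ sum_list l = p ^ m" using ds prod by simp
      hence "sum_list l = m" using prime_gt_1_nat[OF p] by (simp add: power_inject_exp)
      thus "ds \<in> map (\<lambda>e. p ^ e) ` {l. length l = k \<and> sum_list l = m}" using l ds by auto
    qed (auto simp: prod)
  qed
  from bij_betw_same_card[OF this] show ?thesis
    unfolding divisor_fun_def card_length_sum_list by (rule sym)
qed

lemma moment_const_0: "moment_const 0 = 1"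
proof -
  have "(\<Sum>m. real (divisor_fun 0 (p ^ m)) ^ 2 / real p ^ m) = 1" if p: "prime p" for p
  proof -
    have "(\<Sum>m. real (divisor_fun 0 (p ^ m)) ^ 2 / real p ^ m) = (\<Sum>m\<in>{0}. real (divisor_fun 0 (p ^ m)) ^ 2 / real p ^ m)"
      by (rule suminf_finite) (auto simp: divisor_fun_prime_power[OF p])
    thus ?thesis by (simp add: divisor_fun_prime_power[OF p, of 0 0, simplified])
  qed
  hence "(\<lambda>p. if prime p then (1 - 1 / real p) ^ (0\<^sup>2) * (\<Sum>m. real (divisor_fun 0 (p ^ m)) ^ 2 / real p ^ m) else 1) = (\<lambda>p. 1)"
    by (auto simp: fun_eq_iff)
  thus ?thesis by (simp add: moment_const_def barnes_G_1)
qed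

text \<open>For \<open>k = 0\<close> the exponent \<open>2 * int k - 1\<close> is negative, which
  makes the constant equal to \<open>totient q\<close>, whereas the integral equals
  \<open>T\<close>. The two match exactly when \<open>totient q = 1\<close>.\<close>

lemma hurwitz_moment_const_0:
  assumes "q = 1 \<or> q = 2"
  shows "hurwitz_moment_const 0 q = 1"
proof -
  have "(\<Sum>m. real ((m + 0 - 1) choose m) ^ 2 / real p ^ m) = 1" for p :: nat
  proof -
    have "(\<Sum>m. real ((m + 0 - 1) choose m) ^ 2 / real p ^ m) = (\<Sum>m\<in>{0}. real ((m + 0 - 1) choose m) ^ 2 / real p ^ m)"
      by (rule suminf_finite) auto
    thus ?thesis by simp
  qed
  moreover have "totient q = 1" using assms by auto
  ultimately show ?thesis by (simp add: hurwitz_moment_const_def moment_const_0)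
qed

lemma suminf_geometric_inverse:
  assumes "prime (p :: nat)"
  shows "(\<Sum>m. 1 / real p ^ m) = 1 / (1 - 1 / real p)"
  using suminf_geometric[of "1 / real p"] prime_gt_1_nat[OF assms] by (simp add: power_one_over)

lemma moment_const_1: "moment_const 1 = 1"
proof -
  have "(1 - 1 / real p) ^ (1\<^sup>2) * (\<Sum>m. real (divisor_fun 1 (p ^ m)) ^ 2 / real p ^ m) = 1" if p: "prime p" for p
    using suminf_geometric_inverse[OF p] prime_gt_1_nat[OF p] by (simp add: divisor_fun_prime_power[OF p])
  hence "(\<lambda>p. if prime p then (1 - 1 / real p) ^ (1\<^sup>2) * (\<Sum>m. real (divisor_fun 1 (p ^ m)) ^ 2 / real p ^ m) else 1) = (\<lambda>p. 1)"
    by (auto simp: fun_eq_iff)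
  hence "moment_const 1 = barnes_G (real 1 + 1) ^ 2 / barnes_G (2 * real 1 + 1)"
    unfolding moment_const_def by (simp only: prodinf_zero mult_1_right)
  thus ?thesis using barnes_G_2_3 by simp
qed

text \<open>At \<open>k = 1\<close> the local series are geometric, and the product of their
  inverses over the primes dividing \<open>q\<close> is \<open>totient q / q\<close>.\<close>

lemma hurwitz_moment_const_1:
  assumes "q > 0"
  shows "hurwitz_moment_const 1 q = 1"
proof -
  have "{p. prime p \<and> p dvd q} = prime_factors q" using assms by (auto simp: prime_factors_dvd)
  hence "(\<Prod>p | prime p \<and> p dvd q. inverse (\<Sum>m. real ((m + 1 - 1) choose m) ^ 2 / real p ^ m)) = (\<Prod>p\<in>prime_factors q. 1 - 1 / real p)"
  proof (rule prod.cong)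
    fix p assume "p \<in> prime_factors q"
    hence "prime p" by auto
    thus "inverse (\<Sum>m. real ((m + 1 - 1) choose m) ^ 2 / real p ^ m) = 1 - 1 / real p"
      using suminf_geometric_inverse[of p] by simp
  qed
  hence "hurwitz_moment_const 1 q = real q / real (totient q) * (\<Prod>p\<in>prime_factors q. 1 - 1 / real p)"
    unfolding hurwitz_moment_const_def moment_const_1 by simp
  also have "real (totient q) = real q * (\<Prod>p\<in>prime_factors q. 1 - 1 / real p)"
    by (rule totient_formula2)
  finally have "hurwitz_moment_const 1 q = (real q * P) / (real q * P)" if "P = (\<Prod>p\<in>prime_factors q. 1 - 1 / real p)" for P
    using that by simp
  moreover have "real q * (\<Prod>p\<in>prime_factors q. 1 - 1 / real p) \<noteq> 0"
    using totient_formula2[of q] assms by (metis less_numeral_extra(3) of_nat_eq_0_iff totient_0_iff)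
  ultimately show ?thesis by simp
qed

section \<open>Dirichlet series over smooth numbers\<close>

lemma has_sum_product:
  fixes f :: "'a \<Rightarrow> 'c :: {real_normed_field, banach}" and g :: "'b \<Rightarrow> 'c"
  assumes f: "(f has_sum F) A" "(\<lambda>x. norm (f x)) summable_on A" and g: "(g has_sum G) B" "(\<lambda>x. norm (g x)) summable_on B"
  shows "((\<lambda>(x, y). f x * g y) has_sum (F * G)) (A \<times> B)" "(\<lambda>z. norm (case z of (x, y) \<Rightarrow> f x * g y)) summable_on (A \<times> B)"
proof -
  have "(\<lambda>z. norm (case z of (x, y) \<Rightarrow> f x * g y)) summable_on (A \<times> B)"
  proof (rule summable_on_SigmaI)
    fix x assume "x \<in> A"
    have "((\<lambda>y. norm (g y)) has_sum infsum (\<lambda>y. norm (g y)) B) B"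
      using g(2) by (rule has_sum_infsum)
    thus "((\<lambda>y. norm (case (x, y) of (x, y) \<Rightarrow> f x * g y)) has_sum (norm (f x) * infsum (\<lambda>y. norm (g y)) B)) B"
      by (simp add: norm_mult has_sum_cmult_right)
  next
    show "(\<lambda>x. norm (f x) * infsum (\<lambda>y. norm (g y)) B) summable_on A"
      using f(2) by (rule summable_on_cmult_left)
  qed auto
  thus abs: "(\<lambda>z. norm (case z of (x, y) \<Rightarrow> f x * g y)) summable_on (A \<times> B)" .
  show "((\<lambda>(x, y). f x * g y) has_sum (F * G)) (A \<times> B)"
  proof (rule has_sum_SigmaI)
    show "((\<lambda>y. case (x, y) of (x, y) \<Rightarrow> f x * g y) has_sum f x * G) B" for x
      using has_sum_cmult_right[OF g(1), of "f x"] by simp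
    show "((\<lambda>x. f x * G) has_sum F * G) A"
      using has_sum_cmult_left[OF f(1)] .
    show "(\<lambda>(x, y). f x * g y) summable_on A \<times> B"
      by (rule abs_summable_summable[OF abs])
  qed
qed

definition smooth :: "nat set \<Rightarrow> nat set" where
  "smooth S = {n. n > 0 \<and> (\<forall>p. prime p \<longrightarrow> p dvd n \<longrightarrow> p \<in> S)}"

lemma smooth_empty: "smooth {} = {1}"
  unfolding smooth_def using prime_factor_nat by auto

lemma bij_betw_smooth_insert:
  assumes p: "prime p" "p \<notin> S"
  shows "bij_betw (\<lambda>(m, j). m * p ^ j) (smooth S \<times> UNIV) (smooth (insert p S))"
proof (rule bij_betwI[where g = "\<lambda>n. (n div p ^ multiplicity p n, multiplicity p n)"])
  show "(\<lambda>(m, j). m * p ^ j) \<in> smooth S \<times> UNIV \<rightarrow> smooth (insert p S)"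
  proof safe
    fix m j assume m: "m \<in> smooth S"
    show "m * p ^ j \<in> smooth (insert p S)"
      unfolding smooth_def
    proof (intro CollectI conjI allI impI)
      show "m * p ^ j > 0" using m p by (simp add: smooth_def prime_gt_0_nat)
      fix r assume r: "prime r" "r dvd m * p ^ j"
      hence "r dvd m \<or> r dvd p" using prime_dvd_mult_nat prime_dvd_power_nat by blast
      thus "r \<in> insert p S" using m r p by (auto simp: smooth_def primes_dvd_imp_eq)
    qed
  qed
next
  have "(n div p ^ multiplicity p n) \<in> smooth S" if n: "n \<in> smooth (insert p S)" for n
  proof -
    have n0: "n \<noteq> 0" using n by (simp add: smooth_def)
    obtain m where m: "n = p ^ multiplicity p n * m" "\<not> p dvd m"
      using multiplicity_decompose'[of n p] n0 p by (metis not_prime_unit)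
    have d: "n div p ^ multiplicity p n = m"
      using m(1) p by (metis nonzero_mult_div_cancel_left power_eq_0_iff not_prime_0)
    have "r \<in> S" if r: "prime r" "r dvd m" for r
    proof -
      have "r dvd n" using r m(1) by (metis dvd_mult)
      moreover have "r \<noteq> p" using r m(2) by auto
      ultimately show ?thesis using n r by (auto simp: smooth_def)
    qed
    moreover have "m > 0" using m(1) n0 by (cases m) auto
    ultimately show ?thesis unfolding d by (simp add: smooth_def)
  qed
  thus "(\<lambda>n. (n div p ^ multiplicity p n, multiplicity p n)) \<in> smooth (insert p S) \<rightarrow> smooth S \<times> UNIV"
    by auto
next
  fix x assume "x \<in> smooth S \<times> (UNIV :: nat set)"
  then obtain m j where x: "x = (m, j)" "m \<in> smooth S" by auto
  have m: "m > 0" "\<not> p dvd m" using x p by (auto simp: smooth_def)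
  have "multiplicity p (m * p ^ j) = j"
    using m p by (simp add: prime_elem_multiplicity_mult_distrib not_dvd_imp_multiplicity_0)
  thus "(\<lambda>n. (n div p ^ multiplicity p n, multiplicity p n)) (case x of (m, j) \<Rightarrow> m * p ^ j) = x"
    using p prime_gt_0_nat[of p] by (simp add: x)
next
  fix n
  show "(case (n div p ^ multiplicity p n, multiplicity p n) of (m, j) \<Rightarrow> m * p ^ j) = n"
    by (simp add: multiplicity_dvd)
qed

text \<open>Adjoining a prime multiplies a sum over smooth numbers by a power series in that prime.
  This step serves both the Euler product of zeta and the Dirichlet series of
  \<open>P_fun\<close>.\<close>

lemma has_sum_smooth_insert:
  fixes a b c :: "nat \<Rightarrow> 'c :: {real_normed_field, banach}"
  assumes p: "prime p" "p \<notin> S"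
    and a: "(a has_sum F) (smooth S)" "(\<lambda>n. norm (a n)) summable_on smooth S"
    and b: "b sums G" "summable (\<lambda>j. norm (b j))"
    and c: "\<And>m j. m \<in> smooth S \<Longrightarrow> c (m * p ^ j) = a m * b j"
  shows "(c has_sum (F * G)) (smooth (insert p S))" "(\<lambda>n. norm (c n)) summable_on smooth (insert p S)"
proof -
  have b': "(b has_sum G) UNIV" using b(2,1) by (rule norm_summable_imp_has_sum)
  have b'': "(\<lambda>n. norm (b n)) summable_on UNIV"
    using b(2) by (simp add: summable_on_UNIV_nonneg_real_iff)
  note * = has_sum_product[OF a b' b'']
  show "(c has_sum (F * G)) (smooth (insert p S))"
    using *(1) unfolding has_sum_reindex_bij_betw[OF bij_betw_smooth_insert[OF p], of c "F * G", symmetric]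
    by (rule has_sum_cong[THEN iffD1, rotated]) (auto simp: c)
  show "(\<lambda>n. norm (c n)) summable_on smooth (insert p S)"
    using *(2) unfolding summable_on_reindex_bij_betw[OF bij_betw_smooth_insert[OF p], of "\<lambda>n. norm (c n)", symmetric]
    by (rule summable_on_cong[THEN iffD1, rotated]) (auto simp: c)
qed

lemma has_sum_smooth_euler_product:
  assumes "finite S" "\<And>p. p \<in> S \<Longrightarrow> prime p" and s: "s > 0"
  shows "((\<lambda>n. real n powr (-s)) has_sum (\<Prod>p\<in>S. 1 / (1 - real p powr (-s)))) (smooth S) \<and>
         (\<lambda>n. norm (real n powr (-s))) summable_on smooth S"
  using assms(1,2)
proof (induction S rule: finite_induct)
  case empty
  thus ?case by (simp add: smooth_empty has_sum_finiteI)
next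
  case (insert p S)
  have p: "prime p" "p \<notin> S" using insert by auto
  have p1: "real p > 1" using prime_gt_1_nat[OF p(1)] by simp
  have g: "norm (real p powr (-s)) < 1" using p1 s by (simp add: powr_less_one)
  have mult: "real (m * p ^ j) powr (-s) = real m powr (-s) * (real p powr (-s)) ^ j" for m j
    using p1 by (simp add: powr_mult powr_power powr_realpow[symmetric] powr_powr mult_ac)
  have sums: "(\<lambda>j. (real p powr (-s)) ^ j) sums (1 / (1 - real p powr (-s)))"
    by (rule geometric_sums[OF g])
  have abs: "summable (\<lambda>j. norm ((real p powr (-s)) ^ j))"
    using summable_geometric[OF g] by (simp add: power_abs)
  have IH: "((\<lambda>n. real n powr (-s)) has_sum (\<Prod>p\<in>S. 1 / (1 - real p powr (-s)))) (smooth S)"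
    "(\<lambda>n. norm (real n powr (-s))) summable_on smooth S" using insert by auto
  show ?case
    using has_sum_smooth_insert[where c = "\<lambda>n. real n powr (-s)", OF p IH sums abs mult] insert
    by (simp add: mult.commute)
qed

text \<open>\<open>M\<close> is Bohr's mean value of \<open>\<bar>F\<bar>\<^sup>2\<close>.\<close>
definition dirichlet_rep :: "nat set \<Rightarrow> (real \<Rightarrow> complex) \<Rightarrow> real \<Rightarrow> bool" where
  "dirichlet_rep S F M \<longleftrightarrow> (\<exists>a. (\<lambda>n. norm (a n)) summable_on smooth S \<and>
     (\<forall>t. ((\<lambda>n. a n * exp (- (\<i> * of_real (ln (real n) * t)))) has_sum F t) (smooth S)) \<and>
     ((\<lambda>n. (norm (a n))\<^sup>2) has_sum M) (smooth S))"

lemma dirichlet_rep_empty: "dirichlet_rep {} (\<lambda>_. 1) 1"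
  unfolding dirichlet_rep_def smooth_empty
  by (intro exI[of _ "\<lambda>_. 1"]) (auto intro!: has_sum_finiteI)

text \<open>By unique factorisation \<open>n = m * p ^ j\<close>, each product
  \<open>a m * b j\<close> is the coefficient at its own \<open>n\<close>. No terms are merged, so
  the squared moduli multiply too and the mean value is multiplicative over the primes.\<close>

lemma dirichlet_rep_insert:
  assumes rep: "dirichlet_rep S F M" and p: "prime p" "p \<notin> S"
    and b: "summable (\<lambda>j. norm (b j))" and b2: "(\<lambda>j. (norm (b j))\<^sup>2) sums L"
    and G: "\<And>t. (\<lambda>j. b j * exp (- (\<i> * of_real (ln (real p) * t))) ^ j) sums G t"
  shows "dirichlet_rep (insert p S) (\<lambda>t. F t * G t) (M * L)"
proof -
  obtain a where a: "(\<lambda>n. norm (a n)) summable_on smooth S"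
     "\<And>t. ((\<lambda>n. a n * exp (- (\<i> * of_real (ln (real n) * t)))) has_sum F t) (smooth S)"
     "((\<lambda>n. (norm (a n))\<^sup>2) has_sum M) (smooth S)"
    using rep unfolding dirichlet_rep_def by blast
  define c where "c n = a (n div p ^ multiplicity p n) * b (multiplicity p n)" for n
  have p1: "real p > 0" using prime_gt_0_nat[OF p(1)] by simp
  have c: "c (m * p ^ j) = a m * b j" if "m \<in> smooth S" for m j
  proof -
    have m: "m > 0" "\<not> p dvd m" using that p by (auto simp: smooth_def)
    have "multiplicity p (m * p ^ j) = j"
      using m p by (simp add: prime_elem_multiplicity_mult_distrib not_dvd_imp_multiplicity_0)
    thus ?thesis using p1 by (simp add: c_def)
  qed
  define X where "X t n = exp (- (\<i> * of_real (ln (real n) * t)))" for t n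
  have nX: "norm (X t n) = 1" for t n by (simp add: X_def)
  have X: "X t (m * p ^ j) = X t m * X t p ^ j" if "m \<in> smooth S" for t m j
  proof -
    have "m > 0" using that by (simp add: smooth_def)
    hence "ln (real (m * p ^ j)) = ln (real m) + real j * ln (real p)"
      using p1 by (simp add: ln_mult ln_realpow)
    thus ?thesis unfolding X_def exp_of_nat_mult[symmetric] exp_add[symmetric]
      by (simp add: algebra_simps)
  qed
  show ?thesis
    unfolding dirichlet_rep_def
  proof (intro exI[of _ c] conjI allI)
    have abs: "(\<lambda>n. norm (a n * X t n)) summable_on smooth S" for t
      using a(1) by (simp add: norm_mult nX)
    have babs: "summable (\<lambda>j. norm (b j * X t p ^ j))" for t
      using b by (simp add: norm_mult norm_power nX)
    have cX: "c (m * p ^ j) * X t (m * p ^ j) = (a m * X t m) * (b j * X t p ^ j)" if "m \<in> smooth S" for m j t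
      unfolding c[OF that] X[OF that] by (simp add: mult_ac)
    note * = has_sum_smooth_insert[where c = "\<lambda>n. c n * X t n" for t, OF p a(2)[folded X_def] abs G[folded X_def] babs cX]
    show "((\<lambda>n. c n * exp (- (\<i> * of_real (ln (real n) * t)))) has_sum F t * G t) (smooth (insert p S))" for t
      using *(1)[of t] unfolding X_def .
    show "(\<lambda>n. norm (c n)) summable_on smooth (insert p S)"
      using *(2)[of 0] by (simp add: X_def)
    have a2: "(\<lambda>n. norm ((norm (a n))\<^sup>2)) summable_on smooth S"
      using a(3) by (auto simp: summable_on_def)
    have b2': "summable (\<lambda>j. norm ((norm (b j))\<^sup>2))" using b2 by (simp add: sums_iff)
    show "((\<lambda>n. (norm (c n))\<^sup>2) has_sum M * L) (smooth (insert p S))"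
      by (rule has_sum_smooth_insert(1)[OF p a(3) a2 b2 b2']) (simp add: c norm_mult power_mult_distrib)
  qed
qed

section \<open>Bohr's mean value for absolutely convergent series\<close>

lemma mean_value_trig:
  fixes u v l :: real
  shows "((\<lambda>T. 1 / T * integral {T..2*T} (\<lambda>t. u * cos (l * t) - v * sin (l * t))) \<longlongrightarrow> (if l = 0 then u else 0)) at_top"
proof (cases "l = 0")
  case True
  have "eventually (\<lambda>T. 1 / T * integral {T..2*T} (\<lambda>t. u * cos (l * t) - v * sin (l * t)) = u) at_top"
    using eventually_gt_at_top[of 0] by eventually_elim (use True in auto)
  thus ?thesis using True by (simp add: tendsto_eventually)
next
  case False
  have eq: "integral {T..2*T} (\<lambda>t. u * cos (l * t) - v * sin (l * t)) =
     (u * sin (l * (2*T)) + v * cos (l * (2*T))) / l - (u * sin (l * T) + v * cos (l * T)) / l" if "T \<ge> 0" for T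
  proof (rule integral_unique, rule fundamental_theorem_of_calculus)
    fix t
    have "((\<lambda>t. (u * sin (l * t) + v * cos (l * t)) / l) has_real_derivative (u * cos (l * t) - v * sin (l * t))) (at t within {T..2*T})"
      using False by (auto intro!: derivative_eq_intros simp: field_simps)
    thus "((\<lambda>t. (u * sin (l * t) + v * cos (l * t)) / l) has_vector_derivative (u * cos (l * t) - v * sin (l * t))) (at t within {T..2*T})"
      by (simp add: has_real_derivative_iff_has_vector_derivative)
  qed (use that in auto)
  have bound: "\<bar>(u * sin x + v * cos x) / l\<bar> \<le> (\<bar>u\<bar> + \<bar>v\<bar>) / \<bar>l\<bar>" for x
  proof -
    have "\<bar>u * sin x + v * cos x\<bar> \<le> \<bar>u\<bar> * \<bar>sin x\<bar> + \<bar>v\<bar> * \<bar>cos x\<bar>"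
      by (rule order_trans[OF abs_triangle_ineq]) (simp add: abs_mult)
    also have "\<dots> \<le> \<bar>u\<bar> * 1 + \<bar>v\<bar> * 1" by (intro add_mono mult_left_mono) auto
    finally show ?thesis by (simp add: divide_right_mono)
  qed
  have "((\<lambda>T. 1 / T * integral {T..2*T} (\<lambda>t. u * cos (l * t) - v * sin (l * t))) \<longlongrightarrow> 0) at_top"
  proof (rule Lim_null_comparison)
    show "((\<lambda>T. 2 * ((\<bar>u\<bar> + \<bar>v\<bar>) / \<bar>l\<bar>) / T) \<longlongrightarrow> 0) at_top" by real_asymp
    show "eventually (\<lambda>T. norm (1 / T * integral {T..2*T} (\<lambda>t. u * cos (l * t) - v * sin (l * t))) \<le> 2 * ((\<bar>u\<bar> + \<bar>v\<bar>) / \<bar>l\<bar>) / T) at_top"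
      using eventually_gt_at_top[of 0]
    proof eventually_elim
      case (elim T)
      have "\<bar>integral {T..2*T} (\<lambda>t. u * cos (l * t) - v * sin (l * t))\<bar> \<le> 2 * ((\<bar>u\<bar> + \<bar>v\<bar>) / \<bar>l\<bar>)"
      proof -
        have "\<bar>A - B\<bar> \<le> 2 * K" if "\<bar>A\<bar> \<le> K" "\<bar>B\<bar> \<le> K" for A B K :: real
          using that by linarith
        thus ?thesis unfolding eq[OF less_imp_le[OF elim]] using bound by blast
      qed
      hence "\<bar>integral {T..2*T} (\<lambda>t. u * cos (l * t) - v * sin (l * t))\<bar> / T \<le> 2 * ((\<bar>u\<bar> + \<bar>v\<bar>) / \<bar>l\<bar>) / T"
        using elim by (intro divide_right_mono) auto
      thus ?case using elim by (simp only: norm_mult norm_divide real_norm_def) simp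
    qed
  qed
  thus ?thesis using False by simp
qed

text \<open>The frequencies \<open>ln n\<close> are distinct, so that only the diagonal of the
  expanded square has a nonzero mean.\<close>

lemma bohr_mean_finite:
  fixes a :: "nat \<Rightarrow> complex"
  assumes fin: "finite A" and pos: "\<And>n. n \<in> A \<Longrightarrow> n > 0"
  shows "((\<lambda>T. 1 / T * integral {T..2*T} (\<lambda>t. (norm (\<Sum>n\<in>A. a n * exp (- (\<i> * of_real (ln (real n) * t)))))\<^sup>2))
     \<longlongrightarrow> (\<Sum>n\<in>A. (norm (a n))\<^sup>2)) at_top"
proof -
  define c where "c m n = a m * cnj (a n)" for m n
  define l where "l m n = ln (real n) - ln (real m)" for m n
  define w where "w m n t = Re (c m n) * cos (l m n * t) - Im (c m n) * sin (l m n * t)" for m n t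
  have eq: "(norm (\<Sum>n\<in>A. a n * exp (- (\<i> * of_real (ln (real n) * t)))))\<^sup>2 = (\<Sum>m\<in>A. \<Sum>n\<in>A. w m n t)" for t
  proof -
    have "complex_of_real ((norm (\<Sum>n\<in>A. a n * exp (- (\<i> * of_real (ln (real n) * t)))))\<^sup>2) =
      (\<Sum>m\<in>A. \<Sum>n\<in>A. (a m * exp (- (\<i> * of_real (ln (real m) * t)))) * cnj (a n * exp (- (\<i> * of_real (ln (real n) * t)))))"
      unfolding complex_norm_square cnj_sum sum_product ..
    also have "Re \<dots> = (\<Sum>m\<in>A. \<Sum>n\<in>A. w m n t)"
    proof (unfold Re_sum, intro sum.cong refl)
      fix m n
      have "(a m * exp (- (\<i> * of_real (ln (real m) * t)))) * cnj (a n * exp (- (\<i> * of_real (ln (real n) * t)))) =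
        c m n * (exp (- (\<i> * of_real (ln (real m) * t))) * exp (\<i> * of_real (ln (real n) * t)))"
        by (simp add: c_def exp_cnj)
      also have "\<dots> = c m n * exp (\<i> * of_real (l m n * t))"
        unfolding exp_add[symmetric] by (simp add: l_def algebra_simps)
      also have "exp (\<i> * of_real (l m n * t)) = Complex (cos (l m n * t)) (sin (l m n * t))"
        by (simp add: complex_eq_iff Re_exp Im_exp)
      finally show "Re ((a m * exp (- (\<i> * of_real (ln (real m) * t)))) * cnj (a n * exp (- (\<i> * of_real (ln (real n) * t))))) = w m n t"
        by (simp add: w_def)
    qed
    finally show ?thesis by simp
  qed
  have "((\<lambda>T. \<Sum>m\<in>A. \<Sum>n\<in>A. 1 / T * integral {T..2*T} (w m n)) \<longlongrightarrow> (\<Sum>m\<in>A. \<Sum>n\<in>A. if l m n = 0 then Re (c m n) else 0)) at_top"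
    unfolding w_def by (intro tendsto_sum mean_value_trig)
  also have "(\<lambda>T. \<Sum>m\<in>A. \<Sum>n\<in>A. 1 / T * integral {T..2*T} (w m n)) = (\<lambda>T. 1 / T * integral {T..2*T} (\<lambda>t. \<Sum>m\<in>A. \<Sum>n\<in>A. w m n t))"
  proof
    fix T
    have int: "w m n integrable_on {T..2*T}" for m n
      unfolding w_def by (intro integrable_continuous_real continuous_intros)
    have "integral {T..2*T} (\<lambda>t. \<Sum>m\<in>A. \<Sum>n\<in>A. w m n t) = (\<Sum>m\<in>A. \<Sum>n\<in>A. integral {T..2*T} (w m n))"
      using int fin by (simp add: Henstock_Kurzweil_Integration.integral_sum integrable_sum)
    thus "(\<Sum>m\<in>A. \<Sum>n\<in>A. 1 / T * integral {T..2*T} (w m n)) = 1 / T * integral {T..2*T} (\<lambda>t. \<Sum>m\<in>A. \<Sum>n\<in>A. w m n t)"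
      by (simp only: sum_distrib_left)
  qed
  also have "(\<Sum>m\<in>A. \<Sum>n\<in>A. if l m n = 0 then Re (c m n) else 0) = (\<Sum>m\<in>A. (norm (a m))\<^sup>2)"
  proof (intro sum.cong refl)
    fix m assume m: "m \<in> A"
    have "(\<Sum>n\<in>A. if l m n = 0 then Re (c m n) else 0) = (\<Sum>n\<in>A. if m = n then Re (c m n) else 0)"
      using pos m by (intro sum.cong refl) (auto simp: l_def)
    also have "\<dots> = Re (c m m)" using fin m by simp
    also have "c m m = of_real ((norm (a m))\<^sup>2)" unfolding c_def complex_norm_square ..
    finally show "(\<Sum>n\<in>A. if l m n = 0 then Re (c m n) else 0) = (norm (a m))\<^sup>2" by simp
  qed
  finally show ?thesis unfolding eq .
qed

lemma dirichlet_rep_continuous: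
  assumes "dirichlet_rep S F M"
  shows "continuous_on A F"
proof -
  obtain a where a: "(\<lambda>n. norm (a n)) summable_on smooth S"
     "\<And>t. ((\<lambda>n. a n * exp (- (\<i> * of_real (ln (real n) * t)))) has_sum F t) (smooth S)"
    using assms unfolding dirichlet_rep_def by blast
  have F: "F = (\<lambda>t. \<Sum>\<^sub>\<infinity>n\<in>smooth S. a n * exp (- (\<i> * of_real (ln (real n) * t))))"
    using infsumI[OF a(2)] by (rule ext[OF sym])
  have "uniform_limit A (\<lambda>X t. \<Sum>n\<in>X. a n * exp (- (\<i> * of_real (ln (real n) * t))))
     (\<lambda>t. \<Sum>\<^sub>\<infinity>n\<in>smooth S. a n * exp (- (\<i> * of_real (ln (real n) * t)))) (finite_subsets_at_top (smooth S))"
    by (rule Weierstrass_m_test_general[OF _ a(1)]) (simp add: norm_mult)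
  thus ?thesis unfolding F
    by (rule uniform_limit_theorem[rotated]) (auto intro!: always_eventually continuous_intros)
qed

text \<open>Absolute convergence makes the approximation by a finite partial sum uniform in
  \<open>t\<close>, so the finite case carries over.\<close>

lemma dirichlet_rep_bohr_mean:
  assumes "dirichlet_rep S F M"
  shows "((\<lambda>T. 1 / T * integral {T..2*T} (\<lambda>t. (norm (F t))\<^sup>2)) \<longlongrightarrow> M) at_top"
proof -
  obtain a where a: "(\<lambda>n. norm (a n)) summable_on smooth S"
     "\<And>t. ((\<lambda>n. a n * exp (- (\<i> * of_real (ln (real n) * t)))) has_sum F t) (smooth S)"
     "((\<lambda>n. (norm (a n))\<^sup>2) has_sum M) (smooth S)"
    using assms unfolding dirichlet_rep_def by blast
  define e where "e n t = a n * exp (- (\<i> * of_real (ln (real n) * t)))" for n t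
  have ne: "norm (e n t) = norm (a n)" for n t by (simp add: e_def norm_mult)
  define C where "C = infsum (\<lambda>n. norm (a n)) (smooth S)"
  have C: "((\<lambda>n. norm (a n)) has_sum C) (smooth S)" unfolding C_def using a(1) by (rule has_sum_infsum)
  have C0: "C \<ge> 0" unfolding C_def by (rule infsum_nonneg) auto
  show ?thesis
  proof (rule tendstoI)
    fix \<epsilon> :: real assume \<epsilon>: "\<epsilon> > 0"
    \<comment> \<open>The errors \<open>2 * C * \<delta>\<close> in the integrands and
      \<open>C * \<delta>\<close> in the mean values have to stay below
      \<open>\<epsilon> / 2\<close> together. The added 1 covers \<open>C = 0\<close>.\<close>
    define \<delta> where "\<delta> = \<epsilon> / (4 * (2 * C + 1))"
    have \<delta>: "\<delta> > 0" using \<epsilon> C0 by (simp add: \<delta>_def)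
    have "eventually (\<lambda>A. dist (\<Sum>n\<in>A. norm (a n)) C < \<delta>) (finite_subsets_at_top (smooth S))"
      using C \<delta> unfolding has_sum_def by (rule tendstoD)
    then obtain A where A: "finite A" "A \<subseteq> smooth S" "dist (\<Sum>n\<in>A. norm (a n)) C < \<delta>"
      unfolding eventually_finite_subsets_at_top by blast
    define R where "R = smooth S - A"
    have tail: "((\<lambda>n. norm (a n)) has_sum (C - (\<Sum>n\<in>A. norm (a n)))) R"
      unfolding R_def using C A by (intro has_sum_Diff has_sum_finite) auto
    define \<tau> where "\<tau> = C - (\<Sum>n\<in>A. norm (a n))"
    have \<tau>: "0 \<le> \<tau>" "\<tau> \<le> \<delta>" "\<tau> \<le> C"
    proof -
      show "0 \<le> \<tau>" using tail unfolding \<tau>_def by (rule has_sum_nonneg) auto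
      show "\<tau> \<le> \<delta>" using A(3) unfolding \<tau>_def by (simp add: dist_real_def)
      show "\<tau> \<le> C" unfolding \<tau>_def by (simp add: sum_nonneg)
    qed
    define P where "P t = (\<Sum>n\<in>A. e n t)" for t
    have FP: "norm (F t - P t) \<le> \<tau>" for t
    proof -
      have "((\<lambda>n. e n t) has_sum (F t - P t)) R"
        unfolding R_def P_def using a(2)[of t] A by (intro has_sum_Diff has_sum_finite) (auto simp: e_def)
      moreover have "((\<lambda>n. norm (e n t)) has_sum \<tau>) R" using tail unfolding ne \<tau>_def .
      ultimately show ?thesis by (rule norm_has_sum_bound[rotated])
    qed
    have nF: "norm (F t) \<le> C" for t
      by (rule norm_has_sum_bound[OF _ a(2)[of t]]) (use C in \<open>simp add: norm_mult\<close>)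
    have nP: "norm (P t) \<le> C" for t
    proof -
      have "norm (P t) \<le> (\<Sum>n\<in>A. norm (a n))" unfolding P_def by (rule sum_norm_le) (simp add: ne)
      thus ?thesis using \<tau>(1) by (simp add: \<tau>_def)
    qed
    have FP2: "\<bar>(norm (F t))\<^sup>2 - (norm (P t))\<^sup>2\<bar> \<le> 2 * C * \<delta>" for t
    proof -
      have "\<bar>(norm (F t))\<^sup>2 - (norm (P t))\<^sup>2\<bar> = \<bar>norm (F t) - norm (P t)\<bar> * (norm (F t) + norm (P t))"
        by (simp add: power2_eq_square square_diff_square_factored abs_mult)
      also have "\<dots> \<le> \<delta> * (C + C)"
        using FP[of t] norm_triangle_ineq3[of "F t" "P t"] \<tau>(2) \<delta> nF[of t] nP[of t]
        by (intro mult_mono add_mono) auto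
      finally show ?thesis by (simp add: mult_ac)
    qed
    define MA where "MA = (\<Sum>n\<in>A. (norm (a n))\<^sup>2)"
    have MA: "\<bar>M - MA\<bar> \<le> C * \<delta>"
    proof -
      have hs: "((\<lambda>n. (norm (a n))\<^sup>2) has_sum (M - MA)) R"
        unfolding R_def MA_def using a(3) A by (intro has_sum_Diff has_sum_finite) auto
      have "norm (a n) \<le> C" if "n \<in> smooth S" for n
      proof -
        have "((\<lambda>n. norm (a n)) has_sum norm (a n)) {n}" by (simp add: has_sum_finiteI)
        thus ?thesis using C by (rule has_sum_mono2) (use that in auto)
      qed
      hence "(norm (a n))\<^sup>2 \<le> C * norm (a n)" if "n \<in> R" for n
        using that unfolding power2_eq_square R_def by (intro mult_right_mono) auto
      hence "M - MA \<le> C * \<tau>"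
        using has_sum_mono[OF hs has_sum_cmult_right[OF tail, of C]] unfolding \<tau>_def by blast
      also have "\<dots> \<le> C * \<delta>" using \<tau> C0 by (intro mult_left_mono) auto
      finally have "M - MA \<le> C * \<delta>" .
      moreover have "0 \<le> M - MA" using hs by (rule has_sum_nonneg) auto
      ultimately show ?thesis by simp
    qed
    have "((\<lambda>T. 1 / T * integral {T..2*T} (\<lambda>t. (norm (P t))\<^sup>2)) \<longlongrightarrow> MA) at_top"
      unfolding P_def e_def MA_def using A by (intro bohr_mean_finite) (auto simp: smooth_def)
    hence ev: "eventually (\<lambda>T. dist (1 / T * integral {T..2*T} (\<lambda>t. (norm (P t))\<^sup>2)) MA < \<epsilon> / 2) at_top"
      using \<epsilon> by (intro tendstoD) auto
    show "eventually (\<lambda>T. dist (1 / T * integral {T..2*T} (\<lambda>t. (norm (F t))\<^sup>2)) M < \<epsilon>) at_top"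
      using eventually_gt_at_top[of 0] ev
    proof eventually_elim
      case (elim T)
      have cF: "continuous_on {T..2*T} F" by (rule dirichlet_rep_continuous[OF assms])
      have cP: "continuous_on {T..2*T} P" unfolding P_def e_def by (intro continuous_intros)
      have iF: "(\<lambda>t. (norm (F t))\<^sup>2) integrable_on {T..2*T}" and iP: "(\<lambda>t. (norm (P t))\<^sup>2) integrable_on {T..2*T}"
        by (intro integrable_continuous_real continuous_intros cF cP)+
      have "norm (integral {T..2*T} (\<lambda>t. (norm (F t))\<^sup>2 - (norm (P t))\<^sup>2)) \<le> integral {T..2*T} (\<lambda>t. 2 * C * \<delta>)"
        using FP2 by (intro integral_norm_bound_integral integrable_diff iF iP) auto
      also have "\<dots> = T * (2 * C * \<delta>)" using elim by simp
      also have "integral {T..2*T} (\<lambda>t. (norm (F t))\<^sup>2 - (norm (P t))\<^sup>2) =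
        integral {T..2*T} (\<lambda>t. (norm (F t))\<^sup>2) - integral {T..2*T} (\<lambda>t. (norm (P t))\<^sup>2)"
        by (rule Henstock_Kurzweil_Integration.integral_diff[OF iF iP])
      finally have "\<bar>integral {T..2*T} (\<lambda>t. (norm (F t))\<^sup>2) - integral {T..2*T} (\<lambda>t. (norm (P t))\<^sup>2)\<bar> / T \<le> 2 * C * \<delta>"
        using elim by (simp add: divide_le_eq mult_ac)
      also have "\<bar>integral {T..2*T} (\<lambda>t. (norm (F t))\<^sup>2) - integral {T..2*T} (\<lambda>t. (norm (P t))\<^sup>2)\<bar> / T =
        \<bar>1 / T * integral {T..2*T} (\<lambda>t. (norm (F t))\<^sup>2) - 1 / T * integral {T..2*T} (\<lambda>t. (norm (P t))\<^sup>2)\<bar>"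
        using elim by (simp add: diff_divide_distrib[symmetric])
      finally have "\<bar>1 / T * integral {T..2*T} (\<lambda>t. (norm (F t))\<^sup>2) - 1 / T * integral {T..2*T} (\<lambda>t. (norm (P t))\<^sup>2)\<bar> \<le> 2 * C * \<delta>" .
      moreover have "3 * (C * \<delta>) < \<epsilon> / 2"
      proof -
        have "3 * (C * \<delta>) = 3 * C * \<epsilon> / (4 * (2 * C + 1))" by (simp add: \<delta>_def)
        also have "\<dots> < \<epsilon> / 2" using \<epsilon> C0 by (simp add: divide_less_eq)
        finally show ?thesis .
      qed
      ultimately show ?case using MA elim(2) unfolding dist_real_def by linarith
    qed
  qed
qed

section \<open>Mertens' theorem along a subsequence\<close>

text \<open>Abel summation: the weights \<open>n powr (-\<delta>)\<close> decrease, so partial sums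
  \<open>\<ge> \<epsilon>\<close> from \<open>N\<close> on force \<open>F \<delta> \<ge> \<epsilon>
  * N powr (-\<delta>) - B * (1 - N powr (-\<delta>))\<close>, and the right side tends to
  \<open>\<epsilon>\<close>.\<close>

lemma abelian_not_bounded_below:
  fixes h :: "nat \<Rightarrow> real"
  assumes h0: "h 0 = 0" and F: "\<And>\<delta>. \<delta> > 0 \<Longrightarrow> (\<lambda>n. h n * real n powr (-\<delta>)) sums F \<delta>"
    and lim: "(F \<longlongrightarrow> 0) (at_right 0)" and \<epsilon>: "\<epsilon> > 0"
  shows "\<not> eventually (\<lambda>n. (\<Sum>k\<le>n. h k) \<ge> \<epsilon>) sequentially"
proof
  define D where "D n = (\<Sum>k\<le>n. h k)" for n
  assume "eventually (\<lambda>n. (\<Sum>k\<le>n. h k) \<ge> \<epsilon>) sequentially"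
  then obtain N where N: "N \<ge> 1" "\<And>n. n \<ge> N \<Longrightarrow> D n \<ge> \<epsilon>"
    unfolding eventually_sequentially D_def by (metis max.cobounded1 max.cobounded2 order_trans)
  define B where "B = (\<Sum>n<N. \<bar>D n\<bar>)"
  have B: "\<bar>D n\<bar> \<le> B" if "n < N" for n
    unfolding B_def by (rule member_le_sum) (use that in auto)
  have lower: "F \<delta> \<ge> \<epsilon> * real N powr (-\<delta>) - B * (1 - real N powr (-\<delta>))" if \<delta>: "\<delta> > 0" for \<delta>
  proof -
    define w where "w n = real n powr (-\<delta>)" for n
    have wS: "w (Suc n) \<le> w n" if "n \<ge> 1" for n
      unfolding w_def using that \<delta> by (intro powr_mono2') auto
    have w1: "w 1 = 1" by (simp add: w_def)
    have wpos: "w n \<ge> 0" for n by (simp add: w_def)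
    \<comment> \<open>\<open>(D n - \<epsilon>) * w n\<close> is the boundary term of the summation
      by parts; keeping it makes the inequality inductive. Up to \<open>N\<close> only
      \<open>\<bar>D n\<bar> \<le> B\<close> is available, from then on
      \<open>D n \<ge> \<epsilon>\<close>.\<close>
    have part: "(\<Sum>k\<le>n. h k * w k) \<ge> \<epsilon> * w N - B * (1 - w N) + (D n - \<epsilon>) * w n" if "n \<ge> N" for n
      using that
    proof (induction n rule: dec_induct)
      case base
      have "(\<Sum>k\<le>n. h k * w k) \<ge> D n * w n - B * (1 - w n)" if "1 \<le> n" "n \<le> N" for n
        using that
      proof (induction n rule: dec_induct)
        case base
        \<comment> \<open>The weight at 0 is 0, since \<open>0 powr\<close> anything is 0, so the
          partial sum \<open>D\<close> must not contain \<open>h 0\<close> either.\<close>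
        show ?case using w1 by (simp add: D_def h0)
      next
        case (step n)
        have "(D n - D (Suc n)) = - h (Suc n)" by (simp add: D_def)
        have "\<bar>D n\<bar> \<le> B" using B step by auto
        hence "- B * (w n - w (Suc n)) \<le> D n * (w n - w (Suc n))"
          using wS[of n] step by (intro mult_right_mono) auto
        moreover have "D (Suc n) = D n + h (Suc n)" by (simp add: D_def)
        ultimately show ?case using step.IH step by (simp add: algebra_simps)
      qed
      from this[of N] N show ?case by (simp add: algebra_simps)
    next
      case (step n)
      have "0 \<le> (D n - \<epsilon>) * (w n - w (Suc n))"
        using N(2)[of n] N(1) wS[of n] step by (intro mult_nonneg_nonneg) auto
      moreover have "D (Suc n) = D n + h (Suc n)" by (simp add: D_def)
      ultimately show ?case using step.IH by (simp add: algebra_simps)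
    qed
    have lower: "(\<Sum>k\<le>n. h k * w k) \<ge> \<epsilon> * w N - B * (1 - w N)" if "n \<ge> N" for n
    proof -
      have "0 \<le> (D n - \<epsilon>) * w n" using N(2)[OF that] wpos[of n] by simp
      thus ?thesis using part[OF that] by linarith
    qed
    have "(\<lambda>n. \<Sum>k\<le>n. h k * w k) \<longlonglongrightarrow> F \<delta>"
      using F[OF \<delta>] unfolding sums_def_le w_def .
    thus ?thesis
      unfolding w_def[symmetric] by (rule tendsto_lowerbound) (use lower in \<open>auto simp: eventually_sequentially\<close>)
  qed
  have "((\<lambda>\<delta>. \<epsilon> * real N powr (-\<delta>) - B * (1 - real N powr (-\<delta>))) \<longlongrightarrow> \<epsilon> * real N powr (-0) - B * (1 - real N powr (-0))) (at_right 0)"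
    using N(1) by (intro tendsto_intros) auto
  hence l2: "((\<lambda>\<delta>. \<epsilon> * real N powr (-\<delta>) - B * (1 - real N powr (-\<delta>))) \<longlongrightarrow> \<epsilon>) (at_right 0)"
    using N(1) by simp
  have "\<epsilon> \<le> 0"
    by (rule tendsto_le[OF _ lim l2]) (use lower in \<open>auto simp: eventually_at_right_less intro!: eventually_mono[OF eventually_at_right_less[of 0]]\<close>)
  thus False using \<epsilon> by simp
qed

text \<open>If the partial sums stayed at distance \<open>\<epsilon>\<close> from 0, a change of
  sign would take a jump of at least \<open>2 * \<epsilon>\<close>. As \<open>h\<close> tends to 0,
  the sign would eventually be constant, against the previous lemma for \<open>h\<close> or for
  \<open>- h\<close>.\<close>

lemma abelian_subsequence:
  fixes h :: "nat \<Rightarrow> real"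
  assumes h0: "h 0 = 0" and F: "\<And>\<delta>. \<delta> > 0 \<Longrightarrow> (\<lambda>n. h n * real n powr (-\<delta>)) sums F \<delta>"
    and lim: "(F \<longlongrightarrow> 0) (at_right 0)" and h: "h \<longlonglongrightarrow> 0"
  shows "\<exists>r :: nat \<Rightarrow> nat. filterlim r at_top sequentially \<and> (\<lambda>j. \<Sum>k\<le>r j. h k) \<longlonglongrightarrow> 0"
proof -
  define D where "D n = (\<Sum>k\<le>n. h k)" for n
  have freq: "\<exists>n\<ge>m. \<bar>D n\<bar> < \<epsilon>" if \<epsilon>: "\<epsilon> > 0" for \<epsilon> m
  proof (rule ccontr)
    assume "\<not> (\<exists>n\<ge>m. \<bar>D n\<bar> < \<epsilon>)"
    hence big: "\<bar>D n\<bar> \<ge> \<epsilon>" if "n \<ge> m" for n using that by (meson not_le)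
    have "eventually (\<lambda>n. \<bar>h n\<bar> < \<epsilon>) sequentially"
      using order_tendstoD(2)[OF tendsto_rabs[OF h], of \<epsilon>] \<epsilon> by simp
    then obtain m' where m': "\<bar>h n\<bar> < \<epsilon>" if "n \<ge> m'" for n by (auto simp: eventually_sequentially)
    define M where "M = max m m'"
    have DS: "D (Suc n) = D n + h (Suc n)" for n by (simp add: D_def)
    show False
    proof (cases "D M \<ge> \<epsilon>")
      case True
      have "D n \<ge> \<epsilon>" if "n \<ge> M" for n
        using that
      proof (induction n rule: dec_induct)
        case (step n)
        have "\<bar>D (Suc n)\<bar> \<ge> \<epsilon>" using step by (intro big) (auto simp: M_def)
        moreover have "\<bar>h (Suc n)\<bar> < \<epsilon>" using step by (intro m') (auto simp: M_def)
        ultimately show ?case using step.IH unfolding DS by linarith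
      qed (use True in auto)
      hence "eventually (\<lambda>n. (\<Sum>k\<le>n. h k) \<ge> \<epsilon>) sequentially"
        unfolding D_def eventually_sequentially by blast
      thus False using abelian_not_bounded_below[OF h0 F lim \<epsilon>] by blast
    next
      case False
      have neg: "D n \<le> - \<epsilon>" if "n \<ge> M" for n
        using that
      proof (induction n rule: dec_induct)
        case base
        thus ?case using False big[of M] by (auto simp: M_def)
      next
        case (step n)
        have "\<bar>D (Suc n)\<bar> \<ge> \<epsilon>" using step by (intro big) (auto simp: M_def)
        moreover have "\<bar>h (Suc n)\<bar> < \<epsilon>" using step by (intro m') (auto simp: M_def)
        ultimately show ?case using step.IH unfolding DS by linarith
      qed
      have "(\<Sum>k\<le>n. - h k) \<ge> \<epsilon>" if "n \<ge> M" for n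
        using neg[OF that] unfolding sum_negf D_def by linarith
      hence ev: "eventually (\<lambda>n. (\<Sum>k\<le>n. - h k) \<ge> \<epsilon>) sequentially"
        unfolding eventually_sequentially by blast
      have "(\<lambda>n. - h n * real n powr (-\<delta>)) sums (- F \<delta>)" if "\<delta> > 0" for \<delta>
        using sums_minus[OF F[OF that]] by simp
      moreover have "((\<lambda>\<delta>. - F \<delta>) \<longlongrightarrow> 0) (at_right 0)" using tendsto_minus[OF lim] by simp
      ultimately show False
        using abelian_not_bounded_below[where h = "\<lambda>n. - h n" and F = "\<lambda>\<delta>. - F \<delta>"] h0 ev \<epsilon> by auto
    qed
  qed
  have "\<forall>j. \<exists>n\<ge>j. \<bar>D n\<bar> < 1 / real (Suc j)" using freq by simp
  then obtain r where r: "\<And>j. r j \<ge> j" "\<And>j. \<bar>D (r j)\<bar> < 1 / real (Suc j)" by metis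
  have "filterlim r at_top sequentially"
    using r(1) by (intro filterlim_at_top_mono[OF filterlim_ident]) auto
  moreover have "(\<lambda>j. D (r j)) \<longlonglongrightarrow> 0"
  proof (rule Lim_null_comparison)
    show "(\<lambda>j. 1 / real (Suc j)) \<longlonglongrightarrow> 0" by (rule LIMSEQ_Suc[OF lim_1_over_n])
    show "eventually (\<lambda>j. norm (D (r j)) \<le> 1 / real (Suc j)) sequentially"
      using r(2) by (intro always_eventually) (auto intro: less_imp_le)
  qed
  ultimately show ?thesis unfolding D_def by blast
qed

section \<open>The zeta sum and its Euler product near 1\<close>

text \<open>By the mean value theorem, \<open>\<delta>\<close> times a summand compares with a
  difference of consecutive values of \<open>x powr (-\<delta>)\<close>; these differences telescope
  to 1.\<close>

lemma zeta_sum_bounds: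
  assumes \<delta>: "\<delta> > 0"
  shows "summable (\<lambda>n. real n powr (-(1+\<delta>)))" "1 / \<delta> \<le> (\<Sum>n. real n powr (-(1+\<delta>)))" "(\<Sum>n. real n powr (-(1+\<delta>))) \<le> 1 / \<delta> + 1"
proof -
  show summ: "summable (\<lambda>n. real n powr (-(1+\<delta>)))" using \<delta> by (simp add: summable_real_powr_iff)
  have mvt: "x powr (-\<delta>) - (x + 1) powr (-\<delta>) \<le> \<delta> * x powr (-(1+\<delta>))"
    "\<delta> * (x + 1) powr (-(1+\<delta>)) \<le> x powr (-\<delta>) - (x + 1) powr (-\<delta>)" if x: "x > 0" for x :: real
  proof -
    have "\<exists>z. x < z \<and> z < x + 1 \<and> - ((x + 1) powr (-\<delta>)) - (- (x powr (-\<delta>))) = (x + 1 - x) * (\<delta> * z powr (-(1+\<delta>)))"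
    proof (rule MVT2)
      fix y assume "x \<le> y"
      thus "((\<lambda>x. - (x powr (-\<delta>))) has_real_derivative \<delta> * y powr (-(1+\<delta>))) (at y)"
        using x by (auto intro!: derivative_eq_intros simp: powr_diff powr_minus powr_add field_simps)
    qed simp
    then obtain z where z: "x < z" "z < x + 1"
      and eq: "- ((x + 1) powr (-\<delta>)) - (- (x powr (-\<delta>))) = (x + 1 - x) * (\<delta> * z powr (-(1+\<delta>)))" by blast
    have z3: "x powr (-\<delta>) - (x + 1) powr (-\<delta>) = \<delta> * z powr (-(1+\<delta>))" using eq by simp
    show "x powr (-\<delta>) - (x + 1) powr (-\<delta>) \<le> \<delta> * x powr (-(1+\<delta>))"
      unfolding z3 using z x \<delta> by (intro mult_left_mono powr_mono2') auto
    show "\<delta> * (x + 1) powr (-(1+\<delta>)) \<le> x powr (-\<delta>) - (x + 1) powr (-\<delta>)"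
      unfolding z3 using z x \<delta> by (intro mult_left_mono powr_mono2') auto
  qed
  define f where "f n = real (Suc n) powr (-\<delta>)" for n
  have "(\<lambda>n. f n - f (Suc n)) sums (f 0 - 0)"
  proof (rule telescope_sums')
    show "f \<longlonglongrightarrow> 0" unfolding f_def using \<delta> by real_asymp
  qed
  hence tel: "(\<lambda>n. f n - f (Suc n)) sums 1" by (simp add: f_def)
  \<comment> \<open>The term at \<open>n = 0\<close> vanishes because \<open>0 powr\<close> anything
    is 0.\<close>
  have Z: "(\<Sum>n. real n powr (-(1+\<delta>))) = (\<Sum>n. real (Suc n) powr (-(1+\<delta>)))"
    using suminf_split_head[OF summ] by simp
  have summ1: "summable (\<lambda>n. real (Suc n) powr (-(1+\<delta>)))" using summ by (subst summable_Suc_iff)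
  have summ2: "summable (\<lambda>n. real (Suc (Suc n)) powr (-(1+\<delta>)))" using summ1 by (subst summable_Suc_iff)
  have "1 = (\<Sum>n. f n - f (Suc n))" using tel by (simp add: sums_iff)
  also have "\<dots> \<le> (\<Sum>n. \<delta> * real (Suc n) powr (-(1+\<delta>)))"
  proof (rule suminf_le)
    show "f n - f (Suc n) \<le> \<delta> * real (Suc n) powr (-(1+\<delta>))" for n
      using mvt(1)[of "real (Suc n)"] by (simp add: f_def add_ac)
  qed (use tel summ1 in \<open>auto simp: sums_iff intro!: summable_mult\<close>)
  also have "\<dots> = \<delta> * (\<Sum>n. real (Suc n) powr (-(1+\<delta>)))" by (rule suminf_mult[OF summ1])
  finally show "1 / \<delta> \<le> (\<Sum>n. real n powr (-(1+\<delta>)))" unfolding Z using \<delta> by (simp add: divide_le_eq mult_ac)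
  have "\<delta> * (\<Sum>n. real (Suc (Suc n)) powr (-(1+\<delta>))) = (\<Sum>n. \<delta> * real (Suc (Suc n)) powr (-(1+\<delta>)))"
    by (rule suminf_mult[OF summ2, symmetric])
  also have "\<dots> \<le> (\<Sum>n. f n - f (Suc n))"
  proof (rule suminf_le)
    show "\<delta> * real (Suc (Suc n)) powr (-(1+\<delta>)) \<le> f n - f (Suc n)" for n
      using mvt(2)[of "real (Suc n)"] by (simp add: f_def add_ac)
  qed (use tel summ2 in \<open>auto simp: sums_iff intro!: summable_mult\<close>)
  also have "\<dots> = 1" using tel by (simp add: sums_iff)
  finally have "(\<Sum>n. real (Suc (Suc n)) powr (-(1+\<delta>))) \<le> 1 / \<delta>" using \<delta> by (simp add: le_divide_eq mult_ac)
  moreover have "(\<Sum>n. real (Suc n) powr (-(1+\<delta>))) = (\<Sum>n. real (Suc (Suc n)) powr (-(1+\<delta>))) + 1"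
    using suminf_split_head[OF summ1] by simp
  ultimately show "(\<Sum>n. real n powr (-(1+\<delta>))) \<le> 1 / \<delta> + 1" unfolding Z by simp
qed

text \<open>The product over \<open>p \<le> N\<close> sums \<open>n powr (-s)\<close> over all
  \<open>n\<close> whose prime factors are at most \<open>N\<close>. This set contains
  \<open>{1..N}\<close>, so the product lies between the partial sum and the full sum.\<close>

lemma ln_zeta_sums:
  assumes s: "s > 1"
  shows "(\<lambda>p. if prime p then - ln (1 - real p powr (-s)) else 0) sums ln (\<Sum>n. real n powr (-s))"
proof -
  define Z where "Z = (\<Sum>n. real n powr (-s))"
  have summ: "summable (\<lambda>n. real n powr (-s))" using s by (simp add: summable_real_powr_iff)
  have Zhs: "((\<lambda>n. real n powr (-s)) has_sum Z) UNIV"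
    unfolding Z_def using summ by (intro sums_nonneg_imp_has_sum summable_sums) auto
  have "(\<Sum>n\<in>{1}. real n powr (-s)) \<le> Z"
    unfolding Z_def by (rule sum_le_suminf[OF summ]) auto
  hence Z1: "Z \<ge> 1" by simp
  define P where "P N = (\<Prod>p | prime p \<and> p \<le> N. 1 / (1 - real p powr (-s)))" for N
  have hs: "((\<lambda>n. real n powr (-s)) has_sum P N) (smooth {p. prime p \<and> p \<le> N})" for N
    unfolding P_def by (rule conjunct1[OF has_sum_smooth_euler_product]) (use s in auto)
  have up: "P N \<le> Z" for N
    by (rule has_sum_mono2[OF hs Zhs]) auto
  have lo: "(\<Sum>n\<le>N. real n powr (-s)) \<le> P N" for N
  proof -
    have "(\<Sum>n\<le>N. real n powr (-s)) = (\<Sum>n=1..N. real n powr (-s))"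
      by (rule sum.mono_neutral_right) auto
    moreover have "((\<lambda>n. real n powr (-s)) has_sum (\<Sum>n=1..N. real n powr (-s))) {1..N}" by (rule has_sum_finite) auto
    hence "(\<Sum>n=1..N. real n powr (-s)) \<le> P N"
      by (rule has_sum_mono2[OF _ hs]) (auto simp: smooth_def dest: dvd_imp_le)
    ultimately show ?thesis by simp
  qed
  have "P \<longlonglongrightarrow> Z"
  proof (rule tendsto_sandwich)
    show "(\<lambda>N. \<Sum>n\<le>N. real n powr (-s)) \<longlonglongrightarrow> Z" using summ unfolding Z_def by (rule summable_LIMSEQ')
    show "(\<lambda>_. Z) \<longlonglongrightarrow> Z" by simp
  qed (use up lo in auto)
  hence "(\<lambda>N. ln (P N)) \<longlonglongrightarrow> ln Z" using Z1 by (intro tendsto_ln) auto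
  also have "(\<lambda>N. ln (P N)) = (\<lambda>N. \<Sum>p\<le>N. if prime p then - ln (1 - real p powr (-s)) else 0)"
  proof
    fix N
    have pos: "1 - real p powr (-s) > 0" if "prime p" for p
      using prime_gt_1_nat[OF that] s by (simp add: powr_less_one)
    have "ln (P N) = (\<Sum>p | prime p \<and> p \<le> N. ln (1 / (1 - real p powr (-s))))"
      unfolding P_def
    proof (rule ln_prod)
      fix p assume "p \<in> {p. prime p \<and> p \<le> N}"
      thus "1 / (1 - real p powr (-s)) \<noteq> 0" using pos[of p] by simp
    qed simp
    also have "\<dots> = (\<Sum>p | prime p \<and> p \<le> N. - ln (1 - real p powr (-s)))"
      using pos by (intro sum.cong refl) (simp add: ln_div)
    also have "{p. prime p \<and> p \<le> N} = {p\<in>{..N}. prime p}" by auto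
    also have "(\<Sum>p\<in>{p\<in>{..N}. prime p}. - ln (1 - real p powr (-s))) = (\<Sum>p\<le>N. if prime p then - ln (1 - real p powr (-s)) else 0)"
      by (rule sum.inter_filter) simp
    finally show "ln (P N) = (\<Sum>p\<le>N. if prime p then - ln (1 - real p powr (-s)) else 0)" .
  qed
  finally show ?thesis unfolding sums_def_le Z_def .
qed

text \<open>
  The weights \<open>1/(m+1)\<close> at the points \<open>\<lceil>e\<^bsup>m+1\<^esup>\<rceil>\<close> serve as a comparison sequence: their Dirichlet series
  has the same asymptotics at 0 as that of \<open>- ln (1 - 1/p)\<close> over the primes, and their partial sums
  are harmonic numbers.
\<close>
definition exp_ceil :: "nat \<Rightarrow> nat" where
  "exp_ceil m = nat \<lceil>exp (real (Suc m))\<rceil>"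

lemma exp_ceil_le_iff:
  assumes "n \<ge> 1"
  shows "exp_ceil m \<le> n \<longleftrightarrow> m < nat \<lfloor>ln (real n)\<rfloor>"
proof -
  have "exp_ceil m \<le> n \<longleftrightarrow> exp (real (Suc m)) \<le> real n"
    unfolding exp_ceil_def by (simp add: nat_le_iff ceiling_le_iff)
  also have "\<dots> \<longleftrightarrow> real (Suc m) \<le> ln (real n)"
    using assms by (simp add: ln_ge_iff)
  also have "\<dots> \<longleftrightarrow> Suc m \<le> nat \<lfloor>ln (real n)\<rfloor>" by linarith
  finally show ?thesis by (simp add: Suc_le_eq)
qed

lemma exp_ceil_bounds: "exp (real (Suc m)) \<le> real (exp_ceil m)" "real (exp_ceil m) \<le> exp (real (Suc m)) + 1"
  unfolding exp_ceil_def using exp_gt_zero[of "real (Suc m)"] by linarith+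

lemma strict_mono_exp_ceil: "strict_mono exp_ceil"
proof (rule strict_mono_Suc_iff[THEN iffD2], intro allI)
  fix m
  have "exp (real (Suc m)) + 1 < exp (real (Suc m)) * exp 1"
  proof -
    have "exp (real (Suc m)) \<ge> 1 + real (Suc m)" by (rule exp_ge_add_one_self)
    moreover have "exp (1::real) \<ge> 2" using exp_ge_add_one_self[of 1] by simp
    hence "exp (real (Suc m)) * 2 \<le> exp (real (Suc m)) * exp 1" by (intro mult_left_mono) auto
    ultimately show ?thesis by linarith
  qed
  also have "\<dots> = exp (real (Suc (Suc m)))" by (simp add: exp_add[symmetric] add_ac)
  finally show "exp_ceil m < exp_ceil (Suc m)"
    using exp_ceil_bounds(2)[of m] exp_ceil_bounds(1)[of "Suc m"] by linarith
qed

definition exp_ceil_weight :: "nat \<Rightarrow> real" where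
  "exp_ceil_weight n = (if n \<in> range exp_ceil then 1 / real (Suc (inv_into UNIV exp_ceil n)) else 0)"

lemma exp_ceil_weight_exp_ceil: "exp_ceil_weight (exp_ceil m) = 1 / real (Suc m)"
  using strict_mono_imp_inj_on[OF strict_mono_exp_ceil] by (simp add: exp_ceil_weight_def)

lemma sum_exp_ceil_weight:
  assumes "n \<ge> 1"
  shows "(\<Sum>k\<le>n. exp_ceil_weight k) = harm (nat \<lfloor>ln (real n)\<rfloor>)"
proof -
  have "(\<Sum>k\<le>n. exp_ceil_weight k) = (\<Sum>k\<in>exp_ceil ` {..<nat \<lfloor>ln (real n)\<rfloor>}. exp_ceil_weight k)"
  proof (rule sum.mono_neutral_right)
    show "exp_ceil ` {..<nat \<lfloor>ln (real n)\<rfloor>} \<subseteq> {..n}"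
      using exp_ceil_le_iff[OF assms] by auto
    show "\<forall>k\<in>{..n} - exp_ceil ` {..<nat \<lfloor>ln (real n)\<rfloor>}. exp_ceil_weight k = 0"
      using exp_ceil_le_iff[OF assms] by (auto simp: exp_ceil_weight_def)
  qed auto
  also have "\<dots> = (\<Sum>m<nat \<lfloor>ln (real n)\<rfloor>. 1 / real (Suc m))"
    using inj_on_subset[OF strict_mono_imp_inj_on[OF strict_mono_exp_ceil]]
    by (subst sum.reindex) (auto simp: exp_ceil_weight_exp_ceil)
  finally show ?thesis by (simp add: harm_altdef inverse_eq_divide)
qed

lemma sums_exp_over: 
  assumes "\<delta> > 0"
  shows "(\<lambda>m. 1 / real (Suc m) * exp (- \<delta> * real (Suc m))) sums (- ln (1 - exp (- \<delta>)))"
proof -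
  define x where "x = exp (- \<delta>)"
  have x: "0 < x" "x < 1" using assms by (auto simp: x_def)
  have "(\<lambda>n. - ((- (-x)) ^ n / real n)) sums ln (1 + (-x))"
    using ln_series'[of "-x"] x by simp
  from sums_minus[OF this] have "(\<lambda>n. x ^ n / real n) sums (- ln (1 - x))" by simp
  hence "(\<lambda>n. x ^ Suc n / real (Suc n)) sums (- ln (1 - x))"
    by (subst sums_Suc_iff) simp
  moreover have "x ^ Suc n / real (Suc n) = 1 / real (Suc n) * exp (- \<delta> * real (Suc n))" for n
    unfolding x_def exp_of_nat_mult[symmetric] by (simp add: mult.commute)
  ultimately show ?thesis unfolding x_def by simp
qed

text \<open>Rounding up moves \<open>y = exp (m + 1)\<close> by at most 1, which multiplies
  \<open>y powr (-\<delta>)\<close> by at least \<open>1 - \<delta> / y\<close>. Summed over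
  \<open>m\<close>, the errors are \<open>O(\<delta>)\<close>.\<close>

lemma exp_ceil_powr_bounds:
  assumes \<delta>: "\<delta> > 0"
  shows "real (exp_ceil m) powr (-\<delta>) \<le> exp (- \<delta> * real (Suc m))"
    "exp (- \<delta> * real (Suc m)) - \<delta> * exp (- real (Suc m)) \<le> real (exp_ceil m) powr (-\<delta>)"
proof -
  define y where "y = exp (real (Suc m))"
  have y: "y > 0" "y \<le> real (exp_ceil m)" "real (exp_ceil m) \<le> y + 1"
    using exp_ceil_bounds[of m] by (auto simp: y_def)
  have yp: "y powr (-\<delta>) = exp (- \<delta> * real (Suc m))"
    unfolding y_def powr_def by simp
  show "real (exp_ceil m) powr (-\<delta>) \<le> exp (- \<delta> * real (Suc m))"
    unfolding yp[symmetric] using y \<delta> by (intro powr_mono2') auto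
  have "1 - \<delta> * exp (- real (Suc m)) \<le> 1 - \<delta> * ln (1 + 1 / y)"
  proof -
    have "ln (1 + 1 / y) \<le> 1 / y" using y by (intro ln_add_one_self_le_self) auto
    also have "1 / y = exp (- real (Suc m))" unfolding y_def exp_minus by (simp add: inverse_eq_divide)
    finally show ?thesis using \<delta> by (simp add: mult_left_mono)
  qed
  also have "\<dots> \<le> exp (- \<delta> * ln (1 + 1 / y))" using exp_ge_add_one_self[of "- \<delta> * ln (1 + 1 / y)"] by simp
  also have "\<dots> = (1 + 1 / y) powr (-\<delta>)"
  proof -
    have "1 + 1 / y > 0" using y by (intro add_pos_pos) auto
    thus ?thesis by (simp add: powr_def)
  qed
  finally have 1: "1 - \<delta> * exp (- real (Suc m)) \<le> (1 + 1 / y) powr (-\<delta>)" .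
  have e1: "exp (- \<delta> * real (Suc m)) \<le> 1" using \<delta> by (simp add: mult_nonneg_nonneg)
  have "exp (- \<delta> * real (Suc m)) - \<delta> * exp (- real (Suc m)) \<le> exp (- \<delta> * real (Suc m)) * (1 - \<delta> * exp (- real (Suc m)))"
    using mult_right_mono[OF e1, of "\<delta> * exp (- real (Suc m))"] \<delta> by (simp add: algebra_simps)
  also have "\<dots> \<le> y powr (-\<delta>) * (1 + 1 / y) powr (-\<delta>)"
    unfolding yp using 1 by (intro mult_left_mono) auto
  also have "\<dots> = (y + 1) powr (-\<delta>)"
    using y by (simp add: powr_mult[symmetric] distrib_left)
  also have "\<dots> \<le> real (exp_ceil m) powr (-\<delta>)" using y \<delta> by (intro powr_mono2') auto
  finally show "exp (- \<delta> * real (Suc m)) - \<delta> * exp (- real (Suc m)) \<le> real (exp_ceil m) powr (-\<delta>)" .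
qed

text \<open>Without the rounding the series would be \<open>- ln (1 - exp (- \<delta>))\<close>,
  which is \<open>ln (1 / \<delta>) + o(1)\<close>. The rounding costs at most
  \<open>\<delta> * C\<close>.\<close>

lemma exp_ceil_weight_sums:
  obtains E where "\<And>\<delta>. \<delta> > 0 \<Longrightarrow> (\<lambda>n. exp_ceil_weight n * real n powr (-\<delta>)) sums E \<delta>"
    "((\<lambda>\<delta>. E \<delta> - ln (1 / \<delta>)) \<longlongrightarrow> 0) (at_right 0)"
proof
  define E where "E \<delta> = (\<Sum>m. 1 / real (Suc m) * real (exp_ceil m) powr (-\<delta>))" for \<delta>
  define C where "C = (\<Sum>m. exp (- real (Suc m)))"
  have geo: "summable (\<lambda>m. exp (- real (Suc m)))"
  proof -
    have "summable (\<lambda>m. exp (-1 :: real) * exp (-1) ^ m)"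
      by (intro summable_mult summable_geometric) auto
    moreover have "exp (-1 :: real) * exp (-1) ^ m = exp (- real (Suc m))" for m
      by (simp flip: exp_of_nat_mult exp_add)
    ultimately show ?thesis by simp
  qed
  have summ: "summable (\<lambda>m. 1 / real (Suc m) * real (exp_ceil m) powr (-\<delta>))" if \<delta>: "\<delta> > 0" for \<delta>
  proof (rule summable_comparison_test)
    have "norm (1 / real (Suc m) * real (exp_ceil m) powr (-\<delta>)) \<le> 1 / real (Suc m) * exp (- \<delta> * real (Suc m))" for m
      using exp_ceil_powr_bounds(1)[OF \<delta>, of m] by (simp add: divide_right_mono)
    thus "\<exists>N. \<forall>m\<ge>N. norm (1 / real (Suc m) * real (exp_ceil m) powr (-\<delta>)) \<le> 1 / real (Suc m) * exp (- \<delta> * real (Suc m))" by blast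
    show "summable (\<lambda>m. 1 / real (Suc m) * exp (- \<delta> * real (Suc m)))"
      using sums_exp_over[OF \<delta>] by (rule sums_summable)
  qed
  show "(\<lambda>n. exp_ceil_weight n * real n powr (-\<delta>)) sums E \<delta>" if \<delta>: "\<delta> > 0" for \<delta>
  proof -
    have "(\<lambda>m. exp_ceil_weight (exp_ceil m) * real (exp_ceil m) powr (-\<delta>)) sums E \<delta>"
      unfolding E_def exp_ceil_weight_exp_ceil using summ[OF \<delta>] by (rule summable_sums)
    thus ?thesis
      by (subst (asm) sums_mono_reindex[OF strict_mono_exp_ceil]) (auto simp: exp_ceil_weight_def)
  qed
  have up: "E \<delta> \<le> - ln (1 - exp (- \<delta>))" and lo: "- ln (1 - exp (- \<delta>)) - \<delta> * C \<le> E \<delta>" if \<delta>: "\<delta> > 0" for \<delta>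
  proof -
    show "E \<delta> \<le> - ln (1 - exp (- \<delta>))"
      unfolding E_def
      by (rule sums_le[OF _ summable_sums[OF summ[OF \<delta>]] sums_exp_over[OF \<delta>]])
         (intro mult_left_mono exp_ceil_powr_bounds(1)[OF \<delta>], simp)
    have s: "(\<lambda>m. 1 / real (Suc m) * exp (- \<delta> * real (Suc m)) - \<delta> * exp (- real (Suc m))) sums (- ln (1 - exp (- \<delta>)) - \<delta> * C)"
      unfolding C_def by (intro sums_diff sums_exp_over \<delta> sums_mult summable_sums geo)
    show "- ln (1 - exp (- \<delta>)) - \<delta> * C \<le> E \<delta>"
      unfolding E_def
    proof (rule sums_le[OF _ s summable_sums[OF summ[OF \<delta>]]])
      fix m
      have "1 / real (Suc m) * (exp (- \<delta> * real (Suc m)) - \<delta> * exp (- real (Suc m))) \<le> 1 / real (Suc m) * real (exp_ceil m) powr (-\<delta>)"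
        by (intro mult_left_mono exp_ceil_powr_bounds(2)[OF \<delta>]) auto
      moreover have "1 / real (Suc m) * (\<delta> * exp (- real (Suc m))) \<le> 1 * (\<delta> * exp (- real (Suc m)))"
        using \<delta> by (intro mult_right_mono) auto
      ultimately show "1 / real (Suc m) * exp (- \<delta> * real (Suc m)) - \<delta> * exp (- real (Suc m)) \<le> 1 / real (Suc m) * real (exp_ceil m) powr (-\<delta>)"
        unfolding right_diff_distrib by linarith
    qed
  qed
  show "((\<lambda>\<delta>. E \<delta> - ln (1 / \<delta>)) \<longlongrightarrow> 0) (at_right 0)"
  proof (rule tendsto_sandwich[where f = "\<lambda>\<delta>. - ln (1 - exp (- \<delta>)) - ln (1 / \<delta>) - \<delta> * C"
        and h = "\<lambda>\<delta>. - ln (1 - exp (- \<delta>)) - ln (1 / \<delta>)"])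
    have "((\<lambda>\<delta>. (1 - exp (- \<delta>)) / \<delta>) \<longlongrightarrow> (1::real)) (at_right 0)" by real_asymp
    hence "((\<lambda>\<delta>. - ln ((1 - exp (- \<delta>)) / \<delta>)) \<longlongrightarrow> - ln (1::real)) (at_right 0)"
      by (intro tendsto_minus tendsto_ln) auto
    moreover have "eventually (\<lambda>\<delta>::real. - ln ((1 - exp (- \<delta>)) / \<delta>) = - ln (1 - exp (- \<delta>)) - ln (1 / \<delta>)) (at_right 0)"
      using eventually_at_right_less[of 0] by eventually_elim (simp add: ln_div)
    ultimately show lim: "((\<lambda>\<delta>. - ln (1 - exp (- \<delta>)) - ln (1 / \<delta>)) \<longlongrightarrow> 0) (at_right (0::real))"
      by (simp add: filterlim_cong)
    have "((\<lambda>\<delta>. - ln (1 - exp (- \<delta>)) - ln (1 / \<delta>) - \<delta> * C) \<longlongrightarrow> 0 - 0 * C) (at_right 0)"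
      by (intro tendsto_diff tendsto_mult tendsto_const tendsto_ident_at lim)
    thus "((\<lambda>\<delta>. - ln (1 - exp (- \<delta>)) - ln (1 / \<delta>) - \<delta> * C) \<longlongrightarrow> 0) (at_right 0)" by simp
    show "\<forall>\<^sub>F \<delta> in at_right 0. E \<delta> - ln (1 / \<delta>) \<le> - ln (1 - exp (- \<delta>)) - ln (1 / \<delta>)"
      using eventually_at_right_less[of 0] by eventually_elim (use up in auto)
    show "\<forall>\<^sub>F \<delta> in at_right 0. - ln (1 - exp (- \<delta>)) - ln (1 / \<delta>) - \<delta> * C \<le> E \<delta> - ln (1 / \<delta>)"
      using eventually_at_right_less[of 0]
    proof eventually_elim
      case (elim \<delta>)
      thus ?case using lo[of \<delta>] by linarith
    qed
  qed
qed

lemma abs_ln_one_minus_bound: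
  fixes x :: real
  assumes "0 \<le> x" "x \<le> 1/2"
  shows "\<bar>- ln (1 - x) - x\<bar> \<le> 2 * x\<^sup>2"
  using abs_ln_one_plus_x_minus_x_bound_nonpos[of "-x"] assms by (simp add: abs_minus_commute)

text \<open>\<open>d p \<delta>\<close> is the difference between the wanted term and
  \<open>- ln (1 - p powr (-(1+\<delta>)))\<close>. The parts of order \<open>1 / p\<close> cancel
  in it, so \<open>4 / p\<^sup>2\<close> is a bound uniform in \<open>\<delta>\<close>, and by
  Tannery's theorem the differences sum to \<open>o(1)\<close>. What remains is
  \<open>ln \<zeta>(1 + \<delta>)\<close>.\<close>

lemma prime_ln_weight_sums:
  obtains A where "\<And>\<delta>. \<delta> > 0 \<Longrightarrow> (\<lambda>p. (if prime p then - ln (1 - 1 / real p) else 0) * real p powr (-\<delta>)) sums A \<delta>"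
    "((\<lambda>\<delta>. A \<delta> - ln (1 / \<delta>)) \<longlongrightarrow> 0) (at_right 0)"
proof
  define d where "d p \<delta> = (if prime p then - ln (1 - 1 / real p) * real p powr (-\<delta>) + ln (1 - real p powr (-(1+\<delta>))) else 0)" for p \<delta>
  define Z where "Z \<delta> = (\<Sum>n. real n powr (-(1+\<delta>)))" for \<delta>
  define A where "A \<delta> = (\<Sum>p. d p \<delta>) + ln (Z \<delta>)" for \<delta>
  have dlim: "(d p \<longlongrightarrow> 0) (at_right 0)" for p
  proof (cases "prime p")
    case True
    hence p: "real p > 1" using prime_gt_1_nat by fastforce
    have "((\<lambda>\<delta>. - ln (1 - 1 / real p) * real p powr (-\<delta>) + ln (1 - real p powr (-(1+\<delta>)))) \<longlongrightarrow>
       - ln (1 - 1 / real p) * real p powr (-0) + ln (1 - real p powr (-(1+0)))) (at_right 0)"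
      using p by (intro tendsto_intros) (auto simp: powr_minus)
    also have "- ln (1 - 1 / real p) * real p powr (-0) + ln (1 - real p powr (-(1+0))) = 0"
      using p by (simp add: powr_minus inverse_eq_divide)
    finally show ?thesis using True by (simp add: d_def [abs_def])
  qed (simp add: d_def [abs_def])
  have dbound: "norm (d p \<delta>) \<le> 4 * (1 / (real p)\<^sup>2)" if \<delta>: "\<delta> > 0" for p \<delta>
  proof (cases "prime p")
    case True
    hence p: "real p \<ge> 2" using prime_ge_2_nat by fastforce
    define x where "x = real p powr (-(1+\<delta>))"
    have x: "0 \<le> x" "x \<le> 1 / real p"
    proof -
      have "x \<le> real p powr (-1)" unfolding x_def using p \<delta> by (intro powr_mono) auto
      thus "x \<le> 1 / real p" using p by (simp add: powr_minus inverse_eq_divide)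
    qed (simp add: x_def)
    have p2: "1 / real p \<le> 1 / 2" using p by simp
    have xx: "x = 1 / real p * real p powr (-\<delta>)"
      unfolding x_def using p by (simp add: powr_diff powr_minus field_simps)
    have w: "0 \<le> real p powr (-\<delta>)" "real p powr (-\<delta>) \<le> 1"
      using p \<delta> powr_mono[of "-\<delta>" 0 "real p"] by auto
    have "d p \<delta> = (- ln (1 - 1 / real p) - 1 / real p) * real p powr (-\<delta>) - (- ln (1 - x) - x)"
      using True unfolding d_def x_def[symmetric] by (simp add: left_diff_distrib xx)
    also have "\<bar>\<dots>\<bar> \<le> \<bar>- ln (1 - 1 / real p) - 1 / real p\<bar> * real p powr (-\<delta>) + \<bar>- ln (1 - x) - x\<bar>"
      by (rule order_trans[OF abs_triangle_ineq4]) (simp add: abs_mult)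
    also have "\<dots> \<le> 2 * (1 / real p)\<^sup>2 * 1 + 2 * x\<^sup>2"
      using w x p2 by (intro add_mono mult_mono abs_ln_one_minus_bound) auto
    also have "\<dots> \<le> 2 * (1 / real p)\<^sup>2 * 1 + 2 * (1 / real p)\<^sup>2"
      using x by (intro add_mono mult_left_mono power_mono) auto
    finally show ?thesis by (simp add: power_divide)
  qed (simp add: d_def)
  have summ4: "summable (\<lambda>p. 4 * (1 / (real p)\<^sup>2))"
    using inverse_power_summable[of 2, where 'a = real] by (intro summable_mult) (simp add: inverse_eq_divide)
  have dsumm: "summable (\<lambda>p. d p \<delta>)" if "\<delta> > 0" for \<delta>
    by (rule summable_comparison_test[OF _ summ4]) (use dbound[OF that] in blast)
  show "(\<lambda>p. (if prime p then - ln (1 - 1 / real p) else 0) * real p powr (-\<delta>)) sums A \<delta>" if \<delta>: "\<delta> > 0" for \<delta>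
  proof -
    have "(\<lambda>p. d p \<delta> + (if prime p then - ln (1 - real p powr (-(1+\<delta>))) else 0)) sums A \<delta>"
      unfolding A_def Z_def using \<delta> by (intro sums_add summable_sums dsumm ln_zeta_sums) auto
    moreover have "d p \<delta> + (if prime p then - ln (1 - real p powr (-(1+\<delta>))) else 0) =
       (if prime p then - ln (1 - 1 / real p) else 0) * real p powr (-\<delta>)" for p
      by (simp add: d_def)
    ultimately show ?thesis by simp
  qed
  have "((\<lambda>\<delta>. \<Sum>p. d p \<delta>) \<longlongrightarrow> (\<Sum>p. 0)) (at_right 0)"
  proof -
    have ev: "eventually (\<lambda>(p,\<delta>). norm (d p \<delta>) \<le> 4 * (1 / (real p)\<^sup>2)) (at_top \<times>\<^sub>F at_right 0)"
      unfolding eventually_prod_filter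
      using dbound by (intro exI[of _ "\<lambda>_. True"] exI[of _ "\<lambda>\<delta>. \<delta> > 0"]) (simp add: eventually_at_right_less)
    show ?thesis
      using tannerys_theorem[OF dlim ev summ4] by (simp add: trivial_limit_at_right_real)
  qed
  moreover have "((\<lambda>\<delta>. ln (Z \<delta>) - ln (1 / \<delta>)) \<longlongrightarrow> 0) (at_right 0)"
  proof (rule tendsto_sandwich[where f = "\<lambda>_. 0" and h = "\<lambda>\<delta>. ln (1 + \<delta>)"])
    show "((\<lambda>\<delta>::real. ln (1 + \<delta>)) \<longlongrightarrow> 0) (at_right 0)" by real_asymp
    show "eventually (\<lambda>\<delta>. 0 \<le> ln (Z \<delta>) - ln (1 / \<delta>)) (at_right 0)"
      using eventually_at_right_less[of 0]
    proof eventually_elim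
      case (elim \<delta>)
      have "1 / \<delta> > 0" using elim by simp
      hence "ln (1 / \<delta>) \<le> ln (Z \<delta>)" using zeta_sum_bounds(2)[OF elim] unfolding Z_def by (subst ln_le_cancel_iff) linarith+
      thus ?case by simp
    qed
    show "eventually (\<lambda>\<delta>. ln (Z \<delta>) - ln (1 / \<delta>) \<le> ln (1 + \<delta>)) (at_right 0)"
      using eventually_at_right_less[of 0]
    proof eventually_elim
      case (elim \<delta>)
      have "1 / \<delta> > 0" using elim by simp
      hence "ln (Z \<delta>) \<le> ln (1 / \<delta> + 1)" using zeta_sum_bounds(2,3)[OF elim] unfolding Z_def by (subst ln_le_cancel_iff) linarith+
      also have "1 / \<delta> + 1 = (1 + \<delta>) / \<delta>" using elim by (simp add: field_simps)
      also have "ln \<dots> = ln (1 + \<delta>) + ln (1 / \<delta>)" using elim by (simp add: ln_div)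
      finally show ?case by simp
    qed
  qed auto
  ultimately have "((\<lambda>\<delta>. (\<Sum>p. d p \<delta>) + (ln (Z \<delta>) - ln (1 / \<delta>))) \<longlongrightarrow> (\<Sum>p::nat. 0::real) + 0) (at_right 0)"
    by (rule tendsto_add)
  thus "((\<lambda>\<delta>. A \<delta> - ln (1 / \<delta>)) \<longlongrightarrow> 0) (at_right 0)"
    by (simp add: A_def add_diff_eq)
qed

lemma exp_ceil_weight_tendsto_0: "exp_ceil_weight \<longlonglongrightarrow> 0"
proof (rule Lim_null_comparison)
  show "(\<lambda>n. 1 / ln (real n - 1)) \<longlonglongrightarrow> 0" by real_asymp
  show "eventually (\<lambda>n. norm (exp_ceil_weight n) \<le> 1 / ln (real n - 1)) sequentially"
    using eventually_ge_at_top[of 3]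
  proof eventually_elim
    case (elim n)
    have l: "ln (real n - 1) > 0" using elim by simp
    show ?case
    proof (cases "n \<in> range exp_ceil")
      case True
      then obtain m where m: "n = exp_ceil m" by blast
      have "real n - 1 \<le> exp (real (Suc m))" using exp_ceil_bounds(2)[of m] m by linarith
      hence "ln (real n - 1) \<le> ln (exp (real (Suc m)))" using elim by (subst ln_le_cancel_iff) auto
      hence "ln (real n - 1) \<le> real (Suc m)" by (simp only: ln_exp)
      hence "1 / real (Suc m) \<le> 1 / ln (real n - 1)" using l by (intro divide_left_mono) auto
      thus ?thesis unfolding m exp_ceil_weight_exp_ceil by simp
    next
      case False
      thus ?thesis using l by (simp add: exp_ceil_weight_def)
    qed
  qed
qed

text \<open>
  Mertens' third theorem along a subsequence. Abelian information on the Euler product near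
  \<open>s = 1\<close> suffices for this: it prevents the difference of the two summatory functions from
  staying away from 0 on one side, and the jumps of that difference tend to 0.
\<close>
lemma mertens_subsequence:
  "\<exists>r :: nat \<Rightarrow> nat. filterlim r at_top sequentially \<and>
     (\<lambda>j. (\<Prod>p | prime p \<and> p \<le> r j. 1 - 1 / real p) * (exp euler_mascheroni * ln (real (r j)))) \<longlonglongrightarrow> 1"
proof -
  obtain A where A: "\<And>\<delta>. \<delta> > 0 \<Longrightarrow> (\<lambda>p. (if prime p then - ln (1 - 1 / real p) else 0) * real p powr (-\<delta>)) sums A \<delta>"
    "((\<lambda>\<delta>. A \<delta> - ln (1 / \<delta>)) \<longlongrightarrow> 0) (at_right 0)" by (rule prime_ln_weight_sums) blast
  obtain E where E: "\<And>\<delta>. \<delta> > 0 \<Longrightarrow> (\<lambda>n. exp_ceil_weight n * real n powr (-\<delta>)) sums E \<delta>"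
    "((\<lambda>\<delta>. E \<delta> - ln (1 / \<delta>)) \<longlongrightarrow> 0) (at_right 0)" by (rule exp_ceil_weight_sums) blast
  define a where "a p = (if prime p then - ln (1 - 1 / real p) else 0)" for p :: nat
  \<comment> \<open>Both Dirichlet series are \<open>ln (1 / \<delta>) + o(1)\<close>, so that of
    \<open>h\<close> tends to 0 as \<open>\<delta>\<close> decreases to 0.\<close>
  define h where "h n = a n - exp_ceil_weight n" for n
  have h0: "h 0 = 0"
  proof -
    have "exp_ceil m \<noteq> 0" for m using exp_ceil_bounds(1)[of m] exp_gt_zero[of "real (Suc m)"] by linarith
    hence "0 \<notin> range exp_ceil" by (metis rangeE)
    thus ?thesis by (simp add: h_def a_def exp_ceil_weight_def)
  qed
  have F: "(\<lambda>n. h n * real n powr (-\<delta>)) sums (A \<delta> - E \<delta>)" if "\<delta> > 0" for \<delta>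
    using sums_diff[OF A(1)[OF that] E(1)[OF that]] by (simp add: h_def a_def left_diff_distrib)
  have lim: "((\<lambda>\<delta>. A \<delta> - E \<delta>) \<longlongrightarrow> 0) (at_right 0)"
    using tendsto_diff[OF A(2) E(2)] by simp
  have a0: "a \<longlonglongrightarrow> 0"
  proof (rule Lim_null_comparison)
    show "(\<lambda>n. - ln (1 - 1 / real n)) \<longlonglongrightarrow> 0" by real_asymp
    show "eventually (\<lambda>n. norm (a n) \<le> - ln (1 - 1 / real n)) sequentially"
      using eventually_ge_at_top[of 2]
    proof eventually_elim
      case (elim n)
      have "ln (1 - 1 / real n) \<le> 0" using elim by (intro ln_le_zero_iff[THEN iffD2]) (auto simp: field_simps)
      thus ?case by (simp add: a_def)
    qed
  qed
  have "h \<longlonglongrightarrow> 0" using tendsto_diff[OF a0 exp_ceil_weight_tendsto_0] by (simp add: h_def [abs_def])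
  then obtain r where r: "filterlim r at_top sequentially" "(\<lambda>j. \<Sum>k\<le>r j. h k) \<longlonglongrightarrow> 0"
    using abelian_subsequence[OF h0 F lim] by blast
  define m where "m n = nat \<lfloor>ln (real n)\<rfloor>" for n :: nat
  have m: "filterlim m at_top sequentially"
    unfolding m_def by real_asymp
  \<comment> \<open>The source of the constant in Mertens' theorem: the partial sums of the
    comparison weights are harmonic numbers of index about \<open>ln n\<close>, hence
    \<open>ln (ln n) + \<gamma> + o(1)\<close>.\<close>
  have "(\<lambda>n. harm (m n) - ln (real (m n))) \<longlonglongrightarrow> euler_mascheroni"
    using filterlim_compose[OF euler_mascheroni_LIMSEQ m] by simp
  moreover have "(\<lambda>n. ln (real (m n)) - ln (ln (real n))) \<longlonglongrightarrow> 0"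
    unfolding m_def by real_asymp
  ultimately have "(\<lambda>n. (harm (m n) - ln (real (m n))) + (ln (real (m n)) - ln (ln (real n)))) \<longlonglongrightarrow> euler_mascheroni + 0"
    by (rule tendsto_add)
  hence "(\<lambda>n. harm (m n) - ln (ln (real n))) \<longlonglongrightarrow> euler_mascheroni" by simp
  from filterlim_compose[OF this r(1)]
  have "(\<lambda>j. harm (m (r j)) - ln (ln (real (r j)))) \<longlonglongrightarrow> euler_mascheroni" .
  from tendsto_add[OF r(2) this]
  have "(\<lambda>j. exp (euler_mascheroni - ((\<Sum>k\<le>r j. h k) + (harm (m (r j)) - ln (ln (real (r j))))))) \<longlonglongrightarrow> exp (euler_mascheroni - (0 + euler_mascheroni))"
    by (intro tendsto_exp tendsto_diff tendsto_const)
  hence l: "(\<lambda>j. exp (euler_mascheroni - ((\<Sum>k\<le>r j. h k) + (harm (m (r j)) - ln (ln (real (r j))))))) \<longlonglongrightarrow> 1" by simp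
  have "eventually (\<lambda>j. r j \<ge> 3) sequentially" using r(1) by (simp add: filterlim_at_top)
  hence ev: "eventually (\<lambda>j. exp (euler_mascheroni - ((\<Sum>k\<le>r j. h k) + (harm (m (r j)) - ln (ln (real (r j)))))) =
      (\<Prod>p | prime p \<and> p \<le> r j. 1 - 1 / real p) * (exp euler_mascheroni * ln (real (r j)))) sequentially"
  proof eventually_elim
    case (elim j)
    define n where "n = r j"
    have n: "n \<ge> 3" using elim by (simp add: n_def)
    have lnn: "ln (real n) > 0" using n by simp
    have "(\<Sum>k\<le>n. h k) = (\<Sum>k\<le>n. a k) - harm (m n)"
      unfolding h_def sum_subtractf m_def using n by (simp add: sum_exp_ceil_weight)
    hence "exp (euler_mascheroni - ((\<Sum>k\<le>n. h k) + (harm (m n) - ln (ln (real n))))) = exp (euler_mascheroni + ln (ln (real n)) + - (\<Sum>k\<le>n. a k))"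
      by (simp add: algebra_simps)
    also have "\<dots> = exp euler_mascheroni * ln (real n) * exp (\<Sum>k\<le>n. - a k)"
      using lnn by (simp only: exp_add sum_negf exp_ln)
    also have "exp (\<Sum>k\<le>n. - a k) = (\<Prod>k\<le>n. exp (- a k))" by (rule exp_sum) simp
    also have "\<dots> = (\<Prod>k\<le>n. if prime k then 1 - 1 / real k else 1)"
    proof (intro prod.cong refl)
      fix k
      show "exp (- a k) = (if prime k then 1 - 1 / real k else 1)"
        using prime_gt_1_nat[of k] by (auto simp: a_def)
    qed
    also have "\<dots> = (\<Prod>p\<in>{p\<in>{..n}. prime p}. 1 - 1 / real p)" by (rule prod.inter_filter[symmetric]) simp
    also have "{p\<in>{..n}. prime p} = {p. prime p \<and> p \<le> n}" by auto
    finally show ?case unfolding n_def by (simp add: mult_ac)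
  qed
  have "(\<lambda>j. (\<Prod>p | prime p \<and> p \<le> r j. 1 - 1 / real p) * (exp euler_mascheroni * ln (real (r j)))) \<longlonglongrightarrow> 1"
    by (rule Lim_transform_eventually[OF l ev])
  thus ?thesis using r(1) by blast
qed

section \<open>The local factors of \<open>P\<^sub>X\<close>\<close>

definition binom_coeff :: "nat \<Rightarrow> nat \<Rightarrow> real" where
  "binom_coeff k m = real ((m + k - 1) choose m)"

text \<open>Coefficients \<open>c m\<close> of \<open>exp (k * (\<Sum>j=1..J. z ^ j / j))\<close>.
  The recursion compares coefficients in the equation that the derivative is
  \<open>k * (\<Sum>i<J. z ^ i)\<close> times the function. Without truncation the function is
  \<open>(1 - z)\<close> to the power \<open>- k\<close>, with coefficients
  \<open>binom_coeff k m\<close>.\<close>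

fun trunc_coeff :: "nat \<Rightarrow> nat \<Rightarrow> nat \<Rightarrow> real" where
  "trunc_coeff k J 0 = 1"
| "trunc_coeff k J (Suc m) = real k / real (Suc m) * (\<Sum>i\<le>m. if i < J then trunc_coeff k J (m - i) else 0)"

lemma binom_coeff_0: "binom_coeff k 0 = 1"
  by (simp add: binom_coeff_def)

lemma binom_coeff_nonneg: "binom_coeff k m \<ge> 0"
  by (simp add: binom_coeff_def)

lemma Suc_times_binomial_Suc: "Suc m * (n choose Suc m) = (n - m) * (n choose m)"
proof (cases "m \<le> n")
  case True
  thus ?thesis using binomial_absorption[of m n] binomial_absorb_comp[of n m] by simp
qed (simp add: binomial_eq_0)

text \<open>The first form serves the ratio test. The second is the recursion of
  \<open>trunc_coeff\<close> without truncation; it is the hockey stick identity.\<close>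

lemma binom_coeff_Suc:
  assumes "k \<ge> 1"
  shows "binom_coeff k (Suc m) = (real m + real k) / real (Suc m) * binom_coeff k m"
    and "binom_coeff k (Suc m) = real k / real (Suc m) * (\<Sum>i\<le>m. binom_coeff k (m - i))"
proof -
  have sum: "(\<Sum>i\<le>m. binom_coeff k i) = real ((m + k) choose m)"
  proof -
    have "(\<Sum>i\<le>m. binom_coeff k i) = real (\<Sum>i\<le>m. ((k - 1) + i) choose i)"
      using assms by (simp add: binom_coeff_def add_ac)
    also have "(\<Sum>i\<le>m. ((k - 1) + i) choose i) = Suc ((k - 1) + m) choose m" by (rule sum_choose_lower)
    finally show ?thesis using assms by (simp add: add_ac)
  qed
  have "Suc m * ((m + k) choose Suc m) = k * ((m + k) choose m)"
    using Suc_times_binomial_Suc[of m "m + k"] by simp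
  hence "real (Suc m) * binom_coeff k (Suc m) = real k * real ((m + k) choose m)"
  proof -
    assume "Suc m * ((m + k) choose Suc m) = k * ((m + k) choose m)"
    hence "real (Suc m * ((m + k) choose Suc m)) = real (k * ((m + k) choose m))" by (simp only:)
    thus ?thesis by (simp only: of_nat_mult binom_coeff_def) simp
  qed
  hence 1: "binom_coeff k (Suc m) = real k / real (Suc m) * real ((m + k) choose m)"
    by (simp add: field_simps)
  have "(\<Sum>i\<le>m. binom_coeff k (m - i)) = (\<Sum>i\<le>m. binom_coeff k i)"
    by (rule sum.reindex_bij_witness[of _ "\<lambda>i. m - i" "\<lambda>i. m - i"]) auto
  thus "binom_coeff k (Suc m) = real k / real (Suc m) * (\<Sum>i\<le>m. binom_coeff k (m - i))"
    using 1 sum by simp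
  have "(m + k - m) * ((m + k) choose m) = (m + k) * ((m + k - 1) choose m)"
    by (rule binomial_absorb_comp)
  hence "real k * real ((m + k) choose m) = (real m + real k) * binom_coeff k m"
    unfolding binom_coeff_def by (simp flip: of_nat_mult of_nat_add)
  thus "binom_coeff k (Suc m) = (real m + real k) / real (Suc m) * binom_coeff k m"
    unfolding 1 by (simp add: field_simps)
qed

text \<open>Truncation only deletes nonnegative terms from the recursion satisfied by
  \<open>binom_coeff\<close>.\<close>

lemma trunc_coeff_bounds:
  assumes "k \<ge> 1"
  shows "0 \<le> trunc_coeff k J m \<and> trunc_coeff k J m \<le> binom_coeff k m"
proof (induction m rule: less_induct)
  case (less m)
  show ?case
  proof (cases m)
    case 0
    thus ?thesis by (simp add: binom_coeff_0)
  next
    case (Suc n)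
    have "0 \<le> (if i < J then trunc_coeff k J (n - i) else 0)" for i
      using less[of "n - i"] Suc by auto
    moreover have "(if i < J then trunc_coeff k J (n - i) else 0) \<le> binom_coeff k (n - i)" for i
      using less[of "n - i"] Suc by (auto simp: binom_coeff_nonneg)
    ultimately show ?thesis
      unfolding Suc trunc_coeff.simps binom_coeff_Suc(2)[OF assms]
      by (intro conjI mult_nonneg_nonneg mult_left_mono sum_nonneg sum_mono divide_nonneg_nonneg) auto
  qed
qed

text \<open>In the recursion for index \<open>m\<close> the condition \<open>i < J\<close> deletes
  nothing as long as \<open>m \<le> J\<close>.\<close>

lemma trunc_coeff_eq:
  assumes "k \<ge> 1" "m \<le> J"
  shows "trunc_coeff k J m = binom_coeff k m"
  using assms(2)
proof (induction m rule: less_induct)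
  case (less m)
  show ?case
  proof (cases m)
    case 0
    thus ?thesis by (simp add: binom_coeff_0)
  next
    case (Suc n)
    have "(\<Sum>i\<le>n. if i < J then trunc_coeff k J (n - i) else 0) = (\<Sum>i\<le>n. binom_coeff k (n - i))"
      using less Suc by (intro sum.cong refl) auto
    thus ?thesis unfolding Suc trunc_coeff.simps binom_coeff_Suc(2)[OF assms(1)] by simp
  qed
qed

lemma summable_binom_coeff_power:
  assumes k: "k \<ge> 1" and r: "0 < r" "r < 1"
  shows "summable (\<lambda>m. binom_coeff k m ^ e * r ^ m)"
proof -
  have "(\<lambda>m. (real m + real k) / real (Suc m)) \<longlonglongrightarrow> 1" by real_asymp
  hence "(\<lambda>m. ((real m + real k) / real (Suc m)) ^ e * r) \<longlonglongrightarrow> 1 ^ e * r"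
    by (intro tendsto_intros)
  hence "eventually (\<lambda>m. ((real m + real k) / real (Suc m)) ^ e * r < (1 + r) / 2) sequentially"
    using r by (intro order_tendstoD(2)) auto
  then obtain N where N: "\<And>m. m \<ge> N \<Longrightarrow> ((real m + real k) / real (Suc m)) ^ e * r < (1 + r) / 2"
    by (auto simp: eventually_sequentially)
  show ?thesis
  proof (rule summable_ratio_test[of "(1 + r) / 2" N])
    fix m assume m: "m \<ge> N"
    have "norm (binom_coeff k (Suc m) ^ e * r ^ Suc m) = ((real m + real k) / real (Suc m)) ^ e * r * norm (binom_coeff k m ^ e * r ^ m)"
      unfolding binom_coeff_Suc(1)[OF k] using r by (simp add: power_mult_distrib power_divide binom_coeff_nonneg mult_ac)
    also have "\<dots> \<le> (1 + r) / 2 * norm (binom_coeff k m ^ e * r ^ m)"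
      using N[OF m] by (intro mult_right_mono) auto
    finally show "norm (binom_coeff k (Suc m) ^ e * r ^ Suc m) \<le> (1 + r) / 2 * norm (binom_coeff k m ^ e * r ^ m)" .
  qed (use r in auto)
qed

lemma summable_trunc_coeff_norm:
  assumes k: "k \<ge> 1" and z: "norm (z :: complex) < 1"
  shows "summable (\<lambda>m. norm (of_real (trunc_coeff k J m) * z ^ m))"
proof -
  \<comment> \<open>A radius between \<open>norm z\<close> and 1 instead of \<open>norm z\<close>
    itself, since it has to be positive even for \<open>z = 0\<close>.\<close>
  define r where "r = (1 + norm z) / 2"
  have r: "0 < r" "r < 1" "norm z \<le> r" using z unfolding r_def by (auto simp: add_pos_nonneg)
  show ?thesis
  proof (rule summable_comparison_test)
    have "norm (norm (of_real (trunc_coeff k J m) * z ^ m)) \<le> binom_coeff k m ^ 1 * r ^ m" for m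
      using trunc_coeff_bounds[OF k, of J m] r
      by (simp add: norm_mult norm_power) (intro mult_mono power_mono, auto)
    thus "\<exists>N. \<forall>m\<ge>N. norm (norm (of_real (trunc_coeff k J m) * z ^ m)) \<le> binom_coeff k m ^ 1 * r ^ m" by blast
    show "summable (\<lambda>m. binom_coeff k m ^ 1 * r ^ m)"
      by (rule summable_binom_coeff_power[OF k r(1,2)])
  qed
qed

text \<open>Both sides solve the same first order linear differential equation.\<close>
lemma trunc_coeff_sums:
  assumes k: "k \<ge> 1" and z: "norm (z :: complex) < 1"
  shows "(\<lambda>m. of_real (trunc_coeff k J m) * z ^ m) sums exp (of_nat k * (\<Sum>j=1..J. z ^ j / of_nat j))"
proof -
  define c where "c m = complex_of_real (trunc_coeff k J m)" for m
  define B where "B z = (\<Sum>m. c m * z ^ m)" for z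
  define P where "P z = of_nat k * (\<Sum>j=1..J. z ^ j / of_nat j)" for z :: complex
  have summ: "summable (\<lambda>m. norm (c m * z ^ m))" if "norm z < 1" for z
    unfolding c_def by (rule summable_trunc_coeff_norm[OF k that])
  have dB: "(B has_field_derivative (of_nat k * (\<Sum>i<J. z ^ i) * B z)) (at z)" if z: "norm z < 1" for z
  proof -
    have "(B has_field_derivative (\<Sum>m. diffs c m * z ^ m)) (at z)"
      unfolding B_def by (rule termdiffs_strong'[where K = 1]) (use z summable_norm_cancel[OF summ] in auto)
    also have "(\<Sum>m. diffs c m * z ^ m) = of_nat k * (\<Sum>i<J. z ^ i) * B z"
    proof -
      define e where "e i = (if i < J then z ^ i else 0)" for i
      have e: "e sums (\<Sum>i<J. z ^ i)"
      proof -
        have "e sums (\<Sum>i<J. e i)" by (rule sums_finite) (auto simp: e_def)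
        thus ?thesis by (simp add: e_def)
      qed
      have esumm: "summable (\<lambda>i. norm (e i))"
        by (rule summable_finite[of "{..<J}"]) (auto simp: e_def)
      \<comment> \<open>Up to the factor \<open>k\<close>, the terms of this Cauchy product are the
        right side of the recursion for \<open>Suc m * c (Suc m)\<close>.\<close>
      have "(\<lambda>m. \<Sum>i\<le>m. e i * (c (m - i) * z ^ (m - i))) sums ((\<Sum>i. e i) * (\<Sum>m. c m * z ^ m))"
        by (rule Cauchy_product_sums[OF esumm summ[OF z]])
      hence "(\<lambda>m. of_nat k * (\<Sum>i\<le>m. e i * (c (m - i) * z ^ (m - i)))) sums (of_nat k * ((\<Sum>i<J. z ^ i) * B z))"
        using sums_unique[OF e] unfolding B_def by (intro sums_mult) simp
      moreover have "of_nat k * (\<Sum>i\<le>m. e i * (c (m - i) * z ^ (m - i))) = diffs c m * z ^ m" for m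
      proof -
        have "(\<Sum>i\<le>m. e i * (c (m - i) * z ^ (m - i))) = (\<Sum>i\<le>m. if i < J then c (m - i) else 0) * z ^ m"
          unfolding sum_distrib_right
        proof (intro sum.cong refl)
          fix i assume "i \<in> {..m}"
          hence "z ^ m = z ^ i * z ^ (m - i)" by (simp flip: power_add)
          thus "e i * (c (m - i) * z ^ (m - i)) = (if i < J then c (m - i) else 0) * z ^ m"
            by (simp add: e_def)
        qed
        moreover have "diffs c m = of_nat k * (\<Sum>i\<le>m. if i < J then c (m - i) else 0)"
        proof -
          have "real (Suc m) * trunc_coeff k J (Suc m) = real k * (\<Sum>i\<le>m. if i < J then trunc_coeff k J (m - i) else 0)"
            by simp
          hence "complex_of_real (real (Suc m) * trunc_coeff k J (Suc m)) = complex_of_real (real k * (\<Sum>i\<le>m. if i < J then trunc_coeff k J (m - i) else 0))"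
            by (simp only:)
          moreover have "complex_of_real (\<Sum>i\<le>m. if i < J then trunc_coeff k J (m - i) else 0) = (\<Sum>i\<le>m. if i < J then c (m - i) else 0)"
            unfolding of_real_sum c_def by (intro sum.cong refl) auto
          ultimately show ?thesis unfolding diffs_def c_def by (simp only: of_real_mult of_real_of_nat_eq)
        qed
        ultimately show ?thesis by (simp add: mult_ac)
      qed
      ultimately show ?thesis by (simp add: sums_iff mult_ac)
    qed
    finally show ?thesis .
  qed
  have dP: "(P has_field_derivative (of_nat k * (\<Sum>i<J. z ^ i))) (at z)" for z
  proof -
    have "((\<lambda>z. z ^ j / of_nat j) has_field_derivative z ^ (j - 1)) (at z)" if "j \<in> {1..J}" for j
      using that by (auto intro!: derivative_eq_intros)
    hence "(P has_field_derivative (of_nat k * (\<Sum>j=1..J. z ^ (j - 1)))) (at z)"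
      unfolding P_def by (intro DERIV_cmult DERIV_sum)
    also have "(\<Sum>j=1..J. z ^ (j - 1)) = (\<Sum>i<J. z ^ i)"
      by (rule sum.reindex_bij_witness[of _ Suc "\<lambda>j. j - 1"]) auto
    finally show ?thesis .
  qed
  have "((\<lambda>z. B z * exp (- P z)) has_field_derivative 0) (at z within ball 0 1)" if "z \<in> ball 0 1" for z
  proof -
    have "((\<lambda>z. B z * exp (- P z)) has_field_derivative
       (B z * (exp (- P z) * - (of_nat k * (\<Sum>i<J. z ^ i))) + (of_nat k * (\<Sum>i<J. z ^ i) * B z) * exp (- P z))) (at z)"
      using that by (intro DERIV_mult' dB DERIV_fun_exp DERIV_minus dP) auto
    moreover have "B z * (exp (- P z) * - (of_nat k * (\<Sum>i<J. z ^ i))) + (of_nat k * (\<Sum>i<J. z ^ i) * B z) * exp (- P z) = 0"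
      by (simp add: algebra_simps)
    ultimately show ?thesis using has_field_derivative_at_within by metis
  qed
  then obtain C where C: "\<And>z. z \<in> ball 0 1 \<Longrightarrow> B z * exp (- P z) = C"
    using has_field_derivative_zero_constant[of "ball 0 1" "\<lambda>z. B z * exp (- P z)"] by auto
  have "B 0 = 1"
    unfolding B_def using powser_zero[of c] by (simp add: c_def)
  moreover have "P 0 = 0" unfolding P_def by (auto intro!: sum.neutral)
  ultimately have "C = 1" using C[of 0] by simp
  hence "B z * exp (- P z) = 1" using C[of z] z by simp
  hence "B z = exp (P z)" by (simp add: exp_minus field_simps)
  moreover have "(\<lambda>m. c m * z ^ m) sums B z"
    unfolding B_def by (rule summable_sums[OF summable_norm_cancel[OF summ[OF z]]])
  ultimately show ?thesis by (simp add: c_def P_def)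
qed

section \<open>Local mean values\<close>

definition local_mean :: "nat \<Rightarrow> nat \<Rightarrow> nat \<Rightarrow> real" where
  "local_mean k J p = (\<Sum>m. (trunc_coeff k J m)\<^sup>2 / real p ^ m)"

definition local_series :: "nat \<Rightarrow> nat \<Rightarrow> real" where
  "local_series k p = (\<Sum>m. (binom_coeff k m)\<^sup>2 / real p ^ m)"

text \<open>Bounds \<open>p\<^sup>2\<close> times the part of a local mean from \<open>m = 2\<close>
  on, independently of \<open>p\<close> and of the truncation: \<open>p ^ (m + 2)\<close> is at
  least \<open>p\<^sup>2 * 2 ^ m\<close>.\<close>

definition local_bound :: "nat \<Rightarrow> real" where
  "local_bound k = (\<Sum>m. (binom_coeff k (m + 2))\<^sup>2 / 2 ^ m)"

lemma summable_binom_coeff_square: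
  assumes "k \<ge> 1" "p \<ge> 2"
  shows "summable (\<lambda>m. (binom_coeff k m)\<^sup>2 / real p ^ m)"
  using summable_binom_coeff_power[OF assms(1), of "1 / real p" 2] assms by (simp add: power_one_over field_simps)

lemma summable_trunc_coeff_square:
  assumes "k \<ge> 1" "p \<ge> 2"
  shows "summable (\<lambda>m. (trunc_coeff k J m)\<^sup>2 / real p ^ m)"
proof (rule summable_comparison_test[OF _ summable_binom_coeff_square[OF assms]])
  show "\<exists>N. \<forall>m\<ge>N. norm ((trunc_coeff k J m)\<^sup>2 / real p ^ m) \<le> (binom_coeff k m)\<^sup>2 / real p ^ m"
    using trunc_coeff_bounds[OF assms(1)] by (auto intro!: divide_right_mono power_mono)
qed

lemma summable_local_bound:
  assumes "k \<ge> 1"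
  shows "summable (\<lambda>m. (binom_coeff k (m + 2))\<^sup>2 / 2 ^ m)"
proof -
  have "summable (\<lambda>m. (binom_coeff k m)\<^sup>2 / 2 ^ m)" using summable_binom_coeff_square[OF assms, of 2] by simp
  hence "summable (\<lambda>m. (binom_coeff k (m + 2))\<^sup>2 / 2 ^ (m + 2))" by (subst summable_iff_shift)
  hence "summable (\<lambda>m. 4 * ((binom_coeff k (m + 2))\<^sup>2 / 2 ^ (m + 2)))" by (rule summable_mult)
  thus ?thesis by (simp add: power_add)
qed

text \<open>As soon as \<open>J \<ge> 1\<close> the first two coefficients are 1 and
  \<open>k\<close>; the remaining terms are nonnegative and \<open>O(1 / p\<^sup>2)\<close>,
  uniformly in \<open>J\<close>.\<close>

lemma local_mean_bounds:
  assumes k: "k \<ge> 1" and p: "p \<ge> 2" and J: "J \<ge> 1"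
  shows "1 \<le> local_mean k J p" "\<bar>local_mean k J p - (1 + (real k)\<^sup>2 / real p)\<bar> \<le> local_bound k / (real p)\<^sup>2"
proof -
  define f where "f m = (trunc_coeff k J m)\<^sup>2 / real p ^ m" for m
  have summ: "summable f" unfolding f_def by (rule summable_trunc_coeff_square[OF k p])
  have f0: "f 0 = 1" by (simp add: f_def)
  have f1: "f 1 = (real k)\<^sup>2 / real p" using J by (simp add: f_def)
  have fn: "f m \<ge> 0" for m by (simp add: f_def)
  have "local_mean k J p = (\<Sum>m. f (m + 2)) + (\<Sum>m<2. f m)"
    unfolding local_mean_def f_def[symmetric] by (rule suminf_split_initial_segment[OF summ])
  hence eq: "local_mean k J p - (1 + (real k)\<^sup>2 / real p) = (\<Sum>m. f (m + 2))"
    using f0 f1 by (simp add: numeral_2_eq_2)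
  have summ2: "summable (\<lambda>m. f (m + 2))" using summ by (subst summable_iff_shift)
  have nn: "(\<Sum>m. f (m + 2)) \<ge> 0" by (rule suminf_nonneg[OF summ2]) (rule fn)
  have "(\<Sum>m. f (m + 2)) \<le> (\<Sum>m. 1 / (real p)\<^sup>2 * ((binom_coeff k (m + 2))\<^sup>2 / 2 ^ m))"
  proof (rule suminf_le[OF _ summ2])
    show "summable (\<lambda>m. 1 / (real p)\<^sup>2 * ((binom_coeff k (m + 2))\<^sup>2 / 2 ^ m))"
      by (rule summable_mult[OF summable_local_bound[OF k]])
    fix m
    have "f (m + 2) = 1 / (real p)\<^sup>2 * ((trunc_coeff k J (m + 2))\<^sup>2 / real p ^ m)"
      by (simp add: f_def power_add power2_eq_square)
    also have "\<dots> \<le> 1 / (real p)\<^sup>2 * ((binom_coeff k (m + 2))\<^sup>2 / 2 ^ m)"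
      using trunc_coeff_bounds[OF k, of J "m + 2"] p by (intro mult_left_mono frac_le power_mono) auto
    finally show "f (m + 2) \<le> 1 / (real p)\<^sup>2 * ((binom_coeff k (m + 2))\<^sup>2 / 2 ^ m)" .
  qed
  also have "\<dots> = local_bound k / (real p)\<^sup>2"
    unfolding local_bound_def by (subst suminf_mult[OF summable_local_bound[OF k]]) simp
  finally show "\<bar>local_mean k J p - (1 + (real k)\<^sup>2 / real p)\<bar> \<le> local_bound k / (real p)\<^sup>2"
    unfolding eq using nn by simp
  have "(real k)\<^sup>2 / real p \<ge> 0" by simp
  thus "1 \<le> local_mean k J p" using eq nn by linarith
qed

text \<open>Each coefficient eventually has its untruncated value, and the untruncated series
  dominates all the others: Tannery's theorem.\<close>

lemma local_mean_tendsto: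
  assumes k: "k \<ge> 1" and p: "p \<ge> 2" and J: "filterlim J at_top F" and F: "F \<noteq> bot"
  shows "((\<lambda>N. local_mean k (J N) p) \<longlongrightarrow> local_series k p) F"
proof -
  have lim: "((\<lambda>N. (trunc_coeff k (J N) m)\<^sup>2 / real p ^ m) \<longlongrightarrow> (binom_coeff k m)\<^sup>2 / real p ^ m) F" for m
  proof -
    have "eventually (\<lambda>N. m \<le> J N) F" using J by (simp add: filterlim_at_top)
    hence "eventually (\<lambda>N. (trunc_coeff k (J N) m)\<^sup>2 / real p ^ m = (binom_coeff k m)\<^sup>2 / real p ^ m) F"
      by eventually_elim (simp add: trunc_coeff_eq[OF k])
    thus ?thesis by (rule tendsto_eventually)
  qed
  have ev: "eventually (\<lambda>(m, N). norm ((trunc_coeff k (J N) m)\<^sup>2 / real p ^ m) \<le> (binom_coeff k m)\<^sup>2 / real p ^ m) (at_top \<times>\<^sub>F F)"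
    using trunc_coeff_bounds[OF k] by (intro always_eventually) (auto intro!: divide_right_mono power_mono)
  show ?thesis
    unfolding local_mean_def local_series_def
    using tannerys_theorem[OF lim ev summable_binom_coeff_square[OF k p] F] by blast
qed

section \<open>Factorisation of P_X over the primes\<close>

definition prime_exp :: "nat \<Rightarrow> nat \<Rightarrow> nat" where
  "prime_exp p N = nat \<lfloor>log (real p) (real N)\<rfloor>"

lemma power_le_iff_prime_exp:
  assumes "p \<ge> 2" "N \<ge> 1"
  shows "p ^ j \<le> N \<longleftrightarrow> j \<le> prime_exp p N"
proof -
  have "p ^ j \<le> N \<longleftrightarrow> real p powr real j \<le> real N"
    using assms by (simp add: powr_realpow flip: of_nat_power)
  also have "\<dots> \<longleftrightarrow> real j \<le> log (real p) (real N)"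
    using assms by (subst le_log_iff) auto
  also have "\<dots> \<longleftrightarrow> j \<le> prime_exp p N"
  proof -
    have "log (real p) (real N) \<ge> 0" using assms by simp
    thus ?thesis unfolding prime_exp_def by linarith
  qed
  finally show ?thesis .
qed

lemma filterlim_prime_exp:
  assumes "p \<ge> 2"
  shows "filterlim (prime_exp p) at_top sequentially"
  unfolding filterlim_at_top
proof
  fix j
  show "eventually (\<lambda>N. j \<le> prime_exp p N) sequentially"
    using eventually_ge_at_top[of "p ^ j"] eventually_ge_at_top[of 1]
    by eventually_elim (use power_le_iff_prime_exp[OF assms] in blast)
qed

lemma sum_mangoldt:
  fixes g :: "nat \<Rightarrow> complex"
  assumes "N \<ge> 1"
  shows "(\<Sum>n\<in>{n. 1 \<le> n \<and> n \<le> N}. g n * mangoldt n) =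
     (\<Sum>p | prime p \<and> p \<le> N. \<Sum>j=1..prime_exp p N. g (p ^ j) * of_real (ln (real p)))"
proof -
  have fin: "finite {p. prime p \<and> p \<le> N}" by (rule finite_subset[of _ "{..N}"]) auto
  have "(\<Sum>n\<in>{n. 1 \<le> n \<and> n \<le> N}. g n * mangoldt n) = (\<Sum>n\<in>{n. primepow n \<and> n \<le> N}. g n * mangoldt n)"
  proof (rule sum.mono_neutral_right)
    show "finite {n. 1 \<le> n \<and> n \<le> N}" by (rule finite_subset[of _ "{..N}"]) auto
    show "{n. primepow n \<and> n \<le> N} \<subseteq> {n. 1 \<le> n \<and> n \<le> N}"
      using primepow_gt_0_nat by (auto simp: Suc_le_eq)
  qed (auto simp: mangoldt_def)
  also have "\<dots> = (\<Sum>(p, j)\<in>(SIGMA p:{p. prime p \<and> p \<le> N}. {1..prime_exp p N}). g (p ^ j) * of_real (ln (real p)))"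
  proof (rule sum.reindex_bij_witness[of _ "\<lambda>(p, j). p ^ j" "\<lambda>n. (aprimedivisor n, multiplicity (aprimedivisor n) n)"])
    fix n assume n: "n \<in> {n. primepow n \<and> n \<le> N}"
    then obtain p j where pj: "prime p" "j > 0" "n = p ^ j" by (auto simp: primepow_def)
    have ap: "aprimedivisor n = p" using pj by (simp add: aprimedivisor_prime_power)
    have mu: "multiplicity p n = j" using pj by simp
    have "j \<le> prime_exp p N" using power_le_iff_prime_exp[of p N j] assms n pj prime_ge_2_nat by auto
    moreover have "p \<le> N" using self_le_power[of p j] pj n prime_gt_0_nat[of p] by auto
    ultimately show "(aprimedivisor n, multiplicity (aprimedivisor n) n) \<in> (SIGMA p:{p. prime p \<and> p \<le> N}. {1..prime_exp p N})"
      unfolding ap mu using pj(1,2) by (simp add: Suc_le_eq)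
    show "(case (aprimedivisor n, multiplicity (aprimedivisor n) n) of (p, j) \<Rightarrow> p ^ j) = n"
      unfolding ap mu using pj(3) by simp
    show "(case (aprimedivisor n, multiplicity (aprimedivisor n) n) of (p, j) \<Rightarrow> g (p ^ j) * of_real (ln (real p))) = g n * mangoldt n"
      unfolding ap mu using pj by simp
  next
    fix b assume "b \<in> (SIGMA p:{p. prime p \<and> p \<le> N}. {1..prime_exp p N})"
    then obtain p j where b: "b = (p, j)" "prime p" "p \<le> N" "1 \<le> j" "j \<le> prime_exp p N" by auto
    have "p ^ j \<le> N" using power_le_iff_prime_exp[of p N j] assms b prime_ge_2_nat by auto
    thus "(case b of (p, j) \<Rightarrow> p ^ j) \<in> {n. primepow n \<and> n \<le> N}"
      using b by (auto simp: primepow_def Suc_le_eq)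
    show "(aprimedivisor (case b of (p, j) \<Rightarrow> p ^ j), multiplicity (aprimedivisor (case b of (p, j) \<Rightarrow> p ^ j)) (case b of (p, j) \<Rightarrow> p ^ j)) = b"
      using b by (simp add: aprimedivisor_prime_power)
  qed
  also have "\<dots> = (\<Sum>p | prime p \<and> p \<le> N. \<Sum>j=1..prime_exp p N. g (p ^ j) * of_real (ln (real p)))"
    using fin by (subst sum.Sigma) auto
  finally show ?thesis .
qed

definition trunc_log_exp :: "nat \<Rightarrow> complex \<Rightarrow> complex" where
  "trunc_log_exp J z = exp (\<Sum>j=1..J. z ^ j / of_nat j)"

definition local_arg :: "nat \<Rightarrow> (nat \<Rightarrow> complex) \<Rightarrow> complex \<Rightarrow> nat \<Rightarrow> complex" where
  "local_arg q chi s p = prim_char q chi p * of_nat p powr (-s)"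

text \<open>The sum over prime powers splits by primes. \<open>N \<ge> q\<close> puts all prime
  divisors of \<open>q\<close> below the cutoff, so that each factor \<open>1 - z\<close> of
  \<open>P_fun\<close> meets the exponential that it nearly cancels.\<close>

lemma P_fun_eq:
  assumes chi: "chi \<in> dchars q" and q: "q > 0" and N: "N \<ge> 1" "N \<ge> q"
  shows "P_fun q (real N) chi s =
    (\<Prod>p | prime p \<and> p dvd q. (1 - local_arg q chi s p) * trunc_log_exp (prime_exp p N) (local_arg q chi s p)) *
    (\<Prod>p | prime p \<and> p \<le> N \<and> \<not> p dvd q. trunc_log_exp (prime_exp p N) (local_arg q chi s p))"
proof -
  define z where "z = local_arg q chi s"
  have fin: "finite {p. prime p \<and> p dvd q}" "finite {p. prime p \<and> p \<le> N \<and> \<not> p dvd q}" "finite {p. prime p \<and> p \<le> N}"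
  proof -
    show "finite {p. prime p \<and> p \<le> N}" "finite {p. prime p \<and> p \<le> N \<and> \<not> p dvd q}"
      by (rule finite_subset[of _ "{..N}"]; auto)+
    have "finite {p. p dvd q}" using q by simp
    thus "finite {p. prime p \<and> p dvd q}" by (rule rev_finite_subset) auto
  qed
  have "(\<Sum>n\<in>{n. 1 \<le> n \<and> real n \<le> real N}. prim_char q chi n * mangoldt n / (of_nat n powr s * of_real (ln (real n)))) =
        (\<Sum>n\<in>{n. 1 \<le> n \<and> n \<le> N}. (prim_char q chi n / (of_nat n powr s * of_real (ln (real n)))) * mangoldt n)"
    by simp
  also have "\<dots> = (\<Sum>p | prime p \<and> p \<le> N. \<Sum>j=1..prime_exp p N. prim_char q chi (p ^ j) / (of_nat (p ^ j) powr s * of_real (ln (real (p ^ j)))) * of_real (ln (real p)))"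
    by (rule sum_mangoldt[OF N(1)])
  also have "\<dots> = (\<Sum>p | prime p \<and> p \<le> N. \<Sum>j=1..prime_exp p N. z p ^ j / of_nat j)"
  proof (intro sum.cong refl)
    fix p j assume pj: "p \<in> {p. prime p \<and> p \<le> N}" "j \<in> {1..prime_exp p N}"
    hence p: "real p > 1" using prime_gt_1_nat[of p] by simp
    have lp: "complex_of_real (ln (real p)) \<noteq> 0" using p by simp
    have "of_nat (p ^ j) powr s = (of_nat p powr s :: complex) ^ j"
    proof -
      have "of_nat (p ^ j) powr s = exp (s * of_real (ln (real (p ^ j))))"
        using p by (simp add: powr_def Ln_of_nat del: of_nat_power)
      also have "ln (real (p ^ j)) = real j * ln (real p)" using p by (simp add: ln_realpow)
      also have "exp (s * of_real (real j * ln (real p))) = exp (s * of_real (ln (real p))) ^ j"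
        by (simp add: exp_of_nat_mult[symmetric] mult_ac)
      also have "exp (s * of_real (ln (real p))) = of_nat p powr s" using p by (simp add: powr_def Ln_of_nat)
      finally show ?thesis .
    qed
    moreover have "ln (real (p ^ j)) = real j * ln (real p)" using p by (simp add: ln_realpow)
    moreover have "prim_char q chi (p ^ j) = prim_char q chi p ^ j" by (rule prim_char_power_and_norm(1)[OF chi q])
    moreover have "z p ^ j = prim_char q chi p ^ j / (of_nat p powr s) ^ j"
      by (simp add: z_def local_arg_def powr_minus power_mult_distrib power_inverse field_simps)
    ultimately show "prim_char q chi (p ^ j) / (of_nat (p ^ j) powr s * of_real (ln (real (p ^ j)))) * of_real (ln (real p)) = z p ^ j / of_nat j"
      using lp by simp
  qed
  finally have "exp (\<Sum>n\<in>{n. 1 \<le> n \<and> real n \<le> real N}. prim_char q chi n * mangoldt n / (of_nat n powr s * of_real (ln (real n)))) =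
     (\<Prod>p | prime p \<and> p \<le> N. trunc_log_exp (prime_exp p N) (z p))"
    unfolding trunc_log_exp_def using fin(3) by (simp add: exp_sum)
  also have "{p. prime p \<and> p \<le> N} = {p. prime p \<and> p dvd q} \<union> {p. prime p \<and> p \<le> N \<and> \<not> p dvd q}"
    using N(2) dvd_imp_le[OF _ q] le_trans by blast
  also have "(\<Prod>p\<in>\<dots>. trunc_log_exp (prime_exp p N) (z p)) =
    (\<Prod>p | prime p \<and> p dvd q. trunc_log_exp (prime_exp p N) (z p)) * (\<Prod>p | prime p \<and> p \<le> N \<and> \<not> p dvd q. trunc_log_exp (prime_exp p N) (z p))"
    using fin(1,2) by (intro prod.union_disjoint) auto
  finally show ?thesis
    unfolding P_fun_def z_def local_arg_def[symmetric] by (simp add: prod.distrib mult_ac)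
qed

text \<open>The product is \<open>exp (- tail)\<close>, where \<open>tail\<close> is the series of
  \<open>- ln (1 - z)\<close> beyond \<open>J\<close>, dominated by a geometric series in
  \<open>\<rho>\<close>.\<close>

lemma trunc_log_exp_bounds:
  assumes z: "norm z \<le> \<rho>" and \<rho>: "\<rho> < 1"
  shows "exp (- (\<rho> ^ Suc J / (1 - \<rho>))) \<le> norm ((1 - z) * trunc_log_exp J z)"
    "norm ((1 - z) * trunc_log_exp J z) \<le> exp (\<rho> ^ Suc J / (1 - \<rho>))"
proof -
  have \<rho>0: "\<rho> \<ge> 0" using z norm_ge_zero[of z] by linarith
  have z1: "norm z < 1" using z \<rho> by simp
  hence nz: "1 - z \<noteq> 0" by auto
  have "(\<lambda>n. - (z ^ n / of_nat n)) sums ln (1 - z)"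
    using Ln_series'[of "- z"] z1 by simp
  from sums_minus[OF this] have s: "(\<lambda>n. z ^ n / of_nat n) sums (- ln (1 - z))" by simp
  define tail where "tail = (\<Sum>n. z ^ (n + Suc J) / of_nat (n + Suc J))"
  have "- ln (1 - z) = tail + (\<Sum>n<Suc J. z ^ n / of_nat n)"
    using suminf_split_initial_segment[OF sums_summable[OF s], of "Suc J"] sums_unique[OF s]
    unfolding tail_def by simp
  also have "(\<Sum>n<Suc J. z ^ n / of_nat n) = (\<Sum>j=1..J. z ^ j / of_nat j)"
    by (rule sum.mono_neutral_right) auto
  finally have "(\<Sum>j=1..J. z ^ j / of_nat j) = - ln (1 - z) - tail" by simp
  hence "(1 - z) * trunc_log_exp J z = (1 - z) * (exp (- ln (1 - z)) * exp (- tail))"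
    unfolding trunc_log_exp_def by (simp flip: exp_add)
  also have "\<dots> = exp (- tail)" using nz by (simp add: exp_minus)
  finally have eq: "norm ((1 - z) * trunc_log_exp J z) = exp (- Re tail)" by simp
  have "norm tail \<le> (\<Sum>n. \<rho> ^ Suc J * \<rho> ^ n)"
    unfolding tail_def
  proof (rule norm_suminf_le)
    fix n
    have "norm (z ^ (n + Suc J) / of_nat (n + Suc J)) = norm z ^ (n + Suc J) / real (n + Suc J)"
      by (simp only: norm_divide norm_power norm_of_nat)
    also have "\<dots> \<le> \<rho> ^ (n + Suc J) / 1"
      using z by (intro frac_le power_mono zero_le_power \<rho>0) auto
    finally show "norm (z ^ (n + Suc J) / of_nat (n + Suc J)) \<le> \<rho> ^ Suc J * \<rho> ^ n"
      by (simp add: power_add mult_ac)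
    show "summable (\<lambda>n. \<rho> ^ Suc J * \<rho> ^ n)" using \<rho> \<rho>0 by (intro summable_mult summable_geometric) auto
  qed
  also have "\<dots> = \<rho> ^ Suc J / (1 - \<rho>)"
    using \<rho> \<rho>0 by (subst suminf_mult) (auto simp: suminf_geometric)
  finally have "\<bar>Re tail\<bar> \<le> \<rho> ^ Suc J / (1 - \<rho>)" using abs_Re_le_cmod[of tail] by linarith
  thus "exp (- (\<rho> ^ Suc J / (1 - \<rho>))) \<le> norm ((1 - z) * trunc_log_exp J z)"
    "norm ((1 - z) * trunc_log_exp J z) \<le> exp (\<rho> ^ Suc J / (1 - \<rho>))"
    unfolding eq by auto
qed

lemma local_arg_eq:
  assumes "p \<ge> 1"
  shows "local_arg q chi (Complex (1/2) t) p = (prim_char q chi p / of_real (sqrt (real p))) * exp (- (\<i> * of_real (ln (real p) * t)))"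
proof -
  have p: "real p > 0" using assms by simp
  have "of_nat p powr (- Complex (1/2) t) = exp (- Complex (1/2) t * of_real (ln (real p)))"
    using p by (simp add: powr_def Ln_of_nat)
  also have "- Complex (1/2) t * of_real (ln (real p)) = of_real (- (ln (real p) / 2)) + (- (\<i> * of_real (ln (real p) * t)))"
    by (simp add: complex_eq_iff)
  also have "exp \<dots> = of_real (exp (- (ln (real p) / 2))) * exp (- (\<i> * of_real (ln (real p) * t)))"
    by (simp only: exp_add exp_of_real)
  also have "exp (- (ln (real p) / 2)) = 1 / sqrt (real p)"
    using p by (simp add: exp_minus ln_sqrt[symmetric] inverse_eq_divide)
  finally show ?thesis by (simp add: local_arg_def)
qed

lemma norm_local_arg_le:
  assumes chi: "chi \<in> dchars q" and q: "q > 0" and p: "p \<ge> 2"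
  shows "norm (local_arg q chi (Complex (1/2) t) p) \<le> 1 / sqrt 2"
proof -
  have "norm (local_arg q chi (Complex (1/2) t) p) = norm (prim_char q chi p) / sqrt (real p)"
    using p by (subst local_arg_eq) (auto simp: norm_mult norm_divide)
  also have "\<dots> \<le> 1 / sqrt 2"
    using prim_char_power_and_norm(2)[OF chi q, of p] p by (intro frac_le) auto
  finally show ?thesis .
qed

text \<open>At primes not dividing \<open>q\<close> the primitive character has modulus 1, so the
  squared moduli of the coefficients are \<open>(trunc_coeff k (J p) m)\<^sup>2 / p ^ m\<close>.
  This is why the mean value does not depend on \<open>chi\<close>.\<close>

lemma dirichlet_rep_trunc_product:
  assumes chi: "chi \<in> dchars q" and q: "q > 0" and k: "k \<ge> 1"
    and S: "finite S" "\<And>p. p \<in> S \<Longrightarrow> prime p \<and> \<not> p dvd q"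
  shows "dirichlet_rep S (\<lambda>t. \<Prod>p\<in>S. trunc_log_exp (J p) (local_arg q chi (Complex (1/2) t) p) ^ k)
     (\<Prod>p\<in>S. local_mean k (J p) p)"
  using S
proof (induction S rule: finite_induct)
  case empty
  thus ?case using dirichlet_rep_empty by simp
next
  case (insert p S)
  have p: "prime p" "p \<notin> S" "\<not> p dvd q" using insert by auto
  have p2: "p \<ge> 2" using prime_ge_2_nat[OF p(1)] .
  define w where "w = prim_char q chi p / of_real (sqrt (real p))"
  have "coprime p q" using p by (simp add: prime_imp_coprime)
  hence nw: "norm w = 1 / sqrt (real p)"
    using prim_char_power_and_norm(3)[OF chi q] by (simp add: w_def norm_divide)
  have w1: "norm w < 1" unfolding nw using p2 by simp
  define b where "b m = of_real (trunc_coeff k (J p) m) * w ^ m" for m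
  have "dirichlet_rep (insert p S) (\<lambda>t. (\<Prod>p\<in>S. trunc_log_exp (J p) (local_arg q chi (Complex (1/2) t) p) ^ k) *
      trunc_log_exp (J p) (local_arg q chi (Complex (1/2) t) p) ^ k) ((\<Prod>p\<in>S. local_mean k (J p) p) * local_mean k (J p) p)"
  proof (rule dirichlet_rep_insert[OF _ p(1,2)])
    show "dirichlet_rep S (\<lambda>t. \<Prod>p\<in>S. trunc_log_exp (J p) (local_arg q chi (Complex (1/2) t) p) ^ k) (\<Prod>p\<in>S. local_mean k (J p) p)"
      using insert by auto
    show "summable (\<lambda>j. norm (b j))" unfolding b_def by (rule summable_trunc_coeff_norm[OF k w1])
    have "(norm (b j))\<^sup>2 = (trunc_coeff k (J p) j)\<^sup>2 / real p ^ j" for j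
    proof -
      have "(norm w ^ j)\<^sup>2 = ((norm w)\<^sup>2) ^ j" by (simp flip: power_mult add: mult.commute)
      also have "(norm w)\<^sup>2 = 1 / real p" unfolding nw by (simp add: power_divide)
      finally show ?thesis by (simp add: b_def norm_mult norm_power power_mult_distrib power_one_over)
    qed
    thus "(\<lambda>j. (norm (b j))\<^sup>2) sums local_mean k (J p) p"
      unfolding local_mean_def using summable_sums[OF summable_trunc_coeff_square[OF k p2, of "J p"]] by simp
    fix t
    define z where "z = local_arg q chi (Complex (1/2) t) p"
    have z: "z = w * exp (- (\<i> * of_real (ln (real p) * t)))"
      unfolding z_def w_def using p2 by (intro local_arg_eq) auto
    have "norm z < 1" unfolding z norm_mult using w1 by simp
    hence "(\<lambda>m. of_real (trunc_coeff k (J p) m) * z ^ m) sums exp (of_nat k * (\<Sum>j=1..J p. z ^ j / of_nat j))"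
      by (rule trunc_coeff_sums[OF k])
    also have "exp (of_nat k * (\<Sum>j=1..J p. z ^ j / of_nat j)) = trunc_log_exp (J p) z ^ k"
      unfolding trunc_log_exp_def by (rule exp_of_nat_mult)
    also have "(\<lambda>m. of_real (trunc_coeff k (J p) m) * z ^ m) = (\<lambda>j. b j * exp (- (\<i> * of_real (ln (real p) * t))) ^ j)"
      by (simp add: b_def z power_mult_distrib mult_ac)
    finally show "(\<lambda>j. b j * exp (- (\<i> * of_real (ln (real p) * t))) ^ j) sums
        trunc_log_exp (J p) (local_arg q chi (Complex (1/2) t) p) ^ k" by (simp add: z_def)
  qed
  thus ?case using insert(1,2) by (simp add: mult.commute)
qed

definition coprime_mean :: "nat \<Rightarrow> nat \<Rightarrow> nat \<Rightarrow> real" where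
  "coprime_mean k q N = (\<Prod>p | prime p \<and> p \<le> N \<and> \<not> p dvd q. local_mean k (prime_exp p N) p)"

text \<open>Bounds the absolute value of the logarithm of the modulus of the part of
  \<open>P_fun\<close> at the primes dividing \<open>q\<close>. The number \<open>1 / sqrt 2\<close>
  is the largest value of \<open>1 / sqrt p\<close>.\<close>

definition ramified_error :: "nat \<Rightarrow> nat \<Rightarrow> real" where
  "ramified_error q N = (\<Sum>p | prime p \<and> p dvd q. (1 / sqrt 2) ^ Suc (prime_exp p N) / (1 - 1 / sqrt 2))"

lemma ramified_error_tendsto_0: "q > 0 \<Longrightarrow> ramified_error q \<longlonglongrightarrow> 0"
proof -
  assume q: "q > 0"
  have "(\<lambda>N. \<Sum>p | prime p \<and> p dvd q. (1 / sqrt 2) ^ Suc (prime_exp p N) / (1 - 1 / sqrt 2)) \<longlonglongrightarrow> (\<Sum>p | prime p \<and> p dvd q. 0 / (1 - 1 / sqrt 2))"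
  proof (intro tendsto_sum tendsto_divide tendsto_const)
    fix p assume "p \<in> {p. prime p \<and> p dvd q}"
    hence "p \<ge> 2" using prime_ge_2_nat by auto
    have "(\<lambda>n. (1 / sqrt 2) ^ n) \<longlonglongrightarrow> (0::real)" by (rule LIMSEQ_realpow_zero) auto
    from LIMSEQ_Suc[OF this] show "(\<lambda>N. (1 / sqrt 2) ^ Suc (prime_exp p N)) \<longlonglongrightarrow> (0::real)"
      by (rule filterlim_compose[OF _ filterlim_prime_exp[OF \<open>p \<ge> 2\<close>]])
  qed auto
  thus ?thesis unfolding ramified_error_def by simp
qed

text \<open>\<open>P = W ^ k * Q\<close>, with \<open>W\<close> the part from the primes dividing
  \<open>q\<close>. Only \<open>Q\<close> needs a mean value; \<open>W\<close> is squeezed uniformly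
  in \<open>t\<close> between exponentials, and its power in the squared modulus of \<open>P\<close>
  is \<open>2 * k\<close>.\<close>

lemma P_fun_mean_bounds:
  assumes chi: "chi \<in> dchars q" and q: "q > 0" and k: "k \<ge> 1" and N: "N \<ge> q"
  defines "Q \<equiv> (\<lambda>t. \<Prod>p | prime p \<and> p \<le> N \<and> \<not> p dvd q. trunc_log_exp (prime_exp p N) (local_arg q chi (Complex (1/2) t) p) ^ k)"
  defines "P \<equiv> (\<lambda>t. P_fun q (real N) chi (Complex (1/2) t) ^ k)"
  shows "continuous_on A P" "exp (- (2 * real k * ramified_error q N)) * (norm (Q t))\<^sup>2 \<le> (norm (P t))\<^sup>2"
    "(norm (P t))\<^sup>2 \<le> exp (2 * real k * ramified_error q N) * (norm (Q t))\<^sup>2"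
    "dirichlet_rep {p. prime p \<and> p \<le> N \<and> \<not> p dvd q} Q (coprime_mean k q N)"
proof -
  have N1: "N \<ge> 1" using N q by simp
  define z where "z t p = local_arg q chi (Complex (1/2) t) p" for t p
  define R where "R = {p. prime p \<and> p dvd q}"
  define W where "W t = (\<Prod>p\<in>R. (1 - z t p) * trunc_log_exp (prime_exp p N) (z t p))" for t
  have P: "P t = W t ^ k * Q t" for t
    unfolding P_def P_fun_eq[OF chi q N1 N] Q_def W_def R_def z_def
    by (simp add: power_mult_distrib prod_power_distrib)
  show rep: "dirichlet_rep {p. prime p \<and> p \<le> N \<and> \<not> p dvd q} Q (coprime_mean k q N)"
    unfolding Q_def coprime_mean_def
  proof (rule dirichlet_rep_trunc_product[OF chi q k])
    show "finite {p. prime p \<and> p \<le> N \<and> \<not> p dvd q}" by (rule finite_subset[of _ "{..N}"]) auto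
  qed auto
  have cz: "continuous_on A (\<lambda>t. z t p)" if "p \<in> R" for p
  proof -
    have "p \<ge> 1" using that prime_ge_1_nat by (auto simp: R_def)
    thus ?thesis unfolding z_def by (simp only: local_arg_eq) (intro continuous_intros)
  qed
  show "continuous_on A P"
    unfolding P W_def trunc_log_exp_def
    by (intro continuous_intros dirichlet_rep_continuous[OF rep] cz) auto
  have Wb: "exp (- ramified_error q N) \<le> norm (W t)" "norm (W t) \<le> exp (ramified_error q N)" for t
  proof -
    have finR: "finite R"
    proof -
      have "finite {p. p dvd q}" using q by simp
      thus ?thesis unfolding R_def by (rule rev_finite_subset) auto
    qed
    have nW: "norm (W t) = (\<Prod>p\<in>R. norm ((1 - z t p) * trunc_log_exp (prime_exp p N) (z t p)))"
      unfolding W_def by (rule prod_norm[symmetric])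
    have r: "1 / sqrt 2 < (1::real)" by simp
    have zb: "norm (z t p) \<le> 1 / sqrt 2" if "p \<in> R" for p
      unfolding z_def using that prime_ge_2_nat by (intro norm_local_arg_le[OF chi q]) (auto simp: R_def)
    have "exp (- ramified_error q N) = (\<Prod>p\<in>R. exp (- ((1 / sqrt 2) ^ Suc (prime_exp p N) / (1 - 1 / sqrt 2))))"
      unfolding ramified_error_def R_def[symmetric] sum_negf[symmetric] by (rule exp_sum[OF finR])
    also have "\<dots> \<le> norm (W t)"
      unfolding nW using trunc_log_exp_bounds(1)[OF zb r] by (intro prod_mono) auto
    finally show "exp (- ramified_error q N) \<le> norm (W t)" .
    have "norm (W t) \<le> (\<Prod>p\<in>R. exp ((1 / sqrt 2) ^ Suc (prime_exp p N) / (1 - 1 / sqrt 2)))"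
      unfolding nW using trunc_log_exp_bounds(2)[OF zb r] by (intro prod_mono) auto
    also have "\<dots> = exp (ramified_error q N)"
      unfolding ramified_error_def R_def[symmetric] by (rule exp_sum[OF finR, symmetric])
    finally show "norm (W t) \<le> exp (ramified_error q N)" .
  qed
  have nP: "(norm (P t))\<^sup>2 = norm (W t) ^ (2 * k) * (norm (Q t))\<^sup>2"
    unfolding P norm_mult norm_power power_mult_distrib by (simp add: mult.commute flip: power_mult)
  have e: "exp (2 * real k * x) = exp x ^ (2 * k)" for x :: real
    by (simp add: exp_of_nat_mult[symmetric])
  show "exp (- (2 * real k * ramified_error q N)) * (norm (Q t))\<^sup>2 \<le> (norm (P t))\<^sup>2"
    unfolding nP using e[of "- ramified_error q N"] Wb(1)[of t]
    by (intro mult_right_mono) (auto intro!: power_mono)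
  show "(norm (P t))\<^sup>2 \<le> exp (2 * real k * ramified_error q N) * (norm (Q t))\<^sup>2"
    unfolding nP e using Wb(2)[of t] by (intro mult_right_mono power_mono) auto
qed

section \<open>Convergence of the product of local means\<close>

lemma local_series_ge_1:
  assumes "k \<ge> 1" "p \<ge> 2"
  shows "local_series k p \<ge> 1"
proof -
  have "(\<Sum>m\<in>{0}. (binom_coeff k m)\<^sup>2 / real p ^ m) \<le> local_series k p"
    unfolding local_series_def by (rule sum_le_suminf[OF summable_binom_coeff_square[OF assms]]) auto
  thus ?thesis by (simp add: binom_coeff_0)
qed

text \<open>Both \<open>ln (local_mean k J p)\<close> and
  \<open>- k\<^sup>2 * ln (1 - 1 / p)\<close> are \<open>k\<^sup>2 / p + O(1 / p\<^sup>2)\<close>,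
  so the power \<open>k\<^sup>2\<close> removes the divergent part. Uniformity in \<open>J\<close>
  permits dominated convergence while the truncation moves with the cutoff.\<close>

lemma abs_ln_local_factor_le:
  assumes k: "k \<ge> 1" and p: "p \<ge> 2" and J: "J \<ge> 1"
  defines "B \<equiv> local_bound k"
  shows "\<bar>ln (local_mean k J p * (1 - 1 / real p) ^ (k\<^sup>2))\<bar> \<le> (B + ((real k)\<^sup>2 + B)\<^sup>2 + 2 * (real k)\<^sup>2) * (1 / (real p)\<^sup>2)"
proof -
  define x where "x = local_mean k J p"
  define a where "a = (real k)\<^sup>2"
  define u where "u = 1 / real p"
  have u: "0 < u" "u \<le> 1 / 2" using p by (auto simp: u_def)
  have x: "1 \<le> x" "\<bar>x - (1 + a * u)\<bar> \<le> B * u\<^sup>2"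
    using local_mean_bounds[OF k p J] by (auto simp: x_def a_def u_def B_def power_divide)
  have a0: "a \<ge> 0" by (simp add: a_def)
  have B0: "B * u\<^sup>2 \<ge> 0" using x(2) abs_ge_zero order_trans by blast
  hence B0': "B \<ge> 0" using u by (simp add: zero_le_mult_iff)
  define y where "y = x - 1"
  have y: "y \<ge> 0" "y \<le> a * u + B * u\<^sup>2" "y \<ge> a * u - B * u\<^sup>2" using x unfolding y_def by linarith+
  have "ln x \<le> y" unfolding y_def using x(1) by (intro ln_le_minus_one) auto
  moreover have "ln x \<ge> y - y\<^sup>2"
  proof -
    have "ln (1 / x) \<le> 1 / x - 1" using x(1) by (intro ln_le_minus_one) auto
    hence "ln x \<ge> 1 - 1 / x" using x(1) by (simp add: ln_div)
    moreover have "1 - 1 / x = y / x" using x(1) by (simp add: y_def field_simps)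
    moreover have "y - y\<^sup>2 \<le> y / x"
    proof -
      have "(y - y\<^sup>2) * x = y - y ^ 3" by (simp add: y_def power2_eq_square power3_eq_cube algebra_simps)
      also have "\<dots> \<le> y" using y(1) by simp
      finally show ?thesis using x(1) by (simp add: le_divide_eq)
    qed
    ultimately show ?thesis by linarith
  qed
  moreover have "y\<^sup>2 \<le> (a + B)\<^sup>2 * u\<^sup>2"
  proof -
    have "u\<^sup>2 \<le> u" using u by (simp add: power2_eq_square mult_left_le)
    hence "B * u\<^sup>2 \<le> B * u" using B0' by (intro mult_left_mono) auto
    hence "y \<le> (a + B) * u" using y(2) by (simp add: distrib_right)
    thus ?thesis using power_mono[of y "(a + B) * u" 2] y(1) by (simp add: power_mult_distrib)
  qed
  ultimately have l1: "\<bar>ln x - a * u\<bar> \<le> (B + (a + B)\<^sup>2) * u\<^sup>2"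
    using y by (simp add: distrib_right abs_le_iff)
  have "\<bar>- ln (1 - u) - u\<bar> \<le> 2 * u\<^sup>2" using u by (intro abs_ln_one_minus_bound) auto
  hence "a * \<bar>- ln (1 - u) - u\<bar> \<le> a * (2 * u\<^sup>2)" using a0 by (rule mult_left_mono)
  hence l2: "\<bar>a * ln (1 - u) + a * u\<bar> \<le> 2 * a * u\<^sup>2"
  proof -
    assume "a * \<bar>- ln (1 - u) - u\<bar> \<le> a * (2 * u\<^sup>2)"
    moreover have "a * \<bar>- ln (1 - u) - u\<bar> = \<bar>a * ln (1 - u) + a * u\<bar>"
    proof -
      have "a * ln (1 - u) + a * u = - (a * (- ln (1 - u) - u))" by (simp add: algebra_simps)
      thus ?thesis using a0 by (simp add: abs_mult)
    qed
    ultimately show ?thesis by (simp add: mult_ac)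
  qed
  have "ln (x * (1 - u) ^ (k\<^sup>2)) = ln x + a * ln (1 - u)"
    using x(1) u by (simp add: ln_mult ln_realpow a_def)
  hence "\<bar>ln (x * (1 - u) ^ (k\<^sup>2))\<bar> \<le> (B + (a + B)\<^sup>2) * u\<^sup>2 + 2 * a * u\<^sup>2"
    using l1 l2 by linarith
  also have "\<dots> = (B + (a + B)\<^sup>2 + 2 * a) * (1 / (real p)\<^sup>2)" by (simp add: u_def power_divide algebra_simps)
  finally show ?thesis unfolding x_def u_def a_def .
qed

text \<open>The arithmetic part of the constant: the Euler product of \<open>moment_const\<close>
  with the local series at the primes dividing \<open>q\<close> taken out.\<close>

definition euler_const :: "nat \<Rightarrow> nat \<Rightarrow> real" where
  "euler_const k q = (\<Prod>p. if prime p
           then (1 - 1 / real p) ^ (k\<^sup>2) * (\<Sum>m. real (divisor_fun k (p ^ m)) ^ 2 / real p ^ m)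
           else 1) *
     (\<Prod>p | prime p \<and> p dvd q. inverse (\<Sum>m. real ((m + k - 1) choose m) ^ 2 / real p ^ m))"

text \<open>Logarithms turn the product into a series over \<open>p\<close>, to which Tannery's
  theorem applies. At \<open>p\<close> dividing \<open>q\<close> the local mean is missing while the
  power of \<open>1 - 1 / p\<close> is present, which produces the inverse local series in
  \<open>euler_const\<close>.\<close>

lemma coprime_mean_limit:
  assumes k: "k \<ge> 1" and q: "q > 0"
  shows "(\<lambda>N. coprime_mean k q N * (\<Prod>p | prime p \<and> p \<le> N. 1 - 1 / real p) ^ (k\<^sup>2)) \<longlonglongrightarrow> euler_const k q"
    and "euler_const k q > 0"
proof -
  define F where "F p N = (if prime p \<and> p \<le> N then (if p dvd q then 1 else local_mean k (prime_exp p N) p) * (1 - 1 / real p) ^ (k\<^sup>2) else 1)" for p N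
  define Fi where "Fi p = (if prime p then (if p dvd q then 1 else local_series k p) * (1 - 1 / real p) ^ (k\<^sup>2) else 1)" for p
  define K where "K = local_bound k + ((real k)\<^sup>2 + local_bound k)\<^sup>2 + 2 * (real k)\<^sup>2"
  have J1: "prime_exp p N \<ge> 1" if "p \<ge> 2" "p \<le> N" for p N
    using power_le_iff_prime_exp[of p N 1] that by auto
  have Fipos: "Fi p > 0" for p
  proof (cases "prime p")
    case True
    hence p: "p \<ge> 2" by (rule prime_ge_2_nat)
    hence "1 - 1 / real p > 0" by (simp add: field_simps)
    thus ?thesis using True local_series_ge_1[OF k p] by (simp add: Fi_def)
  qed (simp add: Fi_def)
  have Fpos: "F p N > 0" for p N
  proof (cases "prime p \<and> p \<le> N")
    case True
    hence p: "p \<ge> 2" by (auto intro: prime_ge_2_nat)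
    hence "1 - 1 / real p > 0" by (simp add: field_simps)
    moreover have "local_mean k (prime_exp p N) p > 0"
      using local_mean_bounds(1)[OF k p J1[of p N]] p True by auto
    ultimately show ?thesis using True by (auto simp: F_def)
  next
    case False
    thus ?thesis unfolding F_def by (simp only: if_False)
  qed
  have lim: "(\<lambda>N. ln (F p N)) \<longlonglongrightarrow> ln (Fi p)" for p
  proof (rule tendsto_ln)
    show "Fi p \<noteq> 0" using Fipos[of p] by simp
    show "(\<lambda>N. F p N) \<longlonglongrightarrow> Fi p"
    proof (cases "prime p")
      case True
      hence p: "p \<ge> 2" by (rule prime_ge_2_nat)
      have "(\<lambda>N. (if p dvd q then 1 else local_mean k (prime_exp p N) p) * (1 - 1 / real p) ^ (k\<^sup>2)) \<longlonglongrightarrow> Fi p"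
        using True local_mean_tendsto[OF k p filterlim_prime_exp[OF p]] unfolding Fi_def by (auto intro!: tendsto_intros)
      moreover have "eventually (\<lambda>N. (if p dvd q then 1 else local_mean k (prime_exp p N) p) * (1 - 1 / real p) ^ (k\<^sup>2) = F p N) sequentially"
        using eventually_ge_at_top[of p] by eventually_elim (use True in \<open>auto simp: F_def\<close>)
      ultimately show ?thesis by (rule Lim_transform_eventually)
    qed (simp add: F_def Fi_def)
  qed
  \<comment> \<open>\<open>p > q\<close> excludes the divisors of \<open>q\<close>, where the term
    \<open>k\<^sup>2 / p\<close> does not cancel. Tannery's theorem asks for the bound only for
    large \<open>p\<close>.\<close>
  have bound: "norm (ln (F p N)) \<le> K * (1 / (real p)\<^sup>2)" if pq: "p > q" for p N
  proof (cases "prime p \<and> p \<le> N")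
    case True
    hence p: "p \<ge> 2" by (auto intro: prime_ge_2_nat)
    have "\<not> p dvd q" using pq q by (auto dest: dvd_imp_le)
    hence "F p N = local_mean k (prime_exp p N) p * (1 - 1 / real p) ^ (k\<^sup>2)" using True by (simp add: F_def)
    thus ?thesis using abs_ln_local_factor_le[OF k p J1[of p N]] p True by (simp add: K_def)
  next
    case False
    have "local_bound k \<ge> 0" unfolding local_bound_def by (rule suminf_nonneg[OF summable_local_bound[OF k]]) simp
    thus ?thesis using False by (auto simp: F_def K_def)
  qed
  have ev: "eventually (\<lambda>(p, N). norm (ln (F p N)) \<le> K * (1 / (real p)\<^sup>2)) (at_top \<times>\<^sub>F sequentially)"
    unfolding eventually_prod_filter
    using bound by (intro exI[of _ "\<lambda>p. p > q"] exI[of _ "\<lambda>_. True"]) (simp add: eventually_gt_at_top)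
  have summK: "summable (\<lambda>p. K * (1 / (real p)\<^sup>2))"
    using inverse_power_summable[of 2, where 'a = real] by (intro summable_mult) (simp add: inverse_eq_divide)
  note tan = tannerys_theorem[OF lim ev summK sequentially_bot]
  have summ: "summable (\<lambda>p. ln (Fi p))" using tan by (auto intro: summable_norm_cancel)
  have "(\<lambda>N. exp (\<Sum>p. ln (F p N))) \<longlonglongrightarrow> exp (\<Sum>p. ln (Fi p))"
    using tan by (intro tendsto_exp) blast
  moreover have "exp (\<Sum>p. ln (F p N)) = coprime_mean k q N * (\<Prod>p | prime p \<and> p \<le> N. 1 - 1 / real p) ^ (k\<^sup>2)" for N
  proof -
    define S where "S = {p. prime p \<and> p \<le> N}"
    have fS: "finite S" unfolding S_def by (rule finite_subset[of _ "{..N}"]) auto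
    have "(\<Sum>p. ln (F p N)) = (\<Sum>p\<in>S. ln (F p N))" using fS by (intro suminf_finite) (auto simp: F_def S_def)
    hence "exp (\<Sum>p. ln (F p N)) = (\<Prod>p\<in>S. F p N)" using Fpos fS by (simp add: exp_sum)
    also have "\<dots> = (\<Prod>p\<in>S. (if p dvd q then 1 else local_mean k (prime_exp p N) p)) * (\<Prod>p\<in>S. (1 - 1 / real p) ^ (k\<^sup>2))"
      unfolding prod.distrib[symmetric] by (intro prod.cong refl) (auto simp: F_def S_def)
    also have "(\<Prod>p\<in>S. (if p dvd q then 1 else local_mean k (prime_exp p N) p)) = (\<Prod>p\<in>S. (if \<not> p dvd q then local_mean k (prime_exp p N) p else 1))"
      by (intro prod.cong refl) auto
    also have "\<dots> = (\<Prod>p\<in>{p\<in>S. \<not> p dvd q}. local_mean k (prime_exp p N) p)"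
      by (rule prod.inter_filter[OF fS, symmetric])
    also have "{p\<in>S. \<not> p dvd q} = {p. prime p \<and> p \<le> N \<and> \<not> p dvd q}" by (auto simp: S_def)
    finally show ?thesis unfolding coprime_mean_def S_def by (simp add: prod_power_distrib)
  qed
  ultimately have main: "(\<lambda>N. coprime_mean k q N * (\<Prod>p | prime p \<and> p \<le> N. 1 - 1 / real p) ^ (k\<^sup>2)) \<longlonglongrightarrow> exp (\<Sum>p. ln (Fi p))" by simp
  define R where "R = {p. prime p \<and> p dvd q}"
  have finR: "finite R"
  proof -
    have "finite {p. p dvd q}" using q by simp
    thus ?thesis unfolding R_def by (rule rev_finite_subset) auto
  qed
  have Rp: "p \<ge> 2" if "p \<in> R" for p using that prime_ge_2_nat by (auto simp: R_def)
  \<comment> \<open>Puts the local series at the primes dividing \<open>q\<close> back, so that the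
    infinite product becomes that of \<open>moment_const\<close>.\<close>
  have "(\<lambda>p. ln (Fi p) + (if p \<in> R then ln (local_series k p) else 0)) sums ((\<Sum>p. ln (Fi p)) + (\<Sum>p\<in>R. ln (local_series k p)))"
    by (intro sums_add summable_sums[OF summ] sums_If_finite_set finR)
  hence sG: "(\<lambda>p. exp (ln (Fi p) + (if p \<in> R then ln (local_series k p) else 0))) has_prod exp ((\<Sum>p. ln (Fi p)) + (\<Sum>p\<in>R. ln (local_series k p)))"
    by (simp add: has_prod_def sums_imp_has_prod_exp)
  have G: "exp (ln (Fi p) + (if p \<in> R then ln (local_series k p) else 0)) =
     (if prime p then (1 - 1 / real p) ^ (k\<^sup>2) * (\<Sum>m. real (divisor_fun k (p ^ m)) ^ 2 / real p ^ m) else 1)" for p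
  proof -
    have ls: "(\<Sum>m. real (divisor_fun k (p ^ m)) ^ 2 / real p ^ m) = local_series k p" if "prime p"
      by (simp add: divisor_fun_prime_power[OF that] local_series_def binom_coeff_def)
    have "exp (ln (Fi p) + (if p \<in> R then ln (local_series k p) else 0)) = Fi p * (if p \<in> R then local_series k p else 1)"
      using Fipos[of p] local_series_ge_1[OF k Rp, of p] by (auto simp: exp_add)
    thus ?thesis using ls by (auto simp: Fi_def R_def)
  qed
  have "(\<Prod>p. if prime p then (1 - 1 / real p) ^ (k\<^sup>2) * (\<Sum>m. real (divisor_fun k (p ^ m)) ^ 2 / real p ^ m) else 1) =
     exp ((\<Sum>p. ln (Fi p)) + (\<Sum>p\<in>R. ln (local_series k p)))"
    using has_prod_unique[OF sG] unfolding G by (rule sym)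
  also have "\<dots> = exp (\<Sum>p. ln (Fi p)) * (\<Prod>p\<in>R. local_series k p)"
  proof -
    have "exp (\<Sum>p\<in>R. ln (local_series k p)) = (\<Prod>p\<in>R. exp (ln (local_series k p)))" by (rule exp_sum[OF finR])
    also have "\<dots> = (\<Prod>p\<in>R. local_series k p)"
    proof (intro prod.cong refl)
      fix p assume "p \<in> R"
      thus "exp (ln (local_series k p)) = local_series k p" using local_series_ge_1[OF k Rp, of p] by simp
    qed
    finally show ?thesis by (simp add: exp_add)
  qed
  finally have "euler_const k q = exp (\<Sum>p. ln (Fi p)) * ((\<Prod>p\<in>R. local_series k p) * (\<Prod>p\<in>R. inverse (local_series k p)))"
    unfolding euler_const_def R_def local_series_def binom_coeff_def by simp
  also have "(\<Prod>p\<in>R. local_series k p) * (\<Prod>p\<in>R. inverse (local_series k p)) = (\<Prod>p\<in>R. 1)"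
    unfolding prod.distrib[symmetric]
  proof (intro prod.cong refl)
    fix p assume "p \<in> R"
    thus "local_series k p * inverse (local_series k p) = 1" using local_series_ge_1[OF k Rp, of p] by simp
  qed
  finally have eq: "euler_const k q = exp (\<Sum>p. ln (Fi p))" by simp
  show "(\<lambda>N. coprime_mean k q N * (\<Prod>p | prime p \<and> p \<le> N. 1 - 1 / real p) ^ (k\<^sup>2)) \<longlonglongrightarrow> euler_const k q"
    unfolding eq by (rule main)
  show "euler_const k q > 0" unfolding eq by simp
qed

section \<open>The moments\<close>

lemma abs_power_diff_le:
  fixes a b M :: real
  assumes "0 \<le> a" "0 \<le> b" "a \<le> M" "b \<le> M"
  shows "\<bar>a ^ Suc m - b ^ Suc m\<bar> \<le> real (Suc m) * \<bar>a - b\<bar> * M ^ m"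
proof (induction m)
  case (Suc m)
  have "a ^ Suc (Suc m) - b ^ Suc (Suc m) = a * (a ^ Suc m - b ^ Suc m) + b ^ Suc m * (a - b)"
    by (simp add: algebra_simps)
  hence "\<bar>a ^ Suc (Suc m) - b ^ Suc (Suc m)\<bar> \<le> \<bar>a * (a ^ Suc m - b ^ Suc m)\<bar> + \<bar>b ^ Suc m * (a - b)\<bar>"
    by (metis abs_triangle_ineq)
  also have "\<dots> = a * \<bar>a ^ Suc m - b ^ Suc m\<bar> + b ^ Suc m * \<bar>a - b\<bar>"
    using assms by (simp add: abs_mult)
  also have "\<dots> \<le> M * (real (Suc m) * \<bar>a - b\<bar> * M ^ m) + M ^ Suc m * \<bar>a - b\<bar>"
    using assms Suc by (intro add_mono mult_mono power_mono) auto
  also have "\<dots> = real (Suc (Suc m)) * \<bar>a - b\<bar> * M ^ Suc m" by (simp add: algebra_simps)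
  finally show ?case .
qed auto

text \<open>Let \<open>z i\<close> be a largest term, with modulus \<open>x\<close>. The modulus of
  the sum differs from \<open>x\<close> by at most \<open>y\<close>, the sum of the other moduli, so
  the powers differ by at most \<open>K * (x ^ (2 * k - 1) * y)\<close>; completing a square splits
  this into a small multiple of \<open>x ^ (2 * k)\<close> and cross terms. As \<open>i\<close>
  depends on \<open>z\<close>, the final bound runs over all \<open>i\<close>.\<close>

lemma norm_sum_power_diff_le:
  assumes A: "finite (A :: 'a set)" and k: "k \<ge> 2" and \<epsilon>: "\<epsilon> > (0::real)"
  shows "\<exists>C\<ge>0. \<forall>z :: 'a \<Rightarrow> complex.
    \<bar>norm (\<Sum>i\<in>A. z i) ^ (2 * k) - (\<Sum>i\<in>A. norm (z i) ^ (2 * k))\<bar> \<le>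
    \<epsilon> * (\<Sum>i\<in>A. norm (z i) ^ (2 * k)) + C * (\<Sum>i\<in>A. \<Sum>j\<in>A-{i}. norm (z i) ^ (2 * (k - 1)) * (norm (z j))\<^sup>2)"
proof -
  define n where "n = real (card A)"
  define K where "K = real (2 * k) * n ^ (2 * k - 1)"
  \<comment> \<open>\<open>K\<^sup>2 / (4 * \<epsilon>)\<close> comes from the completed square and
    \<open>n\<close> from the Cauchy-Schwarz inequality for \<open>y\<close>. The 1 pays for the
    powers of the other terms, each of which is at most a cross term because \<open>z i\<close> is
    largest.\<close>
  define C where "C = K\<^sup>2 * n / (4 * \<epsilon>) + 1"
  have n0: "n \<ge> 0" by (simp add: n_def)
  have C0: "C \<ge> 0" using \<epsilon> n0 by (simp add: C_def add_nonneg_nonneg)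
  have "\<bar>norm (\<Sum>i\<in>A. z i) ^ (2 * k) - (\<Sum>i\<in>A. norm (z i) ^ (2 * k))\<bar> \<le>
    \<epsilon> * (\<Sum>i\<in>A. norm (z i) ^ (2 * k)) + C * (\<Sum>i\<in>A. \<Sum>j\<in>A-{i}. norm (z i) ^ (2 * (k - 1)) * (norm (z j))\<^sup>2)"
    for z :: "'a \<Rightarrow> complex"
  proof (cases "A = {}")
    case True
    thus ?thesis using k by (simp add: power_0_left)
  next
    case False
    have n1: "n \<ge> 1" unfolding n_def using A False by (simp add: Suc_le_eq card_gt_0_iff)
    have "Max ((\<lambda>j. norm (z j)) ` A) \<in> (\<lambda>j. norm (z j)) ` A" using A False by (intro Max_in) auto
    then obtain i where i0: "i \<in> A" "Max ((\<lambda>j. norm (z j)) ` A) = norm (z i)" by auto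
    have i: "i \<in> A" "\<And>j. j \<in> A \<Longrightarrow> norm (z j) \<le> norm (z i)"
      using i0(1) A unfolding i0(2)[symmetric] by auto
    define x where "x = norm (z i)"
    define y where "y = (\<Sum>j\<in>A-{i}. norm (z j))"
    define S where "S = norm (\<Sum>i\<in>A. z i)"
    have x0: "x \<ge> 0" by (simp add: x_def)
    have Sx: "\<bar>S - x\<bar> \<le> y"
    proof -
      have "(\<Sum>i\<in>A. z i) = z i + (\<Sum>j\<in>A-{i}. z j)" using A i by (simp add: sum.remove)
      hence "\<bar>S - x\<bar> \<le> norm (\<Sum>j\<in>A-{i}. z j)"
        unfolding S_def x_def using norm_triangle_ineq3[of "\<Sum>i\<in>A. z i" "z i"] by simp
      also have "\<dots> \<le> y" unfolding y_def by (rule norm_sum)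
      finally show ?thesis .
    qed
    have Sn: "S \<le> n * x"
    proof -
      have "S \<le> (\<Sum>j\<in>A. norm (z j))" unfolding S_def by (rule norm_sum)
      also have "\<dots> \<le> (\<Sum>j\<in>A. x)" using i by (intro sum_mono) (auto simp: x_def)
      finally show ?thesis by (simp add: n_def)
    qed
    have xn: "x \<le> n * x" using n1 x0 mult_right_mono[of 1 n x] by simp
    have "\<bar>S ^ (2 * k) - x ^ (2 * k)\<bar> \<le> real (2 * k) * \<bar>S - x\<bar> * (n * x) ^ (2 * k - 1)"
      using abs_power_diff_le[of S x "n * x" "2 * k - 1"] Sn xn x0 k by (simp add: S_def)
    also have "\<dots> \<le> real (2 * k) * y * (n * x) ^ (2 * k - 1)"
      using Sx n0 x0 by (intro mult_right_mono mult_left_mono) auto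
    also have "\<dots> = K * (x ^ (2 * k - 1) * y)" by (simp add: K_def power_mult_distrib mult_ac)
    also have "\<dots> \<le> \<epsilon> * x ^ (2 * k) + K\<^sup>2 / (4 * \<epsilon>) * (x ^ (2 * (k - 1)) * y\<^sup>2)"
    proof -
      have e1: "x ^ (2 * k - 1) = x ^ (2 * (k - 1)) * x" and e2: "x ^ (2 * k) = x ^ (2 * (k - 1)) * x\<^sup>2"
      proof -
        have "2 * k - 1 = Suc (2 * (k - 1))" "2 * k = 2 * (k - 1) + 2" using k by auto
        thus "x ^ (2 * k - 1) = x ^ (2 * (k - 1)) * x" "x ^ (2 * k) = x ^ (2 * (k - 1)) * x\<^sup>2"
          by (metis power_Suc2) (metis \<open>2 * k = 2 * (k - 1) + 2\<close> power_add)
      qed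
      have "0 \<le> (2 * \<epsilon> * x - K * y)\<^sup>2 / (4 * \<epsilon>)" using \<epsilon> by simp
      also have "\<dots> = \<epsilon> * x\<^sup>2 + K\<^sup>2 / (4 * \<epsilon>) * y\<^sup>2 - K * x * y"
        using \<epsilon> by (simp add: power2_eq_square field_simps)
      finally have "K * x * y \<le> \<epsilon> * x\<^sup>2 + K\<^sup>2 / (4 * \<epsilon>) * y\<^sup>2" by simp
      hence "x ^ (2 * (k - 1)) * (K * x * y) \<le> x ^ (2 * (k - 1)) * (\<epsilon> * x\<^sup>2 + K\<^sup>2 / (4 * \<epsilon>) * y\<^sup>2)"
        using x0 by (intro mult_left_mono) auto
      thus ?thesis unfolding e1 e2 by (simp add: algebra_simps)
    qed
    finally have 0: "\<bar>S ^ (2 * k) - x ^ (2 * k)\<bar> \<le> \<epsilon> * x ^ (2 * k) + K\<^sup>2 / (4 * \<epsilon>) * (x ^ (2 * (k - 1)) * y\<^sup>2)" .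
    have ysq: "y\<^sup>2 \<le> n * (\<Sum>j\<in>A-{i}. (norm (z j))\<^sup>2)"
    proof -
      have "y\<^sup>2 \<le> (\<Sum>j\<in>A-{i}. (norm (z j))\<^sup>2) * real (card (A - {i}))"
        unfolding y_def by (rule sum_squared_le_sum_of_squares) 
      also have "\<dots> \<le> (\<Sum>j\<in>A-{i}. (norm (z j))\<^sup>2) * n"
        unfolding n_def using A by (intro mult_left_mono sum_nonneg) (auto simp: card_Diff1_le)
      finally show ?thesis by (simp add: mult.commute)
    qed
    have "K\<^sup>2 / (4 * \<epsilon>) * (x ^ (2 * (k - 1)) * y\<^sup>2) \<le> K\<^sup>2 / (4 * \<epsilon>) * (x ^ (2 * (k - 1)) * (n * (\<Sum>j\<in>A-{i}. (norm (z j))\<^sup>2)))"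
      using \<epsilon> x0 ysq by (intro mult_left_mono) auto
    also have "\<dots> = K\<^sup>2 * n / (4 * \<epsilon>) * (x ^ (2 * (k - 1)) * (\<Sum>j\<in>A-{i}. (norm (z j))\<^sup>2))" by simp
    finally have 1: "\<bar>S ^ (2 * k) - x ^ (2 * k)\<bar> \<le> \<epsilon> * x ^ (2 * k) + K\<^sup>2 * n / (4 * \<epsilon>) * (x ^ (2 * (k - 1)) * (\<Sum>j\<in>A-{i}. (norm (z j))\<^sup>2))"
      using 0 by linarith
    have split: "(\<Sum>j\<in>A. norm (z j) ^ (2 * k)) = x ^ (2 * k) + (\<Sum>j\<in>A-{i}. norm (z j) ^ (2 * k))"
      using A i by (simp add: sum.remove x_def)
    have 2: "(\<Sum>j\<in>A-{i}. norm (z j) ^ (2 * k)) \<le> x ^ (2 * (k - 1)) * (\<Sum>j\<in>A-{i}. (norm (z j))\<^sup>2)"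
      unfolding sum_distrib_left
    proof (intro sum_mono)
      fix j assume j: "j \<in> A - {i}"
      have "2 * k = 2 * (k - 1) + 2" using k by simp
      hence "norm (z j) ^ (2 * k) = norm (z j) ^ (2 * (k - 1)) * (norm (z j))\<^sup>2" by (metis power_add)
      also have "\<dots> \<le> x ^ (2 * (k - 1)) * (norm (z j))\<^sup>2"
        using i(2)[of j] j by (intro mult_right_mono power_mono) (auto simp: x_def)
      finally show "norm (z j) ^ (2 * k) \<le> x ^ (2 * (k - 1)) * (norm (z j))\<^sup>2" .
    qed
    define V where "V = x ^ (2 * (k - 1)) * (\<Sum>j\<in>A-{i}. (norm (z j))\<^sup>2)"
    have V: "V \<le> (\<Sum>i\<in>A. \<Sum>j\<in>A-{i}. norm (z i) ^ (2 * (k - 1)) * (norm (z j))\<^sup>2)"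
    proof -
      have "V = (\<Sum>j\<in>A-{i}. norm (z i) ^ (2 * (k - 1)) * (norm (z j))\<^sup>2)" by (simp add: V_def x_def sum_distrib_left)
      also have "\<dots> \<le> (\<Sum>i\<in>A. \<Sum>j\<in>A-{i}. norm (z i) ^ (2 * (k - 1)) * (norm (z j))\<^sup>2)"
        using A i(1) by (intro member_le_sum[of i A "\<lambda>i. \<Sum>j\<in>A-{i}. norm (z i) ^ (2 * (k - 1)) * (norm (z j))\<^sup>2"]) (auto intro!: sum_nonneg)
      finally show ?thesis .
    qed
    have rest0: "0 \<le> (\<Sum>j\<in>A-{i}. norm (z j) ^ (2 * k))" by (intro sum_nonneg) auto
    have "\<bar>S ^ (2 * k) - (\<Sum>j\<in>A. norm (z j) ^ (2 * k))\<bar> \<le> \<bar>S ^ (2 * k) - x ^ (2 * k)\<bar> + (\<Sum>j\<in>A-{i}. norm (z j) ^ (2 * k))"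
      unfolding split using rest0 by linarith
    also have "\<dots> \<le> (\<epsilon> * x ^ (2 * k) + K\<^sup>2 * n / (4 * \<epsilon>) * V) + V"
      using 1 2 unfolding V_def by (intro add_mono)
    also have "\<dots> = \<epsilon> * x ^ (2 * k) + C * V" by (simp add: C_def algebra_simps)
    also have "\<dots> \<le> \<epsilon> * (\<Sum>j\<in>A. norm (z j) ^ (2 * k)) + C * (\<Sum>i\<in>A. \<Sum>j\<in>A-{i}. norm (z i) ^ (2 * (k - 1)) * (norm (z j))\<^sup>2)"
      using V C0 \<epsilon> rest0 unfolding split by (intro add_mono mult_left_mono) auto
    finally show ?thesis unfolding S_def .
  qed
  thus ?thesis using C0 by blast
qed

text \<open>\<open>J T\<close> is the largest index whose threshold \<open>T\<close> has passed.
  Restricting to \<open>j \<le> T\<close> makes the set finite, so that the maximum exists.\<close>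

lemma eventually_diagonal:
  fixes Q :: "nat \<Rightarrow> real \<Rightarrow> bool"
  assumes "\<And>j. eventually (Q j) at_top"
  obtains J :: "real \<Rightarrow> nat" where "filterlim J at_top at_top" "eventually (\<lambda>T. Q (J T) T) at_top"
proof -
  have "\<forall>j. \<exists>T0. \<forall>T\<ge>T0. Q j T" using assms by (simp add: eventually_at_top_linorder)
  then obtain T0 where T0: "\<And>j T. T \<ge> T0 j \<Longrightarrow> Q j T" by metis
  define S where "S T = {j. j \<le> nat \<lfloor>T\<rfloor> \<and> T0 j \<le> T}" for T
  define J where "J T = Max (S T)" for T
  have fin: "finite (S T)" for T unfolding S_def by (rule finite_subset[of _ "{..nat \<lfloor>T\<rfloor>}"]) auto
  have mem: "m \<in> S T" if "T \<ge> real m" "T \<ge> T0 m" for m T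
    unfolding S_def using that by (auto simp: le_nat_floor)
  have "filterlim J at_top at_top"
    unfolding filterlim_at_top
  proof
    fix m
    show "eventually (\<lambda>T. m \<le> J T) at_top"
      using eventually_ge_at_top[of "real m"] eventually_ge_at_top[of "T0 m"]
    proof eventually_elim
      case (elim T)
      thus ?case unfolding J_def using fin mem by (intro Max_ge) auto
    qed
  qed
  moreover have "eventually (\<lambda>T. Q (J T) T) at_top"
    using eventually_ge_at_top[of 0] eventually_ge_at_top[of "T0 0"]
  proof eventually_elim
    case (elim T)
    have "0 \<in> S T" using elim by (intro mem) auto
    hence "J T \<in> S T" unfolding J_def using fin by (intro Max_in) auto
    thus ?case using T0 by (auto simp: S_def)
  qed
  ultimately show ?thesis using that by blast
qed

section \<open>Concentrated and mixed tuples\<close>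

definition single_tuple :: "nat \<Rightarrow> (nat \<Rightarrow> complex) \<Rightarrow> char_tuple" where
  "single_tuple k chi0 = (\<lambda>chi. if chi = chi0 then k else 0)"

definition mixed_tuple :: "nat \<Rightarrow> (nat \<Rightarrow> complex) \<Rightarrow> (nat \<Rightarrow> complex) \<Rightarrow> char_tuple" where
  "mixed_tuple k chi1 chi2 = (\<lambda>chi. if chi = chi1 then k - 1 else if chi = chi2 then 1 else 0)"

lemma prod_single_tuple:
  assumes "finite A" "chi0 \<in> A"
  shows "(\<Prod>chi\<in>A. (f chi :: 'a :: comm_monoid_mult) ^ single_tuple k chi0 chi) = f chi0 ^ k"
proof -
  have "(\<Prod>chi\<in>A. f chi ^ single_tuple k chi0 chi) = (\<Prod>chi\<in>A. if chi = chi0 then f chi0 ^ k else 1)"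
    by (intro prod.cong refl) (auto simp: single_tuple_def)
  thus ?thesis using assms by simp
qed

lemma prod_mixed_tuple:
  assumes "finite A" "chi1 \<in> A" "chi2 \<in> A" "chi1 \<noteq> chi2"
  shows "(\<Prod>chi\<in>A. (f chi :: 'a :: comm_monoid_mult) ^ mixed_tuple k chi1 chi2 chi) = f chi1 ^ (k - 1) * f chi2"
proof -
  have "(\<Prod>chi\<in>A. f chi ^ mixed_tuple k chi1 chi2 chi) =
     (\<Prod>chi\<in>A. (if chi = chi1 then f chi1 ^ (k - 1) else 1) * (if chi = chi2 then f chi2 else 1))"
    using assms(4) by (intro prod.cong refl) (auto simp: mixed_tuple_def)
  thus ?thesis using assms by (simp add: prod.distrib)
qed

lemma tuple_size_single: "finite (dchars q) \<Longrightarrow> chi0 \<in> dchars q \<Longrightarrow> tuple_size q (single_tuple k chi0) = k"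
  by (simp add: tuple_size_def single_tuple_def)

lemma tuple_size_mixed:
  assumes "finite (dchars q)" "chi1 \<in> dchars q" "chi2 \<in> dchars q" "chi1 \<noteq> chi2" "k \<ge> 1"
  shows "tuple_size q (mixed_tuple k chi1 chi2) = k"
proof -
  have "tuple_size q (mixed_tuple k chi1 chi2) = (\<Sum>chi\<in>dchars q. (if chi = chi1 then k - 1 else 0) + (if chi = chi2 then 1 else 0))"
    unfolding tuple_size_def mixed_tuple_def using assms(4) by (intro sum.cong) auto
  thus ?thesis using assms by (simp add: sum.distrib)
qed

section \<open>The mean square of P_X and the choice of the cutoff\<close>

text \<open>The limits are iterated. For a fixed cutoff \<open>r j\<close> Bohr's theorem gives the
  limit in \<open>T\<close>, up to the factors \<open>exp (\<tau> N)\<close> and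
  \<open>exp (- \<tau> N)\<close>. As \<open>j\<close> grows these tend to 1, and along the Mertens
  sequence the normalised \<open>coprime_mean\<close> tends to \<open>euler_const\<close>.\<close>

lemma tendsto_mean_square_P_fun:
  assumes chi: "chi \<in> dchars q" and q: "q > 0" and k: "k \<ge> 1"
    and r: "filterlim r at_top sequentially"
    and mertens: "(\<lambda>j. (\<Prod>p | prime p \<and> p \<le> r j. 1 - 1 / real p) * (exp euler_mascheroni * ln (real (r j)))) \<longlonglongrightarrow> 1"
    and \<epsilon>: "\<epsilon> > 0"
  shows "eventually (\<lambda>j. eventually (\<lambda>T. \<bar>mean_square (P_tuple q (real (r j)) (single_tuple k chi)) T /
     (exp euler_mascheroni * ln (real (r j))) ^ (k\<^sup>2) - euler_const k q\<bar> < \<epsilon>) at_top) sequentially"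
proof -
  define D where "D N = (exp euler_mascheroni * ln (real N)) ^ (k\<^sup>2)" for N :: nat
  define c where "c N = coprime_mean k q N / D N" for N
  define \<tau> where "\<tau> N = 2 * real k * ramified_error q N" for N
  define V where "V N = (\<Prod>p | prime p \<and> p \<le> N. 1 - 1 / real p)" for N :: nat
  have Vpos: "V N > 0" for N
    unfolding V_def
  proof (rule prod_pos)
    fix p assume "p \<in> {p. prime p \<and> p \<le> N}"
    hence "real p > 1" using prime_gt_1_nat by auto
    thus "0 < 1 - 1 / real p" by simp
  qed
  have "(\<lambda>j. (coprime_mean k q (r j) * V (r j) ^ (k\<^sup>2)) / (V (r j) * (exp euler_mascheroni * ln (real (r j)))) ^ (k\<^sup>2)) \<longlonglongrightarrow> euler_const k q / 1 ^ (k\<^sup>2)"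
    using filterlim_compose[OF coprime_mean_limit(1)[OF k q] r] mertens unfolding V_def
    by (intro tendsto_divide tendsto_power) auto
  moreover have "(coprime_mean k q (r j) * V (r j) ^ (k\<^sup>2)) / (V (r j) * (exp euler_mascheroni * ln (real (r j)))) ^ (k\<^sup>2) = c (r j)" for j
    using Vpos[of "r j"] unfolding c_def D_def power_mult_distrib by simp
  ultimately have c: "(\<lambda>j. c (r j)) \<longlonglongrightarrow> euler_const k q" by simp
  have "\<tau> \<longlonglongrightarrow> 2 * real k * 0" unfolding \<tau>_def by (intro tendsto_mult tendsto_const ramified_error_tendsto_0 q)
  hence "(\<lambda>j. \<tau> (r j)) \<longlonglongrightarrow> 0" using filterlim_compose[OF _ r] by simp
  hence \<tau>: "(\<lambda>j. \<tau> (r j)) \<longlonglongrightarrow> 0" .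
  have up: "(\<lambda>j. exp (\<tau> (r j)) * c (r j)) \<longlonglongrightarrow> exp 0 * euler_const k q"
    by (intro tendsto_mult tendsto_exp \<tau> c)
  have lo: "(\<lambda>j. exp (- \<tau> (r j)) * c (r j)) \<longlonglongrightarrow> exp (- 0) * euler_const k q"
    by (intro tendsto_mult tendsto_exp tendsto_minus \<tau> c)
  have "eventually (\<lambda>j. exp (\<tau> (r j)) * c (r j) < euler_const k q + \<epsilon>) sequentially"
    using order_tendstoD(2)[OF up] \<epsilon> by simp
  moreover have "eventually (\<lambda>j. exp (- \<tau> (r j)) * c (r j) > euler_const k q - \<epsilon>) sequentially"
    using order_tendstoD(1)[OF lo] \<epsilon> by simp
  moreover have "eventually (\<lambda>j. r j \<ge> max q 3) sequentially" using r[unfolded filterlim_at_top, rule_format, of "max q 3"] .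
  ultimately show ?thesis
  proof eventually_elim
    case (elim j)
    define N where "N = r j"
    have N: "N \<ge> q" "N \<ge> 3" using elim(3) by (auto simp: N_def)
    have "ln (real N) > 0" using N by simp
    hence D: "D N > 0" by (simp add: D_def)
    define Q where "Q t = (\<Prod>p | prime p \<and> p \<le> N \<and> \<not> p dvd q. trunc_log_exp (prime_exp p N) (local_arg q chi (Complex (1/2) t) p) ^ k)" for t
    define P where "P t = P_fun q (real N) chi (Complex (1/2) t) ^ k" for t
    note PQ = P_fun_mean_bounds[OF chi q k N(1), folded Q_def P_def \<tau>_def]
    define mQ where "mQ T = 1 / T * integral {T..2*T} (\<lambda>t. (norm (Q t))\<^sup>2)" for T
    have mQ: "(mQ \<longlongrightarrow> coprime_mean k q N) at_top"
      unfolding mQ_def by (rule dirichlet_rep_bohr_mean[OF PQ(4)])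
    have ms: "mean_square (P_tuple q (real N) (single_tuple k chi)) T = 1 / T * integral {T..2*T} (\<lambda>t. (norm (P t))\<^sup>2)" for T
      unfolding mean_square_def P_tuple_def P_def by (subst prod_single_tuple[OF finite_dchars[OF q] chi]) simp
    have "((\<lambda>T. exp (\<tau> N) * mQ T / D N) \<longlongrightarrow> exp (\<tau> N) * coprime_mean k q N / D N) at_top"
      by (intro tendsto_intros mQ) (use D in auto)
    hence e1: "eventually (\<lambda>T. exp (\<tau> N) * mQ T / D N < euler_const k q + \<epsilon>) at_top"
      using elim(1) by (intro order_tendstoD(2)) (auto simp: c_def N_def)
    have "((\<lambda>T. exp (- \<tau> N) * mQ T / D N) \<longlongrightarrow> exp (- \<tau> N) * coprime_mean k q N / D N) at_top"
      by (intro tendsto_intros mQ) (use D in auto)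
    hence e2: "eventually (\<lambda>T. exp (- \<tau> N) * mQ T / D N > euler_const k q - \<epsilon>) at_top"
      using elim(2) by (intro order_tendstoD(1)) (auto simp: c_def N_def)
    have "eventually (\<lambda>T. \<bar>mean_square (P_tuple q (real N) (single_tuple k chi)) T / D N - euler_const k q\<bar> < \<epsilon>) at_top"
      using e1 e2 eventually_gt_at_top[of 0]
    proof eventually_elim
      case (elim T)
      have cQ: "continuous_on {T..2*T} Q" by (rule dirichlet_rep_continuous[OF PQ(4)])
      have iP: "(\<lambda>t. (norm (P t))\<^sup>2) integrable_on {T..2*T}" by (intro integrable_continuous_real continuous_intros PQ(1))
      have iQ: "(\<lambda>t. c * (norm (Q t))\<^sup>2) integrable_on {T..2*T}" for c by (intro integrable_continuous_real continuous_intros cQ)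
      have "integral {T..2*T} (\<lambda>t. (norm (P t))\<^sup>2) \<le> integral {T..2*T} (\<lambda>t. exp (\<tau> N) * (norm (Q t))\<^sup>2)"
        by (rule integral_le[OF iP iQ]) (rule PQ(3))
      hence "mean_square (P_tuple q (real N) (single_tuple k chi)) T \<le> exp (\<tau> N) * mQ T"
        unfolding ms mQ_def using elim(3) by (simp add: divide_right_mono)
      hence "mean_square (P_tuple q (real N) (single_tuple k chi)) T / D N \<le> exp (\<tau> N) * mQ T / D N"
        using D by (intro divide_right_mono) auto
      moreover have "integral {T..2*T} (\<lambda>t. exp (- \<tau> N) * (norm (Q t))\<^sup>2) \<le> integral {T..2*T} (\<lambda>t. (norm (P t))\<^sup>2)"
        by (rule integral_le[OF iQ iP]) (rule PQ(2))
      hence "exp (- \<tau> N) * mQ T \<le> mean_square (P_tuple q (real N) (single_tuple k chi)) T"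
        unfolding ms mQ_def using elim(3) by (simp add: divide_right_mono)
      hence "exp (- \<tau> N) * mQ T / D N \<le> mean_square (P_tuple q (real N) (single_tuple k chi)) T / D N"
        using D by (intro divide_right_mono) auto
      ultimately show ?case using elim by linarith
    qed
    thus ?case unfolding N_def D_def .
  qed
qed

text \<open>For a fixed cutoff all products and sums are finite and each term has modulus
  independent of \<open>t\<close>. This crude bound is all that the mixed tuples require.\<close>

lemma norm_P_fun_bounded: "\<exists>B\<ge>0. \<forall>t. norm (P_fun q X chi (Complex (1/2) t)) \<le> B"
proof -
  define w where "w n = prim_char q chi n" for n
  define f where "f n = norm (w n) * norm (mangoldt n :: complex) / (real n powr (1/2) * \<bar>ln (real n)\<bar>)" for n
  define B where "B = (\<Prod>p | prime p \<and> p dvd q. 1 + norm (w p) * real p powr (-(1/2))) * exp (\<Sum>n\<in>{n. 1 \<le> n \<and> real n \<le> X}. f n)"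
  have "norm (P_fun q X chi (Complex (1/2) t)) \<le> B" for t
    unfolding P_fun_def norm_mult w_def[symmetric] B_def
  proof (intro mult_mono)
    have np: "norm (of_nat n powr z :: complex) = real n powr Re z" if "n > 0" for n z
      using norm_of_real_powr[of "real n" z] that by simp
    show "norm (\<Prod>p | prime p \<and> p dvd q. 1 - w p * of_nat p powr (- Complex (1/2) t)) \<le> (\<Prod>p | prime p \<and> p dvd q. 1 + norm (w p) * real p powr (-(1/2)))"
      unfolding prod_norm[symmetric]
    proof (intro prod_mono conjI norm_ge_zero)
      fix p assume "p \<in> {p. prime p \<and> p dvd q}"
      hence p: "p > 0" using prime_gt_0_nat by auto
      have "norm (1 - w p * of_nat p powr (- Complex (1/2) t)) \<le> norm (1::complex) + norm (w p * of_nat p powr (- Complex (1/2) t))"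
        by (rule norm_triangle_ineq4)
      thus "norm (1 - w p * of_nat p powr (- Complex (1/2) t)) \<le> 1 + norm (w p) * real p powr (-(1/2))"
        by (simp add: norm_mult np[OF p])
    qed
    have "norm (\<Sum>n\<in>{n. 1 \<le> n \<and> real n \<le> X}. w n * mangoldt n / (of_nat n powr (Complex (1/2) t) * of_real (ln (real n)))) \<le> (\<Sum>n\<in>{n. 1 \<le> n \<and> real n \<le> X}. f n)"
    proof (rule sum_norm_le)
      fix n assume "n \<in> {n. 1 \<le> n \<and> real n \<le> X}"
      hence n: "n > 0" by auto
      show "norm (w n * mangoldt n / (of_nat n powr (Complex (1/2) t) * of_real (ln (real n)))) \<le> f n"
        unfolding f_def norm_divide norm_mult np[OF n] by simp
    qed
    thus "norm (exp (\<Sum>n\<in>{n. 1 \<le> n \<and> real n \<le> X}. w n * mangoldt n / (of_nat n powr (Complex (1/2) t) * of_real (ln (real n))))) \<le> exp (\<Sum>n\<in>{n. 1 \<le> n \<and> real n \<le> X}. f n)"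
      by (intro order_trans[OF norm_exp]) simp
  qed (auto intro!: prod_nonneg)
  moreover have "B \<ge> 0" unfolding B_def by (intro mult_nonneg_nonneg prod_nonneg) auto
  ultimately show ?thesis by blast
qed

lemma mean_square_P_tuple_bounded:
  assumes q: "q > 0"
  shows "\<exists>B. \<forall>T>0. mean_square (P_tuple q X l) T \<le> B"
proof -
  have "\<forall>chi. \<exists>B\<ge>0. \<forall>t. norm (P_fun q X chi (Complex (1/2) t)) \<le> B" using norm_P_fun_bounded by blast
  then obtain B where B: "\<And>chi. B chi \<ge> 0" "\<And>chi t. norm (P_fun q X chi (Complex (1/2) t)) \<le> B chi" by metis
  define C where "C = (\<Prod>chi\<in>dchars q. B chi ^ l chi)"
  have bound: "norm (P_tuple q X l (Complex (1/2) t)) \<le> C" for t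
    unfolding P_tuple_def C_def prod_norm[symmetric] norm_power
    using B by (intro prod_mono conjI zero_le_power power_mono) auto
  have "mean_square (P_tuple q X l) T \<le> C\<^sup>2" if T: "T > 0" for T
  proof (cases "(\<lambda>t. (norm (P_tuple q X l (Complex (1/2) t)))\<^sup>2) integrable_on {T..2*T}")
    case True
    have "integral {T..2*T} (\<lambda>t. (norm (P_tuple q X l (Complex (1/2) t)))\<^sup>2) \<le> integral {T..2*T} (\<lambda>t. C\<^sup>2)"
      using bound by (intro integral_le[OF True]) (auto intro!: power_mono)
    thus ?thesis using T by (simp add: mean_square_def divide_le_eq mult.commute)
  \<comment> \<open>In the remaining case the integral has the default value 0.\<close>
  qed (simp add: mean_square_def not_integrable_integral)
  thus ?thesis by blast
qed

text \<open>Diagonal argument: \<open>X T\<close> runs through good cutoffs so slowly that at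
  \<open>T\<close> the mean square for the current cutoff is already near its limit,
  \<open>X T \<le> ln T\<close> holds, and every bound depending on the cutoff alone has fallen
  below \<open>sqrt (ln T)\<close>. Finiteness of \<open>L\<close> lets a single cutoff serve all
  the tuples.\<close>

lemma exists_slow_cutoff:
  assumes q: "q > 0" and k: "k \<ge> 1" and L: "finite L"
  obtains X :: "real \<Rightarrow> real" where "filterlim X at_top at_top" "eventually (\<lambda>T. X T \<le> ln T) at_top"
    "\<And>chi. chi \<in> dchars q \<Longrightarrow> ((\<lambda>T. mean_square (P_tuple q (X T) (single_tuple k chi)) T / (exp euler_mascheroni * ln (X T)) ^ (k\<^sup>2)) \<longlongrightarrow> euler_const k q) at_top"
    "\<And>l. l \<in> L \<Longrightarrow> eventually (\<lambda>T. mean_square (P_tuple q (X T) l) T \<le> sqrt (ln T)) at_top"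
proof -
  obtain r :: "nat \<Rightarrow> nat" where r: "filterlim r at_top sequentially"
    "(\<lambda>j. (\<Prod>p | prime p \<and> p \<le> r j. 1 - 1 / real p) * (exp euler_mascheroni * ln (real (r j)))) \<longlonglongrightarrow> 1"
    using mertens_subsequence by blast
  define R where "R j chi T = mean_square (P_tuple q (real (r j)) (single_tuple k chi)) T / (exp euler_mascheroni * ln (real (r j))) ^ (k\<^sup>2)" for j chi T
  have "\<exists>j\<ge>i. \<forall>chi\<in>dchars q. eventually (\<lambda>T. \<bar>R j chi T - euler_const k q\<bar> < 1 / real (Suc i)) at_top" for i
  proof -
    have "eventually (\<lambda>j. \<forall>chi\<in>dchars q. eventually (\<lambda>T. \<bar>R j chi T - euler_const k q\<bar> < 1 / real (Suc i)) at_top) sequentially"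
      unfolding R_def by (intro eventually_ball_finite finite_dchars[OF q] ballI tendsto_mean_square_P_fun q k r) auto
    from eventually_happens'[OF sequentially_bot eventually_conj[OF this eventually_ge_at_top[of i]]] show ?thesis
      by blast
  qed
  then obtain s where s: "\<And>i. s i \<ge> i" "\<And>i chi. chi \<in> dchars q \<Longrightarrow> eventually (\<lambda>T. \<bar>R (s i) chi T - euler_const k q\<bar> < 1 / real (Suc i)) at_top"
    by metis
  define Q where "Q i T \<longleftrightarrow> (\<forall>chi\<in>dchars q. \<bar>R (s i) chi T - euler_const k q\<bar> < 1 / real (Suc i)) \<and> real (r (s i)) \<le> ln T \<and>
     (\<forall>l\<in>L. mean_square (P_tuple q (real (r (s i))) l) T \<le> sqrt (ln T))" for i T
  have Q: "eventually (Q i) at_top" for i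
    unfolding Q_def
  proof (intro eventually_conj eventually_ball_finite finite_dchars[OF q] L ballI s(2))
    show "eventually (\<lambda>T. real (r (s i)) \<le> ln T) at_top"
      using ln_at_top unfolding filterlim_at_top by blast
    fix l assume "l \<in> L"
    obtain B where B: "\<And>T. T > 0 \<Longrightarrow> mean_square (P_tuple q (real (r (s i))) l) T \<le> B"
      using mean_square_P_tuple_bounded[OF q] by blast
    have "filterlim (\<lambda>T::real. sqrt (ln T)) at_top at_top" by real_asymp
    hence "eventually (\<lambda>T. B \<le> sqrt (ln T)) at_top" unfolding filterlim_at_top by blast
    thus "eventually (\<lambda>T. mean_square (P_tuple q (real (r (s i))) l) T \<le> sqrt (ln T)) at_top"
      using eventually_gt_at_top[of 0]
    proof eventually_elim
      case (elim T)
      thus ?case using B[of T] by linarith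
    qed
  qed
  obtain J where J: "filterlim J at_top at_top" "eventually (\<lambda>T. Q (J T) T) at_top"
    by (rule eventually_diagonal[of Q, OF Q])
  show ?thesis
  proof (rule that[of "\<lambda>T. real (r (s (J T)))"])
    have "filterlim s at_top sequentially"
      using s(1) by (intro filterlim_at_top_mono[OF filterlim_ident]) auto
    from filterlim_compose[OF r(1) this] have "filterlim (\<lambda>i. r (s i)) at_top sequentially" .
    from filterlim_compose[OF filterlim_real_sequentially filterlim_compose[OF this J(1)]]
    show "filterlim (\<lambda>T. real (r (s (J T)))) at_top at_top" .
    show "eventually (\<lambda>T. real (r (s (J T))) \<le> ln T) at_top"
      using J(2) by eventually_elim (simp add: Q_def)
    show "eventually (\<lambda>T. mean_square (P_tuple q (real (r (s (J T)))) l) T \<le> sqrt (ln T)) at_top" if "l \<in> L" for l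
      using J(2) by eventually_elim (use that in \<open>simp add: Q_def\<close>)
    fix chi assume chi: "chi \<in> dchars q"
    have "((\<lambda>T. R (s (J T)) chi T - euler_const k q) \<longlongrightarrow> 0) at_top"
    proof (rule Lim_null_comparison)
      show "eventually (\<lambda>T. norm (R (s (J T)) chi T - euler_const k q) \<le> 1 / real (Suc (J T))) at_top"
        using J(2) by eventually_elim (use chi in \<open>auto simp: Q_def intro: less_imp_le\<close>)
      show "((\<lambda>T. 1 / real (Suc (J T))) \<longlongrightarrow> 0) at_top"
        by (rule filterlim_compose[OF LIMSEQ_Suc[OF lim_1_over_n] J(1)])
    qed
    thus "((\<lambda>T. mean_square (P_tuple q (real (r (s (J T)))) (single_tuple k chi)) T / (exp euler_mascheroni * ln (real (r (s (J T))))) ^ (k\<^sup>2)) \<longlongrightarrow> euler_const k q) at_top"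
      unfolding R_def by (simp add: LIM_zero_iff)
  qed
qed

section \<open>Mean squares of products of L-functions\<close>

definition random_matrix_factor :: "nat \<Rightarrow> char_tuple \<Rightarrow> real \<Rightarrow> real \<Rightarrow> real" where
  "random_matrix_factor q l X T = (\<Prod>chi\<in>dchars q.
        barnes_G (real (l chi) + 1) ^ 2 / barnes_G (2 * real (l chi) + 1) *
        (ln (real (conductor q chi) * T) / (exp euler_mascheroni * ln X)) ^ ((l chi)\<^sup>2))"

text \<open>\<open>X T \<le> ln T\<close> places \<open>(X T, T)\<close> in
  \<open>XT_range 1 1\<close>, so the hypotheses, instantiated with \<open>\<epsilon> = 1\<close>
  and \<open>C = 1\<close>, can be composed with the path of \<open>T\<close>.\<close>

lemma mean_square_L_asymp:
  assumes "splitting_hypothesis f q l" "random_matrix_hypothesis f q l"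
    and X: "filterlim X at_top at_top" "eventually (\<lambda>T. X T \<le> ln T) at_top"
  shows "(\<lambda>T. mean_square (L_tuple q l) T) \<sim>[at_top]
         (\<lambda>T. mean_square (P_tuple q (X T) l) T * random_matrix_factor q l (X T) T)"
proof -
  have lim: "filterlim (\<lambda>T. (X T, T)) (XT_range 1 1) at_top"
    unfolding XT_range_def filterlim_inf filterlim_principal
  proof
    show "filterlim (\<lambda>T. (X T, T)) (at_top \<times>\<^sub>F at_top) at_top"
      by (intro filterlim_Pair X(1) filterlim_ident)
    show "eventually (\<lambda>T. (X T, T) \<in> {(X, T). X \<le> 1 * ln T powr (2 - 1)}) at_top"
      using X(2) eventually_gt_at_top[of 1] by eventually_elim simp
  qed
  have s: "(\<lambda>(X, T). mean_square (L_tuple q l) T) \<sim>[XT_range 1 1]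
     (\<lambda>(X, T). mean_square (P_tuple q X l) T * mean_square (Z_tuple f q X l) T)"
    using assms(1) unfolding splitting_hypothesis_def by simp
  have z: "(\<lambda>(X, T). mean_square (Z_tuple f q X l) T) \<sim>[XT_range 1 1] (\<lambda>(X, T). random_matrix_factor q l X T)"
    using assms(2) unfolding random_matrix_hypothesis_def random_matrix_factor_def by simp
  have "(\<lambda>T. mean_square (L_tuple q l) T) \<sim>[at_top]
     (\<lambda>T. mean_square (P_tuple q (X T) l) T * mean_square (Z_tuple f q (X T) l) T)"
    using asymp_equiv_compose'[OF s lim] by simp
  also have "\<dots> \<sim>[at_top] (\<lambda>T. mean_square (P_tuple q (X T) l) T * random_matrix_factor q l (X T) T)"
    using asymp_equiv_compose'[OF z lim] by (intro asymp_equiv_mult asymp_equiv_refl) simp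
  finally show ?thesis .
qed

lemma random_matrix_factor_single:
  assumes "finite (dchars q)" "chi0 \<in> dchars q"
  shows "random_matrix_factor q (single_tuple k chi0) X T =
    barnes_G (real k + 1) ^ 2 / barnes_G (2 * real k + 1) *
    (ln (real (conductor q chi0) * T) / (exp euler_mascheroni * ln X)) ^ (k\<^sup>2)"
proof -
  have "random_matrix_factor q (single_tuple k chi0) X T = (\<Prod>chi\<in>dchars q. if chi = chi0 then
    barnes_G (real k + 1) ^ 2 / barnes_G (2 * real k + 1) *
    (ln (real (conductor q chi0) * T) / (exp euler_mascheroni * ln X)) ^ (k\<^sup>2) else 1)"
    unfolding random_matrix_factor_def by (intro prod.cong refl) (auto simp: single_tuple_def barnes_G_1)
  thus ?thesis using assms by simp
qed

lemma random_matrix_factor_mixed: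
  assumes "finite (dchars q)" "chi1 \<in> dchars q" "chi2 \<in> dchars q" "chi1 \<noteq> chi2"
  shows "random_matrix_factor q (mixed_tuple k chi1 chi2) X T =
    barnes_G (real (k - 1) + 1) ^ 2 / barnes_G (2 * real (k - 1) + 1) *
    (ln (real (conductor q chi1) * T) / (exp euler_mascheroni * ln X)) ^ ((k - 1)\<^sup>2) *
    (ln (real (conductor q chi2) * T) / (exp euler_mascheroni * ln X))"
proof -
  \<comment> \<open>Thus the Barnes quotient for the entry 1 at \<open>chi2\<close> is 1.\<close>
  have B: "(barnes_G 2)\<^sup>2 = barnes_G 3" "barnes_G 3 \<noteq> 0"
    using barnes_G_2_3 by (auto simp: field_simps)
  have "random_matrix_factor q (mixed_tuple k chi1 chi2) X T = (\<Prod>chi\<in>dchars q. (if chi = chi1 then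
    barnes_G (real (k - 1) + 1) ^ 2 / barnes_G (2 * real (k - 1) + 1) *
    (ln (real (conductor q chi1) * T) / (exp euler_mascheroni * ln X)) ^ ((k - 1)\<^sup>2) else 1) *
    (if chi = chi2 then ln (real (conductor q chi2) * T) / (exp euler_mascheroni * ln X) else 1))"
    unfolding random_matrix_factor_def using assms(4)
    by (intro prod.cong refl) (auto simp: mixed_tuple_def barnes_G_1 B)
  thus ?thesis using assms by (simp add: prod.distrib)
qed

lemma ln_mult_ratio_tendsto_1:
  assumes "c > (0::real)"
  shows "((\<lambda>T. ln (c * T) / ln T) \<longlongrightarrow> 1) at_top"
  using assms by real_asymp

lemma barnes_ratio_pos: "barnes_G (real k + 1) ^ 2 / barnes_G (2 * real k + 1) > 0"
  using barnes_G_pos[of k] barnes_G_pos[of "2 * k"] by simp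

text \<open>The powers of \<open>exp euler_mascheroni * ln (X T)\<close> in the two factors cancel,
  and the conductor disappears because \<open>ln (d * T)\<close> is asymptotic to
  \<open>ln T\<close>.\<close>

lemma mean_square_L_single:
  assumes q: "q > 0" and chi: "chi \<in> dchars q"
    and hyp: "splitting_hypothesis f q (single_tuple k chi)" "random_matrix_hypothesis f q (single_tuple k chi)"
    and X: "filterlim X at_top at_top" "eventually (\<lambda>T. X T \<le> ln T) at_top"
    and P: "((\<lambda>T. mean_square (P_tuple q (X T) (single_tuple k chi)) T / (exp euler_mascheroni * ln (X T)) ^ (k\<^sup>2)) \<longlongrightarrow> E) at_top"
  shows "((\<lambda>T. mean_square (L_tuple q (single_tuple k chi)) T / ln T ^ (k\<^sup>2)) \<longlongrightarrow>
    barnes_G (real k + 1) ^ 2 / barnes_G (2 * real k + 1) * E) at_top"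
proof -
  define c where "c = barnes_G (real k + 1) ^ 2 / barnes_G (2 * real k + 1)"
  define d where "d = real (conductor q chi)"
  have d: "d > 0" using prim_char(1)[OF chi q] by (simp add: d_def)
  have "((\<lambda>T. c * (mean_square (P_tuple q (X T) (single_tuple k chi)) T / (exp euler_mascheroni * ln (X T)) ^ (k\<^sup>2)) *
      (ln (d * T) / ln T) ^ (k\<^sup>2)) \<longlongrightarrow> c * E * 1 ^ (k\<^sup>2)) at_top"
    by (intro tendsto_mult tendsto_const P tendsto_power ln_mult_ratio_tendsto_1 d)
  hence "((\<lambda>T. mean_square (P_tuple q (X T) (single_tuple k chi)) T *
      random_matrix_factor q (single_tuple k chi) (X T) T / ln T ^ (k\<^sup>2)) \<longlongrightarrow> c * E) at_top"
    unfolding random_matrix_factor_single[OF finite_dchars[OF q] chi] c_def[symmetric] d_def[symmetric]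
    by (simp add: power_divide mult_ac)
  thus ?thesis unfolding c_def[symmetric]
    by (rule asymp_equiv_tendsto_transfer[rotated])
       (intro asymp_equiv_divide asymp_equiv_refl asymp_equiv_symI[OF mean_square_L_asymp[OF hyp X]])
qed

lemma mean_square_nonneg: "T > 0 \<Longrightarrow> mean_square F T \<ge> 0"
  by (cases "(\<lambda>t. (norm (F (Complex (1/2) t)))\<^sup>2) integrable_on {T..2*T}")
     (auto simp: mean_square_def not_integrable_integral intro!: divide_nonneg_pos integral_nonneg)

text \<open>Upper bounds suffice. The divisors \<open>e * ln (X T)\<close> are at least 1 and may be
  dropped, \<open>P_tuple\<close> costs \<open>sqrt (ln T)\<close>, and the logarithms have total
  order \<open>(k - 1)\<^sup>2 + 1 \<le> k\<^sup>2 - 1\<close>. The quotient is therefore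
  \<open>O(1 / sqrt (ln T))\<close>.\<close>

lemma mean_square_L_mixed:
  assumes q: "q > 0" and chi: "chi1 \<in> dchars q" "chi2 \<in> dchars q" "chi1 \<noteq> chi2" and k: "k \<ge> 2"
    and hyp: "splitting_hypothesis f q (mixed_tuple k chi1 chi2)" "random_matrix_hypothesis f q (mixed_tuple k chi1 chi2)"
    and X: "filterlim X at_top at_top" "eventually (\<lambda>T. X T \<le> ln T) at_top"
    and P: "eventually (\<lambda>T. mean_square (P_tuple q (X T) (mixed_tuple k chi1 chi2)) T \<le> sqrt (ln T)) at_top"
  shows "((\<lambda>T. mean_square (L_tuple q (mixed_tuple k chi1 chi2)) T / ln T ^ (k\<^sup>2)) \<longlongrightarrow> 0) at_top"
proof -
  define c where "c = barnes_G (real (k - 1) + 1) ^ 2 / barnes_G (2 * real (k - 1) + 1)"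
  define d1 where "d1 = real (conductor q chi1)"
  define d2 where "d2 = real (conductor q chi2)"
  define m where "m = (k - 1)\<^sup>2"
  define l where "l = mixed_tuple k chi1 chi2"
  define e :: real where "e = exp euler_mascheroni"
  have d: "d1 \<ge> 1" "d2 \<ge> 1"
    using prim_char(1)[OF chi(1) q] prim_char(1)[OF chi(2) q] by (simp_all add: d1_def d2_def)
  have c: "c > 0" unfolding c_def by (rule barnes_ratio_pos)
  have e: "e \<ge> 1" using euler_mascheroni_pos by (simp add: e_def)
  obtain i where i: "k = i + 2" using k by (metis add.commute le_Suc_ex)
  have mk: "m + 2 \<le> k\<^sup>2" unfolding m_def i by (simp add: power2_eq_square algebra_simps)
  have "((\<lambda>T. mean_square (P_tuple q (X T) l) T * random_matrix_factor q l (X T) T / ln T ^ (k\<^sup>2)) \<longlongrightarrow> 0) at_top"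
  proof (rule Lim_null_comparison)
    have "((\<lambda>T::real. c * (ln (d1 * T) / ln T) ^ m * (ln (d2 * T) / ln T) * (sqrt (ln T) / ln T)) \<longlongrightarrow> c * 1 ^ m * 1 * 0) at_top"
    proof (intro tendsto_mult tendsto_const tendsto_power ln_mult_ratio_tendsto_1)
      show "((\<lambda>T::real. sqrt (ln T) / ln T) \<longlongrightarrow> 0) at_top" by real_asymp
    qed (use d in auto)
    thus "((\<lambda>T::real. c * (ln (d1 * T) / ln T) ^ m * (ln (d2 * T) / ln T) * (sqrt (ln T) / ln T)) \<longlongrightarrow> 0) at_top" by simp
    have "eventually (\<lambda>T. X T \<ge> exp 1) at_top" using X(1) unfolding filterlim_at_top by blast
    thus "eventually (\<lambda>T. norm (mean_square (P_tuple q (X T) l) T * random_matrix_factor q l (X T) T / ln T ^ (k\<^sup>2)) \<le>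
       c * (ln (d1 * T) / ln T) ^ m * (ln (d2 * T) / ln T) * (sqrt (ln T) / ln T)) at_top"
      using P eventually_ge_at_top[of "exp 1"]
    proof eventually_elim
      case (elim T)
      have T: "T \<ge> 1" using elim(3) exp_ge_add_one_self[of 1] by linarith
      hence lT: "ln T \<ge> 1" using elim(3) by (subst ln_ge_iff) auto
      have "X T > 0" using elim(1) by (rule less_le_trans[rotated]) simp
      hence lX: "ln (X T) \<ge> 1" using elim(1) by (subst ln_ge_iff) auto
      have eX: "e * ln (X T) \<ge> 1" using mult_mono[OF e lX] e by simp
      have nn: "ln (d1 * T) \<ge> 0" "ln (d2 * T) \<ge> 0"
        using mult_mono[OF d(1) T] mult_mono[OF d(2) T] d by simp_all
      have le: "x / (e * ln (X T)) \<le> x" if "x \<ge> 0" for x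
        using mult_left_mono[OF eX that] eX by (subst divide_le_eq) auto
      define A where "A = (ln (d1 * T) / (e * ln (X T))) ^ m"
      define B where "B = ln (d2 * T) / (e * ln (X T))"
      have A: "0 \<le> A" "A \<le> ln (d1 * T) ^ m"
        unfolding A_def using nn eX le[OF nn(1)] by (auto intro!: power_mono zero_le_power divide_nonneg_nonneg)
      have B: "0 \<le> B" "B \<le> ln (d2 * T)"
        unfolding B_def using nn eX le[OF nn(2)] by (auto intro!: divide_nonneg_nonneg)
      have r: "random_matrix_factor q l (X T) T = c * A * B"
        unfolding l_def random_matrix_factor_mixed[OF finite_dchars[OF q] chi] c_def A_def B_def d1_def d2_def e_def m_def ..
      have r2: "0 \<le> c * A * B" "c * A * B \<le> c * ln (d1 * T) ^ m * ln (d2 * T)"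
        using A B c nn by (auto intro!: mult_mono mult_nonneg_nonneg)
      have p: "0 \<le> mean_square (P_tuple q (X T) l) T" using T by (intro mean_square_nonneg) auto
      have p2: "mean_square (P_tuple q (X T) l) T \<le> sqrt (ln T)" using elim(2) by (simp add: l_def)
      have "mean_square (P_tuple q (X T) l) T * (c * A * B) \<le> sqrt (ln T) * (c * ln (d1 * T) ^ m * ln (d2 * T))"
        by (rule mult_mono[OF p2 r2(2) _ r2(1)]) (use lT in simp)
      moreover have "ln T ^ (m + 2) \<le> ln T ^ (k\<^sup>2)" using mk lT by (rule power_increasing)
      moreover have "0 \<le> sqrt (ln T) * (c * ln (d1 * T) ^ m * ln (d2 * T))" using nn c lT by simp
      ultimately have "mean_square (P_tuple q (X T) l) T * (c * A * B) / ln T ^ (k\<^sup>2) \<le> sqrt (ln T) * (c * ln (d1 * T) ^ m * ln (d2 * T)) / ln T ^ (m + 2)"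
        using lT p r2(1) by (intro frac_le) auto
      also have "\<dots> = c * (ln (d1 * T) / ln T) ^ m * (ln (d2 * T) / ln T) * (sqrt (ln T) / ln T)"
        using lT by (simp add: power_divide power_add power2_eq_square mult_ac)
      finally show ?case unfolding r using p r2(1) lT by simp
    qed
  qed
  thus ?thesis unfolding l_def[symmetric]
    by (rule asymp_equiv_tendsto_transfer[rotated])
       (use hyp in \<open>intro asymp_equiv_divide asymp_equiv_refl asymp_equiv_symI[OF mean_square_L_asymp[OF _ _ X]], simp_all add: l_def\<close>)
qed

text \<open>The weights do not affect the moduli, so every character contributes the same limit, and
  \<open>totient q\<close> counts the characters. The constant \<open>C\<close> of the cross terms
  depends on \<open>\<epsilon>\<close>, but \<open>\<epsilon>\<close> is fixed while the cross terms
  tend to 0.\<close>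

lemma moment_dirichlet_sum:
  assumes q: "q > 0" and k: "k \<ge> 2" and w: "\<And>chi. chi \<in> dchars q \<Longrightarrow> norm (w chi :: complex) = 1"
    and hyp: "\<And>l. tuple_size q l = k \<Longrightarrow> splitting_hypothesis f q l" "\<And>l. tuple_size q l = k \<Longrightarrow> random_matrix_hypothesis f q l"
  shows "((\<lambda>T. integral {T..2*T} (\<lambda>t. norm (\<Sum>chi\<in>dchars q. w chi * dirichlet_L chi (Complex (1/2) t)) ^ (2 * k)) / (T * ln T ^ (k\<^sup>2)))
     \<longlongrightarrow> real (totient q) * (barnes_G (real k + 1) ^ 2 / barnes_G (2 * real k + 1) * euler_const k q)) at_top"
proof -
  define E where "E = barnes_G (real k + 1) ^ 2 / barnes_G (2 * real k + 1) * euler_const k q"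
  define D where "D = dchars q"
  have fin: "finite D" unfolding D_def by (rule finite_dchars[OF q])
  \<comment> \<open>A single cutoff has to serve all mixed tuples. Equal pairs are included, though
    only distinct ones occur later.\<close>
  define S where "S = (\<lambda>(chi1, chi2). mixed_tuple k chi1 chi2) ` (D \<times> D)"
  have S: "finite S" using fin by (simp add: S_def)
  have k1: "k \<ge> 1" using k by simp
  obtain X where X: "filterlim X at_top at_top" "eventually (\<lambda>T. X T \<le> ln T) at_top"
    "\<And>chi. chi \<in> dchars q \<Longrightarrow> ((\<lambda>T. mean_square (P_tuple q (X T) (single_tuple k chi)) T / (exp euler_mascheroni * ln (X T)) ^ (k\<^sup>2)) \<longlongrightarrow> euler_const k q) at_top"
    "\<And>l. l \<in> S \<Longrightarrow> eventually (\<lambda>T. mean_square (P_tuple q (X T) l) T \<le> sqrt (ln T)) at_top"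
    using exists_slow_cutoff[OF q k1 S] by blast
  define L where "L chi t = dirichlet_L chi (Complex (1/2) t)" for chi t
  define z where "z t chi = w chi * L chi t" for t chi
  have nz: "norm (z t chi) = norm (L chi t)" if "chi \<in> D" for t chi
    using w that by (simp add: z_def norm_mult D_def)
  define Y where "Y chi T = integral {T..2*T} (\<lambda>t. norm (L chi t) ^ (2 * k)) / (T * ln T ^ (k\<^sup>2))" for chi T
  define M where "M chi1 chi2 T = integral {T..2*T} (\<lambda>t. norm (L chi1 t) ^ (2 * (k - 1)) * (norm (L chi2 t))\<^sup>2) / (T * ln T ^ (k\<^sup>2))" for chi1 chi2 T
  define I where "I T = integral {T..2*T} (\<lambda>t. norm (\<Sum>chi\<in>D. z t chi) ^ (2 * k)) / (T * ln T ^ (k\<^sup>2))" for T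
  have Y: "(Y chi \<longlongrightarrow> E) at_top" if chi: "chi \<in> D" for chi
  proof -
    have ts: "tuple_size q (single_tuple k chi) = k" using tuple_size_single fin chi by (simp add: D_def)
    have "((\<lambda>T. mean_square (L_tuple q (single_tuple k chi)) T / ln T ^ (k\<^sup>2)) \<longlongrightarrow> E) at_top"
      unfolding E_def by (rule mean_square_L_single[OF q _ hyp(1)[OF ts] hyp(2)[OF ts] X(1,2) X(3)]) (use chi in \<open>simp_all add: D_def\<close>)
    moreover have "mean_square (L_tuple q (single_tuple k chi)) T / ln T ^ (k\<^sup>2) = Y chi T" for T
      unfolding mean_square_def L_tuple_def Y_def L_def D_def[symmetric] prod_single_tuple[OF fin chi]
      by (simp add: norm_power power_mult[symmetric] mult.commute)
    ultimately show ?thesis by simp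
  qed
  have M: "(M chi1 chi2 \<longlongrightarrow> 0) at_top" if chi: "chi1 \<in> D" "chi2 \<in> D" "chi1 \<noteq> chi2" for chi1 chi2
  proof -
    have ts: "tuple_size q (mixed_tuple k chi1 chi2) = k" using tuple_size_mixed fin chi k1 by (simp add: D_def)
    have "((\<lambda>T. mean_square (L_tuple q (mixed_tuple k chi1 chi2)) T / ln T ^ (k\<^sup>2)) \<longlongrightarrow> 0) at_top"
      by (rule mean_square_L_mixed[OF q _ _ chi(3) k hyp(1)[OF ts] hyp(2)[OF ts] X(1,2) X(4)]) (use chi in \<open>auto simp: D_def S_def\<close>)
    moreover have "mean_square (L_tuple q (mixed_tuple k chi1 chi2)) T / ln T ^ (k\<^sup>2) = M chi1 chi2 T" for T
      unfolding mean_square_def L_tuple_def M_def L_def D_def[symmetric] prod_mixed_tuple[OF fin chi]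
      by (simp add: norm_power norm_mult power_mult_distrib power_mult[symmetric] mult.commute)
    ultimately show ?thesis by simp
  qed
  have contL: "continuous_on A (L chi)" if "chi \<in> D" for A chi
    unfolding L_def using continuous_on_dirichlet_L[OF _ q] that by (simp add: D_def)
  have sumY: "((\<lambda>T. \<Sum>chi\<in>D. Y chi T) \<longlongrightarrow> real (totient q) * E) at_top"
    using tendsto_sum[of D Y "\<lambda>_. E" at_top] Y card_dchars[OF q] by (simp add: D_def)
  have sumM: "((\<lambda>T. \<Sum>chi1\<in>D. \<Sum>chi2\<in>D-{chi1}. M chi1 chi2 T) \<longlongrightarrow> (\<Sum>chi1\<in>D. \<Sum>chi2\<in>D-{chi1}. 0)) at_top"
    by (intro tendsto_sum M) auto
  have bound: "\<exists>C\<ge>0. eventually (\<lambda>T. \<bar>I T - (\<Sum>chi\<in>D. Y chi T)\<bar> \<le> \<epsilon> * (\<Sum>chi\<in>D. Y chi T) + C * (\<Sum>chi1\<in>D. \<Sum>chi2\<in>D-{chi1}. M chi1 chi2 T)) at_top"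
    if \<epsilon>: "\<epsilon> > 0" for \<epsilon>
  proof -
    obtain C where C: "C \<ge> 0" "\<And>z :: (nat \<Rightarrow> complex) \<Rightarrow> complex. \<bar>norm (\<Sum>i\<in>D. z i) ^ (2 * k) - (\<Sum>i\<in>D. norm (z i) ^ (2 * k))\<bar> \<le>
      \<epsilon> * (\<Sum>i\<in>D. norm (z i) ^ (2 * k)) + C * (\<Sum>i\<in>D. \<Sum>j\<in>D-{i}. norm (z i) ^ (2 * (k - 1)) * (norm (z j))\<^sup>2)"
      using norm_sum_power_diff_le[OF fin k \<epsilon>] by blast
    have "eventually (\<lambda>T. \<bar>I T - (\<Sum>chi\<in>D. Y chi T)\<bar> \<le> \<epsilon> * (\<Sum>chi\<in>D. Y chi T) + C * (\<Sum>chi1\<in>D. \<Sum>chi2\<in>D-{chi1}. M chi1 chi2 T)) at_top"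
      using eventually_gt_at_top[of 1]
    proof eventually_elim
      case (elim T)
      define N where "N = T * ln T ^ (k\<^sup>2)"
      have N: "N > 0" using elim by (simp add: N_def)
      define F where "F t = norm (\<Sum>chi\<in>D. z t chi) ^ (2 * k)" for t
      define G where "G t = (\<Sum>chi\<in>D. norm (L chi t) ^ (2 * k))" for t
      define R where "R t = (\<Sum>chi1\<in>D. \<Sum>chi2\<in>D-{chi1}. norm (L chi1 t) ^ (2 * (k - 1)) * (norm (L chi2 t))\<^sup>2)" for t
      have cF: "continuous_on {T..2*T} F" unfolding F_def z_def by (intro continuous_intros contL)
      have cG: "continuous_on {T..2*T} G" unfolding G_def by (intro continuous_intros contL)
      have cR: "continuous_on {T..2*T} R" unfolding R_def by (intro continuous_intros contL) auto
      have pt: "\<bar>F t - G t\<bar> \<le> \<epsilon> * G t + C * R t" for t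
      proof -
        have "(\<Sum>i\<in>D. norm (z t i) ^ (2 * k)) = G t" unfolding G_def by (intro sum.cong refl) (simp add: nz)
        moreover have "(\<Sum>i\<in>D. \<Sum>j\<in>D-{i}. norm (z t i) ^ (2 * (k - 1)) * (norm (z t j))\<^sup>2) = R t"
          unfolding R_def by (intro sum.cong refl) (simp add: nz)
        ultimately show ?thesis using C(2)[of "z t"] unfolding F_def by simp
      qed
      have iG: "integral {T..2*T} G = N * (\<Sum>chi\<in>D. Y chi T)"
        unfolding G_def Y_def N_def[symmetric] sum_distrib_left using N
        by (subst integral_sum) (auto intro!: integrable_continuous_real continuous_intros contL fin)
      have iR: "integral {T..2*T} R = N * (\<Sum>chi1\<in>D. \<Sum>chi2\<in>D-{chi1}. M chi1 chi2 T)"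
      proof -
        have "integral {T..2*T} R = (\<Sum>chi1\<in>D. integral {T..2*T} (\<lambda>t. \<Sum>chi2\<in>D-{chi1}. norm (L chi1 t) ^ (2 * (k - 1)) * (norm (L chi2 t))\<^sup>2))"
          unfolding R_def by (rule integral_sum) (auto intro!: integrable_continuous_real continuous_intros contL fin)
        also have "\<dots> = (\<Sum>chi1\<in>D. \<Sum>chi2\<in>D-{chi1}. integral {T..2*T} (\<lambda>t. norm (L chi1 t) ^ (2 * (k - 1)) * (norm (L chi2 t))\<^sup>2))"
          by (intro sum.cong refl integral_sum) (auto intro!: integrable_continuous_real continuous_intros contL fin)
        also have "\<dots> = N * (\<Sum>chi1\<in>D. \<Sum>chi2\<in>D-{chi1}. M chi1 chi2 T)"
          unfolding sum_distrib_left M_def N_def[symmetric] using N by (intro sum.cong refl) simp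
        finally show ?thesis .
      qed
      have iF: "integral {T..2*T} F = N * I T" using N unfolding I_def N_def[symmetric] F_def[symmetric] by simp
      have "N * \<bar>I T - (\<Sum>chi\<in>D. Y chi T)\<bar> = \<bar>N * I T - N * (\<Sum>chi\<in>D. Y chi T)\<bar>"
        using N by (simp add: abs_mult flip: right_diff_distrib)
      also have "\<dots> = \<bar>integral {T..2*T} (\<lambda>t. F t - G t)\<bar>"
        unfolding iF[symmetric] iG[symmetric] using cF cG by (simp add: integral_diff integrable_continuous_real)
      also have "\<dots> \<le> integral {T..2*T} (\<lambda>t. \<epsilon> * G t + C * R t)"
        using integral_norm_bound_integral[of "\<lambda>t. F t - G t" "{T..2*T}" "\<lambda>t. \<epsilon> * G t + C * R t"] pt cF cG cR
        by (simp add: integrable_continuous_real continuous_on_diff continuous_on_add continuous_on_mult_left)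
      also have "\<dots> = \<epsilon> * integral {T..2*T} G + C * integral {T..2*T} R"
        using cG cR by (subst integral_add) (auto intro!: integrable_continuous_real continuous_intros)
      also have "\<dots> = N * (\<epsilon> * (\<Sum>chi\<in>D. Y chi T) + C * (\<Sum>chi1\<in>D. \<Sum>chi2\<in>D-{chi1}. M chi1 chi2 T))"
        unfolding iG iR by (simp add: algebra_simps)
      finally show ?case using N by (simp only: mult_le_cancel_left_pos)
    qed
    thus ?thesis using C(1) by blast
  qed
  have "((\<lambda>T. I T - (\<Sum>chi\<in>D. Y chi T)) \<longlongrightarrow> 0) at_top"
  proof (rule tendstoI)
    fix e :: real assume e: "e > 0"
    have E0: "real (totient q) * E > 0"
      unfolding E_def using barnes_ratio_pos[of k] coprime_mean_limit(2)[OF k1 q] q by (intro mult_pos_pos) auto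
    \<comment> \<open>Gives the bound the limit \<open>e / 2\<close>.\<close>
    define \<epsilon> where "\<epsilon> = e / (2 * (real (totient q) * E))"
    have \<epsilon>: "\<epsilon> > 0" using e E0 by (simp add: \<epsilon>_def)
    obtain C where C: "C \<ge> 0" "eventually (\<lambda>T. \<bar>I T - (\<Sum>chi\<in>D. Y chi T)\<bar> \<le> \<epsilon> * (\<Sum>chi\<in>D. Y chi T) + C * (\<Sum>chi1\<in>D. \<Sum>chi2\<in>D-{chi1}. M chi1 chi2 T)) at_top"
      using bound[OF \<epsilon>] by blast
    have "((\<lambda>T. \<epsilon> * (\<Sum>chi\<in>D. Y chi T) + C * (\<Sum>chi1\<in>D. \<Sum>chi2\<in>D-{chi1}. M chi1 chi2 T)) \<longlongrightarrow>
        \<epsilon> * (real (totient q) * E) + C * (\<Sum>chi1\<in>D. \<Sum>chi2\<in>D-{chi1}. 0)) at_top"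
      by (intro tendsto_add tendsto_mult tendsto_const sumY sumM)
    moreover have "\<epsilon> * (real (totient q) * E) = e / 2"
      unfolding \<epsilon>_def using E0 by (metis (no_types, lifting) divide_divide_eq_left nonzero_eq_divide_eq order_less_irrefl)
    ultimately have "((\<lambda>T. \<epsilon> * (\<Sum>chi\<in>D. Y chi T) + C * (\<Sum>chi1\<in>D. \<Sum>chi2\<in>D-{chi1}. M chi1 chi2 T)) \<longlongrightarrow> e / 2) at_top"
      by simp
    hence "eventually (\<lambda>T. \<epsilon> * (\<Sum>chi\<in>D. Y chi T) + C * (\<Sum>chi1\<in>D. \<Sum>chi2\<in>D-{chi1}. M chi1 chi2 T) < e) at_top"
      by (rule order_tendstoD) (use e in simp)
    thus "eventually (\<lambda>T. dist (I T - (\<Sum>chi\<in>D. Y chi T)) 0 < e) at_top"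
      using C(2) by eventually_elim (simp add: dist_real_def)
  qed
  from tendsto_add[OF this sumY] have "(I \<longlongrightarrow> real (totient q) * E) at_top" by simp
  thus ?thesis unfolding I_def z_def L_def D_def E_def .
qed

text \<open>The factor \<open>totient q\<close> that counts the characters lowers the exponent of
  the denominator from \<open>2 * k\<close> to \<open>2 * k - 1\<close>.\<close>

lemma hurwitz_moment_const_eq:
  assumes "k \<ge> 1" "q > 0"
  shows "hurwitz_moment_const k q = real q ^ k / real (totient q) ^ (2 * k) *
    (real (totient q) * (barnes_G (real k + 1) ^ 2 / barnes_G (2 * real k + 1) * euler_const k q))"
proof -
  have "totient q > 0" using assms by simp
  hence "real (totient q) powi (2 * int k - 1) = real (totient q) ^ (2 * k) / real (totient q)"
    by (simp add: power_int_diff flip: power_int_of_nat)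
  thus ?thesis unfolding hurwitz_moment_const_def moment_const_def euler_const_def by (simp add: mult_ac)
qed

theorem theorem5:
  fixes k a q :: nat and f :: "real \<Rightarrow> real"
  assumes "1 \<le> a" and "a \<le> q" and "coprime a q"
    and "k = 0 \<longrightarrow> q \<le> 2"
    and "admissible_weight f"
    and "\<forall>l. tuple_size q l = k \<longrightarrow> splitting_hypothesis f q l"
    and "\<forall>l. tuple_size q l = k \<longrightarrow> random_matrix_hypothesis f q l"
  shows "(\<lambda>T. integral {T..2*T}
            (\<lambda>t. norm (hurwitz_zeta (real a / real q) (Complex (1/2) t)) ^ (2 * k)))
         \<sim>[at_top] (\<lambda>T. hurwitz_moment_const k q * T * ln T ^ (k\<^sup>2))"
proof -
  have q: "q > 0" using assms by simp
  consider "k = 0" | "k = 1" | "k \<ge> 2" by linarith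
  thus ?thesis
  proof cases
    case 1
    hence "q = 1 \<or> q = 2" using assms(4) q by auto
    hence hq: "hurwitz_moment_const k q = 1" using hurwitz_moment_const_0 1 by blast
    show ?thesis
    proof (rule asymp_equiv_refl_ev)
      show "eventually (\<lambda>T. integral {T..2*T} (\<lambda>t. norm (hurwitz_zeta (real a / real q) (Complex (1/2) t)) ^ (2 * k)) =
         hurwitz_moment_const k q * T * ln T ^ (k\<^sup>2)) at_top"
        using eventually_gt_at_top[of 0] by eventually_elim (simp add: hq, simp add: 1)
    qed
  next
    case 2
    have "hurwitz_moment_const k q = 1" using hurwitz_moment_const_1[OF q] 2 by simp
    thus ?thesis using hurwitz_second_moment[of "real a / real q"] assms(1,2) 2 by simp
  next
    case 3
    define K where "K = real q ^ k / real (totient q) ^ (2 * k)"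
    define E where "E = real (totient q) * (barnes_G (real k + 1) ^ 2 / barnes_G (2 * real k + 1) * euler_const k q)"
    define w where "w chi = cnj (chi a)" for chi :: "nat \<Rightarrow> complex"
    have K: "K > 0" using q by (simp add: K_def)
    have E: "E > 0" unfolding E_def using barnes_ratio_pos[of k] coprime_mean_limit(2)[of k q] q 3
      by (intro mult_pos_pos) auto
    have hmc: "hurwitz_moment_const k q = K * E"
      unfolding K_def E_def using 3 q by (intro hurwitz_moment_const_eq) auto
    have w: "norm (w chi) = 1" if "chi \<in> dchars q" for chi
      using norm_dchar[OF that assms(3) q] by (simp add: w_def)
    define F where "F t = norm (\<Sum>chi\<in>dchars q. w chi * dirichlet_L chi (Complex (1/2) t)) ^ (2 * k)" for t
    have lim: "((\<lambda>T. integral {T..2*T} F / (T * ln T ^ (k\<^sup>2))) \<longlongrightarrow> E) at_top"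
      unfolding F_def E_def by (rule moment_dirichlet_sum[OF q 3 w]) (use assms in auto)
    have eq: "norm (hurwitz_zeta (real a / real q) (Complex (1/2) t)) ^ (2 * k) = K * F t" for t
    proof -
      have s: "Complex (1/2) t \<noteq> 1" by (simp add: complex_eq_iff)
      \<comment> \<open>On the critical line this modulus is \<open>sqrt q\<close>, whose power of
        order \<open>2 * k\<close> is the factor \<open>q ^ k\<close> of the constant.\<close>
      have "norm (of_nat q powr Complex (1/2) t :: complex) = real q powr (1/2)"
        using norm_of_real_powr[of "real q" "Complex (1/2) t"] q by simp
      hence n: "norm (of_nat q powr Complex (1/2) t :: complex) = sqrt (real q)" by (simp add: powr_half_sqrt)
      have "sqrt (real q) ^ (2 * k) = real q ^ k" by (simp add: power_mult)
      thus ?thesis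
        unfolding hurwitz_zeta_eq_sum_dirichlet_L[OF assms(1-3) s] norm_mult norm_divide n K_def F_def w_def
        by (simp add: power_mult_distrib power_divide)
    qed
    have int: "integral {T..2*T} (\<lambda>t. norm (hurwitz_zeta (real a / real q) (Complex (1/2) t)) ^ (2 * k)) = K * integral {T..2*T} F" for T
      unfolding eq by simp
    show ?thesis unfolding int hmc
    proof (rule asymp_equivI')
      have "((\<lambda>T. integral {T..2*T} F / (T * ln T ^ (k\<^sup>2)) / E) \<longlongrightarrow> E / E) at_top"
        using E by (intro tendsto_divide lim tendsto_const) auto
      thus "((\<lambda>T. K * integral {T..2*T} F / (K * E * T * ln T ^ (k\<^sup>2))) \<longlongrightarrow> 1) at_top"
        using K E by (simp add: mult_ac)
    qed
  qed
qed

end
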